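(* Let $1<p<\infty$, let $Z=(Z,d,\mu)$ be a $p$-PI space and let $\Omega\subset Z$ be a measurable set satisfying the measure-density condition. If $\Omega$ is a $c_0$-valued $W^{1,p}$-extension set, then $\Omega$ is a $\mathbb V$-valued $W^{1,p}$-extension set for all Banach spaces $\mathbb V$.
   Context: Metric measure space: a triple $(Z,d,\mu)$ with $(Z,d)$ a separable metric space and $\mu$ a Borel regular outer measure with $0<\mu(B)<\infty$ for all open balls $B$. $\mu$ is doubling if there is $c_\mu>0$ with $\mu(2B)\le c_\mu\mu(B)$ for every open ball $B$. $c_0$ is the Banach space of real sequences tending to $0$ with the supremum norm. $L^p(Z;\mathbb V)$: a map $u:Z\to\mathbb V$ is measurable if preimages of open sets are $\mu$-measurable and $u(Z\setminus N)$ is separable for some $\mu$-null set $N$; $L^p(Z;\mathbb V)$ is the space of a.e.-equivalence classes of measurable $u$ with $|u|\in L^p(Z)$. Newton–Sobolev functions: a path is a continuous $\gamma:[a,b]\to Z$. For Borel $\rho:Z\to[0,\infty]$, $\int_\gamma\rho\,ds$ is the usual integral with respect to the length measure of $\gamma$ if $\gamma$ is rectifiable, and $\infty$ otherwise. A family of paths $\Gamma$ is $p$-negligible if there is an $L^p$-integrable Borel $\rho:Z\to[0,\infty]$ with $\int_\gamma\rho\,ds=\infty$ for all $\gamma\in\Gamma$. A Borel $\rho:Z\to[0,\infty]$ is a $p$-weak upper gradient of $u:Z\to\mathbb V$ if $|u(\gamma(a))-u(\gamma(b))|\le\int_\gamma\rho\,ds$ for all paths $\gamma:[a,b]\to Z$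 outside a $p$-negligible family. $W^{1,p}(Z;\mathbb V)$ is the set of $u\in L^p(Z;\mathbb V)$ having a representative $\widetilde u$ that admits an $L^p$-integrable $p$-weak upper gradient, with norm $\|u\|_{L^p(Z;\mathbb V)}+\inf_\rho\|\rho\|_{L^p(Z)}$, infimum over $L^p$-integrable $p$-weak upper gradients of $\widetilde u$. For measurable $\Omega\subset Z$, $W^{1,p}(\Omega;\mathbb V)$ is defined using the restricted distance and measure. $p$-PI space: a complete metric measure space with $\mu$ doubling and supporting a weak $(1,p)$-Poincaré inequality: there are $C>0$, $\lambda\ge1$ such that $\frac1{\mu(B)}\int_B|u-u_B|\,d\mu\le C\operatorname{diam}(B)\big(\frac1{\mu(\lambda B)}\int_{\lambda B}\rho^p\,d\mu\big)^{1/p}$ for every ball $B$, every integrable $u:\lambda B\to\mathbb R$ and every $L^p$-integrable $p$-weak upper gradient $\rho:\lambda B\to[0,\infty]$ of $u$, where $u_B$ is the average of $u$ over $B$. Measure-density condition: there is $c_\Omega>0$ with $\mu(B(x,r)\cap\Omega)\ge c_\Omega\,\mu(B(x,r))$ for every $x\in\Omega$, $r\in(0,1]$. $\Omega$ is a $\mathbb V$-valued $W^{1,p}$-extension set if there are $C>0$ and a (not necessarily linear) map $E:W^{1,p}(\Omega;\mathbb V)\to W^{1,p}(Z;\mathbb V)$ with $E(u)|_\Omega=u$ a.e. and $\|E(u)\|_{W^{1,p}(Z;\mathbb V)}\le C\|u\|_{W^{1,p}(\Omega;\mathbb V)}$ for all $u$. *)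

theory Defs
  imports "HOL-Analysis.Analysis"
begin

section \<open>The Banach space of real null sequences\<close>

typedef c0 = "{x :: nat \<Rightarrow> real. x \<longlonglongrightarrow> 0}"
  morphisms c0_nth Abs_c0
  by (intro exI[of _ "\<lambda>_. 0"]) simp

setup_lifting type_definition_c0

lemma c0_nth_tendsto: "c0_nth x \<longlonglongrightarrow> 0"
  using c0_nth[of x] by simp

lemma c0_bdd_above: "bdd_above (range (\<lambda>n. \<bar>c0_nth x n\<bar>))"
proof -
  have "Bseq (c0_nth x)"
    using c0_nth_tendsto convergentI convergent_imp_Bseq by blast
  then obtain K where "\<And>n. norm (c0_nth x n) \<le> K"
    by (auto simp: Bseq_def)
  then show ?thesis
    by (intro bdd_aboveI[of _ K]) auto
qed

instantiation c0 :: real_normed_vector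
begin

lift_definition zero_c0 :: c0 is "\<lambda>_. 0" by simp

lift_definition plus_c0 :: "c0 \<Rightarrow> c0 \<Rightarrow> c0" is "\<lambda>x y n. x n + y n"
  by (auto intro: tendsto_add_zero)

lift_definition uminus_c0 :: "c0 \<Rightarrow> c0" is "\<lambda>x n. - x n"
  using tendsto_minus by fastforce

lift_definition minus_c0 :: "c0 \<Rightarrow> c0 \<Rightarrow> c0" is "\<lambda>x y n. x n - y n"
  using tendsto_diff by fastforce

lift_definition scaleR_c0 :: "real \<Rightarrow> c0 \<Rightarrow> c0" is "\<lambda>c x n. c * x n"
  by (auto intro: tendsto_mult_right_zero)

definition norm_c0 :: "c0 \<Rightarrow> real"
  where "norm_c0 x = (SUP n. \<bar>c0_nth x n\<bar>)"

definition dist_c0 :: "c0 \<Rightarrow> c0 \<Rightarrow> real"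
  where "dist_c0 x y = norm (x - y)"

definition sgn_c0 :: "c0 \<Rightarrow> c0"
  where "sgn_c0 x = inverse (norm x) *\<^sub>R x"

definition uniformity_c0 :: "(c0 \<times> c0) filter"
  where "uniformity_c0 = (INF e\<in>{0<..}. principal {(x, y :: c0). dist x y < e})"

definition open_c0 :: "c0 set \<Rightarrow> bool"
  where "open_c0 S \<longleftrightarrow> (\<forall>x\<in>S. \<forall>\<^sub>F (x', y) in uniformity. x' = x \<longrightarrow> y \<in> S)"

lemma c0_nth_le_norm: "\<bar>c0_nth x n\<bar> \<le> norm x"
  unfolding norm_c0_def by (intro cSUP_upper c0_bdd_above) simp

lemma c0_norm_le: "(\<And>n. \<bar>c0_nth x n\<bar> \<le> K) \<Longrightarrow> norm x \<le> K"
  for x :: c0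
  unfolding norm_c0_def by (intro cSUP_least) auto

instance
proof
  fix x y z :: c0 and a b :: real
  show "x + y + z = x + (y + z)" by transfer (simp add: add.assoc)
  show "x + y = y + x" by transfer (simp add: add.commute)
  show "0 + x = x" by transfer simp
  show "- x + x = 0" by transfer simp
  show "x - y = x + - y" by transfer simp
  show "a *\<^sub>R (x + y) = a *\<^sub>R x + a *\<^sub>R y" by transfer (simp add: algebra_simps)
  show "(a + b) *\<^sub>R x = a *\<^sub>R x + b *\<^sub>R x" by transfer (simp add: algebra_simps)
  show "a *\<^sub>R b *\<^sub>R x = (a * b) *\<^sub>R x" by transfer (simp add: algebra_simps)
  show "1 *\<^sub>R x = x" by transfer simp
  show "dist x y = norm (x - y)" by (rule dist_c0_def)
  show "sgn x = inverse (norm x) *\<^sub>R x" by (rule sgn_c0_def)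
  show "uniformity = (INF e\<in>{0<..}. principal {(x, y :: c0). dist x y < e})"
    by (rule uniformity_c0_def)
  show "open S \<longleftrightarrow> (\<forall>x\<in>S. \<forall>\<^sub>F (x', y) in uniformity. x' = x \<longrightarrow> y \<in> S)" for S :: "c0 set"
    by (rule open_c0_def)
  show "norm x = 0 \<longleftrightarrow> x = 0"
  proof
    assume "norm x = 0"
    then have "c0_nth x n = 0" for n
      using c0_nth_le_norm[of x n] by simp
    then have "c0_nth x = c0_nth 0"
      by (simp add: zero_c0.rep_eq fun_eq_iff)
    then show "x = 0"
      by (simp add: c0_nth_inject)
  next
    assume "x = 0"
    then show "norm x = 0"
      by (simp add: norm_c0_def zero_c0.rep_eq)
  qed
  show "norm (x + y) \<le> norm x + norm y"
  proof (rule c0_norm_le)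
    fix n
    show "\<bar>c0_nth (x + y) n\<bar> \<le> norm x + norm y"
      using c0_nth_le_norm[of x n] c0_nth_le_norm[of y n] by (simp add: plus_c0.rep_eq)
  qed
  show "norm (a *\<^sub>R x) = \<bar>a\<bar> * norm x"
  proof (rule antisym)
    show "norm (a *\<^sub>R x) \<le> \<bar>a\<bar> * norm x"
      by (rule c0_norm_le)
        (simp add: scaleR_c0.rep_eq abs_mult mult_left_mono c0_nth_le_norm)
    show "\<bar>a\<bar> * norm x \<le> norm (a *\<^sub>R x)"
    proof (cases "a = 0")
      case True
      then show ?thesis
        using c0_nth_le_norm[of "a *\<^sub>R x" 0] by simp
    next
      case False
      have "norm x \<le> norm (a *\<^sub>R x) / \<bar>a\<bar>"
      proof (rule c0_norm_le)
        fix n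
        show "\<bar>c0_nth x n\<bar> \<le> norm (a *\<^sub>R x) / \<bar>a\<bar>"
          using c0_nth_le_norm[of "a *\<^sub>R x" n] False
          by (simp add: scaleR_c0.rep_eq abs_mult field_simps)
      qed
      then show ?thesis
        using False by (simp add: field_simps)
    qed
  qed
qed

end

instance c0 :: banach
proof
  fix X :: "nat \<Rightarrow> c0"
  assume X: "Cauchy X"
  have "uniformly_Cauchy_on UNIV (\<lambda>k n. c0_nth (X k) n)"
    unfolding uniformly_Cauchy_on_def
  proof (intro allI impI)
    fix e :: real
    assume "e > 0"
    then obtain M where M: "\<forall>m\<ge>M. \<forall>n\<ge>M. dist (X m) (X n) < e"
      using X by (meson Cauchy_def)
    have "dist (c0_nth (X m) j) (c0_nth (X n) j) < e" if "m \<ge> M" "n \<ge> M" for m n j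
      using c0_nth_le_norm[of "X m - X n" j] M that
      by (force simp: dist_norm minus_c0.rep_eq)
    then show "\<exists>M. \<forall>x\<in>UNIV. \<forall>m\<ge>M. \<forall>n\<ge>M. dist (c0_nth (X m) x) (c0_nth (X n) x) < e"
      by blast
  qed
  then obtain l where l: "uniform_limit UNIV (\<lambda>k n. c0_nth (X k) n) l sequentially"
    using Cauchy_uniformly_convergent uniformly_convergent_on_def by blast
  have "l \<longlonglongrightarrow> 0"
    by (rule swap_uniform_limit'[OF _ _ l, where g = "\<lambda>_. 0"]) (simp_all add: c0_nth_tendsto)
  then have l0: "c0_nth (Abs_c0 l) = l"
    by (simp add: Abs_c0_inverse)
  have "X \<longlonglongrightarrow> Abs_c0 l"
  proof (rule metric_LIMSEQ_I)
    fix e :: real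
    assume "e > 0"
    then have "\<forall>\<^sub>F k in sequentially. \<forall>n. dist (c0_nth (X k) n) (l n) < e / 2"
      using l by (auto simp: uniform_limit_iff dest!: spec[of _ "e / 2"])
    then obtain N where N: "\<And>k n. k \<ge> N \<Longrightarrow> dist (c0_nth (X k) n) (l n) < e / 2"
      by (auto simp: eventually_sequentially)
    have "dist (X k) (Abs_c0 l) < e" if "k \<ge> N" for k
    proof -
      have "norm (X k - Abs_c0 l) \<le> e / 2"
        using N[OF that] by (intro c0_norm_le) (simp add: minus_c0.rep_eq l0 dist_norm less_imp_le)
      then show ?thesis
        using \<open>e > 0\<close> by (simp add: dist_norm)
    qed
    then show "\<exists>N. \<forall>k\<ge>N. dist (X k) (Abs_c0 l) < e"
      by blast
  qed
  then show "convergent X"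
    by (rule convergentI)
qed

section \<open>Metric measure spaces\<close>

text \<open>
  The metric space is the whole type, and the measure is an outer measure on all of its subsets.
\<close>

definition caratheodory_measure :: "('z set \<Rightarrow> ennreal) \<Rightarrow> 'z measure"
  where "caratheodory_measure \<mu> = measure_of UNIV (lambda_system UNIV (Pow UNIV) \<mu>) \<mu>"

definition borel_regular_outer_measure :: "('z::topological_space set \<Rightarrow> ennreal) \<Rightarrow> bool"
  where "borel_regular_outer_measure \<mu> \<longleftrightarrow>
    outer_measure_space (Pow UNIV) \<mu> \<and>
    sets borel \<subseteq> lambda_system UNIV (Pow UNIV) \<mu> \<and>
    (\<forall>A. \<exists>B\<in>sets borel. A \<subseteq> B \<and> \<mu> B = \<mu> A)"

definition metric_measure_space :: "('z::metric_space set \<Rightarrow> ennreal) \<Rightarrow> bool"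
  where "metric_measure_space \<mu> \<longleftrightarrow>
    separable_space (euclidean :: 'z topology) \<and>
    borel_regular_outer_measure \<mu> \<and>
    (\<forall>x r. 0 < r \<longrightarrow> 0 < \<mu> (ball x r) \<and> \<mu> (ball x r) < \<infinity>)"

definition doubling :: "('z::metric_space set \<Rightarrow> ennreal) \<Rightarrow> bool"
  where "doubling \<mu> \<longleftrightarrow>
    (\<exists>c>0. \<forall>x r. 0 < r \<longrightarrow> \<mu> (ball x (2 * r)) \<le> ennreal c * \<mu> (ball x r))"

definition measure_density :: "('z::metric_space set \<Rightarrow> ennreal) \<Rightarrow> 'z set \<Rightarrow> bool"
  where "measure_density \<mu> \<Omega> \<longleftrightarrow>
    (\<exists>c>0. \<forall>x\<in>\<Omega>. \<forall>r\<in>{0<..1}. \<mu> (ball x r \<inter> \<Omega>) \<ge> ennreal c * \<mu> (ball x r))"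

section \<open>Lebesgue spaces\<close>

text \<open>
  From here on the underlying space is the set \<open>space M\<close> of a measure \<open>M\<close>, with the distance of
  the ambient type. A measurable subset \<open>S\<close> with the restricted distance and measure is
  \<open>restrict_space M S\<close>. Functions live on the ambient type, and only their values on \<open>space M\<close>
  matter.
\<close>

text \<open>Meant for positive exponents only.\<close>

definition epowr :: "ennreal \<Rightarrow> real \<Rightarrow> ennreal"
  where "epowr x p = (if x = \<infinity> then \<infinity> else ennreal (enn2real x powr p))"

definition Lp_norm :: "'z measure \<Rightarrow> real \<Rightarrow> ('z \<Rightarrow> ennreal) \<Rightarrow> ennreal"
  where "Lp_norm M p f = epowr (\<integral>\<^sup>+ x. epowr (f x) p \<partial>M) (1 / p)"

definition bochner_measurable :: "'z measure \<Rightarrow> ('z \<Rightarrow> 'v::real_normed_vector) \<Rightarrow> bool"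
  where "bochner_measurable M u \<longleftrightarrow>
    u \<in> borel_measurable M \<and>
    (\<exists>N\<in>null_sets M. separable_space (top_of_set (u ` (space M - N))))"

definition Lp :: "'z measure \<Rightarrow> real \<Rightarrow> ('z \<Rightarrow> 'v::real_normed_vector) set"
  where "Lp M p = {u. bochner_measurable M u \<and>
    (\<integral>\<^sup>+ x. epowr (ennreal (norm (u x))) p \<partial>M) < \<infinity>}"

section \<open>Path integrals and weak upper gradients\<close>

text \<open>The triple \<open>(a, b, \<gamma>)\<close> stands for the path \<open>\<gamma>\<close> restricted to \<open>{a..b}\<close>.\<close>

type_synonym 'z param_path = "real \<times> real \<times> (real \<Rightarrow> 'z)"

definition paths_in :: "'z::metric_space set \<Rightarrow> 'z param_path set"
  where "paths_in S = {(a, b, \<gamma>). a \<le> b \<and> continuous_on {a..b} \<gamma> \<and> \<gamma> ` {a..b} \<subseteq> S}"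

definition curve_length :: "(real \<Rightarrow> 'z::metric_space) \<Rightarrow> real \<Rightarrow> real \<Rightarrow> ennreal"
  where "curve_length \<gamma> a b =
    (SUP (n, t)\<in>{(n :: nat, t :: nat \<Rightarrow> real). mono_on {..n} t \<and> t 0 = a \<and> t n = b}.
      \<Sum>i<n. ennreal (dist (\<gamma> (t i)) (\<gamma> (t (Suc i)))))"

text \<open>
  The Lebesgue-Stieltjes measure of the length function of a rectifiable path. It gives every
  \<open>{c..d} \<subseteq> {a..b}\<close> the length of \<open>\<gamma>\<close> on \<open>{c..d}\<close>, and it vanishes outside \<open>{a..b}\<close>.
\<close>

definition length_measure :: "'z::metric_space param_path \<Rightarrow> real measure"
  where "length_measure = (\<lambda>(a, b, \<gamma>).
    interval_measure (\<lambda>t. enn2real (curve_length \<gamma> a (max a (min b t)))))"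

definition path_integral :: "'z::metric_space param_path \<Rightarrow> ('z \<Rightarrow> ennreal) \<Rightarrow> ennreal"
  where "path_integral = (\<lambda>(a, b, \<gamma>) \<rho>.
    if curve_length \<gamma> a b < \<infinity>
    then \<integral>\<^sup>+ t\<in>{a..b}. \<rho> (\<gamma> t) \<partial>length_measure (a, b, \<gamma>)
    else \<infinity>)"

text \<open>
  The Borel sets of the subspace \<open>space M\<close> are in general fewer than the measurable sets of \<open>M\<close>.
\<close>

definition Lp_integrable_borel :: "'z::metric_space measure \<Rightarrow> real \<Rightarrow> ('z \<Rightarrow> ennreal) \<Rightarrow> bool"
  where "Lp_integrable_borel M p \<rho> \<longleftrightarrow>
    \<rho> \<in> borel_measurable (restrict_space borel (space M)) \<and>
    (\<integral>\<^sup>+ x. epowr (\<rho> x) p \<partial>M) < \<infinity>"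

definition p_negligible :: "'z::metric_space measure \<Rightarrow> real \<Rightarrow> 'z param_path set \<Rightarrow> bool"
  where "p_negligible M p \<Gamma> \<longleftrightarrow>
    \<Gamma> \<subseteq> paths_in (space M) \<and>
    (\<exists>\<rho>. Lp_integrable_borel M p \<rho> \<and> (\<forall>\<gamma>\<in>\<Gamma>. path_integral \<gamma> \<rho> = \<infinity>))"

definition weak_upper_gradient ::
    "'z::metric_space measure \<Rightarrow> real \<Rightarrow> ('z \<Rightarrow> 'v::real_normed_vector) \<Rightarrow> ('z \<Rightarrow> ennreal) \<Rightarrow> bool"
  where "weak_upper_gradient M p u \<rho> \<longleftrightarrow>
    \<rho> \<in> borel_measurable (restrict_space borel (space M)) \<and>
    (\<exists>\<Gamma>. p_negligible M p \<Gamma> \<and>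
      (\<forall>(a, b, \<gamma>)\<in>paths_in (space M) - \<Gamma>.
        ennreal (norm (u (\<gamma> a) - u (\<gamma> b))) \<le> path_integral (a, b, \<gamma>) \<rho>))"

section \<open>Newton-Sobolev spaces\<close>

text \<open>
  The weak upper gradients of all representatives of \<open>u\<close>. Two representatives that both have an
  \<open>L\<^sup>p\<close>-integrable \<open>p\<close>-weak upper gradient have the same ones, so that the infimum in the norm
  does not depend on a choice of representative.
\<close>

definition Lp_weak_upper_gradients ::
    "'z::metric_space measure \<Rightarrow> real \<Rightarrow> ('z \<Rightarrow> 'v::real_normed_vector) \<Rightarrow> ('z \<Rightarrow> ennreal) set"
  where "Lp_weak_upper_gradients M p u =
    {\<rho>. Lp_integrable_borel M p \<rho> \<and>
      (\<exists>v. (AE x in M. v x = u x) \<and> weak_upper_gradient M p v \<rho>)}"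

definition W1p :: "'z::metric_space measure \<Rightarrow> real \<Rightarrow> ('z \<Rightarrow> 'v::real_normed_vector) set"
  where "W1p M p = {u \<in> Lp M p. Lp_weak_upper_gradients M p u \<noteq> {}}"

definition W1p_norm :: "'z::metric_space measure \<Rightarrow> real \<Rightarrow> ('z \<Rightarrow> 'v::real_normed_vector) \<Rightarrow> ennreal"
  where "W1p_norm M p u =
    Lp_norm M p (\<lambda>x. ennreal (norm (u x))) + (INF \<rho>\<in>Lp_weak_upper_gradients M p u. Lp_norm M p \<rho>)"

section \<open>PI spaces and extension sets\<close>

definition weak_poincare :: "real \<Rightarrow> ('z::metric_space set \<Rightarrow> ennreal) \<Rightarrow> bool"
  where "weak_poincare p \<mu> \<longleftrightarrow>
    (\<exists>C>0. \<exists>\<Lambda>\<ge>1. \<forall>x r. 0 < r \<longrightarrow>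
      (let B = ball x r; B' = ball x (\<Lambda> * r);
           M = restrict_space (caratheodory_measure \<mu>) B;
           M' = restrict_space (caratheodory_measure \<mu>) B'
       in \<forall>(u :: 'z \<Rightarrow> real) \<rho>.
         integrable M' u \<longrightarrow> Lp_integrable_borel M' p \<rho> \<longrightarrow> weak_upper_gradient M' p u \<rho> \<longrightarrow>
         (let u\<^sub>B = (\<integral>y. u y \<partial>M) / enn2real (\<mu> B)
          in (\<integral>\<^sup>+ y. ennreal \<bar>u y - u\<^sub>B\<bar> \<partial>M) / \<mu> B
             \<le> ennreal (C * diameter B) * epowr ((\<integral>\<^sup>+ y. epowr (\<rho> y) p \<partial>M') / \<mu> B') (1 / p))))"

definition PI_space :: "real \<Rightarrow> ('z::metric_space set \<Rightarrow> ennreal) \<Rightarrow> bool"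
  where "PI_space p \<mu> \<longleftrightarrow>
    metric_measure_space \<mu> \<and> complete (UNIV :: 'z set) \<and> doubling \<mu> \<and> weak_poincare p \<mu>"

text \<open>
  The extension map acts on functions. The first condition on it says that it descends to
  almost-everywhere equivalence classes.
\<close>

definition W1p_extension_set ::
    "'v::real_normed_vector itself \<Rightarrow> real \<Rightarrow> ('z::metric_space set \<Rightarrow> ennreal) \<Rightarrow> 'z set \<Rightarrow> bool"
  where "W1p_extension_set V p \<mu> \<Omega> \<longleftrightarrow>
    (let M = caratheodory_measure \<mu>; M\<^sub>\<Omega> = restrict_space M \<Omega>
     in \<exists>C>0. \<exists>E :: ('z \<Rightarrow> 'v) \<Rightarrow> ('z \<Rightarrow> 'v).
       (\<forall>u\<in>W1p M\<^sub>\<Omega> p. \<forall>v\<in>W1p M\<^sub>\<Omega> p.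
          (AE x in M\<^sub>\<Omega>. u x = v x) \<longrightarrow> (AE x in M. E u x = E v x)) \<and>
       (\<forall>u\<in>W1p M\<^sub>\<Omega> p.
          E u \<in> W1p M p \<and>
          (AE x in M\<^sub>\<Omega>. E u x = u x) \<and>
          W1p_norm M p (E u) \<le> ennreal C * W1p_norm M\<^sub>\<Omega> p u))"

end

theory Submission
  imports Defs
begin

text \<open>
  A function \<open>u\<close> in \<open>W\<^bsup>1,p\<^esup>(\<Omega>; V)\<close> has essentially separable range, so Aharoni's bi-Lipschitz embedding
  \<open>F : V\<^sub>0 \<rightarrow> c\<^sub>0\<close> of a separable closed subspace \<open>V\<^sub>0\<close> turns it into \<open>F \<circ> u\<close>, which has an extension
  \<open>w : Z \<rightarrow> c\<^sub>0\<close>. The values of \<open>w\<close> off \<open>\<Omega>\<close> need not lie in \<open>F(V\<^sub>0)\<close>, but their distance \<open>\<delta>\<close> to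
  \<open>F(V\<^sub>0)\<close> is a real Sobolev function that vanishes on \<open>\<Omega>\<close>, and measure density gives the Hardy inequality
  \<open>\<delta> / d(\<cdot>, \<Omega>) \<in> L\<^sup>p\<close>. Replace \<open>w\<close> on the complement of the closure of \<open>\<Omega>\<close> by a Whitney sum
  \<open>\<Sum> \<phi>\<^sub>x v\<^sub>x\<close>, where \<open>F(v\<^sub>x)\<close> is nearly the closest point of \<open>F(V\<^sub>0)\<close> to the average of \<open>w\<close> on the ball at
  \<open>x\<close>, and by \<open>F\<^sup>-\<^sup>1 \<circ> w\<close> on the closure. If \<open>e\<close> is the result, then \<open>h = w - F \<circ> e\<close> satisfies
  \<open>h / d(\<cdot>, \<Omega>) \<in> L\<^sup>p\<close> by the Hardy and Poincare inequalities, so cutting \<open>h\<close> off near the boundary costs a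
  gradient that is bounded in \<open>L\<^sup>p\<close> independently of the cutoff. Hence \<open>F \<circ> e = w - h\<close> has a weak upper
  gradient, and so does \<open>e\<close>.
\<close>

text \<open>The embedding \<open>F\<close> is not linear, and its image is in general neither convex
  nor a Lipschitz retract of c0, so averages and partitions of unity lead out of it. Averages are
  therefore taken in c0, where \<open>w\<close> lives, and the Whitney sum is formed in the linear
  space \<open>V0\<close>; the two sides are compared through the bi-Lipschitz bounds. The given
  Poincare inequality has exponent 1 on its left side, whereas Hardy's inequality and the bound for
  h / d need exponent p. Chaining over nets at all dyadic scales provides it, with one bound for
  countably many functions that share a gradient; applied to coordinates it covers c0-valued
  functions. \<open>V0\<close> and \<open>F\<close> depend on the function to be extended, so a
  single extension constant exists only because the distortion 12 of the embedding and all later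
  constants do not depend on them. Finally, upper gradients are Borel and are tested at every point
  of a path, while Sobolev functions are given up to null sets; hence Borel majorants, Borel hulls
  of null sets and changes of representative accompany the whole argument.\<close>

lemma epowr_0 [simp]: "epowr 0 p = 0"
  by (simp add: epowr_def)

lemma epowr_top [simp]: "epowr top p = top"
  by (simp add: epowr_def)

lemma epowr_ennreal: "0 \<le> x \<Longrightarrow> epowr (ennreal x) p = ennreal (x powr p)"
  by (simp add: epowr_def)

lemma epowr_mono: "x \<le> y \<Longrightarrow> 0 \<le> p \<Longrightarrow> epowr x p \<le> epowr y p"
  by (cases x; cases y) (auto simp: epowr_ennreal powr_mono2 top_unique ennreal_leI)

lemma epowr_less_top: "epowr x p < top \<longleftrightarrow> x < top"
  by (cases x) (auto simp: epowr_ennreal)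

lemma epowr_mult: "epowr (a * b) p = epowr a p * epowr b p"
proof -
  have top: "epowr (a * top) p = epowr a p * top" for a
    by (cases a) (auto simp: epowr_ennreal ennreal_mult_top)
  show ?thesis
  proof (cases a)
    case (real r)
    then show ?thesis
      using top[of a] by (cases b) (auto simp: epowr_ennreal powr_mult simp flip: ennreal_mult)
  next
    case top
    then show ?thesis
      using \<open>\<And>a. epowr (a * top) p = epowr a p * top\<close>[of b] by (simp add: mult.commute)
  qed
qed

lemma epowr_epowr: "epowr (epowr x p) q = epowr x (p * q)"
  by (cases x) (auto simp: epowr_ennreal powr_powr)

lemma epowr_one_right [simp]: "epowr x 1 = x"
  by (cases x) (auto simp: epowr_ennreal)

lemma epowr_inverse: "p \<noteq> 0 \<Longrightarrow> epowr (epowr x p) (1 / p) = x"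
  "p \<noteq> 0 \<Longrightarrow> epowr (epowr x (1 / p)) p = x"
  by (simp_all add: epowr_epowr)

lemma epowr_max: "0 \<le> p \<Longrightarrow> epowr (max a b) p = max (epowr a p) (epowr b p)"
  by (metis epowr_mono max.absorb1 max.absorb2 nle_le)

text \<open>The constant comes from a + b \<le> 2 max(a, b) and is valid for every nonnegative
  exponent, so the inequality is also available for \<open>1 / p\<close>, as
  \<open>Lp_norm_le_sum\<close> requires.\<close>

lemma epowr_add_le:
  assumes "0 \<le> p"
  shows "epowr (a + b) p \<le> ennreal (2 powr p) * (epowr a p + epowr b p)"
proof -
  have "epowr (a + b) p \<le> epowr (ennreal 2 * max a b) p"
  proof (intro epowr_mono assms)
    show "a + b \<le> ennreal 2 * max a b"
      using add_mono[of a "max a b" b "max a b"] by (simp add: mult_2)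
  qed
  also have "\<dots> = ennreal (2 powr p) * max (epowr a p) (epowr b p)"
    using assms epowr_ennreal[of 2 p] by (simp add: epowr_mult epowr_max)
  also have "\<dots> \<le> ennreal (2 powr p) * (epowr a p + epowr b p)"
    by (intro mult_left_mono) auto
  finally show ?thesis .
qed

lemma epowr_measurable [measurable]: "(\<lambda>x. epowr x p) \<in> borel_measurable borel"
  unfolding epowr_def by measurable

lemma epowr_measurable' [measurable (raw)]:
  "f \<in> borel_measurable M \<Longrightarrow> (\<lambda>x. epowr (f x) p) \<in> borel_measurable M"
  by (rule measurable_compose[OF _ epowr_measurable])

lemma nn_integral_epowr_add_le:
  assumes "0 \<le> p" "f \<in> borel_measurable M" "g \<in> borel_measurable M"
  shows "(\<integral>\<^sup>+x. epowr (f x + g x) p \<partial>M) \<le>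
    ennreal (2 powr p) * ((\<integral>\<^sup>+x. epowr (f x) p \<partial>M) + (\<integral>\<^sup>+x. epowr (g x) p \<partial>M))"
proof -
  note [measurable] = assms(2,3)
  have "(\<integral>\<^sup>+x. epowr (f x + g x) p \<partial>M) \<le>
    (\<integral>\<^sup>+x. ennreal (2 powr p) * (epowr (f x) p + epowr (g x) p) \<partial>M)"
    by (intro nn_integral_mono epowr_add_le assms)
  then show ?thesis
    by (simp add: nn_integral_cmult nn_integral_add)
qed

text \<open>All estimates are proved for integrals of p-th powers and turned into norms once, at the
  end. The factor \<open>2 powr (1 / p)\<close> is the cost of \<open>epowr_add_le\<close> with
  exponent \<open>1 / p\<close>.\<close>

lemma Lp_norm_le_sum:
  assumes "0 < p" "0 \<le> C"
    and "(\<integral>\<^sup>+x. epowr (f x) p \<partial>M) \<le> ennreal C * ((\<integral>\<^sup>+x. epowr (g x) p \<partial>M) + (\<integral>\<^sup>+x. epowr (h x) p \<partial>M))"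
  shows "Lp_norm M p f \<le> ennreal (C powr (1 / p) * 2 powr (1 / p)) * (Lp_norm M p g + Lp_norm M p h)"
proof -
  have "Lp_norm M p f \<le> epowr (ennreal C) (1 / p) *
      epowr ((\<integral>\<^sup>+x. epowr (g x) p \<partial>M) + (\<integral>\<^sup>+x. epowr (h x) p \<partial>M)) (1 / p)"
    unfolding Lp_norm_def epowr_mult[symmetric] using assms by (intro epowr_mono) auto
  also have "\<dots> \<le> epowr (ennreal C) (1 / p) * (ennreal (2 powr (1 / p)) * (Lp_norm M p g + Lp_norm M p h))"
    unfolding Lp_norm_def using assms by (intro mult_left_mono epowr_add_le) auto
  finally show ?thesis
    using assms by (simp add: epowr_ennreal ennreal_mult mult.assoc)
qed

lemma Lp_norm_mono:
  assumes "0 < p" "\<And>x. x \<in> space M \<Longrightarrow> f x \<le> g x"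
  shows "Lp_norm M p f \<le> Lp_norm M p g"
  unfolding Lp_norm_def using assms by (intro epowr_mono nn_integral_mono) auto

section \<open>The Caratheodory measure of a Borel regular outer measure\<close>

context
  fixes \<mu> :: "'z::metric_space set \<Rightarrow> ennreal"
  assumes regular: "borel_regular_outer_measure \<mu>"
begin

lemma
  shows space_caratheodory_measure: "space (caratheodory_measure \<mu>) = UNIV"
    and sets_caratheodory_measure:
      "sets (caratheodory_measure \<mu>) = lambda_system UNIV (Pow UNIV) \<mu>"
    and emeasure_caratheodory_measure:
      "A \<in> sets (caratheodory_measure \<mu>) \<Longrightarrow> emeasure (caratheodory_measure \<mu>) A = \<mu> A"
proof -
  interpret sigma_algebra UNIV "Pow UNIV :: 'z set set"
    by (rule sigma_algebra_Pow)
  have ms: "measure_space UNIV (lambda_system UNIV (Pow UNIV) \<mu>) \<mu>"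
    using regular caratheodory_lemma[of \<mu>] by (simp add: borel_regular_outer_measure_def)
  then have sa: "sigma_algebra UNIV (lambda_system UNIV (Pow UNIV) \<mu>)"
    by (simp add: measure_space_def)
  show "space (caratheodory_measure \<mu>) = UNIV"
    by (simp add: caratheodory_measure_def space_measure_of)
  show sets: "sets (caratheodory_measure \<mu>) = lambda_system UNIV (Pow UNIV) \<mu>"
    using sigma_algebra.sets_measure_of_eq[OF sa] by (simp add: caratheodory_measure_def)
  show "emeasure (caratheodory_measure \<mu>) A = \<mu> A" if "A \<in> sets (caratheodory_measure \<mu>)"
  proof (rule emeasure_measure_of[OF caratheodory_measure_def])
    show "A \<in> sets (caratheodory_measure \<mu>)" by fact
    show "positive (sets (caratheodory_measure \<mu>)) \<mu>" "countably_additive (sets (caratheodory_measure \<mu>)) \<mu>"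
      using ms unfolding sets measure_space_def by auto
  qed auto
qed

lemma borel_subset_caratheodory: "sets borel \<subseteq> sets (caratheodory_measure \<mu>)"
  using regular by (simp add: borel_regular_outer_measure_def sets_caratheodory_measure)

lemma caratheodory_borel_hull:
  assumes "A \<in> sets (caratheodory_measure \<mu>)"
  shows "\<exists>B\<in>sets borel. A \<subseteq> B \<and> emeasure (caratheodory_measure \<mu>) B = emeasure (caratheodory_measure \<mu>) A"
  using regular assms borel_subset_caratheodory
  by (auto simp: borel_regular_outer_measure_def emeasure_caratheodory_measure subset_eq)

end

section \<open>Measures whose null sets have Borel hulls\<close>

text \<open>
  Both the measure of the ambient space and its restriction to a measurable subset are of this
  kind; the Borel sets are those of the subspace.
\<close>

definition borel_null_hull :: "'z::metric_space measure \<Rightarrow> bool"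
  where "borel_null_hull M \<longleftrightarrow> sets (restrict_space borel (space M)) \<subseteq> sets M \<and>
    (\<forall>N\<in>null_sets M. \<exists>B\<in>sets (restrict_space borel (space M)). N \<subseteq> B \<and> emeasure M B = 0)"

lemma borel_null_hull_caratheodory:
  assumes "borel_regular_outer_measure \<mu>"
  shows "borel_null_hull (caratheodory_measure \<mu>)"
  unfolding borel_null_hull_def space_caratheodory_measure[OF assms]
proof (intro conjI ballI)
  show "sets (restrict_space borel UNIV) \<subseteq> sets (caratheodory_measure \<mu>)"
    using borel_subset_caratheodory[OF assms] by simp
  fix N assume "N \<in> null_sets (caratheodory_measure \<mu>)"
  then show "\<exists>B\<in>sets (restrict_space borel UNIV). N \<subseteq> B \<and> emeasure (caratheodory_measure \<mu>) B = 0"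
    using caratheodory_borel_hull[OF assms, of N] by (auto simp: null_sets_def)
qed

lemma borel_null_hull_restrict:
  assumes M: "borel_null_hull M" "space M = UNIV" and S: "S \<in> sets M"
  shows "borel_null_hull (restrict_space M S)"
  unfolding borel_null_hull_def
proof (intro conjI ballI)
  have borel: "sets borel \<subseteq> sets M"
    using M by (simp add: borel_null_hull_def)
  have sp: "space (restrict_space M S) = S"
    using M by (simp add: space_restrict_space)
  show "sets (restrict_space borel (space (restrict_space M S))) \<subseteq> sets (restrict_space M S)"
    using borel unfolding sp by (auto simp: sets_restrict_space)
  fix N assume N: "N \<in> null_sets (restrict_space M S)"
  then have "N \<in> null_sets M" "N \<subseteq> S"
    using S by (auto simp: null_sets_restrict_space M)
  then obtain B where B: "B \<in> sets borel" "N \<subseteq> B" "emeasure M B = 0"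
    using M by (auto simp: borel_null_hull_def)
  have "emeasure M (S \<inter> B) = 0"
    using B borel S by (metis emeasure_eq_0 inf_le2 subset_iff)
  then have "emeasure (restrict_space M S) (S \<inter> B) = 0"
    using S M by (subst emeasure_restrict_space) (auto)
  then show "\<exists>B\<in>sets (restrict_space borel (space (restrict_space M S))).
      N \<subseteq> B \<and> emeasure (restrict_space M S) B = 0"
    using B \<open>N \<subseteq> S\<close> unfolding sp by (intro bexI[of _ "S \<inter> B"]) (auto simp: sets_restrict_space)
qed

text \<open>Upper gradients must be Borel and must give bounds at every point of a path, but the
  norm of a Sobolev function is only measurable for \<open>M\<close>. Replacing its superlevel sets
  at rational heights by Borel hulls yields a Borel function that is larger everywhere and equal
  almost everywhere.\<close>

lemma borel_majorant:
  fixes f :: "'z::metric_space \<Rightarrow> ennreal"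
  assumes reg: "\<And>A. A \<in> sets M \<Longrightarrow> \<exists>B\<in>sets borel. A \<subseteq> B \<and> B - A \<in> null_sets M"
    and borel: "sets borel \<subseteq> sets M" and sp: "space M = UNIV"
    and f: "f \<in> borel_measurable M"
  shows "\<exists>g\<in>borel_measurable borel. (\<forall>x. f x \<le> g x) \<and> (AE x in M. g x = f x)"
proof -
  define A where "A q = {x. ennreal (of_rat q) < f x}" for q
  have "A q \<in> sets M" for q
    using f sp measurable_sets[OF f, of "{ennreal (of_rat q)<..}"] by (simp add: A_def vimage_def)
  then have "\<forall>q. \<exists>B\<in>sets borel. A q \<subseteq> B \<and> B - A q \<in> null_sets M"
    using reg by blast
  then obtain B where B: "\<And>q. B q \<in> sets borel" "\<And>q. A q \<subseteq> B q" "\<And>q. B q - A q \<in> null_sets M"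
    by metis
  define g where "g x = (SUP q. ennreal (of_rat q) * indicator (B q) x)" for x
  note [measurable] = B(1)
  have "g \<in> borel_measurable borel"
    unfolding g_def by measurable
  moreover have le: "f x \<le> g x" for x
  proof (rule dense_le)
    fix y assume y: "y < f x"
    then obtain r where r: "0 \<le> r" "y = ennreal r"
      by (cases y) auto
    obtain z where z: "y < z" "z < f x"
      using dense y by blast
    then obtain s where s: "0 \<le> s" "z = ennreal s"
      by (cases z) auto
    then have "r < s"
      using z r by (simp add: ennreal_less_iff)
    then obtain q where q: "r < of_rat q" "of_rat q < s"
      using of_rat_dense by blast
    then have "ennreal (of_rat q) < f x"
      using s z r by (meson ennreal_less_iff order.strict_trans order.trans less_imp_le)
    then have "x \<in> B q"
      using B(2) by (auto simp: A_def)
    then have "ennreal (of_rat q) \<le> g x"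
      unfolding g_def by (intro SUP_upper2[of q]) auto
    moreover have "y \<le> ennreal (of_rat q)"
      using q r by (simp add: ennreal_leI)
    ultimately show "y \<le> g x"
      by order
  qed
  moreover have "AE x in M. g x = f x"
  proof -
    have "AE x in M. \<forall>q. x \<notin> B q - A q"
      by (subst AE_all_countable) (use B(3) AE_not_in in blast)
    then show ?thesis
    proof eventually_elim
      case (elim x)
      have "g x \<le> f x"
        unfolding g_def using elim by (intro SUP_least) (auto simp: A_def split: split_indicator)
      with le[of x] show ?case
        by simp
    qed
  qed
  ultimately show ?thesis
    by blast
qed

section \<open>Length of paths\<close>

definition partitions :: "real \<Rightarrow> real \<Rightarrow> (nat \<times> (nat \<Rightarrow> real)) set"
  where "partitions a b = {(n, t). mono_on {..n} t \<and> t 0 = a \<and> t n = b}"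

definition chord_sum :: "(real \<Rightarrow> 'z::metric_space) \<Rightarrow> nat \<Rightarrow> (nat \<Rightarrow> real) \<Rightarrow> real"
  where "chord_sum \<gamma> n t = (\<Sum>i<n. dist (\<gamma> (t i)) (\<gamma> (t (Suc i))))"

lemma curve_length_eq: "curve_length \<gamma> a b = (SUP (n, t)\<in>partitions a b. ennreal (chord_sum \<gamma> n t))"
  by (simp add: curve_length_def partitions_def chord_sum_def)

lemma chord_sum_le_curve_length:
  "(n, t) \<in> partitions a b \<Longrightarrow> ennreal (chord_sum \<gamma> n t) \<le> curve_length \<gamma> a b"
  unfolding curve_length_eq by (rule SUP_upper2[of "(n, t)"]) auto

lemma chord_sum_nonneg: "0 \<le> chord_sum \<gamma> n t"
  by (simp add: chord_sum_def sum_nonneg)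

lemma partitions_nonempty: "a \<le> b \<Longrightarrow> (1, \<lambda>i. if i = 0 then a else b) \<in> partitions a b"
  by (auto simp: partitions_def mono_on_def)

lemma dist_le_curve_length:
  assumes "a \<le> b"
  shows "ennreal (dist (\<gamma> a) (\<gamma> b)) \<le> curve_length \<gamma> a b"
  using chord_sum_le_curve_length[OF partitions_nonempty[OF assms], of \<gamma>] by (simp add: chord_sum_def)

lemma partitions_bounds: "(n, t) \<in> partitions a b \<Longrightarrow> i \<le> n \<Longrightarrow> a \<le> t i \<and> t i \<le> b"
  by (auto simp: partitions_def mono_on_def)

lemma partitions_min: "(n, t) \<in> partitions a b \<Longrightarrow> a \<le> c \<Longrightarrow> c \<le> b \<Longrightarrow> (n, \<lambda>i. min (t i) c) \<in> partitions a c"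
  by (auto simp: partitions_def mono_on_def simp del: min.bounded_iff intro!: min.mono)

lemma partitions_max: "(n, t) \<in> partitions a b \<Longrightarrow> a \<le> c \<Longrightarrow> c \<le> b \<Longrightarrow> (n, \<lambda>i. max (t i) c) \<in> partitions c b"
  by (auto simp: partitions_def mono_on_def simp del: max.bounded_iff intro!: max.mono)

text \<open>Truncating the nodes at \<open>c\<close> from above and from below keeps their number. A
  chord on one side of \<open>c\<close> survives in one sum and degenerates to a point in the other;
  only the chord across \<open>c\<close> is split, by the triangle inequality.\<close>

lemma chord_sum_split:
  assumes "(n, t) \<in> partitions a b"
  shows "chord_sum \<gamma> n t \<le> chord_sum \<gamma> n (\<lambda>i. min (t i) c) + chord_sum \<gamma> n (\<lambda>i. max (t i) c)"
  unfolding chord_sum_def sum.distrib[symmetric]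
proof (rule sum_mono)
  fix i assume "i \<in> {..<n}"
  then have "t i \<le> t (Suc i)"
    using assms by (auto simp: partitions_def mono_on_def)
  then consider "t (Suc i) \<le> c" | "c \<le> t i" | "t i \<le> c" "c \<le> t (Suc i)"
    by linarith
  then show "dist (\<gamma> (t i)) (\<gamma> (t (Suc i))) \<le> dist (\<gamma> (min (t i) c)) (\<gamma> (min (t (Suc i)) c)) +
      dist (\<gamma> (max (t i) c)) (\<gamma> (max (t (Suc i)) c))"
  proof cases
    case 3
    then show ?thesis
      by (simp add: min_absorb1 min_absorb2 max_absorb1 max_absorb2 dist_triangle)
  qed (use \<open>t i \<le> t (Suc i)\<close> in \<open>auto simp: min_def max_def\<close>)
qed

lemma curve_length_add:
  assumes "a \<le> c" "c \<le> b"
  shows "curve_length \<gamma> a b = curve_length \<gamma> a c + curve_length \<gamma> c b"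
proof (rule antisym)
  show "curve_length \<gamma> a b \<le> curve_length \<gamma> a c + curve_length \<gamma> c b"
    unfolding curve_length_eq[of \<gamma> a b]
  proof (rule SUP_least, clarify)
    fix n t assume t: "(n, t) \<in> partitions a b"
    have "ennreal (chord_sum \<gamma> n t) \<le> ennreal (chord_sum \<gamma> n (\<lambda>i. min (t i) c)) + ennreal (chord_sum \<gamma> n (\<lambda>i. max (t i) c))"
      using chord_sum_split[OF t] by (simp add: chord_sum_nonneg flip: ennreal_plus)
    also have "\<dots> \<le> curve_length \<gamma> a c + curve_length \<gamma> c b"
      using partitions_min[OF t assms] partitions_max[OF t assms] by (intro add_mono chord_sum_le_curve_length)
    finally show "ennreal (chord_sum \<gamma> n t) \<le> curve_length \<gamma> a c + curve_length \<gamma> c b" .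
  qed
  have concat: "ennreal (chord_sum \<gamma> n t) + ennreal (chord_sum \<gamma> m s) \<le> curve_length \<gamma> a b"
    if t: "(n, t) \<in> partitions a c" and s: "(m, s) \<in> partitions c b" for n t m s
  proof -
    \<comment> \<open>Both branches give \<open>c\<close> at \<open>i = n\<close>, so the glued
      partition has exactly \<open>n + m\<close> chords.\<close>
    define r where "r i = (if i \<le> n then t i else s (i - n))" for i
    have r2: "r i = s (i - n)" if "n \<le> i" for i
      using that t s by (auto simp: r_def partitions_def)
    have "(n + m, r) \<in> partitions a b"
    proof -
      have "r i \<le> r j" if "i \<le> j" "j \<le> n + m" for i j
      proof (cases "i \<le> n")
        case i: True
        show ?thesis
        proof (cases "j \<le> n")
          case True
          then show ?thesis
            using i t that by (auto simp: r_def partitions_def mono_on_def)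
        next
          case False
          have "t i \<le> c" "c \<le> s (j - n)"
            using partitions_bounds[OF t i] partitions_bounds[OF s, of "j - n"] that by auto
          then show ?thesis
            using False i by (simp add: r_def)
        qed
      next
        case False
        then have "s (i - n) \<le> s (j - n)"
          using s that by (intro mono_onD[of "{..m}" s]) (auto simp: partitions_def)
        then show ?thesis
          using False that by (simp add: r_def)
      qed
      then show ?thesis
        using t s by (auto simp: partitions_def mono_on_def r_def)
    qed
    then have "ennreal (chord_sum \<gamma> (n + m) r) \<le> curve_length \<gamma> a b"
      by (rule chord_sum_le_curve_length)
    moreover have "chord_sum \<gamma> (n + m) r = chord_sum \<gamma> n t + chord_sum \<gamma> m s"
    proof -
      have "chord_sum \<gamma> (n + m) r = chord_sum \<gamma> n r + (\<Sum>i=n..<n+m. dist (\<gamma> (r i)) (\<gamma> (r (Suc i))))"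
        unfolding chord_sum_def lessThan_atLeast0 by (rule sum.atLeastLessThan_concat[symmetric]) auto
      moreover have "(\<Sum>i=n..<n+m. dist (\<gamma> (r i)) (\<gamma> (r (Suc i)))) = chord_sum \<gamma> m s"
        unfolding chord_sum_def
        by (rule sum.reindex_bij_witness[of _ "\<lambda>i. i + n" "\<lambda>i. i - n"]) (auto simp: r2 Suc_diff_le)
      moreover have "chord_sum \<gamma> n r = chord_sum \<gamma> n t"
        unfolding chord_sum_def by (rule sum.cong) (auto simp: r_def)
      ultimately show ?thesis
        by simp
    qed
    ultimately show ?thesis
      by (simp add: chord_sum_nonneg)
  qed
  have "curve_length \<gamma> a c + curve_length \<gamma> c b =
      (SUP x\<in>partitions a c. SUP y\<in>partitions c b. (case x of (n, t) \<Rightarrow> ennreal (chord_sum \<gamma> n t)) +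
        (case y of (m, s) \<Rightarrow> ennreal (chord_sum \<gamma> m s)))"
    unfolding curve_length_eq using partitions_nonempty[OF assms(1)] partitions_nonempty[OF assms(2)]
    by (subst ennreal_SUP_add_left[symmetric], blast, subst ennreal_SUP_add_right[symmetric], blast) simp
  also have "\<dots> \<le> curve_length \<gamma> a b"
    by (intro SUP_least) (auto intro: concat)
  finally show "curve_length \<gamma> a c + curve_length \<gamma> c b \<le> curve_length \<gamma> a b" .
qed

text \<open>One nearly optimal partition of the whole interval, truncated at \<open>s\<close>,
  approximates the length up to \<open>s\<close> uniformly in \<open>s\<close>, and its chord sum is
  continuous in \<open>s\<close>. So the length function is a uniform limit of continuous
  functions.\<close>

lemma continuous_on_curve_length:
  fixes \<gamma> :: "real \<Rightarrow> 'z::metric_space"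
  assumes ab: "a \<le> b" and cont: "continuous_on {a..b} \<gamma>" and fin: "curve_length \<gamma> a b < \<infinity>"
  shows "continuous_on {a..b} (\<lambda>t. enn2real (curve_length \<gamma> a t))"
proof -
  define L where "L t = enn2real (curve_length \<gamma> a t)" for t
  have fin': "curve_length \<gamma> a t < \<infinity>" "curve_length \<gamma> t b < \<infinity>" if "t \<in> {a..b}" for t
    using curve_length_add[of a t b \<gamma>] that fin by auto
  have approx: "\<exists>S. continuous_on {a..b} S \<and> (\<forall>s\<in>{a..b}. S s \<le> L s \<and> L s \<le> S s + e)" if e: "0 < e" for e
  proof -
    obtain n t where t: "(n, t) \<in> partitions a b" and less: "curve_length \<gamma> a b < ennreal (chord_sum \<gamma> n t) + ennreal e"
    proof -
      have "\<exists>x\<in>partitions a b. curve_length \<gamma> a b < (case x of (n, t) \<Rightarrow> ennreal (chord_sum \<gamma> n t)) + ennreal e"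
      proof (rule ccontr)
        assume "\<not> ?thesis"
        then have "(SUP x\<in>partitions a b. (case x of (n, t) \<Rightarrow> ennreal (chord_sum \<gamma> n t)) + ennreal e) \<le> curve_length \<gamma> a b"
          by (intro SUP_least) (auto simp: not_less)
        then have "curve_length \<gamma> a b + ennreal e \<le> curve_length \<gamma> a b"
          using partitions_nonempty[OF ab] by (subst (asm) ennreal_SUP_add_left) (auto simp: curve_length_eq)
        then show False
          using fin e by (cases "curve_length \<gamma> a b") (auto simp flip: ennreal_plus)
      qed
      then show ?thesis
        using that by auto
    qed
    define S where "S s = chord_sum \<gamma> n (\<lambda>i. min (t i) s)" for s
    have "continuous_on {a..b} S"
      unfolding S_def chord_sum_def
    proof (intro continuous_on_sum continuous_on_dist)
      fix i assume "i \<in> {..<n}"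
      then have i: "a \<le> t i" "t i \<le> b" "a \<le> t (Suc i)" "t (Suc i) \<le> b"
        using partitions_bounds[OF t, of i] partitions_bounds[OF t, of "Suc i"] by auto
      show "continuous_on {a..b} (\<lambda>s. \<gamma> (min (t i) s))" "continuous_on {a..b} (\<lambda>s. \<gamma> (min (t (Suc i)) s))"
        by (rule continuous_on_compose2[OF cont]; use i in \<open>auto intro!: continuous_intros\<close>)+
    qed
    moreover have "S s \<le> L s \<and> L s \<le> S s + e" if s: "s \<in> {a..b}" for s
    proof
      have "ennreal (S s) \<le> curve_length \<gamma> a s"
        unfolding S_def using partitions_min[OF t] s by (intro chord_sum_le_curve_length) auto
      then have "enn2real (ennreal (S s)) \<le> L s"
        unfolding L_def using fin'[OF s] by (intro enn2real_mono) auto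
      then show "S s \<le> L s"
        by (simp add: S_def chord_sum_nonneg)
      \<comment> \<open>On the rest of the path the chord sum cannot exceed the length, so the
        defect up to \<open>s\<close> is at most the total defect \<open>e\<close>.\<close>
      have "curve_length \<gamma> a s + curve_length \<gamma> s b < ennreal (chord_sum \<gamma> n t) + ennreal e"
        using less curve_length_add[of a s b \<gamma>] s by simp
      also have "ennreal (chord_sum \<gamma> n t) \<le> ennreal (S s) + ennreal (chord_sum \<gamma> n (\<lambda>i. max (t i) s))"
        using chord_sum_split[OF t, of \<gamma> s] by (simp add: S_def chord_sum_nonneg flip: ennreal_plus)
      also have "ennreal (chord_sum \<gamma> n (\<lambda>i. max (t i) s)) \<le> curve_length \<gamma> s b"
        using partitions_max[OF t] s by (intro chord_sum_le_curve_length) auto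
      finally have "curve_length \<gamma> s b + curve_length \<gamma> a s < curve_length \<gamma> s b + (ennreal (S s) + ennreal e)"
        by (simp add: ac_simps)
      then have "curve_length \<gamma> a s < ennreal (S s) + ennreal e"
        by (simp add: ennreal_add_left_cancel_less)
      then have "ennreal (L s) < ennreal (S s + e)"
        using fin'[OF s] e by (simp add: L_def S_def chord_sum_nonneg)
      then show "L s \<le> S s + e"
        using e by (metis ennreal_less_iff enn2real_nonneg L_def less_imp_le)
    qed
    ultimately show ?thesis
      by blast
  qed
  have "continuous_on {a..b} L"
    unfolding continuous_on_iff
  proof (intro ballI allI impI)
    fix x e :: real assume x: "x \<in> {a..b}" and e: "0 < e"
    obtain S where S: "continuous_on {a..b} S" "\<forall>s\<in>{a..b}. S s \<le> L s \<and> L s \<le> S s + e / 3"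
      using approx[of "e / 3"] e by auto
    obtain d where d: "d > 0" "\<forall>y\<in>{a..b}. dist y x < d \<longrightarrow> dist (S y) (S x) < e / 3"
      using S(1) x e by (metis continuous_on_iff divide_pos_pos zero_less_numeral)
    have "dist (L y) (L x) < e" if "y \<in> {a..b}" "dist y x < d" for y
    proof -
      have "\<bar>S y - S x\<bar> < e / 3"
        using d(2) that by (auto simp: dist_real_def)
      moreover have "S y \<le> L y \<and> L y \<le> S y + e / 3" "S x \<le> L x \<and> L x \<le> S x + e / 3"
        using S(2) x that(1) by blast+
      ultimately show ?thesis
        unfolding dist_real_def by linarith
    qed
    then show "\<exists>d>0. \<forall>y\<in>{a..b}. dist y x < d \<longrightarrow> dist (L y) (L x) < e"
      using d(1) by blast
  qed
  then show ?thesis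
    by (simp add: L_def)
qed

section \<open>The length measure\<close>

locale rectifiable_path =
  fixes a b :: real and \<gamma> :: "real \<Rightarrow> 'z::metric_space"
  assumes le: "a \<le> b" and cont: "continuous_on {a..b} \<gamma>" and finite_length: "curve_length \<gamma> a b < \<infinity>"
begin

definition G :: "real \<Rightarrow> real"
  where "G t = enn2real (curve_length \<gamma> a (max a (min b t)))"

lemma finite_sub: "a \<le> c \<Longrightarrow> c \<le> d \<Longrightarrow> d \<le> b \<Longrightarrow> curve_length \<gamma> c d < \<infinity>"
  using curve_length_add[of a c b \<gamma>] curve_length_add[of c d b \<gamma>] finite_length
  by (simp add: less_top)

lemma length_eq_G:
  assumes "a \<le> c" "c \<le> d" "d \<le> b"
  shows "curve_length \<gamma> c d = ennreal (G d - G c)"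
proof -
  have *: "max a (min b c) = c" "max a (min b d) = d"
    using assms by auto
  have "G d = enn2real (curve_length \<gamma> a c) + enn2real (curve_length \<gamma> c d)"
    unfolding G_def * curve_length_add[OF assms(1,2)]
    using finite_sub[of a c] finite_sub[of c d] assms by (intro enn2real_plus) auto
  then show ?thesis
    using finite_sub[of c d] assms unfolding G_def * by simp
qed

lemma mono_G: "c \<le> d \<Longrightarrow> G c \<le> G d"
proof -
  assume "c \<le> d"
  let ?c = "max a (min b c)" and ?d = "max a (min b d)"
  have "?c \<le> ?d"
    using \<open>c \<le> d\<close> by auto
  then have "curve_length \<gamma> a ?c \<le> curve_length \<gamma> a ?d"
    using curve_length_add[of a ?c ?d \<gamma>] by simp
  then show "G c \<le> G d"
    unfolding G_def using finite_sub[of a ?d] le by (intro enn2real_mono) auto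
qed

lemma continuous_G: "continuous_on UNIV G"
  unfolding G_def
  by (rule continuous_on_compose2[OF continuous_on_curve_length[OF le cont finite_length]])
    (use le in \<open>auto intro!: continuous_intros\<close>)

abbreviation \<nu> :: "real measure"
  where "\<nu> \<equiv> length_measure (a, b, \<gamma>)"

lemma length_measure_eq: "\<nu> = interval_measure G"
  by (simp add: length_measure_def G_def[abs_def])

lemma sets_length_measure [simp, measurable_cong]: "sets \<nu> = sets borel"
  by (simp add: length_measure_eq)

lemma space_length_measure [simp]: "space \<nu> = UNIV"
  by (simp add: length_measure_eq)

lemma emeasure_Icc: "c \<le> d \<Longrightarrow> emeasure \<nu> {c..d} = ennreal (G d - G c)"
  unfolding length_measure_eq by (rule emeasure_interval_measure_Icc[OF _ mono_G continuous_G])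

lemma emeasure_point [simp]: "emeasure \<nu> {x} = 0"
  using emeasure_Icc[of x x] by simp

lemma emeasure_Icc_length: "a \<le> c \<Longrightarrow> c \<le> d \<Longrightarrow> d \<le> b \<Longrightarrow> emeasure \<nu> {c..d} = curve_length \<gamma> c d"
  by (simp add: emeasure_Icc length_eq_G)

lemma AE_in_interval: "AE t in \<nu>. t \<in> {a..b}"
proof -
  have "{a - real n..a} \<in> null_sets \<nu>" "{b..b + real n} \<in> null_sets \<nu>" for n
    using le by (auto simp: null_sets_def emeasure_Icc G_def)
  then have "(\<Union>n::nat. {a - real n..a}) \<union> (\<Union>n::nat. {b..b + real n}) \<in> null_sets \<nu>"
    by (intro null_sets.Un null_sets_UN)
  then show ?thesis
  proof (rule AE_I')
    show "{t \<in> space \<nu>. t \<notin> {a..b}} \<subseteq> (\<Union>n::nat. {a - real n..a}) \<union> (\<Union>n::nat. {b..b + real n})"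
    proof
      fix t assume "t \<in> {t \<in> space \<nu>. t \<notin> {a..b}}"
      then have "t < a \<or> b < t"
        by auto
      moreover obtain n :: nat where "\<bar>t\<bar> + \<bar>a\<bar> + \<bar>b\<bar> \<le> real n"
        using real_arch_simple by blast
      ultimately show "t \<in> (\<Union>n::nat. {a - real n..a}) \<union> (\<Union>n::nat. {b..b + real n})"
        by (auto intro!: exI[of _ n])
    qed
  qed
qed

lemma emeasure_greaterThan: "emeasure \<nu> {x<..} = ennreal (G b - G x)"
proof (cases "x \<le> b")
  case True
  have "emeasure \<nu> {x<..} = emeasure \<nu> {x..b}"
  proof (rule emeasure_eq_AE)
    have "AE t in \<nu>. t \<noteq> x"
      by (rule AE_I'[of "{x}"]) (auto simp: null_sets_def)
    with AE_in_interval show "AE t in \<nu>. (t \<in> {x<..}) = (t \<in> {x..b})"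
      by eventually_elim auto
  qed auto
  then show ?thesis
    using True by (simp add: emeasure_Icc)
next
  case False
  have "emeasure \<nu> {x<..} = emeasure \<nu> {}"
    using AE_in_interval by (intro emeasure_eq_AE) (use False in auto)
  then show ?thesis
    using False le by (simp add: G_def)
qed

lemma subpath: "a \<le> c \<Longrightarrow> c \<le> d \<Longrightarrow> d \<le> b \<Longrightarrow> rectifiable_path c d \<gamma>"
  using finite_sub continuous_on_subset[OF cont, of "{c..d}"] by unfold_locales auto

text \<open>Integrals over subpaths become set integrals for one fixed atomless measure on the line,
  so that all estimates along a path can be made for this measure. The two sides are compared on
  rays, where both are finite.\<close>

lemma length_measure_subpath:
  assumes "a \<le> c" "c \<le> d" "d \<le> b"
  shows "length_measure (c, d, \<gamma>) = density \<nu> (indicator {c..d})"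
proof (rule measure_eqI_lessThan)
  interpret sub: rectifiable_path c d \<gamma>
    using subpath assms by blast
  show "sets (length_measure (c, d, \<gamma>)) = sets borel" "sets (density \<nu> (indicator {c..d})) = sets borel"
    by auto
  show "emeasure (length_measure (c, d, \<gamma>)) {x<..} < \<infinity>" for x
    by (simp add: sub.emeasure_greaterThan)
  fix x
  let ?x = "max c (min d x)"
  have x: "c \<le> ?x" "?x \<le> d"
    using assms by auto
  have "emeasure (density \<nu> (indicator {c..d})) {x<..} = emeasure \<nu> ({c..d} \<inter> {x<..})"
    by (simp add: emeasure_density nn_integral_set_ennreal[symmetric] flip: indicator_inter_arith)
  also have "\<dots> = emeasure \<nu> {?x..d}"
  proof (rule emeasure_eq_AE)
    have "AE t in \<nu>. t \<noteq> x"
      by (rule AE_I'[of "{x}"]) (auto simp: null_sets_def)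
    moreover have "AE t in \<nu>. t \<noteq> d"
      by (rule AE_I'[of "{d}"]) (auto simp: null_sets_def)
    ultimately show "AE t in \<nu>. (t \<in> {c..d} \<inter> {x<..}) = (t \<in> {?x..d})"
      by eventually_elim auto
  qed auto
  also have "\<dots> = curve_length \<gamma> ?x d"
    using assms x by (intro emeasure_Icc_length) auto
  also have "\<dots> = ennreal (sub.G d - sub.G ?x)"
    using sub.length_eq_G[of ?x d] x by simp
  also have "sub.G ?x = sub.G x"
    using assms by (simp add: sub.G_def)
  finally show "emeasure (length_measure (c, d, \<gamma>)) {x<..} = emeasure (density \<nu> (indicator {c..d})) {x<..}"
    by (simp add: sub.emeasure_greaterThan)
qed

text \<open>A continuous continuation of the path to the whole line, which makes compositions with
  Borel functions Borel on the line. The length measure does not see the added parameters.\<close>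

definition clamp_path :: "real \<Rightarrow> 'z"
  where "clamp_path t = \<gamma> (max a (min b t))"

lemma clamp_path_eq: "t \<in> {a..b} \<Longrightarrow> clamp_path t = \<gamma> t"
  by (simp add: clamp_path_def)

lemma continuous_clamp_path: "continuous_on UNIV clamp_path"
  unfolding clamp_path_def
  by (rule continuous_on_compose2[OF cont]) (use le in \<open>auto intro!: continuous_intros\<close>)

lemma measurable_on_path:
  assumes "\<gamma> ` {a..b} \<subseteq> S" "\<rho> \<in> borel_measurable (restrict_space borel S)"
  shows "(\<lambda>t. \<rho> (clamp_path t)) \<in> borel_measurable borel"
proof (rule measurable_compose[OF _ assms(2)])
  show "clamp_path \<in> borel \<rightarrow>\<^sub>M restrict_space borel S"
    using assms(1) le
    by (intro measurable_restrict_space2 borel_measurable_continuous_onI continuous_clamp_path)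
      (auto simp: clamp_path_def)
qed

lemma path_integral_subpath:
  assumes cd: "a \<le> c" "c \<le> d" "d \<le> b"
    and \<rho>: "\<gamma> ` {a..b} \<subseteq> S" "\<rho> \<in> borel_measurable (restrict_space borel S)"
  shows "path_integral (c, d, \<gamma>) \<rho> = (\<integral>\<^sup>+t\<in>{c..d}. \<rho> (clamp_path t) \<partial>\<nu>)"
proof -
  note [measurable] = measurable_on_path[OF \<rho>]
  have "path_integral (c, d, \<gamma>) \<rho> = (\<integral>\<^sup>+t\<in>{c..d}. \<rho> (\<gamma> t) \<partial>length_measure (c, d, \<gamma>))"
    using finite_sub[OF cd] by (simp add: path_integral_def)
  also have "\<dots> = (\<integral>\<^sup>+t\<in>{c..d}. \<rho> (clamp_path t) \<partial>length_measure (c, d, \<gamma>))"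
    using cd by (intro nn_integral_cong) (auto simp: clamp_path_eq split: split_indicator)
  also have "\<dots> = (\<integral>\<^sup>+t. indicator {c..d} t * (\<rho> (clamp_path t) * indicator {c..d} t) \<partial>\<nu>)"
    unfolding length_measure_subpath[OF cd] by (rule nn_integral_density) auto
  also have "\<dots> = (\<integral>\<^sup>+t\<in>{c..d}. \<rho> (clamp_path t) \<partial>\<nu>)"
    by (intro nn_integral_cong) (auto split: split_indicator)
  finally show ?thesis .
qed

lemma dist_le_length_measure:
  "a \<le> c \<Longrightarrow> c \<le> d \<Longrightarrow> d \<le> b \<Longrightarrow> ennreal (dist (\<gamma> c) (\<gamma> d)) \<le> emeasure \<nu> {c..d}"
  using dist_le_curve_length[of c d \<gamma>] by (simp add: emeasure_Icc_length)

end

section \<open>Integral estimates on an interval\<close>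

locale atomless_measure =
  fixes \<nu> :: "real measure"
  assumes sets_nu [simp, measurable_cong]: "sets \<nu> = sets borel" and atomless [simp]: "emeasure \<nu> {x} = 0"
begin

abbreviation I :: "(real \<Rightarrow> ennreal) \<Rightarrow> real \<Rightarrow> real \<Rightarrow> ennreal"
  where "I f c d \<equiv> \<integral>\<^sup>+t\<in>{c..d}. f t \<partial>\<nu>"

lemma I_add:
  assumes [measurable]: "f \<in> borel_measurable borel" and "c \<le> d" "d \<le> e"
  shows "I f c e = I f c d + I f d e"
proof -
  have "AE t in \<nu>. t \<noteq> d"
    by (rule AE_I'[of "{d}"]) (auto simp: null_sets_def)
  then have "I f c e = (\<integral>\<^sup>+t. f t * indicator {c..d} t + f t * indicator {d..e} t \<partial>\<nu>)"
    by (intro nn_integral_cong_AE, eventually_elim) (use assms in \<open>auto split: split_indicator\<close>)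
  then show ?thesis
    by (simp add: nn_integral_add)
qed

lemma I_mono:
  assumes "\<And>t. t \<in> {c..d} \<Longrightarrow> f t \<le> g t" "c' \<le> c" "d \<le> d'"
  shows "I f c d \<le> I g c' d'"
  using assms by (intro nn_integral_mono) (auto split: split_indicator)

text \<open>The measure with density \<open>f\<close> is finite on \<open>{a..b}\<close> and has no
  atoms, so the intervals shrinking to \<open>t\<close> have small measure.\<close>

lemma I_small:
  assumes [measurable]: "f \<in> borel_measurable borel" and fin: "I f a b < \<infinity>" and e: "0 < e"
  shows "\<exists>r>0. I f (max a (t - r)) (min b (t + r)) < e"
proof -
  define N where "N = density \<nu> f"
  define A where "A n = {max a (t - 1 / real (Suc n))..min b (t + 1 / real (Suc n))}" for n
  have N: "emeasure N B = (\<integral>\<^sup>+t\<in>B. f t \<partial>\<nu>)" if "B \<in> sets borel" for B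
    using that by (simp add: N_def emeasure_density)
  have "(\<lambda>n. emeasure N (A n)) \<longlonglongrightarrow> emeasure N (\<Inter>n. A n)"
  proof (rule Lim_emeasure_decseq)
    show "range A \<subseteq> sets N"
      by (auto simp: A_def N_def)
    show "decseq A"
    proof (rule decseq_SucI)
      fix n
      have "1 / real (Suc (Suc n)) \<le> 1 / real (Suc n)"
        by (simp add: frac_le)
      then show "A (Suc n) \<subseteq> A n"
        unfolding A_def by auto
    qed
    show "emeasure N (A n) \<noteq> \<infinity>" for n
    proof -
      have "emeasure N (A n) \<le> emeasure N {a..b}"
        by (rule emeasure_mono) (auto simp: A_def N_def)
      then show ?thesis
        using fin N[of "{a..b}"] by (auto simp: top_unique)
    qed
  qed
  moreover have "emeasure N (\<Inter>n. A n) = 0"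
  proof -
    have "(\<Inter>n. A n) \<subseteq> {t}"
    proof
      fix s assume s: "s \<in> (\<Inter>n. A n)"
      have "\<bar>s - t\<bar> \<le> 1 / real (Suc n)" for n
      proof -
        have "s \<in> A n"
          using s by blast
        then have "t - 1 / real (Suc n) \<le> s" "s \<le> t + 1 / real (Suc n)"
          unfolding A_def atLeastAtMost_iff max.bounded_iff min.bounded_iff by blast+
        moreover have "\<bar>s - t\<bar> \<le> q" if "t - q \<le> s" "s \<le> t + q" for q
          using that by linarith
        ultimately show ?thesis
          by blast
      qed
      then have "\<bar>s - t\<bar> \<le> 0"
        using lim_1_over_n[where 'a = real, THEN LIMSEQ_Suc] by (intro LIMSEQ_le_const) (auto simp: inverse_eq_divide)
      then show "s \<in> {t}"
        by simp
    qed
    then have "emeasure N (\<Inter>n. A n) \<le> emeasure N {t}"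
      by (rule emeasure_mono) (simp add: N_def)
    also have "emeasure N {t} = (\<integral>\<^sup>+s\<in>{t}. f s \<partial>\<nu>)"
      by (rule N) simp
    also have "\<dots> = 0"
      by (rule nn_integral_null_set) (simp add: null_sets_def)
    finally show ?thesis
      by simp
  qed
  ultimately have "eventually (\<lambda>n. emeasure N (A n) < e) sequentially"
    using e by (metis order_tendstoD(2))
  then obtain n where "emeasure N (A n) < e"
    by (meson eventually_sequentially order_refl)
  then show ?thesis
    by (intro exI[of _ "1 / real (Suc n)"]) (auto simp: N A_def)
qed

text \<open>An estimate of an increment by an integral passes from two adjacent intervals to their
  union, by the triangle inequality and \<open>I_add\<close>; bisection therefore reduces it to
  short intervals around a point.\<close>

lemma local_to_global:
  fixes f :: "real \<Rightarrow> 'v::real_normed_vector"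
  assumes ab: "a \<le> b" and [measurable]: "g \<in> borel_measurable borel"
    and loc: "\<And>t. a \<le> t \<Longrightarrow> t \<le> b \<Longrightarrow> \<exists>r>0. \<forall>c d. a \<le> c \<and> c \<le> t \<and> t \<le> d \<and> d \<le> b \<and> d - c < r \<longrightarrow>
      ennreal (norm (f c - f d)) \<le> I g c d"
  shows "ennreal (norm (f a - f b)) \<le> I g a b"
proof -
  have "a \<le> a \<longrightarrow> b \<le> b \<longrightarrow> ennreal (norm (f a - f b)) \<le> I g a b"
    using ab
  proof (induction rule: Bolzano[where P = "\<lambda>c d. a \<le> c \<longrightarrow> d \<le> b \<longrightarrow> ennreal (norm (f c - f d)) \<le> I g c d"])
    case (trans c d e)
    show ?case
    proof (intro impI)
      assume "a \<le> c" "e \<le> b"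
      have "ennreal (norm (f c - f e)) \<le> ennreal (norm (f c - f d)) + ennreal (norm (f d - f e))"
        using norm_triangle_ineq[of "f c - f d" "f d - f e"] by (simp flip: ennreal_plus)
      also have "\<dots> \<le> I g c d + I g d e"
        using trans \<open>a \<le> c\<close> \<open>e \<le> b\<close> by (intro add_mono) auto
      also have "\<dots> = I g c e"
        using trans by (intro I_add[symmetric]) auto
      finally show "ennreal (norm (f c - f e)) \<le> I g c e" .
    qed
  next
    case (local x)
    then show ?case
      using loc[of x] by blast
  qed
  then show ?thesis
    by simp
qed

text \<open>The product rule along a path. Near a parameter where \<open>e\<close> does not vanish
  identically, \<open>f\<close> and \<open>e\<close> oscillate by at most 2\<epsilon>, so
  \<open>e c\<close> and \<open>f d\<close> may be replaced under the integral by the majorants at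
  the variable of integration. The total error is 2\<epsilon> times the finite integral of
  \<open>\<rho> + \<sigma>\<close>, and \<epsilon> is arbitrary. Where \<open>e\<close> vanishes
  nothing is asked of \<open>f\<close>; this is what later allows a cut-off function to hide the
  boundary.\<close>

lemma Leibniz_estimate:
  fixes f :: "real \<Rightarrow> 'v::real_normed_vector" and e :: "real \<Rightarrow> real"
  assumes ab: "a \<le> b"
    and [measurable]: "\<rho> \<in> borel_measurable borel" "\<sigma> \<in> borel_measurable borel"
      "F \<in> borel_measurable borel" "E \<in> borel_measurable borel"
    and fin: "I \<rho> a b < \<infinity>" "I \<sigma> a b < \<infinity>"
    and F: "\<And>t. t \<in> {a..b} \<Longrightarrow> ennreal (norm (f t)) \<le> F t"
    and E: "\<And>t. t \<in> {a..b} \<Longrightarrow> ennreal \<bar>e t\<bar> \<le> E t"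
    and e: "\<And>c d. a \<le> c \<Longrightarrow> c \<le> d \<Longrightarrow> d \<le> b \<Longrightarrow> ennreal \<bar>e c - e d\<bar> \<le> I \<sigma> c d"
    and loc: "\<And>t. a \<le> t \<Longrightarrow> t \<le> b \<Longrightarrow> \<exists>r>0. (\<forall>c\<in>{a..b}. \<bar>c - t\<bar> < r \<longrightarrow> e c = 0) \<or>
      (\<forall>c d. a \<le> c \<and> c \<le> t \<and> t \<le> d \<and> d \<le> b \<and> d - c < r \<longrightarrow> ennreal (norm (f c - f d)) \<le> I \<rho> c d)"
  shows "ennreal (norm (e a *\<^sub>R f a - e b *\<^sub>R f b)) \<le> I (\<lambda>t. E t * \<rho> t + F t * \<sigma> t) a b"
proof -
  let ?K = "I (\<lambda>t. \<rho> t + \<sigma> t) a b"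
  have K: "?K < \<infinity>"
    using fin by (simp add: distrib_right nn_integral_add)
  have main: "ennreal (norm (e a *\<^sub>R f a - e b *\<^sub>R f b)) \<le> I (\<lambda>t. E t * \<rho> t + F t * \<sigma> t) a b + ennreal (2 * \<epsilon>) * ?K"
    if eps: "0 < \<epsilon>" for \<epsilon> :: real
  proof -
    have "ennreal (norm (e a *\<^sub>R f a - e b *\<^sub>R f b)) \<le>
        I (\<lambda>t. E t * \<rho> t + F t * \<sigma> t + ennreal (2 * \<epsilon>) * (\<rho> t + \<sigma> t)) a b"
    proof (rule local_to_global[OF ab, where f = "\<lambda>t. e t *\<^sub>R f t"])
      fix t assume t: "a \<le> t" "t \<le> b"
      obtain r0 where r0: "r0 > 0" "(\<forall>c\<in>{a..b}. \<bar>c - t\<bar> < r0 \<longrightarrow> e c = 0) \<or>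
          (\<forall>c d. a \<le> c \<and> c \<le> t \<and> t \<le> d \<and> d \<le> b \<and> d - c < r0 \<longrightarrow> ennreal (norm (f c - f d)) \<le> I \<rho> c d)"
        using loc[OF t] by blast
      obtain r1 where r1: "r1 > 0" "I \<rho> (max a (t - r1)) (min b (t + r1)) < ennreal \<epsilon>"
        using I_small[of \<rho> a b "ennreal \<epsilon>" t] fin eps by auto
      obtain r2 where r2: "r2 > 0" "I \<sigma> (max a (t - r2)) (min b (t + r2)) < ennreal \<epsilon>"
        using I_small[of \<sigma> a b "ennreal \<epsilon>" t] fin eps by auto
      define r where "r = min r0 (min r1 r2)"
      have "ennreal (norm (e c *\<^sub>R f c - e d *\<^sub>R f d)) \<le>
        I (\<lambda>t. E t * \<rho> t + F t * \<sigma> t + ennreal (2 * \<epsilon>) * (\<rho> t + \<sigma> t)) c d"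
        if cd: "a \<le> c" "c \<le> t" "t \<le> d" "d \<le> b" "d - c < r" for c d
      proof (cases "e c = 0 \<and> e d = 0")
        case False
        then have sub: "ennreal (norm (f c' - f d')) \<le> I \<rho> c' d'" if "c \<le> c'" "c' \<le> t" "t \<le> d'" "d' \<le> d" for c' d'
          using r0(2) cd that by (auto simp: r_def)
        have small: "I \<rho> c d \<le> ennreal \<epsilon>" "I \<sigma> c d \<le> ennreal \<epsilon>"
        proof -
          have "I \<rho> c d \<le> I \<rho> (max a (t - r1)) (min b (t + r1))"
            using cd by (intro I_mono) (auto simp: r_def)
          then show "I \<rho> c d \<le> ennreal \<epsilon>"
            using r1(2) by simp
          have "I \<sigma> c d \<le> I \<sigma> (max a (t - r2)) (min b (t + r2))"
            using cd by (intro I_mono) (auto simp: r_def)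
          then show "I \<sigma> c d \<le> ennreal \<epsilon>"
            using r2(2) by simp
        qed
        \<comment> \<open>Increments of \<open>f\<close> are controlled only on intervals that
          contain \<open>t\<close>, so \<open>d\<close> and \<open>s\<close> are compared through
          \<open>t\<close>, which gives the factor 2.\<close>
        have f_small: "norm (f d - f s) \<le> 2 * \<epsilon>" if "s \<in> {c..d}" for s
        proof -
          have dt: "norm (f t - f d) \<le> \<epsilon>"
            using order_trans[OF sub[of t d] order_trans[OF I_mono small(1)]] cd eps by simp
          have "norm (f t - f s) \<le> \<epsilon>"
          proof (cases "s \<le> t")
            case True
            then show ?thesis
              using order_trans[OF sub[of s t] order_trans[OF I_mono small(1)]] cd eps that
              by (simp add: norm_minus_commute)
          next
            case False
            then show ?thesis
              using order_trans[OF sub[of t s] order_trans[OF I_mono small(1)]] cd eps that by simp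
          qed
          then show ?thesis
            using dt norm_triangle_ineq4[of "f t - f s" "f t - f d"] by simp
        qed
        have e_small: "\<bar>e c - e s\<bar> \<le> 2 * \<epsilon>" if "s \<in> {c..d}" for s
        proof -
          have "ennreal \<bar>e c - e s\<bar> \<le> I \<sigma> c d"
            using order_trans[OF e[of c s] I_mono] cd that by simp
          then have "ennreal \<bar>e c - e s\<bar> \<le> ennreal \<epsilon>"
            using small(2) by order
          then show ?thesis
            using eps by simp
        qed
        have f_le: "ennreal (norm (f d)) \<le> F s + ennreal (2 * \<epsilon>)" if "s \<in> {c..d}" for s
        proof -
          have "ennreal (norm (f d)) \<le> ennreal (norm (f s)) + ennreal (2 * \<epsilon>)"
            using f_small[OF that] norm_triangle_ineq2[of "f d" "f s"] eps by (simp flip: ennreal_plus)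
          also have "\<dots> \<le> F s + ennreal (2 * \<epsilon>)"
            using F[of s] that cd by (intro add_right_mono) auto
          finally show ?thesis .
        qed
        have e_le: "ennreal \<bar>e c\<bar> \<le> E s + ennreal (2 * \<epsilon>)" if "s \<in> {c..d}" for s
        proof -
          have "ennreal \<bar>e c\<bar> \<le> ennreal \<bar>e s\<bar> + ennreal (2 * \<epsilon>)"
            using e_small[OF that] eps by (simp flip: ennreal_plus)
          also have "\<dots> \<le> E s + ennreal (2 * \<epsilon>)"
            using E[of s] that cd by (intro add_right_mono) auto
          finally show ?thesis .
        qed
        have "e c *\<^sub>R f c - e d *\<^sub>R f d = e c *\<^sub>R (f c - f d) + (e c - e d) *\<^sub>R f d"
          by (simp add: algebra_simps)
        then have "norm (e c *\<^sub>R f c - e d *\<^sub>R f d) \<le> \<bar>e c\<bar> * norm (f c - f d) + norm (f d) * \<bar>e c - e d\<bar>"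
          by (metis norm_triangle_ineq norm_scaleR mult.commute)
        then have "ennreal (norm (e c *\<^sub>R f c - e d *\<^sub>R f d)) \<le>
            ennreal \<bar>e c\<bar> * ennreal (norm (f c - f d)) + ennreal (norm (f d)) * ennreal \<bar>e c - e d\<bar>"
          by (simp flip: ennreal_mult ennreal_plus)
        also have "\<dots> \<le> ennreal \<bar>e c\<bar> * I \<rho> c d + ennreal (norm (f d)) * I \<sigma> c d"
          using sub[of c d] e[of c d] cd by (intro add_mono mult_left_mono) auto
        also have "\<dots> = (\<integral>\<^sup>+s. (ennreal \<bar>e c\<bar> * \<rho> s + ennreal (norm (f d)) * \<sigma> s) * indicator {c..d} s \<partial>\<nu>)"
          by (simp add: nn_integral_cmult nn_integral_add distrib_right mult.assoc)
        also have "\<dots> \<le> I (\<lambda>t. E t * \<rho> t + F t * \<sigma> t + ennreal (2 * \<epsilon>) * (\<rho> t + \<sigma> t)) c d"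
        proof (rule I_mono)
          fix s assume s: "s \<in> {c..d}"
          have "ennreal \<bar>e c\<bar> * \<rho> s + ennreal (norm (f d)) * \<sigma> s \<le>
              (E s + ennreal (2 * \<epsilon>)) * \<rho> s + (F s + ennreal (2 * \<epsilon>)) * \<sigma> s"
            using f_le[OF s] e_le[OF s] by (intro add_mono mult_right_mono) auto
          then show "ennreal \<bar>e c\<bar> * \<rho> s + ennreal (norm (f d)) * \<sigma> s \<le>
              E s * \<rho> s + F s * \<sigma> s + ennreal (2 * \<epsilon>) * (\<rho> s + \<sigma> s)"
            by (simp add: algebra_simps)
        qed auto
        finally show ?thesis .
      qed simp
      then show "\<exists>r>0. \<forall>c d. a \<le> c \<and> c \<le> t \<and> t \<le> d \<and> d \<le> b \<and> d - c < r \<longrightarrow>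
          ennreal (norm (e c *\<^sub>R f c - e d *\<^sub>R f d)) \<le>
            I (\<lambda>t. E t * \<rho> t + F t * \<sigma> t + ennreal (2 * \<epsilon>) * (\<rho> t + \<sigma> t)) c d"
        using r0(1) r1(1) r2(1) by (intro exI[of _ r]) (auto simp: r_def)
    qed simp
    also have "\<dots> = I (\<lambda>t. E t * \<rho> t + F t * \<sigma> t) a b + ennreal (2 * \<epsilon>) * ?K"
      by (simp add: distrib_right nn_integral_add mult.assoc nn_integral_cmult)
    finally show ?thesis .
  qed
  show ?thesis
  proof (rule ennreal_le_epsilon)
    fix \<delta> :: real assume \<delta>: "0 < \<delta>"
    obtain k where k: "0 \<le> k" "?K = ennreal k"
      using K by (cases ?K) auto
    have "ennreal (2 * (\<delta> / (2 * (k + 1)))) * ?K \<le> ennreal \<delta>"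
      using k \<delta> by (auto simp: field_simps simp flip: ennreal_mult)
    moreover have "0 < \<delta> / (2 * (k + 1))"
      using k \<delta> by simp
    ultimately show "ennreal (norm (e a *\<^sub>R f a - e b *\<^sub>R f b)) \<le> I (\<lambda>t. E t * \<rho> t + F t * \<sigma> t) a b + ennreal \<delta>"
      using main by (meson add_left_mono order_trans)
  qed
qed

end

sublocale rectifiable_path \<subseteq> atomless_measure "length_measure (a, b, \<gamma>)"
  by unfold_locales auto

lemma (in rectifiable_path) path_near:
  assumes "a \<le> t" "t \<le> b" "0 < r"
  obtains q where "q > 0" "\<And>t'. t' \<in> {a..b} \<Longrightarrow> \<bar>t' - t\<bar> < q \<Longrightarrow> \<gamma> t' \<in> ball (\<gamma> t) r"
proof -
  have "\<exists>q>0. \<forall>t'\<in>{a..b}. dist t' t < q \<longrightarrow> dist (\<gamma> t') (\<gamma> t) < r"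
    using cont assms by (simp add: continuous_on_iff)
  then show ?thesis
    using that by (auto simp: dist_commute dist_real_def)
qed

section \<open>Weak upper gradients\<close>

text \<open>A negligible family is represented by a function \<sigma> that witnesses it: the paths
  left out are those with infinite \<sigma>-integral, among them all nonrectifiable ones. Families
  are then united by taking maxima, and the same \<sigma> serves for an open subset
  \<open>S\<close>.\<close>

definition ug_outside ::
    "('z \<Rightarrow> ennreal) \<Rightarrow> 'z::metric_space set \<Rightarrow> ('z \<Rightarrow> 'v::real_normed_vector) \<Rightarrow> ('z \<Rightarrow> ennreal) \<Rightarrow> bool"
  where "ug_outside \<sigma> S u \<rho> \<longleftrightarrow> (\<forall>a b \<gamma>. (a, b, \<gamma>) \<in> paths_in S \<longrightarrow> path_integral (a, b, \<gamma>) \<sigma> < \<infinity> \<longrightarrow>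
    ennreal (norm (u (\<gamma> a) - u (\<gamma> b))) \<le> path_integral (a, b, \<gamma>) \<rho>)"

lemma ug_outsideD:
  "ug_outside \<sigma> S u \<rho> \<Longrightarrow> (a, b, \<gamma>) \<in> paths_in S \<Longrightarrow> path_integral (a, b, \<gamma>) \<sigma> < \<infinity> \<Longrightarrow>
    ennreal (norm (u (\<gamma> a) - u (\<gamma> b))) \<le> path_integral (a, b, \<gamma>) \<rho>"
  by (simp add: ug_outside_def)

lemma weak_upper_gradient_iff:
  "weak_upper_gradient M p u \<rho> \<longleftrightarrow> \<rho> \<in> borel_measurable (restrict_space borel (space M)) \<and>
    (\<exists>\<sigma>. Lp_integrable_borel M p \<sigma> \<and> ug_outside \<sigma> (space M) u \<rho>)"
proof
  assume ug: "weak_upper_gradient M p u \<rho>"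
  then obtain \<Gamma> where "p_negligible M p \<Gamma>" and \<Gamma>: "\<forall>(a, b, \<gamma>)\<in>paths_in (space M) - \<Gamma>.
      ennreal (norm (u (\<gamma> a) - u (\<gamma> b))) \<le> path_integral (a, b, \<gamma>) \<rho>"
    unfolding weak_upper_gradient_def by blast
  then obtain \<sigma> where \<sigma>: "Lp_integrable_borel M p \<sigma>" "\<forall>\<gamma>\<in>\<Gamma>. path_integral \<gamma> \<sigma> = \<infinity>"
    unfolding p_negligible_def by blast
  have "ug_outside \<sigma> (space M) u \<rho>"
    unfolding ug_outside_def
  proof (intro allI impI)
    fix a b \<gamma> assume "(a, b, \<gamma>) \<in> paths_in (space M)" "path_integral (a, b, \<gamma>) \<sigma> < \<infinity>"
    then have "(a, b, \<gamma>) \<in> paths_in (space M) - \<Gamma>"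
      using \<sigma>(2) by force
    then show "ennreal (norm (u (\<gamma> a) - u (\<gamma> b))) \<le> path_integral (a, b, \<gamma>) \<rho>"
      using \<Gamma> by blast
  qed
  then show "\<rho> \<in> borel_measurable (restrict_space borel (space M)) \<and>
    (\<exists>\<sigma>. Lp_integrable_borel M p \<sigma> \<and> ug_outside \<sigma> (space M) u \<rho>)"
    using \<sigma>(1) ug by (auto simp: weak_upper_gradient_def)
next
  assume "\<rho> \<in> borel_measurable (restrict_space borel (space M)) \<and>
    (\<exists>\<sigma>. Lp_integrable_borel M p \<sigma> \<and> ug_outside \<sigma> (space M) u \<rho>)"
  then obtain \<sigma> where *: "\<rho> \<in> borel_measurable (restrict_space borel (space M))"
    "Lp_integrable_borel M p \<sigma>" "ug_outside \<sigma> (space M) u \<rho>"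
    by blast
  have "p_negligible M p {\<gamma> \<in> paths_in (space M). path_integral \<gamma> \<sigma> = \<infinity>}"
    using * by (auto simp: p_negligible_def)
  moreover have "\<forall>(a, b, \<gamma>)\<in>paths_in (space M) - {\<gamma> \<in> paths_in (space M). path_integral \<gamma> \<sigma> = \<infinity>}.
      ennreal (norm (u (\<gamma> a) - u (\<gamma> b))) \<le> path_integral (a, b, \<gamma>) \<rho>"
    using *(3) by (auto simp: ug_outside_def less_top[symmetric])
  ultimately show "weak_upper_gradient M p u \<rho>"
    using * unfolding weak_upper_gradient_def by blast
qed

lemma rectifiable_pathI:
  assumes "(a, b, \<gamma>) \<in> paths_in S" "path_integral (a, b, \<gamma>) \<sigma> < \<infinity>"
  shows "rectifiable_path a b \<gamma>" "\<gamma> ` {a..b} \<subseteq> S" "a \<le> b"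
proof -
  show "rectifiable_path a b \<gamma>"
    using assms by unfold_locales (auto simp: paths_in_def path_integral_def split: if_splits)
qed (use assms in \<open>auto simp: paths_in_def\<close>)

lemma subpath_in: "(a, b, \<gamma>) \<in> paths_in S \<Longrightarrow> a \<le> c \<Longrightarrow> c \<le> d \<Longrightarrow> d \<le> b \<Longrightarrow> (c, d, \<gamma>) \<in> paths_in S"
  by (auto simp: paths_in_def elim: continuous_on_subset)

lemma path_integral_mono:
  assumes "(a, b, \<gamma>) \<in> paths_in S" "\<And>x. x \<in> S \<Longrightarrow> f x \<le> g x"
  shows "path_integral (a, b, \<gamma>) f \<le> path_integral (a, b, \<gamma>) g"
  using assms(1)
  by (force simp: path_integral_def paths_in_def intro!: nn_integral_mono assms(2) split: split_indicator)

lemma path_integral_subpath_le: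
  assumes "(a, b, \<gamma>) \<in> paths_in S" "f \<in> borel_measurable (restrict_space borel S)" "a \<le> c" "c \<le> d" "d \<le> b"
  shows "path_integral (c, d, \<gamma>) f \<le> path_integral (a, b, \<gamma>) f"
proof (cases "path_integral (a, b, \<gamma>) f < \<infinity>")
  case True
  interpret rectifiable_path a b \<gamma>
    using assms(1) True by (rule rectifiable_pathI)
  note sub = rectifiable_pathI(2)[OF assms(1) True]
  show ?thesis
    unfolding path_integral_subpath[OF assms(3-5) sub assms(2)]
      path_integral_subpath[OF order_refl le order_refl sub assms(2)]
    using assms by (intro I_mono) auto
qed (simp add: less_top[symmetric])

lemma path_integral_add:
  assumes "(a, b, \<gamma>) \<in> paths_in S" "f \<in> borel_measurable (restrict_space borel S)"
    "g \<in> borel_measurable (restrict_space borel S)"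
  shows "path_integral (a, b, \<gamma>) (\<lambda>x. f x + g x) = path_integral (a, b, \<gamma>) f + path_integral (a, b, \<gamma>) g"
proof (cases "curve_length \<gamma> a b < \<infinity>")
  case True
  interpret rectifiable_path a b \<gamma>
    using assms(1) True by unfold_locales (auto simp: paths_in_def)
  have sub: "\<gamma> ` {a..b} \<subseteq> S"
    using assms(1) by (auto simp: paths_in_def)
  note [measurable] = measurable_on_path[OF sub assms(2)] measurable_on_path[OF sub assms(3)]
  have fg: "(\<lambda>x. f x + g x) \<in> borel_measurable (restrict_space borel S)"
    using assms by measurable
  show ?thesis
    unfolding path_integral_subpath[OF order_refl le order_refl sub assms(2)]
      path_integral_subpath[OF order_refl le order_refl sub assms(3)]
      path_integral_subpath[OF order_refl le order_refl sub fg]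
    by (simp add: distrib_right nn_integral_add)
qed (simp add: path_integral_def)

lemma path_integral_cmult:
  assumes "(a, b, \<gamma>) \<in> paths_in S" "f \<in> borel_measurable (restrict_space borel S)" "curve_length \<gamma> a b < \<infinity>"
  shows "path_integral (a, b, \<gamma>) (\<lambda>x. c * f x) = c * path_integral (a, b, \<gamma>) f"
proof -
  interpret rectifiable_path a b \<gamma>
    using assms by unfold_locales (auto simp: paths_in_def)
  have sub: "\<gamma> ` {a..b} \<subseteq> S"
    using assms(1) by (auto simp: paths_in_def)
  note [measurable] = measurable_on_path[OF sub assms(2)]
  have fg: "(\<lambda>x. c * f x) \<in> borel_measurable (restrict_space borel S)"
    using assms by measurable
  show ?thesis
    unfolding path_integral_subpath[OF order_refl le order_refl sub assms(2)]
      path_integral_subpath[OF order_refl le order_refl sub fg]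
    by (simp add: nn_integral_cmult mult.assoc)
qed

lemma borel_null_hull_measurable:
  fixes f :: "'z::metric_space \<Rightarrow> ennreal"
  assumes "borel_null_hull M" "f \<in> borel_measurable (restrict_space borel (space M))"
  shows "f \<in> borel_measurable M"
proof (rule measurableI)
  fix A :: "ennreal set" assume "A \<in> sets borel"
  then show "f -` A \<inter> space M \<in> sets M"
    using measurable_sets[OF assms(2), of A] assms(1) by (auto simp: borel_null_hull_def space_restrict_space)
qed auto

lemma Lp_integrable_borelD:
  "Lp_integrable_borel M p f \<Longrightarrow> f \<in> borel_measurable (restrict_space borel (space M))"
  "Lp_integrable_borel M p f \<Longrightarrow> (\<integral>\<^sup>+x. epowr (f x) p \<partial>M) < \<infinity>"
  unfolding Lp_integrable_borel_def by blast+

lemma Lp_integrable_borel_measurable: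
  "borel_null_hull M \<Longrightarrow> Lp_integrable_borel M p f \<Longrightarrow> f \<in> borel_measurable M"
  by (rule borel_null_hull_measurable[OF _ Lp_integrable_borelD(1)])

lemma Lp_integrable_borel_max:
  assumes "borel_null_hull M" "0 \<le> p" "Lp_integrable_borel M p f" "Lp_integrable_borel M p g"
  shows "Lp_integrable_borel M p (\<lambda>x. max (f x) (g x))"
proof -
  have [measurable]: "f \<in> borel_measurable M" "g \<in> borel_measurable M"
    using assms Lp_integrable_borel_measurable by blast+
  have "(\<integral>\<^sup>+x. epowr (max (f x) (g x)) p \<partial>M) \<le> (\<integral>\<^sup>+x. epowr (f x) p + epowr (g x) p \<partial>M)"
    using assms by (intro nn_integral_mono) (auto simp: epowr_max)
  also have "\<dots> < \<infinity>"
    using assms by (simp add: nn_integral_add Lp_integrable_borel_def)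
  finally show ?thesis
    using assms by (auto simp: Lp_integrable_borel_def)
qed

lemma Lp_integrable_borel_cmult:
  assumes "borel_null_hull M" "Lp_integrable_borel M p f" "c < \<infinity>"
  shows "Lp_integrable_borel M p (\<lambda>x. c * f x)"
proof -
  have [measurable]: "f \<in> borel_measurable M"
    using assms Lp_integrable_borel_measurable by blast+
  have "(\<integral>\<^sup>+x. epowr (c * f x) p \<partial>M) < \<infinity>"
    using assms epowr_less_top[of c p]
    by (auto simp: epowr_mult nn_integral_cmult Lp_integrable_borel_def ennreal_mult_less_top)
  then show ?thesis
    using assms by (auto simp: Lp_integrable_borel_def)
qed

lemma Lp_integrable_borel_null:
  assumes "borel_null_hull M" "B \<in> sets (restrict_space borel (space M))" "emeasure M B = 0"
  shows "Lp_integrable_borel M p (\<lambda>x. top * indicator B x)"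
proof -
  have B: "B \<in> null_sets M"
    using assms by (auto simp: borel_null_hull_def null_sets_def)
  have "(\<integral>\<^sup>+x. epowr (top * indicator B x) p \<partial>M) = (\<integral>\<^sup>+x. 0 \<partial>M)"
    by (intro nn_integral_cong_AE AE_I'[OF B]) (auto split: split_indicator)
  then show ?thesis
    using assms by (simp add: Lp_integrable_borel_def)
qed

lemma path_integral_finite_mono:
  assumes "(a, b, \<gamma>) \<in> paths_in S" "\<And>x. x \<in> S \<Longrightarrow> f x \<le> g x" "path_integral (a, b, \<gamma>) g < \<infinity>"
  shows "path_integral (a, b, \<gamma>) f < \<infinity>"
  using path_integral_mono[OF assms(1,2)] assms(3) by (rule le_less_trans)

text \<open>A subpath inherits the finite \<sigma>-integral, so outside the exceptional family the
  estimate holds for all subpaths at once. Enlarging \<sigma> to dominate \<rho> makes the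
  right-hand sides finite.\<close>

lemma good_paths:
  assumes M: "borel_null_hull M" and p: "0 < p" and ug: "weak_upper_gradient M p v \<rho>"
    and \<rho>: "Lp_integrable_borel M p \<rho>"
  obtains \<sigma> where "Lp_integrable_borel M p \<sigma>" "\<And>x. \<rho> x \<le> \<sigma> x"
    "\<And>a b c d \<gamma>. (a, b, \<gamma>) \<in> paths_in (space M) \<Longrightarrow> path_integral (a, b, \<gamma>) \<sigma> < \<infinity> \<Longrightarrow> a \<le> c \<Longrightarrow> c \<le> d \<Longrightarrow> d \<le> b \<Longrightarrow>
      ennreal (norm (v (\<gamma> c) - v (\<gamma> d))) \<le> path_integral (c, d, \<gamma>) \<rho>"
proof -
  obtain \<sigma> where \<sigma>: "Lp_integrable_borel M p \<sigma>" "ug_outside \<sigma> (space M) v \<rho>"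
    using ug by (auto simp: weak_upper_gradient_iff)
  let ?s = "\<lambda>x. max (\<sigma> x) (\<rho> x)"
  have s: "Lp_integrable_borel M p ?s"
    using Lp_integrable_borel_max[OF M _ \<sigma>(1) \<rho>] p by simp
  show ?thesis
  proof (rule that[OF s])
    fix a b c d :: real and \<gamma> :: "real \<Rightarrow> 'a"
    assume path: "(a, b, \<gamma>) \<in> paths_in (space M)" and fin: "path_integral (a, b, \<gamma>) ?s < \<infinity>"
      and cd: "a \<le> c" "c \<le> d" "d \<le> b"
    have path': "(c, d, \<gamma>) \<in> paths_in (space M)"
      using subpath_in[OF path cd] .
    have "path_integral (c, d, \<gamma>) ?s < \<infinity>"
      using path_integral_subpath_le[OF path _ cd, of ?s] s fin by (auto simp: Lp_integrable_borel_def)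
    then have "path_integral (c, d, \<gamma>) \<sigma> < \<infinity>"
      by (rule path_integral_finite_mono[OF path', rotated]) simp
    then show "ennreal (norm (v (\<gamma> c) - v (\<gamma> d))) \<le> path_integral (c, d, \<gamma>) \<rho>"
      using \<sigma>(2) path' by (rule ug_outsideD[rotated 2])
  qed simp
qed

text \<open>
  The exceptional set of points where \<open>v\<close> leaves \<open>C\<close> is invisible to almost every nonconstant
  path: such a path spends no length in it, and \<open>v\<close> is continuous along the path.
\<close>

lemma weak_upper_gradient_compose:
  fixes v :: "'z::metric_space \<Rightarrow> 'v::real_normed_vector" and T :: "'v \<Rightarrow> 'w::real_normed_vector"
  assumes M: "borel_null_hull M" and p: "0 < p" and ug: "weak_upper_gradient M p v \<rho>"
    and \<rho>: "Lp_integrable_borel M p \<rho>" and C: "AE x in M. v x \<in> C" "closed C"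
    and T: "\<And>x y. x \<in> C \<Longrightarrow> y \<in> C \<Longrightarrow> norm (T x - T y) \<le> L * norm (x - y)" and L: "0 \<le> L"
  shows "weak_upper_gradient M p (\<lambda>x. T (v x)) (\<lambda>x. ennreal L * \<rho> x)"
proof -
  obtain \<sigma> where \<sigma>: "Lp_integrable_borel M p \<sigma>" "\<And>x. \<rho> x \<le> \<sigma> x"
    "\<And>a b c d \<gamma>. (a, b, \<gamma>) \<in> paths_in (space M) \<Longrightarrow> path_integral (a, b, \<gamma>) \<sigma> < \<infinity> \<Longrightarrow> a \<le> c \<Longrightarrow> c \<le> d \<Longrightarrow> d \<le> b \<Longrightarrow>
      ennreal (norm (v (\<gamma> c) - v (\<gamma> d))) \<le> path_integral (c, d, \<gamma>) \<rho>"
    using good_paths[OF M p ug \<rho>] by blast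
  obtain N where N: "{x \<in> space M. \<not> v x \<in> C} \<subseteq> N" "N \<in> null_sets M"
    using C(1) by (auto simp: eventually_ae_filter)
  then obtain B where B: "B \<in> sets (restrict_space borel (space M))" "N \<subseteq> B" "emeasure M B = 0"
    using M by (auto simp: borel_null_hull_def)
  \<comment> \<open>A finite integral of this function means that the path spends zero length in
    \<open>B\<close>; since \<open>B\<close> is null, adding it keeps the witness
    p-integrable.\<close>
  let ?k = "\<lambda>x. top * indicator B x :: ennreal"
  let ?s = "\<lambda>x. max (\<sigma> x) (?k x)"
  have s: "Lp_integrable_borel M p ?s"
    using Lp_integrable_borel_max[OF M _ \<sigma>(1) Lp_integrable_borel_null[OF M B(1,3)]] p by simp
  have \<rho>': "\<rho> \<in> borel_measurable (restrict_space borel (space M))"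
    using \<rho> by (simp add: Lp_integrable_borel_def)
  have "ug_outside ?s (space M) (\<lambda>x. T (v x)) (\<lambda>x. ennreal L * \<rho> x)"
    unfolding ug_outside_def
  proof (intro allI impI)
    fix a b :: real and \<gamma> :: "real \<Rightarrow> 'z"
    assume path: "(a, b, \<gamma>) \<in> paths_in (space M)" and fin: "path_integral (a, b, \<gamma>) ?s < \<infinity>"
    interpret rectifiable_path a b \<gamma>
      using path fin by (rule rectifiable_pathI)
    have sub: "\<gamma> ` {a..b} \<subseteq> space M"
      using path by (auto simp: paths_in_def)
    have fin\<sigma>: "path_integral (a, b, \<gamma>) \<sigma> < \<infinity>"
      by (rule path_integral_finite_mono[OF path _ fin]) simp
    have fin\<rho>: "path_integral (a, b, \<gamma>) \<rho> < \<infinity>"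
      by (rule path_integral_finite_mono[OF path _ fin\<sigma>]) (rule \<sigma>(2))
    have fink: "path_integral (a, b, \<gamma>) ?k < \<infinity>"
      by (rule path_integral_finite_mono[OF path _ fin]) simp
    have k: "?k \<in> borel_measurable (restrict_space borel (space M))"
      using B(1) by measurable
    define r where "r t = \<rho> (clamp_path t)" for t
    have r [measurable]: "r \<in> borel_measurable borel"
      unfolding r_def by (rule measurable_on_path[OF sub \<rho>'])
    have r_eq: "path_integral (c, d, \<gamma>) \<rho> = I r c d" if "a \<le> c" "c \<le> d" "d \<le> b" for c d
      unfolding r_def using path_integral_subpath[OF that sub \<rho>'] .
    have v_est: "ennreal (norm (v (\<gamma> c) - v (\<gamma> d))) \<le> I r c d" if "a \<le> c" "c \<le> d" "d \<le> b" for c d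
      using \<sigma>(3)[OF path fin\<sigma> that] r_eq[OF that] by simp
    have v_cont: "continuous_on {a..b} (\<lambda>t. v (\<gamma> t))"
      unfolding continuous_on_iff
    proof (intro ballI allI impI)
      fix t e :: real assume t: "t \<in> {a..b}" and e: "0 < e"
      have "I r a b < \<infinity>"
        using fin\<rho> r_eq[of a b] le by simp
      then obtain q where q: "q > 0" "I r (max a (t - q)) (min b (t + q)) < ennreal e"
        using I_small[OF r, of a b "ennreal e" t] e by auto
      have "dist (v (\<gamma> s)) (v (\<gamma> t)) < e" if s: "s \<in> {a..b}" "dist s t < q" for s
      proof -
        have "ennreal (norm (v (\<gamma> s) - v (\<gamma> t))) \<le> I r (min s t) (max s t)"
          using v_est[of "min s t" "max s t"] s t
          by (cases "s \<le> t") (auto simp: min_def max_def norm_minus_commute)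
        also have "\<dots> \<le> I r (max a (t - q)) (min b (t + q))"
          using s t by (intro I_mono) (auto simp: dist_real_def)
        also have "\<dots> < ennreal e"
          by (rule q)
        finally show ?thesis
          by (simp add: dist_norm ennreal_less_iff)
      qed
      then show "\<exists>d>0. \<forall>s\<in>{a..b}. dist s t < d \<longrightarrow> dist (v (\<gamma> s)) (v (\<gamma> t)) < e"
        using q(1) by blast
    qed
    have null: "emeasure \<nu> {c..d} = 0" if cd: "a \<le> c" "c \<le> d" "d \<le> b" and out: "\<And>t. c < t \<Longrightarrow> t < d \<Longrightarrow> v (\<gamma> t) \<notin> C" for c d
    proof -
      have "path_integral (a, b, \<gamma>) ?k = I (\<lambda>t. ?k (clamp_path t)) a b"
        using path_integral_subpath[OF order_refl le order_refl sub k] .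
      moreover have "I (\<lambda>t. ?k (clamp_path t)) a b \<ge> (\<integral>\<^sup>+t. top * indicator {c<..<d} t \<partial>\<nu>)"
      proof (rule nn_integral_mono)
        fix t
        have "clamp_path t \<in> B" if t: "c < t" "t < d"
        proof -
          have "\<gamma> t \<in> space M"
            using sub cd t by auto
          then have "\<gamma> t \<in> B"
            using N(1) B(2) out[OF t] by blast
          then show ?thesis
            using cd t by (simp add: clamp_path_eq)
        qed
        then show "top * indicator {c<..<d} t \<le> ?k (clamp_path t) * indicator {a..b} t"
          using cd by (auto split: split_indicator)
      qed
      ultimately have "top * emeasure \<nu> {c<..<d} < (\<infinity>::ennreal)"
        using fink by (simp add: nn_integral_cmult)
      then have 0: "emeasure \<nu> {c<..<d} = 0"
        by (auto simp: ennreal_top_mult split: if_splits)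
      have "emeasure \<nu> {c..d} \<le> emeasure \<nu> ({c<..<d} \<union> {c} \<union> {d})"
        by (intro emeasure_mono) auto
      also have "\<dots> \<le> emeasure \<nu> {c<..<d} + emeasure \<nu> {c} + emeasure \<nu> {d}"
        by (intro order_trans[OF emeasure_subadditive] add_right_mono emeasure_subadditive) auto
      finally show ?thesis
        using 0 by simp
    qed
    have const: "\<gamma> c = \<gamma> d" if cd: "a \<le> c" "c \<le> d" "d \<le> b" and out: "\<And>t. c < t \<Longrightarrow> t < d \<Longrightarrow> v (\<gamma> t) \<notin> C" for c d
      using dist_le_length_measure[OF cd] null[OF cd out] by simp
    \<comment> \<open>If \<open>v (\<gamma> t)\<close> is outside \<open>C\<close>, go from
      \<open>t\<close> to the nearest parameter towards \<open>s\<close> whose value is in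
      \<open>C\<close>. Up to there the path has zero length, hence does not move, so the two values
      of \<open>v\<close> coincide. If no such parameter exists, the path does not move up to
      \<open>s\<close> either.\<close>
    have hit: "v (\<gamma> t) \<in> C" if t: "t \<in> {a..b}" and s: "s \<in> {a..b}" "\<gamma> s \<noteq> \<gamma> t" for s t
    proof (rule ccontr)
      assume out: "v (\<gamma> t) \<notin> C"
      define K where "K = {r \<in> {min s t..max s t}. v (\<gamma> r) \<in> C}"
      have cl: "closed K"
      proof -
        have "continuous_on {min s t..max s t} (\<lambda>t. v (\<gamma> t))"
          using s t by (intro continuous_on_subset[OF v_cont]) auto
        moreover have "K = {min s t..max s t} \<inter> (\<lambda>t. v (\<gamma> t)) -` C"
          by (auto simp: K_def)
        ultimately show ?thesis
          using continuous_closed_preimage[OF _ closed_atLeastAtMost C(2)] by simp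
      qed
      have "K \<noteq> {}"
      proof
        assume "K = {}"
        then have "\<gamma> (min s t) = \<gamma> (max s t)"
          using s t by (intro const) (auto simp: K_def)
        then show False
          using s by (auto simp: min_def max_def split: if_splits)
      qed
      then obtain r where r: "r \<in> K" "\<And>r'. r' \<in> K \<Longrightarrow> dist t r \<le> dist t r'"
        using distance_attains_inf[OF cl, of t] by blast
      have "\<gamma> (min r t) = \<gamma> (max r t)"
      proof (rule const)
        fix q assume q: "min r t < q" "q < max r t"
        show "v (\<gamma> q) \<notin> C"
        proof
          assume "v (\<gamma> q) \<in> C"
          then have "q \<in> K"
            using q r(1) by (auto simp: K_def min_def max_def split: if_splits)
          then show False
            using r(2)[of q] q by (auto simp: dist_real_def min_def max_def split: if_splits)
        qed
      qed (use r s t in \<open>auto simp: K_def min_def max_def split: if_splits\<close>)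
      then have "\<gamma> r = \<gamma> t"
        by (auto simp: min_def max_def split: if_splits)
      then show False
        using r(1) out by (auto simp: K_def)
    qed
    show "ennreal (norm (T (v (\<gamma> a)) - T (v (\<gamma> b)))) \<le> path_integral (a, b, \<gamma>) (\<lambda>x. ennreal L * \<rho> x)"
    proof (cases "\<gamma> a = \<gamma> b")
      case False
      then have "v (\<gamma> a) \<in> C" "v (\<gamma> b) \<in> C"
        using hit[of a b] hit[of b a] le by auto
      then have "norm (T (v (\<gamma> a)) - T (v (\<gamma> b))) \<le> L * norm (v (\<gamma> a) - v (\<gamma> b))"
        by (rule T)
      then have "ennreal (norm (T (v (\<gamma> a)) - T (v (\<gamma> b)))) \<le> ennreal L * ennreal (norm (v (\<gamma> a) - v (\<gamma> b)))"
        using L by (simp flip: ennreal_mult)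
      also have "\<dots> \<le> ennreal L * path_integral (a, b, \<gamma>) \<rho>"
        using \<sigma>(3)[OF path fin\<sigma> order_refl le order_refl] by (intro mult_left_mono) auto
      also have "\<dots> = path_integral (a, b, \<gamma>) (\<lambda>x. ennreal L * \<rho> x)"
        using path_integral_cmult[OF path \<rho>' finite_length] by simp
      finally show ?thesis .
    qed simp
  qed
  then show ?thesis
    unfolding weak_upper_gradient_iff using s \<rho>' by (auto intro!: borel_measurable_times_ennreal)
qed

lemma Lp_integrable_borel_restrict:
  assumes "borel_null_hull M" "space M = UNIV" "S \<in> sets M" "Lp_integrable_borel M p \<rho>"
  shows "Lp_integrable_borel (restrict_space M S) p \<rho>"
proof -
  have "(\<integral>\<^sup>+x. epowr (\<rho> x) p \<partial>restrict_space M S) \<le> (\<integral>\<^sup>+x. epowr (\<rho> x) p \<partial>M)"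
    using assms by (subst nn_integral_restrict_space) (auto intro!: nn_integral_mono split: split_indicator)
  also have "\<dots> < \<infinity>"
    using assms by (simp add: Lp_integrable_borel_def)
  finally show ?thesis
    using assms by (auto simp: Lp_integrable_borel_def space_restrict_space intro: measurable_restrict_space1)
qed

lemma weak_upper_gradient_restrict:
  assumes "borel_null_hull M" "space M = UNIV" "S \<in> sets M" "weak_upper_gradient M p u \<rho>"
  shows "weak_upper_gradient (restrict_space M S) p u \<rho>"
proof -
  obtain \<sigma> where \<sigma>: "Lp_integrable_borel M p \<sigma>" "ug_outside \<sigma> UNIV u \<rho>" "\<rho> \<in> borel_measurable borel"
    using assms by (auto simp: weak_upper_gradient_iff)
  have "paths_in S \<subseteq> paths_in UNIV"
    by (auto simp: paths_in_def)
  then have "ug_outside \<sigma> S u \<rho>"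
    using \<sigma>(2) by (auto simp: ug_outside_def)
  then show ?thesis
    using Lp_integrable_borel_restrict[OF assms(1-3) \<sigma>(1)] \<sigma>(3) assms
    by (auto simp: weak_upper_gradient_iff space_restrict_space intro: measurable_restrict_space1)
qed

text \<open>On a short subpath the Lipschitz bound holds with the value of \<open>s\<close> at every
  parameter. Integrating over the parameter gives increment * length \<le> distance * integral of
  \<open>s\<close>; as the distance is at most the length, the distance can be cancelled.\<close>

lemma ug_local_Lipschitz:
  fixes u :: "'z::metric_space \<Rightarrow> 'v::real_normed_vector"
  assumes loc: "\<And>z. z \<in> W \<Longrightarrow> \<exists>r>0. \<forall>x\<in>ball z r. \<forall>y\<in>ball z r. \<forall>w\<in>ball z r.
      ennreal (norm (u x - u y)) \<le> s w * ennreal (dist x y)"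
    and s: "s \<in> borel_measurable borel"
    and path: "(a, b, \<gamma>) \<in> paths_in W" and fin: "curve_length \<gamma> a b < \<infinity>"
  shows "ennreal (norm (u (\<gamma> a) - u (\<gamma> b))) \<le> path_integral (a, b, \<gamma>) s"
proof -
  interpret rectifiable_path a b \<gamma>
    using path fin by unfold_locales (auto simp: paths_in_def)
  have sub: "\<gamma> ` {a..b} \<subseteq> W"
    using path by (auto simp: paths_in_def)
  have s': "s \<in> borel_measurable (restrict_space borel UNIV)"
    using s by simp
  have sm [measurable]: "(\<lambda>t. s (clamp_path t)) \<in> borel_measurable borel"
    using measurable_on_path[OF subset_UNIV s'] .
  have "ennreal (norm (u (\<gamma> a) - u (\<gamma> b))) \<le> I (\<lambda>t. s (clamp_path t)) a b"
  proof (rule local_to_global[OF le sm, where f = "\<lambda>t. u (\<gamma> t)"])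
    fix t assume t: "a \<le> t" "t \<le> b"
    then have "\<gamma> t \<in> W"
      using sub by auto
    then obtain r where r: "r > 0" "\<forall>x\<in>ball (\<gamma> t) r. \<forall>y\<in>ball (\<gamma> t) r. \<forall>w\<in>ball (\<gamma> t) r.
        ennreal (norm (u x - u y)) \<le> s w * ennreal (dist x y)"
      using loc by blast
    obtain q where q: "q > 0" "\<And>t'. t' \<in> {a..b} \<Longrightarrow> \<bar>t' - t\<bar> < q \<Longrightarrow> \<gamma> t' \<in> ball (\<gamma> t) r"
      using path_near[OF t r(1)] by blast
    have "ennreal (norm (u (\<gamma> c) - u (\<gamma> d))) \<le> I (\<lambda>t. s (clamp_path t)) c d"
      if cd: "a \<le> c" "c \<le> t" "t \<le> d" "d \<le> b" "d - c < q" for c d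
    proof -
      have ball: "\<gamma> t' \<in> ball (\<gamma> t) r" if "t' \<in> {c..d}" for t'
        using q(2)[of t'] that cd by auto
      have "ennreal (norm (u (\<gamma> c) - u (\<gamma> d))) * indicator {c..d} t' \<le>
          ennreal (dist (\<gamma> c) (\<gamma> d)) * (s (clamp_path t') * indicator {c..d} t')" for t'
        using r(2) ball cd by (auto split: split_indicator simp: clamp_path_eq mult.commute)
      then have "(\<integral>\<^sup>+t'. ennreal (norm (u (\<gamma> c) - u (\<gamma> d))) * indicator {c..d} t' \<partial>\<nu>) \<le>
          (\<integral>\<^sup>+t'. ennreal (dist (\<gamma> c) (\<gamma> d)) * (s (clamp_path t') * indicator {c..d} t') \<partial>\<nu>)"
        by (intro nn_integral_mono) blast
      then have *: "ennreal (norm (u (\<gamma> c) - u (\<gamma> d))) * emeasure \<nu> {c..d} \<le>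
          ennreal (dist (\<gamma> c) (\<gamma> d)) * I (\<lambda>t. s (clamp_path t)) c d"
        by (simp add: nn_integral_cmult)
      show ?thesis
      proof (cases "\<gamma> c = \<gamma> d")
        case False
        have "ennreal (dist (\<gamma> c) (\<gamma> d)) * ennreal (norm (u (\<gamma> c) - u (\<gamma> d))) \<le>
            ennreal (norm (u (\<gamma> c) - u (\<gamma> d))) * emeasure \<nu> {c..d}"
          using dist_le_length_measure[of c d] cd by (subst mult.commute) (auto intro!: mult_left_mono)
        with * have "ennreal (dist (\<gamma> c) (\<gamma> d)) * ennreal (norm (u (\<gamma> c) - u (\<gamma> d))) \<le>
            ennreal (dist (\<gamma> c) (\<gamma> d)) * I (\<lambda>t. s (clamp_path t)) c d"
          by order
        then show ?thesis
          using False by (subst (asm) ennreal_mult_le_mult_iff) auto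
      qed simp
    qed
    then show "\<exists>r>0. \<forall>c d. a \<le> c \<and> c \<le> t \<and> t \<le> d \<and> d \<le> b \<and> d - c < r \<longrightarrow>
        ennreal (norm (u (\<gamma> c) - u (\<gamma> d))) \<le> I (\<lambda>t. s (clamp_path t)) c d"
      using q(1) by blast
  qed
  then show ?thesis
    using path_integral_subpath[OF order_refl le order_refl subset_UNIV s'] by simp
qed

text \<open>The function \<open>v\<close> is controlled only on paths inside \<open>W\<close>; a
  point of the path outside \<open>W\<close> has a neighbourhood where \<theta> vanishes, and these
  are the two alternatives in \<open>Leibniz_estimate\<close>. \<open>F\<close> is a Borel majorant
  of the norm of \<open>v\<close>. The bound \<open>S\<close> and the finite length provide the
  finite integral of \<open>s\<close>. The lemma serves for a power of the distance, with
  \<open>W = UNIV\<close>, and for the cut-off at the boundary.\<close>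

lemma ug_mult:
  fixes v :: "'z::metric_space \<Rightarrow> 'v::real_normed_vector" and \<theta> :: "'z \<Rightarrow> real"
  assumes W: "open W" and \<sigma>: "\<sigma> \<in> borel_measurable borel" "\<And>x. \<rho> x \<le> \<sigma> x"
    and \<rho>: "\<rho> \<in> borel_measurable borel"
    and v: "ug_outside \<sigma> W v \<rho>"
    and F: "F \<in> borel_measurable borel" "\<And>x. ennreal (norm (v x)) \<le> F x"
    and \<theta>: "\<theta> \<in> borel_measurable borel"
    and loc: "\<And>z. \<exists>r>0. \<forall>x\<in>ball z r. \<forall>y\<in>ball z r. \<forall>w\<in>ball z r. \<bar>\<theta> x - \<theta> y\<bar> \<le> s w * dist x y"
    and s: "s \<in> borel_measurable borel" "\<And>x. 0 \<le> s x" "\<And>x. s x \<le> S"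
    and zero: "\<And>z. z \<notin> W \<Longrightarrow> \<exists>r>0. \<forall>x\<in>ball z r. \<theta> x = 0"
  shows "ug_outside \<sigma> UNIV (\<lambda>x. \<theta> x *\<^sub>R v x) (\<lambda>x. ennreal \<bar>\<theta> x\<bar> * \<rho> x + F x * ennreal (s x))"
  unfolding ug_outside_def
proof (intro allI impI)
  fix a b :: real and \<gamma> :: "real \<Rightarrow> 'z"
  assume path: "(a, b, \<gamma>) \<in> paths_in UNIV" and fin: "path_integral (a, b, \<gamma>) \<sigma> < \<infinity>"
  interpret rectifiable_path a b \<gamma>
    using path fin by (rule rectifiable_pathI)
  note [measurable] = \<rho> \<sigma>(1) F(1) \<theta> s(1)
  have pm: "(\<lambda>t. f (clamp_path t)) \<in> borel_measurable borel"
    if "f \<in> borel_measurable borel" for f :: "'z \<Rightarrow> ennreal"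
    using measurable_on_path[OF subset_UNIV, of f] that by simp
  have pi: "path_integral (c, d, \<gamma>) f = I (\<lambda>t. f (clamp_path t)) c d"
    if "a \<le> c" "c \<le> d" "d \<le> b" "f \<in> borel_measurable borel" for c d f
    using path_integral_subpath[OF that(1-3) subset_UNIV, of f] that(4) by simp
  let ?g = "\<lambda>x. ennreal \<bar>\<theta> x\<bar> * \<rho> x + F x * ennreal (s x)"
  have g: "?g \<in> borel_measurable borel"
    by measurable
  have fin\<rho>: "path_integral (a, b, \<gamma>) \<rho> < \<infinity>"
    by (rule path_integral_finite_mono[OF path _ fin]) (rule \<sigma>(2))
  have "ennreal (norm (\<theta> (\<gamma> a) *\<^sub>R v (\<gamma> a) - \<theta> (\<gamma> b) *\<^sub>R v (\<gamma> b))) \<le>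
      I (\<lambda>t. ennreal \<bar>\<theta> (clamp_path t)\<bar> * \<rho> (clamp_path t) + F (clamp_path t) * ennreal (s (clamp_path t))) a b"
  proof (rule Leibniz_estimate[OF le, where f = "\<lambda>t. v (\<gamma> t)" and e = "\<lambda>t. \<theta> (\<gamma> t)"])
    show "(\<lambda>t. \<rho> (clamp_path t)) \<in> borel_measurable borel" "(\<lambda>t. ennreal (s (clamp_path t))) \<in> borel_measurable borel"
      "(\<lambda>t. F (clamp_path t)) \<in> borel_measurable borel" "(\<lambda>t. ennreal \<bar>\<theta> (clamp_path t)\<bar>) \<in> borel_measurable borel"
      by (intro pm; measurable)+
    show "I (\<lambda>t. \<rho> (clamp_path t)) a b < \<infinity>"
      using fin\<rho> pi[OF order_refl le order_refl \<rho>] by simp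
    have "I (\<lambda>t. ennreal (s (clamp_path t))) a b \<le> (\<integral>\<^sup>+t. ennreal S * indicator {a..b} t \<partial>\<nu>)"
      using s(3) by (intro nn_integral_mono) (auto split: split_indicator intro: ennreal_leI)
    also have "\<dots> < \<infinity>"
      using le by (simp add: nn_integral_cmult emeasure_Icc ennreal_mult_less_top)
    finally show "I (\<lambda>t. ennreal (s (clamp_path t))) a b < \<infinity>" .
    show "ennreal (norm (v (\<gamma> t))) \<le> F (clamp_path t)" if "t \<in> {a..b}" for t
      using F(2)[of "\<gamma> t"] clamp_path_eq[OF that] by simp
    show "ennreal \<bar>\<theta> (\<gamma> t)\<bar> \<le> ennreal \<bar>\<theta> (clamp_path t)\<bar>" if "t \<in> {a..b}" for t
      using clamp_path_eq[OF that] by simp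
    show "ennreal \<bar>\<theta> (\<gamma> c) - \<theta> (\<gamma> d)\<bar> \<le> I (\<lambda>t. ennreal (s (clamp_path t))) c d"
      if cd: "a \<le> c" "c \<le> d" "d \<le> b" for c d
    proof -
      have "ennreal (norm (\<theta> (\<gamma> c) - \<theta> (\<gamma> d))) \<le> path_integral (c, d, \<gamma>) (\<lambda>x. ennreal (s x))"
      proof (rule ug_local_Lipschitz[where W = UNIV])
        fix z
        obtain r where "r > 0" "\<forall>x\<in>ball z r. \<forall>y\<in>ball z r. \<forall>w\<in>ball z r. \<bar>\<theta> x - \<theta> y\<bar> \<le> s w * dist x y"
          using loc by blast
        then show "\<exists>r>0. \<forall>x\<in>ball z r. \<forall>y\<in>ball z r. \<forall>w\<in>ball z r.
            ennreal (norm (\<theta> x - \<theta> y)) \<le> ennreal (s w) * ennreal (dist x y)"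
          using s(2) by (intro exI[of _ r]) (auto simp flip: ennreal_mult intro!: ennreal_leI)
      next
        show "(c, d, \<gamma>) \<in> paths_in UNIV"
          using subpath_in[OF path cd] .
        show "curve_length \<gamma> c d < \<infinity>"
          using finite_sub[OF cd] .
      qed measurable
      then show ?thesis
        using pi[OF cd, of "\<lambda>x. ennreal (s x)"] by simp
    qed
    fix t assume t: "a \<le> t" "t \<le> b"
    show "\<exists>r>0. (\<forall>c\<in>{a..b}. \<bar>c - t\<bar> < r \<longrightarrow> \<theta> (\<gamma> c) = 0) \<or>
       (\<forall>c d. a \<le> c \<and> c \<le> t \<and> t \<le> d \<and> d \<le> b \<and> d - c < r \<longrightarrow>
         ennreal (norm (v (\<gamma> c) - v (\<gamma> d))) \<le> I (\<lambda>t. \<rho> (clamp_path t)) c d)"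
    proof (cases "\<gamma> t \<in> W")
      case True
      then obtain r where r: "r > 0" "ball (\<gamma> t) r \<subseteq> W"
        using W open_contains_ball by blast
      obtain q where q: "q > 0" "\<And>t'. t' \<in> {a..b} \<Longrightarrow> \<bar>t' - t\<bar> < q \<Longrightarrow> \<gamma> t' \<in> ball (\<gamma> t) r"
        using path_near[OF t r(1)] by blast
      have "ennreal (norm (v (\<gamma> c) - v (\<gamma> d))) \<le> I (\<lambda>t. \<rho> (clamp_path t)) c d"
        if cd: "a \<le> c" "c \<le> t" "t \<le> d" "d \<le> b" "d - c < q" for c d
      proof -
        have cd': "a \<le> c" "c \<le> d" "d \<le> b"
          using cd by auto
        have "\<gamma> t' \<in> W" if "t' \<in> {c..d}" for t'
          using q(2)[of t'] r(2) that cd by auto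
        then have pathW: "(c, d, \<gamma>) \<in> paths_in W"
          using subpath_in[OF path cd'] by (auto simp: paths_in_def)
        have "path_integral (c, d, \<gamma>) \<sigma> < \<infinity>"
          using path_integral_subpath_le[OF path _ cd', of \<sigma>] \<sigma>(1) fin by auto
        then have "ennreal (norm (v (\<gamma> c) - v (\<gamma> d))) \<le> path_integral (c, d, \<gamma>) \<rho>"
          using v pathW by (rule ug_outsideD[rotated 2])
        then show ?thesis
          using pi[OF cd' \<rho>] by simp
      qed
      then show ?thesis
        using q(1) by blast
    next
      case False
      then obtain r where r: "r > 0" "\<forall>x\<in>ball (\<gamma> t) r. \<theta> x = 0"
        using zero by blast
      obtain q where q: "q > 0" "\<And>t'. t' \<in> {a..b} \<Longrightarrow> \<bar>t' - t\<bar> < q \<Longrightarrow> \<gamma> t' \<in> ball (\<gamma> t) r"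
        using path_near[OF t r(1)] by blast
      have "\<forall>c\<in>{a..b}. \<bar>c - t\<bar> < q \<longrightarrow> \<theta> (\<gamma> c) = 0"
        using q(2) r(2) by blast
      then show ?thesis
        using q(1) by blast
    qed
  qed
  then show "ennreal (norm (\<theta> (\<gamma> a) *\<^sub>R v (\<gamma> a) - \<theta> (\<gamma> b) *\<^sub>R v (\<gamma> b))) \<le> path_integral (a, b, \<gamma>) ?g"
    using pi[OF order_refl le order_refl g] by simp
qed

section \<open>Doubling measures, nets and overlap\<close>

locale pi_const =
  fixes \<mu> :: "'z::metric_space set \<Rightarrow> ennreal" and p cD CP lam :: real
  assumes p: "1 < p"
    and regular: "borel_regular_outer_measure \<mu>"
    and separable: "separable_space (euclidean :: 'z topology)"
    and ball_measure: "\<And>x r. 0 < r \<Longrightarrow> 0 < \<mu> (ball x r) \<and> \<mu> (ball x r) < \<infinity>"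
    and cD: "1 \<le> cD" "\<And>x r. 0 < r \<Longrightarrow> \<mu> (ball x (2 * r)) \<le> ennreal cD * \<mu> (ball x r)"
    and CP: "0 < CP" and lam: "1 \<le> lam"
    and poincare: "\<And>x r (u :: 'z \<Rightarrow> real) \<rho>. 0 < r \<Longrightarrow>
      integrable (restrict_space (caratheodory_measure \<mu>) (ball x (lam * r))) u \<Longrightarrow>
      Lp_integrable_borel (restrict_space (caratheodory_measure \<mu>) (ball x (lam * r))) p \<rho> \<Longrightarrow>
      weak_upper_gradient (restrict_space (caratheodory_measure \<mu>) (ball x (lam * r))) p u \<rho> \<Longrightarrow>
      (\<integral>\<^sup>+ y. ennreal \<bar>u y - (\<integral>y. u y \<partial>restrict_space (caratheodory_measure \<mu>) (ball x r)) / enn2real (\<mu> (ball x r))\<bar>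
          \<partial>restrict_space (caratheodory_measure \<mu>) (ball x r)) / \<mu> (ball x r)
        \<le> ennreal (CP * diameter (ball x r)) *
          epowr ((\<integral>\<^sup>+ y. epowr (\<rho> y) p \<partial>restrict_space (caratheodory_measure \<mu>) (ball x (lam * r))) / \<mu> (ball x (lam * r))) (1 / p)"
begin

abbreviation M :: "'z measure"
  where "M \<equiv> caratheodory_measure \<mu>"

lemma space_M [simp]: "space M = UNIV"
  using space_caratheodory_measure[OF regular] .

lemma borel_sets_M: "A \<in> sets borel \<Longrightarrow> A \<in> sets M"
  using borel_subset_caratheodory[OF regular] by blast

lemma ball_sets [measurable, simp]: "ball x r \<in> sets M"
  by (rule borel_sets_M) simp

lemma borel_measurable_M: "f \<in> borel_measurable borel \<Longrightarrow> f \<in> borel_measurable M"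
  by (rule measurableI) (auto intro!: borel_sets_M dest: measurable_sets)

lemma null_hull_M: "borel_null_hull M"
  using borel_null_hull_caratheodory[OF regular] .

lemma emeasure_ball: "emeasure M (ball x r) = \<mu> (ball x r)"
  using emeasure_caratheodory_measure[OF regular ball_sets] .

definition m :: "'z \<Rightarrow> real \<Rightarrow> real"
  where "m x r = measure M (ball x r)"

lemma ball_finite: "emeasure M (ball x r) < \<infinity>"
proof (cases "0 < r")
  case True
  then show ?thesis
    using ball_measure by (simp add: emeasure_ball)
next
  case False
  then have "ball x r = {}"
    by simp
  then show ?thesis
    by (simp only: emeasure_empty) simp
qed

lemma emeasure_m: "emeasure M (ball x r) = ennreal (m x r)"
  using ball_finite[of x r] by (simp add: m_def emeasure_eq_ennreal_measure less_top)

lemma m_pos: "0 < r \<Longrightarrow> 0 < m x r"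
  using ball_measure[of r x] emeasure_m[of x r] by (simp add: emeasure_ball)

lemma m_nonneg: "0 \<le> m x r"
  by (simp add: m_def)

lemma m_mono: "ball x r \<subseteq> ball y s \<Longrightarrow> m x r \<le> m y s"
  unfolding m_def using ball_finite[of y s] by (intro measure_mono_fmeasurable) (auto simp: fmeasurable_def)

lemma m_doubling: "0 < r \<Longrightarrow> m x (2 * r) \<le> cD * m x r"
  using cD(2)[of r x] cD(1) m_nonneg[of x r]
  by (simp add: emeasure_m emeasure_ball[symmetric] flip: ennreal_mult)

lemma m_doubling_power: "0 < r \<Longrightarrow> m x (2 ^ n * r) \<le> cD ^ n * m x r"
proof (induction n)
  case (Suc n)
  have "m x (2 ^ Suc n * r) \<le> cD * m x (2 ^ n * r)"
    using m_doubling[of "2 ^ n * r" x] Suc by (simp add: mult.assoc)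
  also have "\<dots> \<le> cD * (cD ^ n * m x r)"
    using Suc cD(1) by (intro mult_left_mono) auto
  finally show ?case
    by simp
qed simp

lemma m_compare:
  assumes "0 < r" "dist x y + s \<le> 2 ^ n * r"
  shows "m y s \<le> cD ^ n * m x r"
proof -
  have "ball y s \<subseteq> ball x (2 ^ n * r)"
  proof
    fix z assume "z \<in> ball y s"
    then show "z \<in> ball x (2 ^ n * r)"
      using assms(2) dist_triangle[of x z y] by simp
  qed
  then show ?thesis
    using m_mono m_doubling_power[OF assms(1)] order_trans by blast
qed

text \<open>A hull of equal measure differs from the set by a null set only if the measure is
  finite. So the set is first cut into pieces by balls, and the union of the hulls of the pieces is
  taken.\<close>

lemma borel_hull:
  assumes A: "A \<in> sets M"
  shows "\<exists>B\<in>sets borel. A \<subseteq> B \<and> B - A \<in> null_sets M"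
proof -
  define A' where "A' n = A \<inter> ball undefined (real n)" for n :: nat
  have A': "A' n \<in> sets M" for n
    using A by (simp add: A'_def)
  have "\<exists>B\<in>sets borel. A' n \<subseteq> B \<and> B - A' n \<in> null_sets M" for n
  proof -
    obtain B where B: "B \<in> sets borel" "A' n \<subseteq> B" "emeasure M B = emeasure M (A' n)"
      using caratheodory_borel_hull[OF regular A'] by blast
    have "emeasure M (A' n) \<le> emeasure M (ball undefined (real n))"
      by (rule emeasure_mono) (auto simp: A'_def)
    then have "emeasure M (A' n) \<noteq> \<infinity>"
      using ball_finite[of undefined "real n"] by (auto simp: top_unique)
    then have "emeasure M (B - A' n) = 0"
      using B A' borel_sets_M by (subst emeasure_Diff) auto
    then show ?thesis
      using B A' borel_sets_M by (intro bexI[of _ B]) (auto simp: null_sets_def)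
  qed
  then obtain B where B: "\<And>n. B n \<in> sets borel" "\<And>n. A' n \<subseteq> B n" "\<And>n. B n - A' n \<in> null_sets M"
    by metis
  have "A \<subseteq> (\<Union>n. B n)"
  proof
    fix x assume "x \<in> A"
    moreover obtain n :: nat where "dist undefined x < real n"
      using reals_Archimedean2 by blast
    ultimately have "x \<in> A' n"
      by (simp add: A'_def)
    then show "x \<in> (\<Union>n. B n)"
      using B(2) by blast
  qed
  moreover have "(\<Union>n. B n) - A \<in> null_sets M"
  proof (rule null_sets_subset)
    show "(\<Union>n. B n - A' n) \<in> null_sets M"
      using B(3) by (intro null_sets_UN) auto
    show "(\<Union>n. B n) - A \<in> sets M"
      using B(1) A borel_sets_M by auto
  qed (auto simp: A'_def)
  ultimately show ?thesis
    using B(1) by (intro bexI[of _ "\<Union>n. B n"]) auto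
qed

lemma majorant_M:
  fixes f :: "'z \<Rightarrow> ennreal"
  assumes "f \<in> borel_measurable M"
  obtains g where "g \<in> borel_measurable borel" "\<And>x. f x \<le> g x" "AE x in M. g x = f x"
  using borel_majorant[OF borel_hull _ space_M assms] borel_sets_M by blast

text \<open>A volume count: the balls of radius \<open>s / 2\<close> about \<open>S\<close> are
  disjoint and lie in \<open>ball z (2 * R)\<close>, whose measure is at most \<open>cD ^ n\<close>
  times that of each of them.\<close>

lemma card_separated:
  fixes S :: "'z set"
  assumes S: "finite S" "S \<subseteq> ball z R" and sep: "\<And>x y. x \<in> S \<Longrightarrow> y \<in> S \<Longrightarrow> x \<noteq> y \<Longrightarrow> s \<le> dist x y"
    and s: "0 < s" "s \<le> 2 * R" "8 * R \<le> 2 ^ n * s"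
  shows "real (card S) \<le> cD ^ n"
proof -
  have R: "0 < R"
    using s by simp
  have each: "m z (2 * R) \<le> cD ^ n * m x (s / 2)" if "x \<in> S" for x
  proof (rule m_compare)
    have "dist x z < R"
      using S(2) that by (auto simp: dist_commute)
    then show "dist x z + 2 * R \<le> 2 ^ n * (s / 2)"
      using s R by simp
  qed (use s in simp)
  have "(\<Sum>x\<in>S. m x (s / 2)) = measure M (\<Union>x\<in>S. ball x (s / 2))"
    unfolding m_def
  proof (rule measure_finite_Union[symmetric])
    show "disjoint_family_on (\<lambda>x. ball x (s / 2)) S"
      unfolding disjoint_family_on_def
    proof (intro ballI impI, rule ccontr)
      fix x y assume xy: "x \<in> S" "y \<in> S" "x \<noteq> y" and "ball x (s / 2) \<inter> ball y (s / 2) \<noteq> {}"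
      then obtain w where "dist x w < s / 2" "dist y w < s / 2"
        by auto
      then have "dist x y < s"
        using dist_triangle[of x y w] by (simp add: dist_commute)
      then show False
        using sep[OF xy] by simp
    qed
  qed (use S ball_finite in \<open>auto simp: less_top\<close>)
  also have "\<dots> \<le> m z (2 * R)"
    unfolding m_def
  proof (rule measure_mono_fmeasurable)
    show "(\<Union>x\<in>S. ball x (s / 2)) \<subseteq> ball z (2 * R)"
    proof clarify
      fix x w assume "x \<in> S" "w \<in> ball x (s / 2)"
      then have "dist z x < R" "dist x w < s / 2"
        using S(2) by auto
      then show "w \<in> ball z (2 * R)"
        using dist_triangle[of z w x] s by simp
    qed
    show "(\<Union>x\<in>S. ball x (s / 2)) \<in> sets M"
      using S(1) by auto
  qed (use ball_finite in \<open>auto simp: fmeasurable_def\<close>)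
  finally have sum: "(\<Sum>x\<in>S. m x (s / 2)) \<le> m z (2 * R)" .
  have "real (card S) * m z (2 * R) \<le> (\<Sum>x\<in>S. cD ^ n * m x (s / 2))"
    using sum_mono[of S "\<lambda>_. m z (2 * R)" "\<lambda>x. cD ^ n * m x (s / 2)"] each by simp
  also have "\<dots> \<le> cD ^ n * m z (2 * R)"
    unfolding sum_distrib_left[symmetric] using sum cD(1) by (intro mult_left_mono) auto
  finally show ?thesis
    using m_pos[of "2 * R" z] R by simp
qed

text \<open>A maximal separated set at a variable scale. For constant \<tau> it is an ordinary net,
  used for averages and for layers around \<Omega>; for \<tau> proportional to the distance from
  \<Omega> it gives the centres of Whitney balls. The maximum makes separation symmetric, so that
  coverage is exactly maximality.\<close>

definition net :: "('z \<Rightarrow> real) \<Rightarrow> 'z set \<Rightarrow> 'z set \<Rightarrow> bool"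
  where "net \<tau> A X \<longleftrightarrow> X \<subseteq> A \<and> countable X \<and> (\<forall>x\<in>A. 0 < \<tau> x) \<and>
    (\<forall>z\<in>A. \<exists>x\<in>X. dist z x < max (\<tau> z) (\<tau> x)) \<and>
    (\<forall>x\<in>X. \<forall>y\<in>X. x \<noteq> y \<longrightarrow> max (\<tau> x) (\<tau> y) \<le> dist x y)"

text \<open>A maximal separated set exists by Zorn's lemma. It is countable because points of a
  countable dense set chosen within \<open>\<tau> x / 2\<close> of \<open>x\<close> are different
  for different \<open>x\<close>.\<close>

lemma net_exists:
  assumes \<tau>: "\<And>x. x \<in> A \<Longrightarrow> 0 < \<tau> x"
  shows "\<exists>X. net \<tau> A X"
proof -
  define sep where "sep X \<longleftrightarrow> X \<subseteq> A \<and> (\<forall>x\<in>X. \<forall>y\<in>X. x \<noteq> y \<longrightarrow> max (\<tau> x) (\<tau> y) \<le> dist x y)" for X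
  have "\<exists>X\<in>Collect sep. \<forall>Y\<in>Collect sep. X \<subseteq> Y \<longrightarrow> Y = X"
  proof (rule subset_Zorn')
    fix \<C> assume \<C>: "subset.chain (Collect sep) \<C>"
    then have "sep X" if "X \<in> \<C>" for X
      using that by (auto simp: subset.chain_def)
    moreover have "\<exists>X\<in>\<C>. x \<in> X \<and> y \<in> X" if "x \<in> \<Union>\<C>" "y \<in> \<Union>\<C>" for x y
    proof -
      obtain X Y where "X \<in> \<C>" "x \<in> X" "Y \<in> \<C>" "y \<in> Y"
        using \<open>x \<in> \<Union>\<C>\<close> \<open>y \<in> \<Union>\<C>\<close> by (elim UnionE)
      moreover have "X \<subseteq> Y \<or> Y \<subseteq> X"
        using \<C> \<open>X \<in> \<C>\<close> \<open>Y \<in> \<C>\<close> by (auto simp: subset.chain_def)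
      ultimately show ?thesis
        by blast
    qed
    ultimately have "sep (\<Union>\<C>)"
      unfolding sep_def by (smt (verit) Union_least subset_iff UnionE)
    then show "\<Union>\<C> \<in> Collect sep"
      by simp
  qed
  then obtain X where X: "sep X" "\<And>Y. sep Y \<Longrightarrow> X \<subseteq> Y \<Longrightarrow> Y = X"
    by auto
  have XA: "X \<subseteq> A" and X_sep: "\<And>x y. x \<in> X \<Longrightarrow> y \<in> X \<Longrightarrow> x \<noteq> y \<Longrightarrow> max (\<tau> x) (\<tau> y) \<le> dist x y"
    using X(1) by (auto simp: sep_def)
  obtain D :: "'z set" where D: "countable D" "closure D = UNIV"
    using separable by (auto simp: separable_space_def)
  have "\<exists>d\<in>D. dist d x < \<tau> x / 2" if "x \<in> X" for x
    using D(2) \<tau>[of x] XA that by (metis UNIV_I closure_approachable half_gt_zero subset_iff)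
  then obtain f where f: "\<And>x. x \<in> X \<Longrightarrow> f x \<in> D" "\<And>x. x \<in> X \<Longrightarrow> dist (f x) x < \<tau> x / 2"
    by metis
  have "inj_on f X"
  proof (rule inj_onI, rule ccontr)
    fix x y assume xy: "x \<in> X" "y \<in> X" "f x = f y" "x \<noteq> y"
    then have "dist x y < \<tau> x / 2 + \<tau> y / 2"
      using f(2)[of x] f(2)[of y] dist_triangle[of x y "f x"] by (simp add: dist_commute)
    then show False
      using X_sep[OF xy(1,2,4)] by simp
  qed
  then have "countable X"
    using f(1) D(1) by (metis countable_image_inj_on countable_subset image_subsetI)
  moreover have "\<exists>x\<in>X. dist z x < max (\<tau> z) (\<tau> x)" if z: "z \<in> A" for z
  proof (rule ccontr)
    assume far: "\<not> ?thesis"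
    then have "sep (insert z X)"
      using XA z X_sep unfolding sep_def
      by (auto simp: not_less dist_commute max.commute)
    then have "z \<in> X"
      using X(2)[of "insert z X"] by auto
    then show False
      using far \<tau>[OF z] by force
  qed
  ultimately show ?thesis
    using \<tau> XA X_sep unfolding net_def by blast
qed

text \<open>The number 32 N is 8 R / s for R = 2 N \<tau> and s = \<tau> / 2, the radii with which
  \<open>net_overlap\<close> invokes \<open>card_separated\<close>.\<close>

definition overlap :: "real \<Rightarrow> nat"
  where "overlap N = nat \<lfloor>cD ^ (LEAST n. 32 * N \<le> 2 ^ n)\<rfloor>"

text \<open>The Lipschitz constant 1 / (8 N) makes the scales of all net points whose balls contain
  \<open>z\<close> comparable up to the factor 2. They are then separated at a common scale inside a
  common ball and can be counted.\<close>

lemma net_overlap: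
  assumes net: "net \<tau> A X" and N: "1 \<le> N"
    and lip: "\<And>x y. x \<in> A \<Longrightarrow> y \<in> A \<Longrightarrow> \<bar>\<tau> x - \<tau> y\<bar> \<le> dist x y / (8 * N)"
  shows "finite {x \<in> X. z \<in> ball x (N * \<tau> x)}" "card {x \<in> X. z \<in> ball x (N * \<tau> x)} \<le> overlap N"
proof -
  let ?S = "{x \<in> X. z \<in> ball x (N * \<tau> x)}"
  define n where "n = (LEAST n. 32 * N \<le> 2 ^ n)"
  have "\<exists>n. 32 * N \<le> 2 ^ n"
    using real_arch_pow[of 2 "32 * N"] by (auto intro: less_imp_le)
  then have n: "32 * N \<le> 2 ^ n"
    unfolding n_def by (rule LeastI_ex)
  have comp: "\<tau> x \<le> 2 * \<tau> y" if "x \<in> ?S" "y \<in> ?S" for x y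
  proof -
    have "x \<in> A" "y \<in> A"
      using that net by (auto simp: net_def)
    moreover have "dist x y \<le> N * (\<tau> x + \<tau> y)"
      using that dist_triangle[of x y z] by (auto simp: dist_commute algebra_simps)
    ultimately have "\<bar>\<tau> x - \<tau> y\<bar> \<le> N * (\<tau> x + \<tau> y) / (8 * N)"
      using lip N by (meson divide_right_mono order_trans mult_nonneg_nonneg zero_le_numeral zero_le_one)
    also have "\<dots> = (\<tau> x + \<tau> y) / 8"
      using N by (simp add: field_simps)
    finally have "\<tau> x - \<tau> y \<le> (\<tau> x + \<tau> y) / 8"
      by (rule abs_le_D1)
    moreover have "0 < \<tau> y"
      using net \<open>y \<in> A\<close> by (simp add: net_def)
    ultimately show ?thesis
      by (simp add: field_simps)
  qed
  have card: "real (card T) \<le> cD ^ n" if T: "finite T" "T \<subseteq> ?S" for T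
  proof (cases "T = {}")
    case False
    then obtain x0 where x0: "x0 \<in> T"
      by blast
    have \<tau>0: "0 < \<tau> x0"
      using x0 T net by (auto simp: net_def)
    show ?thesis
    proof (rule card_separated[where R = "2 * N * \<tau> x0" and s = "\<tau> x0 / 2"])
      show "T \<subseteq> ball z (2 * N * \<tau> x0)"
      proof
        fix x assume x: "x \<in> T"
        then have "dist z x < N * \<tau> x"
          using T by (auto simp: dist_commute)
        also have "\<dots> \<le> N * (2 * \<tau> x0)"
          using comp[OF subsetD[OF T(2) x] subsetD[OF T(2) x0]] N by (intro mult_left_mono) auto
        finally show "x \<in> ball z (2 * N * \<tau> x0)"
          by (simp add: mult.assoc mult.left_commute)
      qed
      show "\<tau> x0 / 2 \<le> dist x y" if xy: "x \<in> T" "y \<in> T" "x \<noteq> y" for x y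
      proof -
        have "x \<in> X" "y \<in> X"
          using xy T by blast+
        then have "max (\<tau> x) (\<tau> y) \<le> dist x y"
          using xy(3) net unfolding net_def by blast
        then show ?thesis
          using comp[OF subsetD[OF T(2) x0] subsetD[OF T(2) xy(1)]] by simp
      qed
      show "\<tau> x0 / 2 \<le> 2 * (2 * N * \<tau> x0)"
        using \<tau>0 N by simp
      show "8 * (2 * N * \<tau> x0) \<le> 2 ^ n * (\<tau> x0 / 2)"
        using mult_right_mono[OF n, of "\<tau> x0 / 2"] \<tau>0 by (simp add: mult_ac)
    qed (use T \<tau>0 in auto)
  qed (use cD(1) in simp)
  have bound: "card T \<le> overlap N" if "finite T" "T \<subseteq> ?S" for T
    unfolding overlap_def n_def[symmetric] using card[OF that] by (simp add: le_nat_floor)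
  show "finite ?S"
  proof (rule ccontr)
    assume "infinite ?S"
    then obtain T where "T \<subseteq> ?S" "finite T" "card T = Suc (overlap N)"
      using infinite_arbitrarily_large by blast
    then show False
      using bound[of T] by simp
  qed
  then show "card ?S \<le> overlap N"
    by (rule bound) simp
qed

section \<open>Sums over nets\<close>

text \<open>A sum over the countable set \<open>X\<close> is an integral for counting measure; after
  exchanging the integrals the inner one counts the balls that contain a given point.\<close>

lemma overlap_sum:
  assumes X: "countable X" and B: "\<And>y. y \<in> X \<Longrightarrow> B y \<in> sets M"
    and over: "\<And>x. finite {y \<in> X. x \<in> B y}" "\<And>x. card {y \<in> X. x \<in> B y} \<le> k"
    and [measurable]: "f \<in> borel_measurable M"
  shows "(\<integral>\<^sup>+y. (\<integral>\<^sup>+x\<in>B y. f x \<partial>M) \<partial>count_space X) \<le> of_nat k * (\<integral>\<^sup>+x. f x \<partial>M)"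
proof -
  have "(\<integral>\<^sup>+y. (\<integral>\<^sup>+x\<in>B y. f x \<partial>M) \<partial>count_space X) = (\<integral>\<^sup>+x. (\<integral>\<^sup>+y. f x * indicator (B y) x \<partial>count_space X) \<partial>M)"
    using B by (intro nn_integral_count_space_nn_integral[symmetric] X) auto
  also have "\<dots> = (\<integral>\<^sup>+x. f x * of_nat (card {y \<in> X. x \<in> B y}) \<partial>M)"
  proof (rule nn_integral_cong)
    fix x
    have "(\<integral>\<^sup>+y. f x * indicator (B y) x \<partial>count_space X) =
        (\<integral>\<^sup>+y. f x * indicator {y \<in> X. x \<in> B y} y \<partial>count_space X)"
      by (intro nn_integral_cong) (auto split: split_indicator)
    also have "\<dots> = f x * emeasure (count_space X) {y \<in> X. x \<in> B y}"
      by (rule nn_integral_cmult_indicator) auto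
    also have "\<dots> = f x * of_nat (card {y \<in> X. x \<in> B y})"
      using over(1) by (subst emeasure_count_space_finite) auto
    finally show "(\<integral>\<^sup>+y. f x * indicator (B y) x \<partial>count_space X) = f x * of_nat (card {y \<in> X. x \<in> B y})" .
  qed
  also have "\<dots> \<le> (\<integral>\<^sup>+x. of_nat k * f x \<partial>M)"
    using over(2) by (intro nn_integral_mono) (auto simp: mult.commute[of "f _"] intro!: mult_right_mono of_nat_mono)
  also have "\<dots> = of_nat k * (\<integral>\<^sup>+x. f x \<partial>M)"
    by (simp add: nn_integral_cmult)
  finally show ?thesis .
qed

text \<open>Here \<open>f\<close> is meant to be a p-th power already; with
  \<open>f = epow \<rho>\<close> this is the mean on the right of the Poincare inequality.\<close>

definition mean :: "('z \<Rightarrow> ennreal) \<Rightarrow> 'z \<Rightarrow> real \<Rightarrow> ennreal"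
  where "mean f x r = epowr ((\<integral>\<^sup>+z\<in>ball x r. f z \<partial>M) / emeasure M (ball x r)) (1 / p)"

text \<open>A one-scale replacement for a maximal function. As \<open>f\<close> is merely
  integrable, its maximal function would satisfy only a weak type bound; the p-sum over the balls of
  one net dominates each of their means on the whole ball, is Borel, and has a strong bound by
  bounded overlap.\<close>

definition disc_avg :: "'z set \<Rightarrow> ('z \<Rightarrow> real) \<Rightarrow> ('z \<Rightarrow> ennreal) \<Rightarrow> 'z \<Rightarrow> ennreal"
  where "disc_avg X R f x = epowr (\<integral>\<^sup>+y. indicator (ball y (R y)) x * epowr (mean f y (R y)) p \<partial>count_space X) (1 / p)"

lemma borel_measurable_count_space_sum:
  assumes X: "countable X" and f: "\<And>y. y \<in> X \<Longrightarrow> f y \<in> borel_measurable N"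
  shows "(\<lambda>x. \<integral>\<^sup>+y. f y x \<partial>count_space X) \<in> borel_measurable N"
proof -
  interpret sigma_finite_measure "count_space X"
    using X by (rule sigma_finite_measure_count_space_countable)
  have "(\<lambda>w. f (snd w) (fst w)) \<in> borel_measurable (N \<Otimes>\<^sub>M count_space X)"
    by (rule measurable_compose_countable'[where f = "\<lambda>y w. f y (fst w)" and g = snd and I = X])
      (use X f in \<open>auto intro: measurable_compose[OF measurable_fst]\<close>)
  then have "(\<lambda>(x, y). f y x) \<in> borel_measurable (N \<Otimes>\<^sub>M count_space X)"
    by (simp add: case_prod_unfold)
  then show ?thesis
    by (rule borel_measurable_nn_integral)
qed

lemma disc_avg_borel:
  assumes "countable X"
  shows "disc_avg X R f \<in> borel_measurable borel"
  unfolding disc_avg_def[abs_def]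
  by (intro epowr_measurable' borel_measurable_count_space_sum assms borel_measurable_times_ennreal
      borel_measurable_indicator) auto

lemma disc_avg_ge:
  assumes "y \<in> X" "x \<in> ball y (R y)"
  shows "mean f y (R y) \<le> disc_avg X R f x"
proof -
  have "epowr (mean f y (R y)) p \<le> (\<integral>\<^sup>+y. indicator (ball y (R y)) x * epowr (mean f y (R y)) p \<partial>count_space X)"
    using nn_integral_ge_point[OF assms(1), of "\<lambda>y. indicator (ball y (R y)) x * epowr (mean f y (R y)) p"] assms(2)
    by simp
  then have "epowr (epowr (mean f y (R y)) p) (1 / p) \<le> disc_avg X R f x"
    unfolding disc_avg_def using p by (intro epowr_mono) auto
  then show ?thesis
    using p by (simp add: epowr_inverse)
qed

lemma mean_power: "epowr (mean f y r) p = (\<integral>\<^sup>+z\<in>ball y r. f z \<partial>M) / emeasure M (ball y r)"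
  using p by (simp add: mean_def epowr_inverse)

lemma mean_power_times: "0 < r \<Longrightarrow> epowr (mean f y r) p * emeasure M (ball y r) = (\<integral>\<^sup>+z\<in>ball y r. f z \<partial>M)"
  unfolding mean_power using m_pos[of r y] emeasure_m[of y r]
  by (simp add: ennreal_divide_times ennreal_divide_self mult_divide_eq_ennreal)

text \<open>The p-th power of a mean, times the measure of its ball, is the integral of
  \<open>f\<close> over the ball, and overlap bounds the sum. The sets \<open>A\<close> and
  \<open>A'\<close> localize this: only balls that meet \<open>A\<close> contribute, and they stay
  inside \<open>A'\<close>.\<close>

lemma disc_avg_integral:
  assumes X: "countable X" and R: "\<And>y. y \<in> X \<Longrightarrow> 0 < R y"
    and over: "\<And>x. finite {y \<in> X. x \<in> ball y (R y)}" "\<And>x. card {y \<in> X. x \<in> ball y (R y)} \<le> k"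
    and [measurable]: "f \<in> borel_measurable M" "A \<in> sets M" "A' \<in> sets M"
    and meet: "\<And>y. y \<in> X \<Longrightarrow> ball y (R y) \<inter> A \<noteq> {} \<Longrightarrow> ball y (R y) \<subseteq> A'"
  shows "(\<integral>\<^sup>+x\<in>A. epowr (disc_avg X R f x) p \<partial>M) \<le> of_nat k * (\<integral>\<^sup>+x\<in>A'. f x \<partial>M)"
proof -
  have "(\<integral>\<^sup>+x\<in>A. epowr (disc_avg X R f x) p \<partial>M) =
      (\<integral>\<^sup>+x. (\<integral>\<^sup>+y. indicator A x * (indicator (ball y (R y)) x * epowr (mean f y (R y)) p) \<partial>count_space X) \<partial>M)"
    using p by (intro nn_integral_cong) (auto simp: disc_avg_def epowr_inverse nn_integral_cmult mult.commute)
  also have "\<dots> = (\<integral>\<^sup>+y. (\<integral>\<^sup>+x. indicator A x * (indicator (ball y (R y)) x * epowr (mean f y (R y)) p) \<partial>M) \<partial>count_space X)"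
    by (intro nn_integral_count_space_nn_integral X) measurable
  also have "\<dots> \<le> (\<integral>\<^sup>+y. (\<integral>\<^sup>+x\<in>ball y (R y). f x * indicator A' x \<partial>M) \<partial>count_space X)"
  proof (rule nn_integral_mono)
    fix y assume "y \<in> space (count_space X)"
    then have y: "y \<in> X"
      by simp
    show "(\<integral>\<^sup>+x. indicator A x * (indicator (ball y (R y)) x * epowr (mean f y (R y)) p) \<partial>M) \<le>
        (\<integral>\<^sup>+x\<in>ball y (R y). f x * indicator A' x \<partial>M)"
    proof (cases "ball y (R y) \<inter> A = {}")
      case True
      then have "(\<integral>\<^sup>+x. indicator A x * (indicator (ball y (R y)) x * epowr (mean f y (R y)) p) \<partial>M) = (\<integral>\<^sup>+x. 0 \<partial>M)"
        by (intro nn_integral_cong) (auto split: split_indicator)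
      then show ?thesis
        by simp
    next
      case False
      have "(\<integral>\<^sup>+x. indicator A x * (indicator (ball y (R y)) x * epowr (mean f y (R y)) p) \<partial>M) \<le>
          (\<integral>\<^sup>+x. epowr (mean f y (R y)) p * indicator (ball y (R y)) x \<partial>M)"
        by (intro nn_integral_mono) (auto split: split_indicator)
      also have "\<dots> = epowr (mean f y (R y)) p * emeasure M (ball y (R y))"
        by (rule nn_integral_cmult_indicator) simp
      also have "\<dots> = (\<integral>\<^sup>+x\<in>ball y (R y). f x \<partial>M)"
        using mean_power_times[OF R[OF y]] .
      also have "\<dots> \<le> (\<integral>\<^sup>+x\<in>ball y (R y). f x * indicator A' x \<partial>M)"
        using meet[OF y False] by (intro nn_integral_mono) (auto split: split_indicator)
      finally show ?thesis .
    qed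
  qed
  also have "\<dots> \<le> of_nat k * (\<integral>\<^sup>+x. f x * indicator A' x \<partial>M)"
    by (rule overlap_sum[OF X _ over]) auto
  finally show ?thesis .
qed

end

lemma epowr_le_one_plus:
  assumes "0 \<le> q" "q \<le> 1"
  shows "epowr x q \<le> 1 + x"
proof (cases x)
  case (real r)
  have "r powr q \<le> 1 + r"
  proof (cases "r \<le> 1")
    case True
    then have "r powr q \<le> 1 powr q"
      using real assms by (intro powr_mono2) auto
    then show ?thesis
      using real by simp
  next
    case False
    then have "r powr q \<le> r powr 1"
      using assms by (intro powr_mono) auto
    then show ?thesis
      using False by simp
  qed
  then have "ennreal (r powr q) \<le> ennreal (1 + r)"
    by (rule ennreal_leI)
  then show ?thesis
    using real by (simp add: epowr_ennreal)
qed simp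

lemma ennreal_tendsto_0_of_suminf:
  fixes a :: "nat \<Rightarrow> ennreal"
  assumes "(\<Sum>i. a i) < \<infinity>"
  shows "a \<longlonglongrightarrow> 0"
proof -
  define b where "b i = enn2real (a i)" for i
  have "a i \<le> (\<Sum>i. a i)" for i
    using sum_le_suminf[of a "{i}"] by simp
  then have "a i < \<infinity>" for i
    using assms by (rule le_less_trans)
  then have a: "ennreal (b i) = a i" for i
    by (simp add: b_def)
  have "(\<Sum>i. ennreal (b i)) \<noteq> top"
    using assms unfolding a by simp
  then have "summable b"
    by (intro summable_suminf_not_top) (simp_all add: b_def)
  then have "b \<longlonglongrightarrow> 0"
    by (rule summable_LIMSEQ_zero)
  then have "(\<lambda>i. ennreal (b i)) \<longlonglongrightarrow> ennreal 0"
    by (rule tendsto_ennrealI)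
  then show ?thesis
    unfolding a by simp
qed

section \<open>The Poincare inequality with exponent \<open>p\<close> on both sides\<close>

context pi_const
begin

definition loc_int :: "('z \<Rightarrow> real) \<Rightarrow> bool"
  where "loc_int u \<longleftrightarrow> (\<forall>x r. set_integrable M (ball x r) u)"

definition avg :: "('z \<Rightarrow> real) \<Rightarrow> 'z \<Rightarrow> real \<Rightarrow> real"
  where "avg u x r = (LINT y:ball x r|M. u y) / m x r"

abbreviation epow :: "('z \<Rightarrow> ennreal) \<Rightarrow> 'z \<Rightarrow> ennreal"
  where "epow \<rho> \<equiv> \<lambda>x. epowr (\<rho> x) p"

lemma loc_int_measurable: "loc_int u \<Longrightarrow> u \<in> borel_measurable M"
proof -
  assume u: "loc_int u"
  have "(\<lambda>x. indicator (ball undefined (real n)) x *\<^sub>R u x) \<in> borel_measurable M" for n :: nat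
    using u by (auto simp: loc_int_def set_integrable_def)
  then have "(\<lambda>x. lim (\<lambda>n. indicator (ball undefined (real n)) x *\<^sub>R u x)) \<in> borel_measurable M"
    by (rule borel_measurable_lim_metric)
  moreover have "lim (\<lambda>n. indicator (ball undefined (real n)) x *\<^sub>R u x) = u x" for x
  proof (rule limI, rule tendsto_eventually)
    obtain N :: nat where "dist undefined x < real N"
      using reals_Archimedean2 by blast
    then show "eventually (\<lambda>n. indicator (ball undefined (real n)) x *\<^sub>R u x = u x) sequentially"
      by (intro eventually_sequentiallyI[of N]) auto
  qed
  ultimately show ?thesis
    by simp
qed

lemma diameter_ball_le: "0 < r \<Longrightarrow> diameter (ball x r) \<le> 2 * r" for x :: 'z
proof -
  assume r: "0 < r"
  have "(SUP (y, z)\<in>ball x r \<times> ball x r. dist y z) \<le> 2 * r"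
  proof (rule cSUP_least)
    show "ball x r \<times> ball x r \<noteq> {}"
      using r by auto
    fix w assume "w \<in> ball x r \<times> ball x r"
    then have "dist x (fst w) < r" "dist x (snd w) < r"
      by auto
    then show "(case w of (y, z) \<Rightarrow> dist y z) \<le> 2 * r"
      using dist_triangle[of "fst w" "snd w" x] by (auto simp: case_prod_unfold dist_commute)
  qed
  then show ?thesis
    using r by (auto simp: diameter_def)
qed

lemma poincare_ball:
  assumes r: "0 < r" and u: "loc_int u" and \<rho>: "Lp_integrable_borel M p \<rho>" and ug: "weak_upper_gradient M p u \<rho>"
  shows "(\<integral>\<^sup>+y\<in>ball x r. ennreal \<bar>u y - avg u x r\<bar> \<partial>M) \<le>
    ennreal (2 * CP * r) * emeasure M (ball x r) * mean (epow \<rho>) x (lam * r)"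
proof -
  let ?R = "restrict_space M (ball x r)" and ?R' = "restrict_space M (ball x (lam * r))"
  have avg: "(\<integral>y. u y \<partial>?R) / enn2real (\<mu> (ball x r)) = avg u x r"
    by (simp add: avg_def integral_restrict_space set_lebesgue_integral_def m_def measure_def emeasure_ball)
  have nn: "(\<integral>\<^sup>+y. f y \<partial>restrict_space M (ball x s)) = (\<integral>\<^sup>+y\<in>ball x s. f y \<partial>M)" for f s
    by (rule nn_integral_restrict_space) simp
  have "(\<integral>\<^sup>+y. ennreal \<bar>u y - (\<integral>y. u y \<partial>?R) / enn2real (\<mu> (ball x r))\<bar> \<partial>?R) / \<mu> (ball x r)
        \<le> ennreal (CP * diameter (ball x r)) *
          epowr ((\<integral>\<^sup>+y. epowr (\<rho> y) p \<partial>?R') / \<mu> (ball x (lam * r))) (1 / p)"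
  proof (rule poincare[OF r])
    show "integrable ?R' u"
      using u by (simp add: integrable_restrict_space loc_int_def set_integrable_def)
    show "Lp_integrable_borel ?R' p \<rho>"
      by (rule Lp_integrable_borel_restrict[OF null_hull_M _ _ \<rho>]) auto
    show "weak_upper_gradient ?R' p u \<rho>"
      by (rule weak_upper_gradient_restrict[OF null_hull_M _ _ ug]) auto
  qed
  then have "(\<integral>\<^sup>+y\<in>ball x r. ennreal \<bar>u y - avg u x r\<bar> \<partial>M) / emeasure M (ball x r) \<le>
      ennreal (CP * diameter (ball x r)) * mean (epow \<rho>) x (lam * r)"
    by (simp add: avg nn mean_def emeasure_ball)
  also have "\<dots> \<le> ennreal (2 * CP * r) * mean (epow \<rho>) x (lam * r)"
    using diameter_ball_le[OF r, of x] CP by (intro mult_right_mono ennreal_leI) auto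
  finally have "(\<integral>\<^sup>+y\<in>ball x r. ennreal \<bar>u y - avg u x r\<bar> \<partial>M) / emeasure M (ball x r) * emeasure M (ball x r) \<le>
      ennreal (2 * CP * r) * mean (epow \<rho>) x (lam * r) * emeasure M (ball x r)"
    by (rule mult_right_mono) simp
  moreover have "(\<integral>\<^sup>+y\<in>ball x r. ennreal \<bar>u y - avg u x r\<bar> \<partial>M) / emeasure M (ball x r) * emeasure M (ball x r) =
      (\<integral>\<^sup>+y\<in>ball x r. ennreal \<bar>u y - avg u x r\<bar> \<partial>M)"
    using m_pos[OF r, of x] by (simp add: emeasure_m ennreal_divide_times ennreal_divide_self)
  ultimately show ?thesis
    by (simp add: mult_ac)
qed

lemma avg_minus_const:
  assumes "0 < r" "loc_int u"
  shows "avg u x r - c = (LINT y:ball x r|M. u y - c) / m x r"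
proof -
  have c: "set_integrable M (ball x r) (\<lambda>_. c)"
    using ball_finite[of x r] unfolding set_integrable_def by (intro integrable_real_indicator[THEN integrable_scaleR_left]) auto
  have "(LINT y:ball x r|M. u y - c) = (LINT y:ball x r|M. u y) - (LINT y:ball x r|M. c)"
    using assms c by (intro set_integral_diff(2)) (auto simp: loc_int_def)
  also have "(LINT y:ball x r|M. c) = m x r * c"
    using ball_finite[of x r] by (simp add: set_lebesgue_integral_def m_def)
  finally show ?thesis
    using m_pos[OF assms(1), of x] by (simp add: avg_def field_simps)
qed

lemma avg_minus_const_le:
  assumes r: "0 < r" and u: "loc_int u"
  shows "ennreal \<bar>avg u x r - c\<bar> * emeasure M (ball x r) \<le> (\<integral>\<^sup>+y\<in>ball x r. ennreal \<bar>u y - c\<bar> \<partial>M)"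
proof -
  have c: "set_integrable M (ball x r) (\<lambda>_. c)"
    using ball_finite[of x r] unfolding set_integrable_def by (intro integrable_real_indicator[THEN integrable_scaleR_left]) auto
  have int: "set_integrable M (ball x r) (\<lambda>y. u y - c)"
    using u c by (intro set_integral_diff(1)) (auto simp: loc_int_def)
  have "ennreal \<bar>avg u x r - c\<bar> * emeasure M (ball x r) = ennreal (norm (LINT y:ball x r|M. u y - c))"
    using m_pos[OF r, of x] unfolding avg_minus_const[OF assms] emeasure_m
    by (simp flip: ennreal_mult)
  also have "\<dots> \<le> (\<integral>\<^sup>+y. ennreal (norm (indicator (ball x r) y *\<^sub>R (u y - c))) \<partial>M)"
    unfolding set_lebesgue_integral_def using int unfolding set_integrable_def
    by (rule integral_norm_bound_ennreal)
  also have "\<dots> = (\<integral>\<^sup>+y\<in>ball x r. ennreal \<bar>u y - c\<bar> \<partial>M)"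
    by (intro nn_integral_cong) (auto split: split_indicator)
  finally show ?thesis .
qed

text \<open>The oscillation about the average over the larger ball is integrated over the smaller
  one; \<open>D\<close> compensates for the change of measure.\<close>

lemma avg_compare:
  assumes s: "0 < s" "0 < t" and sub: "ball x s \<subseteq> ball y t" and D: "0 \<le> D" "m y t \<le> D * m x s"
    and u: "loc_int u" and \<rho>: "Lp_integrable_borel M p \<rho>" and ug: "weak_upper_gradient M p u \<rho>"
  shows "ennreal \<bar>avg u x s - avg u y t\<bar> \<le> ennreal (D * (2 * CP * t)) * mean (epow \<rho>) y (lam * t)"
proof -
  have "ennreal \<bar>avg u x s - avg u y t\<bar> * emeasure M (ball x s) \<le> (\<integral>\<^sup>+z\<in>ball x s. ennreal \<bar>u z - avg u y t\<bar> \<partial>M)"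
    by (rule avg_minus_const_le[OF s(1) u])
  also have "\<dots> \<le> (\<integral>\<^sup>+z\<in>ball y t. ennreal \<bar>u z - avg u y t\<bar> \<partial>M)"
    using sub by (intro nn_integral_mono) (auto split: split_indicator)
  also have "\<dots> \<le> ennreal (2 * CP * t) * emeasure M (ball y t) * mean (epow \<rho>) y (lam * t)"
    by (rule poincare_ball[OF s(2) u \<rho> ug])
  also have "\<dots> \<le> ennreal (2 * CP * t) * (ennreal D * emeasure M (ball x s)) * mean (epow \<rho>) y (lam * t)"
  proof (intro mult_right_mono mult_left_mono)
    show "emeasure M (ball y t) \<le> ennreal D * emeasure M (ball x s)"
      using D m_nonneg by (simp add: emeasure_m flip: ennreal_mult)
  qed auto
  also have "\<dots> = (ennreal (D * (2 * CP * t)) * mean (epow \<rho>) y (lam * t)) * emeasure M (ball x s)"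
    using D s CP by (simp add: ennreal_mult mult_ac)
  finally have "emeasure M (ball x s) * ennreal \<bar>avg u x s - avg u y t\<bar> \<le>
      emeasure M (ball x s) * (ennreal (D * (2 * CP * t)) * mean (epow \<rho>) y (lam * t))"
    by (simp add: mult.commute)
  then show ?thesis
    using m_pos[OF s(1), of x] by (subst (asm) ennreal_mult_le_mult_iff) (auto simp: emeasure_m)
qed

text \<open>A p-th root of an integral does not add up over a net. The bound t^(1/p) \<le> 1 + t
  replaces it by something additive, at the cost of the measure of the ball, which is harmless where
  only convergence is wanted.\<close>

lemma measure_times_mean_le:
  assumes r: "0 < r" "r \<le> R" and [measurable]: "f \<in> borel_measurable M"
  shows "emeasure M (ball y r) * mean f y R \<le> (\<integral>\<^sup>+z\<in>ball y R. (1 + f z) \<partial>M)"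
proof -
  have R: "0 < R"
    using r by simp
  have "emeasure M (ball y r) * mean f y R \<le> emeasure M (ball y R) *
      (1 + (\<integral>\<^sup>+z\<in>ball y R. f z \<partial>M) / emeasure M (ball y R))"
    unfolding mean_def using r p by (intro mult_mono emeasure_mono epowr_le_one_plus) auto
  also have "\<dots> = emeasure M (ball y R) + (\<integral>\<^sup>+z\<in>ball y R. f z \<partial>M)"
    using m_pos[OF R, of y]
    by (simp add: distrib_left emeasure_m ennreal_times_divide mult.commute[of "ennreal _"] mult_divide_eq_ennreal)
  also have "\<dots> = (\<integral>\<^sup>+z\<in>ball y R. (1 + f z) \<partial>M)"
    by (simp add: distrib_right nn_integral_add)
  finally show ?thesis .
qed

text \<open>
  The Poincare inequality itself gives summable \<open>L\<^sup>1\<close> bounds for the error of the approximation by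
  averages at dyadic scales, so that no differentiation theorem is needed.
\<close>

lemma averages_converge:
  assumes r: "0 < r" and u: "loc_int u" and \<rho>: "Lp_integrable_borel M p \<rho>" and ug: "weak_upper_gradient M p u \<rho>"
    and net: "\<And>n. net (\<lambda>_. r / 2 ^ n) UNIV (X n)"
  shows "AE x in M. x \<in> ball x0 r \<longrightarrow>
    (\<lambda>n. \<integral>\<^sup>+y. indicator (ball y (r / 2 ^ n)) x * ennreal \<bar>u x - avg u y (2 * (r / 2 ^ n))\<bar> \<partial>count_space (X n)) \<longlonglongrightarrow> 0"
proof -
  define s where "s n = r / 2 ^ n" for n :: nat
  have s: "0 < s n" "s n \<le> r" for n
    using r by (auto simp: s_def divide_le_eq)
  \<comment> \<open>The sum over all balls of the net that contain \<open>x\<close> dominates the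
    error for each of them, whichever centre is selected later.\<close>
  define E where "E n x = (\<integral>\<^sup>+y. indicator (ball y (s n)) x * ennreal \<bar>u x - avg u y (2 * s n)\<bar> \<partial>count_space (X n))" for n x
  define f where "f = epow \<rho>"
  define R where "R = 5 * lam * r"
  define c where "c = 2 * CP * 2"
  note [measurable] = loc_int_measurable[OF u]
  have f [measurable]: "f \<in> borel_measurable M"
    unfolding f_def using Lp_integrable_borel_measurable[OF null_hull_M \<rho>] by measurable
  have X: "countable (X n)" for n
    using net by (auto simp: net_def)
  have E_meas [measurable]: "E n \<in> borel_measurable M" for n
    unfolding E_def[abs_def] by (intro borel_measurable_count_space_sum X) measurable
  let ?I = "\<integral>\<^sup>+x. (1 + f x) * indicator (ball x0 R) x \<partial>M"
  have I: "?I < \<infinity>"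
  proof -
    have "?I = emeasure M (ball x0 R) + (\<integral>\<^sup>+x\<in>ball x0 R. f x \<partial>M)"
      by (simp add: distrib_right nn_integral_add)
    moreover have "(\<integral>\<^sup>+x\<in>ball x0 R. f x \<partial>M) \<le> (\<integral>\<^sup>+x. f x \<partial>M)"
      by (intro nn_integral_mono) (auto split: split_indicator)
    moreover have "(\<integral>\<^sup>+x. f x \<partial>M) < \<infinity>"
      using Lp_integrable_borelD(2)[OF \<rho>] by (simp add: f_def)
    ultimately show ?thesis
      using ball_finite[of x0 R] by (auto dest: le_less_trans)
  qed
  have bound: "(\<integral>\<^sup>+x\<in>ball x0 r. E n x \<partial>M) \<le> ennreal (c * s n) * (of_nat (overlap (2 * lam)) * ?I)" for n
  proof -
    have "(\<integral>\<^sup>+x\<in>ball x0 r. E n x \<partial>M) =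
        (\<integral>\<^sup>+x. (\<integral>\<^sup>+y. indicator (ball x0 r) x * (indicator (ball y (s n)) x * ennreal \<bar>u x - avg u y (2 * s n)\<bar>) \<partial>count_space (X n)) \<partial>M)"
      by (intro nn_integral_cong) (auto simp: E_def nn_integral_cmult mult.commute)
    also have "\<dots> = (\<integral>\<^sup>+y. (\<integral>\<^sup>+x. indicator (ball x0 r) x * (indicator (ball y (s n)) x * ennreal \<bar>u x - avg u y (2 * s n)\<bar>) \<partial>M) \<partial>count_space (X n))"
      by (intro nn_integral_count_space_nn_integral X) measurable
    also have "\<dots> \<le> (\<integral>\<^sup>+y. ennreal (c * s n) * (\<integral>\<^sup>+x\<in>ball y (2 * lam * s n). ((1 + f x) * indicator (ball x0 R) x) \<partial>M) \<partial>count_space (X n))"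
    proof (rule nn_integral_mono)
      fix y
      show "(\<integral>\<^sup>+x. indicator (ball x0 r) x * (indicator (ball y (s n)) x * ennreal \<bar>u x - avg u y (2 * s n)\<bar>) \<partial>M) \<le>
          ennreal (c * s n) * (\<integral>\<^sup>+x\<in>ball y (2 * lam * s n). ((1 + f x) * indicator (ball x0 R) x) \<partial>M)"
      proof (cases "ball x0 r \<inter> ball y (s n) = {}")
        case True
        then have "(\<integral>\<^sup>+x. indicator (ball x0 r) x * (indicator (ball y (s n)) x * ennreal \<bar>u x - avg u y (2 * s n)\<bar>) \<partial>M) = (\<integral>\<^sup>+x. 0 \<partial>M)"
          by (intro nn_integral_cong) (auto split: split_indicator)
        then show ?thesis
          by simp
      next
        case False
        have sub: "ball y (2 * lam * s n) \<subseteq> ball x0 R"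
        proof
          fix z assume z: "z \<in> ball y (2 * lam * s n)"
          obtain w where w: "dist x0 w < r" "dist y w < s n"
            using False by auto
          have "dist x0 z \<le> dist x0 w + dist w y + dist y z"
            using dist_triangle[of x0 z w] dist_triangle[of w z y] by linarith
          also have "\<dots> < r + s n + 2 * lam * s n"
            using w z by (simp add: dist_commute)
          also have "\<dots> \<le> r + r + 2 * lam * r"
            using s(2)[of n] lam by (intro add_mono mult_left_mono) auto
          also have "\<dots> \<le> R"
            using lam r by (simp add: R_def)
          finally show "z \<in> ball x0 R"
            by simp
        qed
        have "(\<integral>\<^sup>+x. indicator (ball x0 r) x * (indicator (ball y (s n)) x * ennreal \<bar>u x - avg u y (2 * s n)\<bar>) \<partial>M) \<le>
            (\<integral>\<^sup>+x\<in>ball y (2 * s n). ennreal \<bar>u x - avg u y (2 * s n)\<bar> \<partial>M)"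
          using s(1)[of n] by (intro nn_integral_mono) (auto split: split_indicator)
        also have "\<dots> \<le> ennreal (2 * CP * (2 * s n)) * emeasure M (ball y (2 * s n)) * mean f y (lam * (2 * s n))"
          unfolding f_def using s(1)[of n] by (intro poincare_ball u \<rho> ug) auto
        also have "\<dots> \<le> ennreal (c * s n) * (\<integral>\<^sup>+x\<in>ball y (lam * (2 * s n)). (1 + f x) \<partial>M)"
          unfolding mult.assoc c_def
          using s(1)[of n] lam by (intro mult_left_mono measure_times_mean_le f) auto
        also have "(\<integral>\<^sup>+x\<in>ball y (lam * (2 * s n)). (1 + f x) \<partial>M) =
            (\<integral>\<^sup>+x\<in>ball y (2 * lam * s n). ((1 + f x) * indicator (ball x0 R) x) \<partial>M)"
          using sub by (intro nn_integral_cong) (auto split: split_indicator simp: mult_ac)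
        finally show ?thesis .
      qed
    qed
    also have "\<dots> = ennreal (c * s n) * (\<integral>\<^sup>+y. (\<integral>\<^sup>+x\<in>ball y (2 * lam * s n). ((1 + f x) * indicator (ball x0 R) x) \<partial>M) \<partial>count_space (X n))"
      by (rule nn_integral_cmult) simp
    also have "\<dots> \<le> ennreal (c * s n) * (of_nat (overlap (2 * lam)) * ?I)"
    proof (intro mult_left_mono overlap_sum X)
      have net': "net (\<lambda>_. s n) UNIV (X n)"
        using net by (simp add: s_def)
      show "finite {y \<in> X n. x \<in> ball y (2 * lam * s n)}" "card {y \<in> X n. x \<in> ball y (2 * lam * s n)} \<le> overlap (2 * lam)" for x
        by (rule net_overlap[OF net']; use lam in simp)+
    qed (auto simp: borel_measurable_indicator)
    finally show ?thesis .
  qed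
  have "(\<integral>\<^sup>+x. (\<Sum>n. E n x * indicator (ball x0 r) x) \<partial>M) = (\<Sum>n. \<integral>\<^sup>+x\<in>ball x0 r. E n x \<partial>M)"
    by (intro nn_integral_suminf) measurable
  also have "\<dots> \<le> (\<Sum>n. ennreal (c * s n) * (of_nat (overlap (2 * lam)) * ?I))"
    using bound by (intro suminf_le) auto
  also have "\<dots> = (\<Sum>n. ennreal (c * s n)) * (of_nat (overlap (2 * lam)) * ?I)"
    by (rule ennreal_suminf_multc)
  also have "(\<Sum>n. ennreal (c * s n)) = ennreal (\<Sum>n. c * s n)"
  proof (rule suminf_ennreal2)
    show "0 \<le> c * s n" for n
      using s(1)[of n] CP by (simp add: c_def)
    have "summable (\<lambda>n. c * r * (1 / 2) ^ n)"
      by (intro summable_mult summable_geometric) simp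
    then show "summable (\<lambda>n. c * s n)"
      by (simp add: s_def power_one_over field_simps)
  qed
  also have "ennreal (\<Sum>n. c * s n) * (of_nat (overlap (2 * lam)) * ?I) < \<infinity>"
    using I by (auto simp: ennreal_mult_less_top of_nat_less_top)
  finally have "(\<integral>\<^sup>+x. (\<Sum>n. E n x * indicator (ball x0 r) x) \<partial>M) \<noteq> \<infinity>"
    by simp
  then have "AE x in M. (\<Sum>n. E n x * indicator (ball x0 r) x) \<noteq> \<infinity>"
    by (intro nn_integral_PInf_AE) measurable
  then show ?thesis
  proof eventually_elim
    case (elim x)
    show ?case
    proof
      assume "x \<in> ball x0 r"
      then have "(\<Sum>n. E n x) < \<infinity>"
        using elim by (simp add: less_top)
      then have "(\<lambda>n. E n x) \<longlonglongrightarrow> 0"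
        by (rule ennreal_tendsto_0_of_suminf)
      then show "(\<lambda>n. \<integral>\<^sup>+y. indicator (ball y (r / 2 ^ n)) x * ennreal \<bar>u x - avg u y (2 * (r / 2 ^ n))\<bar> \<partial>count_space (X n)) \<longlonglongrightarrow> 0"
        by (simp add: E_def s_def)
    qed
  qed
qed

end

lemma ennreal_mult_add_self: "0 \<le> a \<Longrightarrow> ennreal a * x + ennreal a * x = ennreal (2 * a) * x"
proof -
  assume "0 \<le> a"
  then have "ennreal (2 * a) = ennreal a + ennreal a"
    by (simp flip: ennreal_plus)
  then show ?thesis
    by (simp only: distrib_right)
qed

context pi_const
begin

text \<open>The scale r / 2^n is split as q^n * (q^n r). One factor q^n makes the chain of averages
  converge at each point, the other makes the p-th powers of the discrete averages summable over the
  scales.\<close>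

definition q_pp :: real
  where "q_pp = sqrt (1 / 2)"

text \<open>Each jump between averages takes two applications of \<open>avg_compare\<close> in a
  ball of at most four times the scale, where doubling costs \<open>cD ^ 3\<close>.\<close>

definition A_pp :: real
  where "A_pp = 2 * (cD ^ 3 * (2 * CP * 4))"

definition C_pp :: real
  where "C_pp = 2 powr p * (A_pp powr p + (A_pp * (1 / (1 - q_pp))) powr p * (real (overlap (3 * lam)) * (1 / (1 - q_pp powr p))))"

lemma q_pp: "0 < q_pp" "q_pp < 1" "q_pp * q_pp = 1 / 2" "0 < q_pp powr p" "q_pp powr p < 1"
proof -
  show q: "0 < q_pp" "q_pp < 1" "q_pp * q_pp = 1 / 2"
    by (auto simp: q_pp_def)
  then show "0 < q_pp powr p"
    by simp
  show "q_pp powr p < 1"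
    using powr_less_mono2[of p q_pp 1] q p by simp
qed

lemma A_pp_pos: "0 < A_pp"
  using CP cD(1) by (simp add: A_pp_def)

lemma C_pp_nonneg: "0 \<le> C_pp"
  using q_pp by (simp add: C_pp_def)

text \<open>The value at \<open>x\<close> is reached from the average over the given ball by a chain
  of averages over net balls around \<open>x\<close> at dyadic scales. Each jump is at most the
  scale times a discrete average of the gradient, and these averages are bounded in L^p. The
  majorant \<open>G\<close> is built from \<rho> alone and hence serves the whole sequence, which
  will be the coordinates of a c0-valued function.\<close>

lemma pp_poincare:
  fixes u :: "nat \<Rightarrow> 'z \<Rightarrow> real"
  assumes r: "0 < r" and \<rho>: "Lp_integrable_borel M p \<rho>"
    and u: "\<And>k. loc_int (u k)" and ug: "\<And>k. weak_upper_gradient M p (u k) \<rho>"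
  shows "\<exists>G\<in>borel_measurable M. (AE x in M. x \<in> ball x0 r \<longrightarrow> (\<forall>k. ennreal \<bar>u k x - avg (u k) x0 r\<bar> \<le> G x)) \<and>
    (\<integral>\<^sup>+x\<in>ball x0 r. epowr (G x) p \<partial>M) \<le> ennreal (C_pp * r powr p) * (\<integral>\<^sup>+x\<in>ball x0 (7 * lam * r). epow \<rho> x \<partial>M)"
proof -
  define s where "s n = r / 2 ^ n" for n :: nat
  have s: "0 < s n" "s n \<le> r" "s (Suc n) = s n / 2" for n
    using r by (auto simp: s_def divide_le_eq)
  have s_eq: "s n = q_pp ^ n * (q_pp ^ n * r)" for n
  proof -
    have "q_pp ^ n * q_pp ^ n = (1 / 2) ^ n"
      by (simp only: power_mult_distrib[symmetric] q_pp(3))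
    then have "q_pp ^ n * (q_pp ^ n * r) = (1 / 2) ^ n * r"
      by (simp only: mult.assoc[symmetric])
    then show ?thesis
      by (simp add: s_def power_one_over)
  qed
  have "\<exists>X. net (\<lambda>_. s n) UNIV X" for n
    by (rule net_exists) (rule s(1))
  then obtain X where X: "\<And>n. net (\<lambda>_. s n) UNIV (X n)"
    by metis
  have cX: "countable (X n)" for n
    using X by (auto simp: net_def)
  have "\<exists>y\<in>X n. dist x y < s n" for n x
    using X[of n] by (force simp: net_def)
  then obtain Y where Y: "\<And>n x. Y n x \<in> X n" "\<And>n x. dist x (Y n x) < s n"
    by metis
  define f where "f = epow \<rho>"
  have f [measurable]: "f \<in> borel_measurable M"
    unfolding f_def using Lp_integrable_borel_measurable[OF null_hull_M \<rho>] by measurable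
  define H where "H n = disc_avg (X n) (\<lambda>_. 3 * lam * s n) f" for n
  have H_borel [measurable]: "H n \<in> borel_measurable M" for n
    unfolding H_def by (intro borel_measurable_M disc_avg_borel cX)
  \<comment> \<open>The l^p-sum over scales dominates each term, and its p-th power integrates to a
    geometric series with ratio \<open>q_pp powr p\<close>.\<close>
  define Z where "Z x = epowr (\<Sum>n. epowr (ennreal (q_pp ^ n * r) * H n x) p) (1 / p)" for x
  have Z_borel [measurable]: "Z \<in> borel_measurable M"
    unfolding Z_def[abs_def] by measurable
  define c0 where "c0 = 1 / (1 - q_pp)"
  have c0: "0 < c0"
    using q_pp by (simp add: c0_def)
  define G1 where "G1 = ennreal (A_pp * r) * mean f x0 (4 * lam * r)"
  define G where "G x = G1 + ennreal (A_pp * c0) * Z x" for x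

  \<comment> \<open>The chain starts at a net ball that depends on \<open>x\<close>; it is compared
    with the given ball inside \<open>ball x0 (4 * r)\<close>, which contains both.\<close>
  have base: "ennreal \<bar>avg (u k) (Y 0 x) (2 * s 0) - avg (u k) x0 r\<bar> \<le> G1" if x: "x \<in> ball x0 r" for x k
  proof -
    have d: "dist x0 (Y 0 x) < 2 * r"
      using dist_triangle[of x0 "Y 0 x" x] x Y(2)[of x 0] by (simp add: s_def)
    have sub1: "ball (Y 0 x) (2 * s 0) \<subseteq> ball x0 (4 * r)"
    proof
      fix z assume "z \<in> ball (Y 0 x) (2 * s 0)"
      then show "z \<in> ball x0 (4 * r)"
        using d dist_triangle[of x0 z "Y 0 x"] by (simp add: s_def)
    qed
    have sub2: "ball x0 r \<subseteq> ball x0 (4 * r)"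
      using r by auto
    have m1: "m x0 (4 * r) \<le> cD ^ 3 * m (Y 0 x) (2 * s 0)"
      by (rule m_compare) (use d r in \<open>auto simp: s_def dist_commute\<close>)
    have m2: "m x0 (4 * r) \<le> cD ^ 3 * m x0 r"
      by (rule m_compare) (use r in auto)
    have "ennreal \<bar>avg (u k) (Y 0 x) (2 * s 0) - avg (u k) x0 r\<bar> \<le>
        ennreal \<bar>avg (u k) (Y 0 x) (2 * s 0) - avg (u k) x0 (4 * r)\<bar> + ennreal \<bar>avg (u k) x0 r - avg (u k) x0 (4 * r)\<bar>"
      by (simp flip: ennreal_plus)
    also have "\<dots> \<le> ennreal (cD ^ 3 * (2 * CP * (4 * r))) * mean f x0 (lam * (4 * r)) +
        ennreal (cD ^ 3 * (2 * CP * (4 * r))) * mean f x0 (lam * (4 * r))"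
      unfolding f_def using r s(1)[of 0] cD(1)
      by (intro add_mono avg_compare[OF _ _ sub1 _ m1 u \<rho> ug] avg_compare[OF _ _ sub2 _ m2 u \<rho> ug]) auto
    also have "\<dots> = G1"
      using r CP cD(1) by (subst ennreal_mult_add_self) (simp_all add: G1_def A_pp_def mult_ac)
    finally show ?thesis .
  qed

  have step: "ennreal \<bar>avg (u k) (Y n x) (2 * s n) - avg (u k) (Y (Suc n) x) (2 * s (Suc n))\<bar> \<le>
      ennreal (A_pp * s n) * H n x" for k n x
  proof -
    have d: "dist (Y n x) (Y (Suc n) x) < 2 * s n"
      using dist_triangle[of "Y n x" "Y (Suc n) x" x] Y(2)[of x n] Y(2)[of x "Suc n"] s[of n]
      by (simp add: dist_commute)
    have sub1: "ball (Y n x) (2 * s n) \<subseteq> ball (Y n x) (3 * s n)"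
      using s(1)[of n] by auto
    have sub2: "ball (Y (Suc n) x) (2 * s (Suc n)) \<subseteq> ball (Y n x) (3 * s n)"
    proof
      fix z assume "z \<in> ball (Y (Suc n) x) (2 * s (Suc n))"
      then show "z \<in> ball (Y n x) (3 * s n)"
        using d dist_triangle[of "Y n x" z "Y (Suc n) x"] by (simp add: s)
    qed
    have m1: "m (Y n x) (3 * s n) \<le> cD ^ 3 * m (Y n x) (2 * s n)"
      by (rule m_compare) (use s(1)[of n] in auto)
    have m2: "m (Y n x) (3 * s n) \<le> cD ^ 3 * m (Y (Suc n) x) (2 * s (Suc n))"
      by (rule m_compare) (use d s(1)[of n] in \<open>auto simp: s(3) dist_commute\<close>)
    have "ennreal \<bar>avg (u k) (Y n x) (2 * s n) - avg (u k) (Y (Suc n) x) (2 * s (Suc n))\<bar> \<le>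
        ennreal \<bar>avg (u k) (Y n x) (2 * s n) - avg (u k) (Y n x) (3 * s n)\<bar> +
        ennreal \<bar>avg (u k) (Y (Suc n) x) (2 * s (Suc n)) - avg (u k) (Y n x) (3 * s n)\<bar>"
      by (simp flip: ennreal_plus)
    also have "\<dots> \<le> ennreal (cD ^ 3 * (2 * CP * (3 * s n))) * mean f (Y n x) (lam * (3 * s n)) +
        ennreal (cD ^ 3 * (2 * CP * (3 * s n))) * mean f (Y n x) (lam * (3 * s n))"
      unfolding f_def using s(1)[of n] s(1)[of "Suc n"] cD(1)
      by (intro add_mono avg_compare[OF _ _ sub1 _ m1 u \<rho> ug] avg_compare[OF _ _ sub2 _ m2 u \<rho> ug]) auto
    also have "\<dots> = ennreal (2 * (cD ^ 3 * (2 * CP * (3 * s n)))) * mean f (Y n x) (3 * lam * s n)"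
      using s(1)[of n] CP cD(1) by (subst ennreal_mult_add_self) (simp_all add: mult_ac)
    also have "\<dots> \<le> ennreal (A_pp * s n) * H n x"
    proof (rule mult_mono)
      show "ennreal (2 * (cD ^ 3 * (2 * CP * (3 * s n)))) \<le> ennreal (A_pp * s n)"
        using s(1)[of n] CP cD(1) by (intro ennreal_leI) (simp add: A_pp_def)
      have "s n \<le> 3 * lam * s n"
        using s(1)[of n] lam by simp
      then have "x \<in> ball (Y n x) (3 * lam * s n)"
        using Y(2)[of x n] by (simp add: dist_commute)
      then show "mean f (Y n x) (3 * lam * s n) \<le> H n x"
        unfolding H_def by (intro disc_avg_ge[where R = "\<lambda>_. 3 * lam * s n"] Y(1))
    qed auto
    finally show ?thesis .
  qed

  have HZ: "ennreal (q_pp ^ n * r) * H n x \<le> Z x" for n x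
  proof -
    have "epowr (ennreal (q_pp ^ n * r) * H n x) p \<le> (\<Sum>n. epowr (ennreal (q_pp ^ n * r) * H n x) p)"
      using sum_le_suminf[of "\<lambda>n. epowr (ennreal (q_pp ^ n * r) * H n x) p" "{n}"] by simp
    then have "epowr (epowr (ennreal (q_pp ^ n * r) * H n x) p) (1 / p) \<le> Z x"
      unfolding Z_def using p by (intro epowr_mono) auto
    then show ?thesis
      using p by (simp add: epowr_inverse)
  qed

  have telescope: "ennreal \<bar>avg (u k) (Y 0 x) (2 * s 0) - avg (u k) (Y n x) (2 * s n)\<bar> \<le>
      ennreal (A_pp * c0) * Z x" for k n x
  proof -
    have "ennreal \<bar>avg (u k) (Y 0 x) (2 * s 0) - avg (u k) (Y n x) (2 * s n)\<bar> \<le>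
        (\<Sum>i<n. ennreal (A_pp * s i) * H i x)"
    proof (induction n)
      case (Suc n)
      have "ennreal \<bar>avg (u k) (Y 0 x) (2 * s 0) - avg (u k) (Y (Suc n) x) (2 * s (Suc n))\<bar> \<le>
          ennreal \<bar>avg (u k) (Y 0 x) (2 * s 0) - avg (u k) (Y n x) (2 * s n)\<bar> +
          ennreal \<bar>avg (u k) (Y n x) (2 * s n) - avg (u k) (Y (Suc n) x) (2 * s (Suc n))\<bar>"
        by (simp flip: ennreal_plus)
      also have "\<dots> \<le> (\<Sum>i<n. ennreal (A_pp * s i) * H i x) + ennreal (A_pp * s n) * H n x"
        by (intro add_mono Suc step)
      finally show ?case
        by simp
    qed simp
    also have "\<dots> \<le> (\<Sum>i<n. ennreal (A_pp * q_pp ^ i) * Z x)"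
    proof (rule sum_mono)
      fix i
      have "ennreal (A_pp * s i) * H i x = ennreal (A_pp * q_pp ^ i) * (ennreal (q_pp ^ i * r) * H i x)"
        using A_pp_pos q_pp(1) r unfolding s_eq by (simp add: ennreal_mult mult_ac)
      also have "\<dots> \<le> ennreal (A_pp * q_pp ^ i) * Z x"
        by (intro mult_left_mono HZ) auto
      finally show "ennreal (A_pp * s i) * H i x \<le> ennreal (A_pp * q_pp ^ i) * Z x" .
    qed
    also have "\<dots> = ennreal (\<Sum>i<n. A_pp * q_pp ^ i) * Z x"
      using A_pp_pos q_pp(1) by (subst sum_distrib_right[symmetric], subst sum_ennreal) auto
    also have "\<dots> \<le> ennreal (A_pp * c0) * Z x"
    proof (intro mult_right_mono ennreal_leI)
      have "(\<Sum>i<n. q_pp ^ i) \<le> c0"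
        using q_pp unfolding c0_def
        by (subst sum_gp_strict) (auto intro!: divide_right_mono simp: less_imp_le)
      then show "(\<Sum>i<n. A_pp * q_pp ^ i) \<le> A_pp * c0"
        unfolding sum_distrib_left[symmetric] using A_pp_pos by simp
    qed auto
    finally show ?thesis .
  qed

  have "AE x in M. \<forall>k. x \<in> ball x0 r \<longrightarrow>
    (\<lambda>n. \<integral>\<^sup>+y. indicator (ball y (r / 2 ^ n)) x * ennreal \<bar>u k x - avg (u k) y (2 * (r / 2 ^ n))\<bar> \<partial>count_space (X n)) \<longlonglongrightarrow> 0"
    unfolding AE_all_countable
    by (intro allI averages_converge[OF r u \<rho> ug]) (use X in \<open>simp add: s_def\<close>)
  then have "AE x in M. x \<in> ball x0 r \<longrightarrow> (\<forall>k. ennreal \<bar>u k x - avg (u k) x0 r\<bar> \<le> G x)"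
  proof eventually_elim
    case (elim x)
    show ?case
    proof (intro impI allI)
      fix k assume x: "x \<in> ball x0 r"
      let ?E = "\<lambda>n. \<integral>\<^sup>+y. indicator (ball y (s n)) x * ennreal \<bar>u k x - avg (u k) y (2 * s n)\<bar> \<partial>count_space (X n)"
      have "?E \<longlonglongrightarrow> 0"
        using elim x by (simp add: s_def)
      then have "(\<lambda>n. ?E n + G x) \<longlonglongrightarrow> 0 + G x"
        by (intro tendsto_intros)
      moreover have "ennreal \<bar>u k x - avg (u k) x0 r\<bar> \<le> ?E n + G x" for n
      proof -
        have "indicator (ball (Y n x) (s n)) x * ennreal \<bar>u k x - avg (u k) (Y n x) (2 * s n)\<bar> \<le> ?E n"
          by (rule nn_integral_ge_point[OF Y(1), of "\<lambda>y. indicator (ball y (s n)) x * ennreal \<bar>u k x - avg (u k) y (2 * s n)\<bar>"])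
        then have E: "ennreal \<bar>u k x - avg (u k) (Y n x) (2 * s n)\<bar> \<le> ?E n"
          using Y(2)[of x n] by (simp add: dist_commute)
        have "ennreal \<bar>u k x - avg (u k) x0 r\<bar> \<le> ennreal \<bar>u k x - avg (u k) (Y n x) (2 * s n)\<bar> +
            (ennreal \<bar>avg (u k) (Y 0 x) (2 * s 0) - avg (u k) x0 r\<bar> +
             ennreal \<bar>avg (u k) (Y 0 x) (2 * s 0) - avg (u k) (Y n x) (2 * s n)\<bar>)"
          by (simp flip: ennreal_plus)
        also have "\<dots> \<le> ?E n + G x"
          unfolding G_def by (intro add_mono E base x telescope)
        finally show ?thesis .
      qed
      ultimately show "ennreal \<bar>u k x - avg (u k) x0 r\<bar> \<le> G x"
        by (intro LIMSEQ_le_const) auto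
    qed
  qed
  moreover have "G \<in> borel_measurable M"
    unfolding G_def[abs_def] by measurable
  moreover have "(\<integral>\<^sup>+x\<in>ball x0 r. epowr (G x) p \<partial>M) \<le> ennreal (C_pp * r powr p) * (\<integral>\<^sup>+x\<in>ball x0 (7 * lam * r). epow \<rho> x \<partial>M)"
  proof -
    let ?B = "ball x0 r" and ?I = "\<integral>\<^sup>+x\<in>ball x0 (7 * lam * r). f x \<partial>M"
    have H_int: "(\<integral>\<^sup>+x\<in>?B. epowr (H n x) p \<partial>M) \<le> of_nat (overlap (3 * lam)) * ?I" for n
      unfolding H_def
    proof (rule disc_avg_integral[OF cX])
      show "0 < 3 * lam * s n"
        using s(1)[of n] lam by simp
      show "finite {y \<in> X n. x \<in> ball y (3 * lam * s n)}" "card {y \<in> X n. x \<in> ball y (3 * lam * s n)} \<le> overlap (3 * lam)" for x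
        by (rule net_overlap[OF X]; use lam in simp)+
      fix y assume "ball y (3 * lam * s n) \<inter> ball x0 r \<noteq> {}"
      then obtain w where w: "dist y w < 3 * lam * s n" "dist x0 w < r"
        by auto
      \<comment> \<open>The dilation factor arises as r + 3 lam r + 3 lam r \<le> 7 lam r.\<close>
      show "ball y (3 * lam * s n) \<subseteq> ball x0 (7 * lam * r)"
      proof
        fix z assume z: "z \<in> ball y (3 * lam * s n)"
        have "dist x0 z \<le> dist x0 w + dist w y + dist y z"
          using dist_triangle[of x0 z w] dist_triangle[of w z y] by linarith
        also have "\<dots> < r + 3 * lam * s n + 3 * lam * s n"
          using w z by (simp add: dist_commute)
        also have "\<dots> \<le> lam * r + 3 * lam * r + 3 * lam * r"
          using s(2)[of n] lam r by (intro add_mono mult_left_mono) auto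
        finally show "z \<in> ball x0 (7 * lam * r)"
          by simp
      qed
    qed auto
    have G1_int: "(\<integral>\<^sup>+x\<in>?B. epowr G1 p \<partial>M) \<le> ennreal (A_pp powr p * r powr p) * ?I"
    proof -
      have "(\<integral>\<^sup>+x\<in>?B. epowr G1 p \<partial>M) = epowr G1 p * emeasure M ?B"
        by (rule nn_integral_cmult_indicator) simp
      also have "\<dots> \<le> epowr G1 p * emeasure M (ball x0 (4 * lam * r))"
        using mult_right_mono[of 1 "4 * lam" r] r lam by (intro mult_left_mono emeasure_mono subset_ball) auto
      also have "\<dots> = ennreal (A_pp powr p * r powr p) * (\<integral>\<^sup>+x\<in>ball x0 (4 * lam * r). f x \<partial>M)"
        using mean_power_times[of "4 * lam * r" f x0] r lam A_pp_pos
        by (simp add: G1_def epowr_mult epowr_ennreal powr_mult mult.assoc)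
      also have "\<dots> \<le> ennreal (A_pp powr p * r powr p) * ?I"
      proof (rule mult_left_mono, rule nn_integral_mono)
        have "ball x0 (4 * lam * r) \<subseteq> ball x0 (7 * lam * r)"
          using r lam by (intro subset_ball) simp
        then show "f x * indicator (ball x0 (4 * lam * r)) x \<le> f x * indicator (ball x0 (7 * lam * r)) x" for x
          by (auto split: split_indicator)
      qed simp
      finally show ?thesis .
    qed
    have Z_int: "(\<integral>\<^sup>+x\<in>?B. epowr (Z x) p \<partial>M) \<le> ennreal (r powr p * (real (overlap (3 * lam)) * (1 / (1 - q_pp powr p)))) * ?I"
    proof -
      have "(\<integral>\<^sup>+x\<in>?B. epowr (Z x) p \<partial>M) = (\<integral>\<^sup>+x. (\<Sum>n. epowr (ennreal (q_pp ^ n * r) * H n x) p * indicator ?B x) \<partial>M)"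
        using p by (intro nn_integral_cong) (auto simp: Z_def epowr_inverse)
      also have "\<dots> = (\<Sum>n. \<integral>\<^sup>+x. epowr (ennreal (q_pp ^ n * r) * H n x) p * indicator ?B x \<partial>M)"
        by (intro nn_integral_suminf) measurable
      also have "\<dots> \<le> (\<Sum>n. ennreal ((q_pp powr p) ^ n) * (ennreal (r powr p) * (of_nat (overlap (3 * lam)) * ?I)))"
      proof (rule suminf_le)
        fix n
        have "(\<integral>\<^sup>+x. epowr (ennreal (q_pp ^ n * r) * H n x) p * indicator ?B x \<partial>M) =
            epowr (ennreal (q_pp ^ n * r)) p * (\<integral>\<^sup>+x\<in>?B. epowr (H n x) p \<partial>M)"
          by (simp add: epowr_mult mult.assoc nn_integral_cmult)
        also have "epowr (ennreal (q_pp ^ n * r)) p = ennreal ((q_pp powr p) ^ n) * ennreal (r powr p)"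
        proof -
          have "(q_pp ^ n) powr p = (q_pp powr p) ^ n"
            using q_pp(1,4) by (simp add: powr_realpow[symmetric] powr_powr mult.commute)
          then show ?thesis
            using q_pp r by (simp add: epowr_ennreal epowr_mult ennreal_mult)
        qed
        also have "\<dots> * (\<integral>\<^sup>+x\<in>?B. epowr (H n x) p \<partial>M) \<le>
            ennreal ((q_pp powr p) ^ n) * ennreal (r powr p) * (of_nat (overlap (3 * lam)) * ?I)"
          by (intro mult_left_mono H_int) simp
        finally show "(\<integral>\<^sup>+x. epowr (ennreal (q_pp ^ n * r) * H n x) p * indicator ?B x \<partial>M) \<le>
            ennreal ((q_pp powr p) ^ n) * (ennreal (r powr p) * (of_nat (overlap (3 * lam)) * ?I))"
          by (simp add: mult.assoc)
      qed auto
      also have "\<dots> = (\<Sum>n. ennreal ((q_pp powr p) ^ n)) * (ennreal (r powr p) * (of_nat (overlap (3 * lam)) * ?I))"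
        by (rule ennreal_suminf_multc)
      also have "(\<Sum>n. ennreal ((q_pp powr p) ^ n)) = ennreal (1 / (1 - q_pp powr p))"
        using q_pp by (subst suminf_ennreal2) (auto simp: suminf_geometric intro: summable_geometric)
      also have "ennreal (1 / (1 - q_pp powr p)) * (ennreal (r powr p) * (of_nat (overlap (3 * lam)) * ?I)) =
          ennreal (r powr p * (real (overlap (3 * lam)) * (1 / (1 - q_pp powr p)))) * ?I"
      proof -
        have "ennreal w * (ennreal a * (of_nat k * J)) = ennreal (a * (real k * w)) * J"
          if "0 \<le> w" "0 \<le> a" for w a k J
          using that by (simp add: ennreal_mult ennreal_of_nat_eq_real_of_nat mult_ac)
        then show ?thesis
          using q_pp(5) by simp
      qed
      finally show ?thesis .
    qed
    have "(\<integral>\<^sup>+x\<in>?B. epowr (G x) p \<partial>M) \<le>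
        (\<integral>\<^sup>+x. ennreal (2 powr p) * (epowr G1 p * indicator ?B x + ennreal ((A_pp * c0) powr p) * (epowr (Z x) p * indicator ?B x)) \<partial>M)"
    proof (rule nn_integral_mono)
      fix x
      have "epowr (G x) p \<le> ennreal (2 powr p) * (epowr G1 p + epowr (ennreal (A_pp * c0) * Z x) p)"
        unfolding G_def using p by (intro epowr_add_le) simp
      also have "epowr (ennreal (A_pp * c0) * Z x) p = ennreal ((A_pp * c0) powr p) * epowr (Z x) p"
        using A_pp_pos c0 by (simp add: epowr_mult epowr_ennreal)
      finally show "epowr (G x) p * indicator ?B x \<le>
          ennreal (2 powr p) * (epowr G1 p * indicator ?B x + ennreal ((A_pp * c0) powr p) * (epowr (Z x) p * indicator ?B x))"
        by (auto split: split_indicator)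
    qed
    also have "\<dots> = ennreal (2 powr p) * ((\<integral>\<^sup>+x\<in>?B. epowr G1 p \<partial>M) + ennreal ((A_pp * c0) powr p) * (\<integral>\<^sup>+x\<in>?B. epowr (Z x) p \<partial>M))"
      by (simp add: nn_integral_cmult nn_integral_add)
    also have "\<dots> \<le> ennreal (2 powr p) * (ennreal (A_pp powr p * r powr p) * ?I +
        ennreal ((A_pp * c0) powr p) * (ennreal (r powr p * (real (overlap (3 * lam)) * (1 / (1 - q_pp powr p)))) * ?I))"
      by (intro mult_left_mono add_mono G1_int Z_int) auto
    also have "\<dots> = ennreal (2 powr p * (A_pp powr p * r powr p + (A_pp * c0) powr p * (r powr p * (real (overlap (3 * lam)) * (1 / (1 - q_pp powr p)))))) * ?I"
    proof -
      have "ennreal a * (ennreal b * J + ennreal c * (ennreal d * J)) = ennreal (a * (b + c * d)) * J"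
        if "0 \<le> a" "0 \<le> b" "0 \<le> c" "0 \<le> d" for a b c d J
        using that by (simp add: ennreal_mult distrib_right distrib_left mult.assoc)
      then show ?thesis
        using q_pp(5) by simp
    qed
    also have "2 powr p * (A_pp powr p * r powr p + (A_pp * c0) powr p * (r powr p * (real (overlap (3 * lam)) * (1 / (1 - q_pp powr p))))) = C_pp * r powr p"
      by (simp add: C_pp_def c0_def algebra_simps)
    finally show ?thesis
      by (simp add: f_def)
  qed
  ultimately show ?thesis
    by blast
qed

end

section \<open>The Hardy inequality\<close>

text \<open>Nonemptiness of \<Omega> enters because \<open>infdist\<close> to the empty set is 0 by
  convention; the empty set is treated separately in the theorem.\<close>

locale pi_omega = pi_const +
  fixes \<Omega> :: "'a set" and c\<Omega> :: real
  assumes \<Omega>_sets: "\<Omega> \<in> sets M" and \<Omega>_nonempty: "\<Omega> \<noteq> {}" and c\<Omega>: "0 < c\<Omega>"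
    and density: "\<And>x r. x \<in> \<Omega> \<Longrightarrow> 0 < r \<Longrightarrow> r \<le> 1 \<Longrightarrow> ennreal c\<Omega> * \<mu> (ball x r) \<le> \<mu> (ball x r \<inter> \<Omega>)"
begin

abbreviation d :: "'a \<Rightarrow> real"
  where "d x \<equiv> infdist x \<Omega>"

text \<open>Truncated at 1 because measure density is available only for radii up to 1: near
  \<Omega> a bound for a quotient by \<open>db\<close> is a Hardy inequality, far away it is a plain
  L^p bound.\<close>

definition db :: "'a \<Rightarrow> real"
  where "db x = min (d x) 1"

lemma d_lipschitz: "\<bar>d x - d y\<bar> \<le> dist x y"
  by (rule infdist_triangle_abs)

lemma db_lipschitz: "\<bar>db x - db y\<bar> \<le> dist x y"
  using d_lipschitz[of x y] unfolding db_def by linarith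

lemma db_bounds: "0 \<le> db x" "db x \<le> 1" "db x \<le> d x"
  by (auto simp: db_def infdist_nonneg)

lemma d_borel [measurable]: "d \<in> borel_measurable borel"
  by (intro borel_measurable_continuous_onI continuous_intros)

lemma db_borel [measurable]: "db \<in> borel_measurable borel"
  unfolding db_def[abs_def] by measurable

lemma d_M [measurable]: "d \<in> borel_measurable M"
  by (rule borel_measurable_M) simp

lemma db_M [measurable]: "db \<in> borel_measurable M"
  by (rule borel_measurable_M) simp

lemma d_lessE:
  assumes "d x < r"
  obtains y where "y \<in> \<Omega>" "dist x y < r"
  using assms \<Omega>_nonempty by (auto simp: infdist_def dest!: cInf_lessD[rotated])

lemma loc_int_of_Lp:
  fixes u :: "'a \<Rightarrow> real"
  assumes [measurable]: "u \<in> borel_measurable M" and fin: "(\<integral>\<^sup>+x. ennreal (\<bar>u x\<bar> powr p) \<partial>M) < \<infinity>"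
  shows "loc_int u"
  unfolding loc_int_def set_integrable_def
proof (intro allI integrableI_bounded)
  fix x r
  have "(\<integral>\<^sup>+y. ennreal (norm (indicator (ball x r) y *\<^sub>R u y)) \<partial>M) \<le>
      (\<integral>\<^sup>+y. indicator (ball x r) y + ennreal (\<bar>u y\<bar> powr p) \<partial>M)"
  proof (rule nn_integral_mono)
    fix y
    have "\<bar>u y\<bar> \<le> 1 + \<bar>u y\<bar> powr p"
    proof (cases "\<bar>u y\<bar> \<le> 1")
      case False
      then have "\<bar>u y\<bar> powr 1 \<le> \<bar>u y\<bar> powr p"
        using p by (intro powr_mono) auto
      then show ?thesis
        using False by simp
    qed (simp add: add_increasing2)
    then have "ennreal \<bar>u y\<bar> \<le> 1 + ennreal (\<bar>u y\<bar> powr p)"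
      by (metis ennreal_1 ennreal_leI ennreal_plus powr_ge_zero zero_le_one)
    then show "ennreal (norm (indicator (ball x r) y *\<^sub>R u y)) \<le> indicator (ball x r) y + ennreal (\<bar>u y\<bar> powr p)"
      by (auto split: split_indicator)
  qed
  also have "\<dots> < \<infinity>"
    using fin ball_finite[of x r] by (simp add: nn_integral_add)
  finally show "(\<integral>\<^sup>+y. ennreal (norm (indicator (ball x r) y *\<^sub>R u y)) \<partial>M) < \<infinity>" .
qed measurable

lemma cover_sum:
  assumes X: "countable X" and cover: "A \<subseteq> (\<Union>y\<in>X. B y)" and B: "\<And>y. y \<in> X \<Longrightarrow> B y \<in> sets M"
    and [measurable]: "f \<in> borel_measurable M"
  shows "(\<integral>\<^sup>+x\<in>A. f x \<partial>M) \<le> (\<integral>\<^sup>+y. (\<integral>\<^sup>+x\<in>B y. f x \<partial>M) \<partial>count_space X)"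
proof -
  have "(\<integral>\<^sup>+x\<in>A. f x \<partial>M) \<le> (\<integral>\<^sup>+x. (\<integral>\<^sup>+y. f x * indicator (B y) x \<partial>count_space X) \<partial>M)"
  proof (rule nn_integral_mono)
    fix x
    show "f x * indicator A x \<le> (\<integral>\<^sup>+y. f x * indicator (B y) x \<partial>count_space X)"
    proof (cases "x \<in> A")
      case True
      then obtain y where "y \<in> X" "x \<in> B y"
        using cover by blast
      then show ?thesis
        using nn_integral_ge_point[of y X "\<lambda>y. f x * indicator (B y) x"] True by simp
    qed simp
  qed
  also have "\<dots> = (\<integral>\<^sup>+y. (\<integral>\<^sup>+x\<in>B y. f x \<partial>M) \<partial>count_space X)"
    using B by (intro nn_integral_count_space_nn_integral X) auto
  finally show ?thesis .
qed

definition C_ball :: real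
  where "C_ball = 2 powr p * ((1 + 1 / c\<Omega>) * C_pp)"

lemma boundary_poincare_ball:
  fixes f :: "'a \<Rightarrow> real"
  assumes y: "y \<in> \<Omega>" and r: "0 < r" "r \<le> 1" and f: "loc_int f" and g: "Lp_integrable_borel M p g"
    and ug: "weak_upper_gradient M p f g" and zero: "AE x in M. x \<in> \<Omega> \<longrightarrow> f x = 0"
  shows "(\<integral>\<^sup>+x\<in>ball y r. ennreal (\<bar>f x\<bar> powr p) \<partial>M) \<le> ennreal (C_ball * r powr p) * (\<integral>\<^sup>+x\<in>ball y (7 * lam * r). epow g x \<partial>M)"
proof -
  let ?a = "avg f y r" and ?B = "ball y r"
  have [measurable]: "\<Omega> \<in> sets M"
    by (rule \<Omega>_sets)
  note [measurable] = loc_int_measurable[OF f]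
  obtain G where [measurable]: "G \<in> borel_measurable M"
    and G: "AE x in M. x \<in> ?B \<longrightarrow> (\<forall>k::nat. ennreal \<bar>f x - ?a\<bar> \<le> G x)"
    and G_int: "(\<integral>\<^sup>+x\<in>?B. epowr (G x) p \<partial>M) \<le> ennreal (C_pp * r powr p) * (\<integral>\<^sup>+x\<in>ball y (7 * lam * r). epow g x \<partial>M)"
    using pp_poincare[OF r(1) g, of "\<lambda>_. f" y] f ug by auto
  let ?IG = "\<integral>\<^sup>+x\<in>?B. epowr (G x) p \<partial>M"
  have "ennreal (\<bar>?a\<bar> powr p) * emeasure M (?B \<inter> \<Omega>) = (\<integral>\<^sup>+x. ennreal (\<bar>?a\<bar> powr p) * indicator (?B \<inter> \<Omega>) x \<partial>M)"
    by (rule nn_integral_cmult_indicator[symmetric]) measurable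
  also have "\<dots> \<le> ?IG"
  proof (rule nn_integral_mono_AE)
    show "AE x in M. ennreal (\<bar>?a\<bar> powr p) * indicator (?B \<inter> \<Omega>) x \<le> epowr (G x) p * indicator ?B x"
      using G zero
    proof eventually_elim
      case (elim x)
      have "ennreal (\<bar>?a\<bar> powr p) \<le> epowr (G x) p" if "x \<in> ?B" "x \<in> \<Omega>"
      proof -
        have "ennreal \<bar>?a\<bar> \<le> G x"
          using elim that by simp
        then have "epowr (ennreal \<bar>?a\<bar>) p \<le> epowr (G x) p"
          using p by (intro epowr_mono) auto
        then show ?thesis
          by (simp add: epowr_ennreal)
      qed
      then show ?case
        by (auto split: split_indicator)
    qed
  qed
  finally have a_Omega: "ennreal (\<bar>?a\<bar> powr p) * emeasure M (?B \<inter> \<Omega>) \<le> ?IG" .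
  have dens: "ennreal c\<Omega> * emeasure M ?B \<le> emeasure M (?B \<inter> \<Omega>)"
    using density[OF y r] \<Omega>_sets by (simp add: emeasure_caratheodory_measure[OF regular])
  have "ennreal c\<Omega> * (ennreal (\<bar>?a\<bar> powr p) * emeasure M ?B) \<le> ?IG"
    using order_trans[OF mult_left_mono[OF dens] a_Omega] by (simp add: mult_ac)
  then have "ennreal (1 / c\<Omega>) * (ennreal c\<Omega> * (ennreal (\<bar>?a\<bar> powr p) * emeasure M ?B)) \<le> ennreal (1 / c\<Omega>) * ?IG"
    by (rule mult_left_mono) simp
  then have a_ball: "ennreal (\<bar>?a\<bar> powr p) * emeasure M ?B \<le> ennreal (1 / c\<Omega>) * ?IG"
    using c\<Omega> by (simp add: mult.assoc[symmetric] flip: ennreal_mult)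
  have "(\<integral>\<^sup>+x\<in>?B. ennreal (\<bar>f x\<bar> powr p) \<partial>M) \<le>
      (\<integral>\<^sup>+x. ennreal (2 powr p) * (epowr (G x) p * indicator ?B x + ennreal (\<bar>?a\<bar> powr p) * indicator ?B x) \<partial>M)"
  proof (rule nn_integral_mono_AE)
    show "AE x in M. ennreal (\<bar>f x\<bar> powr p) * indicator ?B x \<le>
        ennreal (2 powr p) * (epowr (G x) p * indicator ?B x + ennreal (\<bar>?a\<bar> powr p) * indicator ?B x)"
      using G
    proof eventually_elim
      case (elim x)
      have "ennreal (\<bar>f x\<bar> powr p) \<le> ennreal (2 powr p) * (epowr (G x) p + ennreal (\<bar>?a\<bar> powr p))" if "x \<in> ?B"
      proof -
        have "ennreal \<bar>f x\<bar> \<le> ennreal \<bar>f x - ?a\<bar> + ennreal \<bar>?a\<bar>"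
          by (simp flip: ennreal_plus)
        also have "\<dots> \<le> G x + ennreal \<bar>?a\<bar>"
          using elim that by (intro add_right_mono) simp
        finally have "epowr (ennreal \<bar>f x\<bar>) p \<le> epowr (G x + ennreal \<bar>?a\<bar>) p"
          using p by (intro epowr_mono) auto
        also have "\<dots> \<le> ennreal (2 powr p) * (epowr (G x) p + epowr (ennreal \<bar>?a\<bar>) p)"
          using p by (intro epowr_add_le) simp
        finally show ?thesis
          by (simp add: epowr_ennreal)
      qed
      then show ?case
        by (auto split: split_indicator)
    qed
  qed
  also have "\<dots> = ennreal (2 powr p) * (?IG + ennreal (\<bar>?a\<bar> powr p) * emeasure M ?B)"
    by (simp add: nn_integral_cmult nn_integral_add nn_integral_cmult_indicator)
  also have "\<dots> \<le> ennreal (2 powr p) * (?IG + ennreal (1 / c\<Omega>) * ?IG)"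
    by (intro mult_left_mono add_left_mono a_ball) simp
  also have "\<dots> = ennreal (2 powr p) * (ennreal (1 + 1 / c\<Omega>) * ?IG)"
    using c\<Omega> by (simp add: distrib_right)
  also have "\<dots> \<le> ennreal (2 powr p) * (ennreal (1 + 1 / c\<Omega>) * (ennreal (C_pp * r powr p) * (\<integral>\<^sup>+x\<in>ball y (7 * lam * r). epow g x \<partial>M)))"
    by (intro mult_left_mono G_int) simp_all
  also have "\<dots> = ennreal (C_ball * r powr p) * (\<integral>\<^sup>+x\<in>ball y (7 * lam * r). epow g x \<partial>M)"
  proof -
    have "ennreal a * (ennreal b * (ennreal (c * e) * J)) = ennreal (a * (b * c) * e) * J"
      if "0 \<le> a" "0 \<le> b" "0 \<le> c" "0 \<le> e" for a b c e J
      using that by (simp add: ennreal_mult mult.assoc)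
    from this[of "2 powr p" "1 + 1 / c\<Omega>" C_pp "r powr p"] show ?thesis
      using c\<Omega> C_pp_nonneg unfolding C_ball_def by auto
  qed
  finally show ?thesis .
qed

text \<open>The dilation 7 lam of \<open>pp_poincare\<close>, applied to balls of radius 2
  R.\<close>

definition \<Lambda> :: real
  where "\<Lambda> = 14 * lam"

definition C_layer :: real
  where "C_layer = C_ball * 2 powr p * real (overlap \<Lambda>)"

lemma C_layer_nonneg: "0 \<le> C_layer"
  using c\<Omega> C_pp_nonneg by (simp add: C_layer_def C_ball_def)

text \<open>The doubled balls of an R-net of \<Omega> cover the layer, and each of them falls under
  \<open>boundary_poincare_ball\<close>; the radius 2 R \<le> 1 keeps within the range of measure
  density.\<close>

lemma layer_estimate:
  fixes f :: "'a \<Rightarrow> real"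
  assumes R: "0 < R" "R \<le> 1 / 2" and f: "loc_int f" and g: "Lp_integrable_borel M p g"
    and ug: "weak_upper_gradient M p f g" and zero: "AE x in M. x \<in> \<Omega> \<longrightarrow> f x = 0"
  shows "(\<integral>\<^sup>+x\<in>{x. d x < R}. ennreal (\<bar>f x\<bar> powr p) \<partial>M) \<le>
    ennreal (C_layer * R powr p) * (\<integral>\<^sup>+x\<in>{x. d x < \<Lambda> * R}. epow g x \<partial>M)"
proof -
  note [measurable] = loc_int_measurable[OF f] Lp_integrable_borel_measurable[OF null_hull_M g]
  obtain X where X: "net (\<lambda>_. R) \<Omega> X"
    using net_exists[of \<Omega> "\<lambda>_. R"] R(1) by blast
  then have X\<Omega>: "X \<subseteq> \<Omega>" and cX: "countable X"
    by (auto simp: net_def)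
  let ?g = "\<lambda>x. epow g x * indicator {x. d x < \<Lambda> * R} x"
  have meas: "{x. d x < \<Lambda> * R} \<in> sets M"
    by (intro borel_sets_M borel_open open_Collect_less continuous_intros)
  have "(\<integral>\<^sup>+x\<in>{x. d x < R}. ennreal (\<bar>f x\<bar> powr p) \<partial>M) \<le>
      (\<integral>\<^sup>+y. (\<integral>\<^sup>+x\<in>ball y (2 * R). ennreal (\<bar>f x\<bar> powr p) \<partial>M) \<partial>count_space X)"
  proof (rule cover_sum[OF cX])
    show "{x. d x < R} \<subseteq> (\<Union>y\<in>X. ball y (2 * R))"
    proof
      fix x assume "x \<in> {x. d x < R}"
      then obtain z where z: "z \<in> \<Omega>" "dist x z < R"
        by (auto elim: d_lessE)
      then obtain y where "y \<in> X" "dist z y < R"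
        using X by (auto simp: net_def)
      then show "x \<in> (\<Union>y\<in>X. ball y (2 * R))"
        using z(2) dist_triangle[of x y z] by (intro UN_I[of y]) (auto simp: dist_commute)
    qed
  qed auto
  also have "\<dots> \<le> (\<integral>\<^sup>+y. ennreal (C_ball * (2 * R) powr p) * (\<integral>\<^sup>+x\<in>ball y (\<Lambda> * R). ?g x \<partial>M) \<partial>count_space X)"
  proof (rule nn_integral_mono)
    fix y assume "y \<in> space (count_space X)"
    then have y: "y \<in> \<Omega>"
      using X\<Omega> by auto
    have "(\<integral>\<^sup>+x\<in>ball y (2 * R). ennreal (\<bar>f x\<bar> powr p) \<partial>M) \<le>
        ennreal (C_ball * (2 * R) powr p) * (\<integral>\<^sup>+x\<in>ball y (7 * lam * (2 * R)). epow g x \<partial>M)"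
      using R by (intro boundary_poincare_ball y f g ug zero) auto
    also have "7 * lam * (2 * R) = \<Lambda> * R"
      by (simp add: \<Lambda>_def)
    also have "(\<integral>\<^sup>+x\<in>ball y (\<Lambda> * R). epow g x \<partial>M) = (\<integral>\<^sup>+x\<in>ball y (\<Lambda> * R). ?g x \<partial>M)"
    proof (intro nn_integral_cong)
      fix x
      have "d x < \<Lambda> * R" if "x \<in> ball y (\<Lambda> * R)"
        using that infdist_le[OF y, of x] by (auto simp: dist_commute)
      then show "epow g x * indicator (ball y (\<Lambda> * R)) x = ?g x * indicator (ball y (\<Lambda> * R)) x"
        by (auto split: split_indicator)
    qed
    finally show "(\<integral>\<^sup>+x\<in>ball y (2 * R). ennreal (\<bar>f x\<bar> powr p) \<partial>M) \<le>
        ennreal (C_ball * (2 * R) powr p) * (\<integral>\<^sup>+x\<in>ball y (\<Lambda> * R). ?g x \<partial>M)" .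
  qed
  also have "\<dots> = ennreal (C_ball * (2 * R) powr p) * (\<integral>\<^sup>+y. (\<integral>\<^sup>+x\<in>ball y (\<Lambda> * R). ?g x \<partial>M) \<partial>count_space X)"
    by (rule nn_integral_cmult) simp
  also have "\<dots> \<le> ennreal (C_ball * (2 * R) powr p) * (of_nat (overlap \<Lambda>) * (\<integral>\<^sup>+x. ?g x \<partial>M))"
  proof (intro mult_left_mono overlap_sum cX)
    show "finite {y \<in> X. x \<in> ball y (\<Lambda> * R)}" "card {y \<in> X. x \<in> ball y (\<Lambda> * R)} \<le> overlap \<Lambda>" for x
      by (rule net_overlap[OF X]; use lam in \<open>simp add: \<Lambda>_def\<close>)+
    show "?g \<in> borel_measurable M"
      using meas by measurable
  qed auto
  also have "\<dots> = ennreal (C_layer * R powr p) * (\<integral>\<^sup>+x. ?g x \<partial>M)"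
  proof -
    have "ennreal (a * (b * c)) * (of_nat k * J) = ennreal (a * b * real k * c) * J"
      if "0 \<le> a" "0 \<le> b" "0 \<le> c" for a b c k J
      using that by (simp add: ennreal_mult ennreal_of_nat_eq_real_of_nat mult_ac)
    then show ?thesis
      using R(1) c\<Omega> C_pp_nonneg by (simp add: C_layer_def C_ball_def powr_mult)
  qed
  finally show ?thesis .
qed

end

section \<open>Differences of powers and dyadic sums\<close>

lemma powr_diff_le:
  fixes a b s :: real
  assumes "0 < a" "a \<le> b" "0 < s" "s \<le> 1"
  shows "b powr s - a powr s \<le> s * a powr (s - 1) * (b - a)"
proof (cases "a = b")
  case False
  then have "a < b"
    using assms by simp
  moreover have "((\<lambda>x. x powr s) has_real_derivative s * x powr (s - 1)) (at x)" if "a \<le> x" for x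
    using that assms by (intro has_real_derivative_powr) simp
  ultimately obtain z where z: "a < z" "z < b" "b powr s - a powr s = (b - a) * (s * z powr (s - 1))"
    using MVT2[of a b "\<lambda>x. x powr s" "\<lambda>z. s * z powr (s - 1)"] by blast
  have "z powr (s - 1) \<le> a powr (s - 1)"
    using z assms by (intro powr_mono2') auto
  then have "(b - a) * (s * z powr (s - 1)) \<le> (b - a) * (s * a powr (s - 1))"
    using assms by (intro mult_left_mono) auto
  then show ?thesis
    using z by (simp add: mult_ac)
qed simp

text \<open>The term with the largest admissible index suffices: either 2^-(K+1) \<le> t or K = n,
  so 2^-K is at most 2 (t + 2^-n).\<close>

lemma dyadic_sum_lower:
  fixes t :: real
  assumes t: "0 \<le> t" "t < 1 / 2" and n: "1 \<le> n" and q: "0 \<le> q"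
  shows "(2 * (t + 1 / 2 ^ n)) powr (- q) \<le> (\<Sum>k=1..n. if t < 1 / 2 ^ k then (1 / 2 ^ k) powr (- q) else 0)"
proof -
  define K where "K = Max {k \<in> {1..n}. t < 1 / 2 ^ k}"
  have "1 \<in> {k \<in> {1..n}. t < 1 / 2 ^ k}"
    using t n by simp
  then have K: "K \<in> {k \<in> {1..n}. t < 1 / 2 ^ k}"
    unfolding K_def by (intro Max_in) auto
  have K_max: "k \<le> K" if "k \<in> {1..n}" "t < 1 / 2 ^ k" for k
    unfolding K_def using that by (intro Max_ge) auto
  have "1 / 2 ^ K \<le> 2 * (t + 1 / 2 ^ n)"
  proof (cases "K = n")
    case True
    have "y \<le> 2 * (t + y)" if "0 \<le> y" for y
      using that t(1) by simp
    from this[of "1 / 2 ^ n"] show ?thesis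
      unfolding True by auto
  next
    case False
    then have "1 / 2 ^ Suc K \<le> t"
      using K K_max[of "Suc K"] by (force simp: not_less)
    moreover have "y \<le> 2 * (t + e)" if "y / 2 \<le> t" "0 \<le> e" for y e
      using that by simp
    from this[of "1 / 2 ^ K" "1 / 2 ^ n"] show ?thesis
      using calculation by auto
  qed
  then have "(2 * (t + 1 / 2 ^ n)) powr (- q) \<le> (1 / 2 ^ K) powr (- q)"
    using q by (intro powr_mono2') auto
  also have "\<dots> \<le> (\<Sum>k=1..n. if t < 1 / 2 ^ k then (1 / 2 ^ k) powr (- q) else 0)"
    using K member_le_sum[of K "{1..n}" "\<lambda>k. if t < 1 / 2 ^ k then (1 / 2 ^ k) powr (- q) else (0::real)"]
    by auto
  finally show ?thesis .
qed

text \<open>A geometric series with ratio \<open>B = 2 powr b\<close>, dominated by its last term up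
  to the factor 1 / (B - 1) \<le> 2 / b. This is the origin of the 1 / b in
  \<open>weighted_hardy\<close>.\<close>

lemma dyadic_sum_upper:
  fixes t :: real
  assumes t: "0 \<le> t" and L: "1 \<le> L" and b: "0 < b" "b \<le> 1"
  shows "(\<Sum>k=1..n. if t < L * (1 / 2 ^ k) then (1 / 2 ^ k) powr (- b) else 0) \<le>
    8 * L / b * (t + 1 / 2 ^ n) powr (- b)"
proof -
  let ?S = "{k \<in> {1..n}. t < L * (1 / 2 ^ k)}"
  have sum: "(\<Sum>k=1..n. if t < L * (1 / 2 ^ k) then (1 / 2 ^ k) powr (- b) else 0) = (\<Sum>k\<in>?S. (1 / 2 ^ k) powr (- b))"
    by (intro sum.mono_neutral_cong_right) auto
  have pos: "0 < t + 1 / 2 ^ n"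
    using t by (simp add: add_nonneg_pos)
  show ?thesis
  proof (cases "?S = {}")
    case True
    then show ?thesis
      unfolding sum True using L b by simp
  next
    case False
    define K where "K = Max ?S"
    have K: "K \<in> ?S"
      unfolding K_def using False by (intro Max_in) auto
    define B where "B = 2 powr b"
    have B: "1 + b / 2 \<le> B" "B \<le> 2"
    proof -
      have "1 + b * ln 2 \<le> exp (b * ln 2)"
        by (rule exp_ge_add_one_self)
      moreover have "b * (1 / 2) \<le> b * ln 2"
        using ln2_ge_two_thirds b by (intro mult_left_mono) auto
      ultimately have "1 + b * (1 / 2) \<le> exp (b * ln 2)"
        by linarith
      then show "1 + b / 2 \<le> B"
        by (simp add: B_def powr_def algebra_simps)
      have "B \<le> 2 powr 1"
        unfolding B_def using b by (intro powr_mono) auto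
      then show "B \<le> 2"
        by simp
    qed
    have B_pow: "(1 / 2 ^ k) powr (- b) = B ^ k" for k :: nat
    proof -
      have "(1 / 2 ^ k :: real) = 2 powr (- real k)"
        by (simp add: powr_minus powr_realpow divide_inverse)
      then have "(1 / 2 ^ k) powr (- b) = (2 powr b) powr real k"
        by (simp add: powr_powr mult.commute)
      then show ?thesis
        by (simp add: B_def powr_realpow)
    qed
    have "(\<Sum>k\<in>?S. (1 / 2 ^ k) powr (- b)) \<le> (\<Sum>k\<le>K. B ^ k)"
      unfolding B_pow using B b by (intro sum_mono2) (auto simp: K_def intro!: Max_ge)
    also have "\<dots> = (B ^ Suc K - 1) / (B - 1)"
      using B b geometric_sum[of B "Suc K"] by (simp add: lessThan_Suc_atMost)
    also have "\<dots> \<le> 2 * B ^ K / (b / 2)"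
      using B b by (intro frac_le) (auto intro!: order_trans[OF _ mult_right_mono[of B 2 "B ^ K"]])
    also have "B ^ K \<le> (2 * L) * (t + 1 / 2 ^ n) powr (- b)"
    proof -
      have "1 / 2 ^ n \<le> (1::real) / 2 ^ K"
        using K by (intro divide_left_mono power_increasing) auto
      also have "\<dots> \<le> L * (1 / 2 ^ K)"
        using L by (simp add: divide_right_mono)
      finally have "t + 1 / 2 ^ n \<le> 2 * L * (1 / 2 ^ K)"
        using K by auto
      then have "(t + 1 / 2 ^ n) / (2 * L) \<le> 1 / 2 ^ K"
        using L by (simp add: field_simps)
      then have "(1 / 2 ^ K) powr (- b) \<le> ((t + 1 / 2 ^ n) / (2 * L)) powr (- b)"
        using pos L b by (intro powr_mono2') auto
      also have "\<dots> = (2 * L) powr b * (t + 1 / 2 ^ n) powr (- b)"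
      proof -
        have "(c / l) powr (- b) = l powr b * c powr (- b)" if "0 < c" "0 < l" for c l :: real
          using that by (simp add: powr_divide powr_minus divide_simps)
        then show ?thesis
          using pos L by simp
      qed
      also have "\<dots> \<le> (2 * L) powr 1 * (t + 1 / 2 ^ n) powr (- b)"
        using L b by (intro mult_right_mono powr_mono) auto
      finally show ?thesis
        using L unfolding B_pow by simp
    qed
    finally show ?thesis
      unfolding sum using b by (simp add: field_simps)
  qed
qed

section \<open>Wannebo's weighted estimate and the Hardy inequality\<close>

context pi_omega
begin

text \<open>On a ball of radius \<open>e / 4\<close> the quantity \<open>db + e\<close> varies by at
  most the factor 2, so the derivative of the power at \<open>w\<close> serves for all pairs of
  points. Keeping the exponent \<open>s\<close> as a factor is essential: it is the small quantity
  that permits absorption.\<close>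

lemma weight_lipschitz:
  fixes e s :: real
  assumes e: "0 < e" and s: "0 < s" "s \<le> 1"
    and near: "x \<in> ball z (e / 4)" "y \<in> ball z (e / 4)" "w \<in> ball z (e / 4)"
  shows "\<bar>(db x + e) powr s - (db y + e) powr s\<bar> \<le> 2 * s * (db w + e) powr (s - 1) * dist x y"
proof -
  have main: "\<bar>(db x + e) powr s - (db y + e) powr s\<bar> \<le> 2 * s * (db w + e) powr (s - 1) * dist x y"
    if le: "db x \<le> db y" and near: "x \<in> ball z (e / 4)" "w \<in> ball z (e / 4)" for x y
  proof -
    have "dist x w < e / 2"
      using near dist_triangle_half_r[of z x "e / 2" w] by simp
    then have "db w \<le> db x + e / 2"
      using db_lipschitz[of w x] by (simp add: dist_commute)
    then have half: "(db w + e) / 2 \<le> db x + e"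
      using db_bounds(1)[of x] e by simp
    have "\<bar>(db x + e) powr s - (db y + e) powr s\<bar> = (db y + e) powr s - (db x + e) powr s"
      using le db_bounds(1)[of x] e s powr_mono2[of s "db x + e" "db y + e"] by simp
    also have "\<dots> \<le> s * (db x + e) powr (s - 1) * ((db y + e) - (db x + e))"
      using le db_bounds(1)[of x] e s by (intro powr_diff_le) auto
    also have "\<dots> \<le> s * (2 * (db w + e) powr (s - 1)) * dist x y"
    proof (intro mult_mono)
      have "(db x + e) powr (s - 1) \<le> ((db w + e) / 2) powr (s - 1)"
        using half db_bounds(1)[of w] e s by (intro powr_mono2') auto
      also have "\<dots> = 2 powr (1 - s) * (db w + e) powr (s - 1)"
        using db_bounds(1)[of w] e by (simp add: powr_divide powr_minus powr_diff divide_simps)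
      also have "\<dots> \<le> 2 powr 1 * (db w + e) powr (s - 1)"
        using s by (intro mult_right_mono powr_mono) auto
      finally show "(db x + e) powr (s - 1) \<le> 2 * (db w + e) powr (s - 1)"
        by simp
      show "db y + e - (db x + e) \<le> dist x y"
        using db_lipschitz[of x y] by simp
    qed (use le s in auto)
    finally show ?thesis
      by (simp add: mult_ac)
  qed
  show ?thesis
  proof (cases "db x \<le> db y")
    case True
    then show ?thesis
      using main near by blast
  next
    case False
    then show ?thesis
      using main[of y x] near by (simp add: abs_minus_commute dist_commute)
  qed
qed

definition A_hardy :: real
  where "A_hardy = 8 powr p * (8 * \<Lambda> * C_layer)"

lemma A_hardy_nonneg: "0 \<le> A_hardy"
  using lam C_layer_nonneg by (simp add: A_hardy_def \<Lambda>_def)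

text \<open>
  Wannebo's argument: apply the estimate on the layers \<open>d(\<cdot>, \<Omega>) < 2\<^sup>-\<^sup>k\<close> to \<open>\<delta>\<close> times the small power \<open>b / p\<close>
  of the distance and sum up with weights. The term with \<open>J\<close> on the right has the factor
  \<open>b\<^bsup>p-1\<^esup>\<close>, which becomes small with \<open>b\<close> since \<open>p > 1\<close>. The summand \<open>1 / 2 ^ n\<close> makes \<open>J\<close> finite, so that
  the term can be absorbed.
\<close>

lemma weighted_hardy:
  fixes \<delta> :: "'a \<Rightarrow> real"
  assumes \<delta>_meas [measurable]: "\<delta> \<in> borel_measurable M" and \<delta>_nonneg: "\<And>x. 0 \<le> \<delta> x"
    and \<delta>_fin: "(\<integral>\<^sup>+x. ennreal (\<delta> x powr p) \<partial>M) < \<infinity>"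
    and \<rho>: "Lp_integrable_borel M p \<rho>" and ug: "weak_upper_gradient M p \<delta> \<rho>"
    and zero: "AE x in M. x \<in> \<Omega> \<longrightarrow> \<delta> x = 0"
    and b: "0 < b" "b \<le> 1" and n: "1 \<le> n"
  defines "J \<equiv> \<integral>\<^sup>+x. ennreal ((\<delta> x / (db x + 1 / 2 ^ n)) powr p) \<partial>M"
  shows "J \<le> ennreal (A_hardy / b) * ((\<integral>\<^sup>+x. epow \<rho> x \<partial>M) + ennreal ((2 * (b / p)) powr p) * J) +
      ennreal (2 powr p) * (\<integral>\<^sup>+x. ennreal (\<delta> x powr p) \<partial>M)"
    and "J < \<infinity>"
proof -
  define e where "e = 1 / (2::real) ^ n"
  have e: "0 < e" "e \<le> 1"
    by (auto simp: e_def)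
  \<comment> \<open>Chosen so that the p-th power of the weight \<open>\<theta> = v powr s\<close>
    is \<open>v powr b\<close>.\<close>
  define s where "s = b / p"
  have s: "0 < s" "s \<le> 1" "s * p = b"
    using b p by (auto simp: s_def)
  define v where "v x = db x + e" for x
  have v: "0 < v x" "e \<le> v x" "v x \<le> 2" "0 \<le> v x" for x
    using db_bounds[of x] e by (auto simp: v_def add_nonneg_pos)
  have v_borel [measurable]: "v \<in> borel_measurable borel"
    unfolding v_def by measurable
  have v_M [measurable]: "v \<in> borel_measurable M"
    by (rule borel_measurable_M) simp
  have J_eq: "J = (\<integral>\<^sup>+x. ennreal ((\<delta> x / v x) powr p) \<partial>M)"
    by (simp add: J_def v_def e_def)
  define D where "D = (\<integral>\<^sup>+x. ennreal (\<delta> x powr p) \<partial>M)"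
  show J_fin: "J < \<infinity>"
  proof -
    have "J \<le> (\<integral>\<^sup>+x. ennreal ((1 / e) powr p) * ennreal (\<delta> x powr p) \<partial>M)"
      unfolding J_eq
    proof (rule nn_integral_mono)
      fix x
      have "(\<delta> x / v x) powr p \<le> (1 / e * \<delta> x) powr p"
        using v[of x] e \<delta>_nonneg[of x] p by (intro powr_mono2) (auto simp: frac_le)
      also have "\<dots> = (1 / e) powr p * \<delta> x powr p"
        by (rule powr_mult)
      finally show "ennreal ((\<delta> x / v x) powr p) \<le> ennreal ((1 / e) powr p) * ennreal (\<delta> x powr p)"
        by (simp add: ennreal_leI flip: ennreal_mult)
    qed
    also have "\<dots> = ennreal ((1 / e) powr p) * D"
      by (simp add: nn_integral_cmult D_def)
    also have "\<dots> < \<infinity>"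
      using \<delta>_fin by (simp add: D_def ennreal_mult_less_top)
    finally show ?thesis .
  qed

  obtain F where F [measurable]: "F \<in> borel_measurable borel"
    and F_ge: "\<And>x. ennreal (\<delta> x) \<le> F x" and F_eq: "AE x in M. F x = ennreal (\<delta> x)"
    using majorant_M[of "\<lambda>x. ennreal (\<delta> x)"] by auto
  have F_M [measurable]: "F \<in> borel_measurable M"
    by (rule borel_measurable_M) fact
  have \<rho>_borel [measurable]: "\<rho> \<in> borel_measurable borel"
    using Lp_integrable_borelD(1)[OF \<rho>] by simp
  have \<rho>_M [measurable]: "\<rho> \<in> borel_measurable M"
    by (rule borel_measurable_M) simp
  define \<theta> where "\<theta> x = v x powr s" for x
  define S where "S x = 2 * s * v x powr (s - 1)" for x
  define f where "f x = \<theta> x * \<delta> x" for x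
  define g where "g x = ennreal \<bar>\<theta> x\<bar> * \<rho> x + F x * ennreal (S x)" for x
  \<comment> \<open>What remains of the p-th power of the gradient \<open>g\<close> of
    \<theta>\<delta> after the weight \<open>v powr b\<close> is split off; its integral is that of
    \<open>epow \<rho>\<close> plus the small multiple of \<open>J\<close>.\<close>
  define k where "k x = epow \<rho> x + ennreal ((2 * s) powr p * v x powr (- p)) * epow F x" for x
  have [measurable]: "\<theta> \<in> borel_measurable borel" "S \<in> borel_measurable borel" "g \<in> borel_measurable borel"
    "f \<in> borel_measurable M" "k \<in> borel_measurable M"
    unfolding \<theta>_def S_def f_def g_def k_def by measurable
  have g_M [measurable]: "g \<in> borel_measurable M"
    by (rule borel_measurable_M) simp

  have k_int: "(\<integral>\<^sup>+x. k x \<partial>M) = (\<integral>\<^sup>+x. epow \<rho> x \<partial>M) + ennreal ((2 * s) powr p) * J"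
  proof -
    have "(\<integral>\<^sup>+x. k x \<partial>M) = (\<integral>\<^sup>+x. epow \<rho> x + ennreal ((2 * s) powr p) * ennreal ((\<delta> x / v x) powr p) \<partial>M)"
    proof (rule nn_integral_cong_AE)
      show "AE x in M. k x = epow \<rho> x + ennreal ((2 * s) powr p) * ennreal ((\<delta> x / v x) powr p)"
        using F_eq
      proof eventually_elim
        case (elim x)
        have "v x powr (- p) * \<delta> x powr p = (\<delta> x / v x) powr p"
          using v(1)[of x] \<delta>_nonneg[of x] by (simp add: powr_divide powr_minus divide_simps)
        then show ?case
          using elim \<delta>_nonneg[of x] by (simp add: k_def epowr_ennreal mult.assoc flip: ennreal_mult)
      qed
    qed
    then show ?thesis
      by (simp add: nn_integral_add nn_integral_cmult J_eq)
  qed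
  have k_fin: "(\<integral>\<^sup>+x. k x \<partial>M) < \<infinity>"
    unfolding k_int using J_fin Lp_integrable_borelD(2)[OF \<rho>] by (simp add: ennreal_mult_less_top)

  have g_le: "epow g x \<le> ennreal (2 powr p * v x powr b) * k x" for x
  proof -
    have "epow g x \<le> ennreal (2 powr p) * (epowr (ennreal \<bar>\<theta> x\<bar> * \<rho> x) p + epowr (F x * ennreal (S x)) p)"
      unfolding g_def using p by (intro epowr_add_le) simp
    also have "epowr (ennreal \<bar>\<theta> x\<bar> * \<rho> x) p = ennreal (v x powr b) * epow \<rho> x"
      using v[of x] s by (simp add: \<theta>_def epowr_mult epowr_ennreal powr_powr)
    also have "epowr (F x * ennreal (S x)) p = ennreal (v x powr b) * (ennreal ((2 * s) powr p * v x powr (- p)) * epow F x)"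
    proof -
      have "S x powr p = (2 * s) powr p * v x powr ((s - 1) * p)"
        using s v[of x] by (simp add: S_def powr_mult powr_powr)
      also have "(s - 1) * p = b + (- p)"
        using s by (simp add: algebra_simps)
      also have "v x powr (b + (- p)) = v x powr b * v x powr (- p)"
        by (rule powr_add)
      finally have "S x powr p = v x powr b * ((2 * s) powr p * v x powr (- p))"
        by (simp add: mult_ac)
      moreover have "0 \<le> S x"
        using s by (simp add: S_def)
      ultimately show ?thesis
        by (simp add: epowr_mult epowr_ennreal ennreal_mult mult_ac)
    qed
    finally show ?thesis
      by (simp add: k_def ennreal_mult distrib_left mult_ac)
  qed

  have g_Lp: "Lp_integrable_borel M p g"
  proof -
    have "(\<integral>\<^sup>+x. epow g x \<partial>M) \<le> (\<integral>\<^sup>+x. ennreal (2 powr p * 2 powr b) * k x \<partial>M)"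
    proof (rule nn_integral_mono)
      fix x
      have "v x powr b \<le> 2 powr b"
        using v[of x] b by (intro powr_mono2) auto
      then have "ennreal (2 powr p * v x powr b) \<le> ennreal (2 powr p * 2 powr b)"
        by (intro ennreal_leI mult_left_mono) auto
      then have "ennreal (2 powr p * v x powr b) * k x \<le> ennreal (2 powr p * 2 powr b) * k x"
        by (rule mult_right_mono) simp
      with g_le[of x] show "epow g x \<le> ennreal (2 powr p * 2 powr b) * k x"
        by (rule order_trans)
    qed
    also have "\<dots> < \<infinity>"
      using k_fin by (simp add: nn_integral_cmult ennreal_mult_less_top)
    finally show ?thesis
      by (simp add: Lp_integrable_borel_def)
  qed

  have f_ug: "weak_upper_gradient M p f g"
  proof -
    obtain \<sigma>0 where \<sigma>0: "Lp_integrable_borel M p \<sigma>0" "ug_outside \<sigma>0 UNIV \<delta> \<rho>"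
      using ug by (auto simp: weak_upper_gradient_iff)
    define \<sigma> where "\<sigma> x = max (\<sigma>0 x) (\<rho> x)" for x
    have \<sigma>: "Lp_integrable_borel M p \<sigma>"
      unfolding \<sigma>_def using p by (intro Lp_integrable_borel_max null_hull_M \<sigma>0 \<rho>) simp
    have "ug_outside \<sigma> UNIV \<delta> \<rho>"
      unfolding ug_outside_def
    proof (intro allI impI)
      fix a b \<gamma> assume path: "(a, b, \<gamma>) \<in> paths_in UNIV" and fin: "path_integral (a, b, \<gamma>) \<sigma> < \<infinity>"
      have "path_integral (a, b, \<gamma>) \<sigma>0 < \<infinity>"
        by (rule path_integral_finite_mono[OF path _ fin]) (simp add: \<sigma>_def)
      then show "ennreal (norm (\<delta> (\<gamma> a) - \<delta> (\<gamma> b))) \<le> path_integral (a, b, \<gamma>) \<rho>"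
        using \<sigma>0(2) path by (rule ug_outsideD[rotated 2])
    qed
    then have "ug_outside \<sigma> UNIV (\<lambda>x. \<theta> x *\<^sub>R \<delta> x) (\<lambda>x. ennreal \<bar>\<theta> x\<bar> * \<rho> x + F x * ennreal (S x))"
    proof (rule ug_mult[rotated 4, where S = "2 * s * e powr (s - 1)"])
      show "\<sigma> \<in> borel_measurable borel"
        using Lp_integrable_borelD(1)[OF \<sigma>] by simp
      show "ennreal (norm (\<delta> x)) \<le> F x" for x
        using F_ge[of x] \<delta>_nonneg[of x] by simp
      show "\<exists>r>0. \<forall>x\<in>ball z r. \<forall>y\<in>ball z r. \<forall>w\<in>ball z r. \<bar>\<theta> x - \<theta> y\<bar> \<le> S w * dist x y" for z
        unfolding \<theta>_def S_def v_def using e s weight_lipschitz[of e s _ z] by (intro exI[of _ "e / 4"]) auto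
      show "0 \<le> S x" for x
        using s by (simp add: S_def)
      show "S x \<le> 2 * s * e powr (s - 1)" for x
        unfolding S_def using v[of x] e s by (intro mult_left_mono powr_mono2') auto
    qed (auto simp: \<sigma>_def)
    then have "ug_outside \<sigma> UNIV f g"
      by (simp add: f_def[abs_def] g_def[abs_def])
    then show ?thesis
      unfolding weak_upper_gradient_iff using \<sigma> by auto
  qed

  have f_p: "\<bar>f x\<bar> powr p = v x powr b * \<delta> x powr p" for x
    using v[of x] s \<delta>_nonneg[of x] by (simp add: f_def \<theta>_def powr_mult powr_powr abs_mult)
  have f_loc: "loc_int f"
  proof (rule loc_int_of_Lp)
    have "(\<integral>\<^sup>+x. ennreal (\<bar>f x\<bar> powr p) \<partial>M) \<le> (\<integral>\<^sup>+x. ennreal (2 powr b) * ennreal (\<delta> x powr p) \<partial>M)"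
      unfolding f_p using v b
      by (intro nn_integral_mono) (auto simp flip: ennreal_mult intro!: ennreal_leI mult_right_mono powr_mono2)
    also have "\<dots> < \<infinity>"
      using \<delta>_fin by (simp add: nn_integral_cmult ennreal_mult_less_top)
    finally show "(\<integral>\<^sup>+x. ennreal (\<bar>f x\<bar> powr p) \<partial>M) < \<infinity>" .
  qed measurable
  have f_zero: "AE x in M. x \<in> \<Omega> \<longrightarrow> f x = 0"
    using zero by eventually_elim (simp add: f_def)

  \<comment> \<open>The estimate for the layer of width R is multiplied by R^-(p+b), of which R^-b
    is left on the right. The sum starts at 1 because layers of width above 1 / 2 are not
    covered.\<close>
  have layers: "(\<Sum>j=1..n. ennreal ((1 / 2 ^ j) powr (- (p + b))) * (\<integral>\<^sup>+x\<in>{x. d x < 1 / 2 ^ j}. ennreal (\<bar>f x\<bar> powr p) \<partial>M)) \<le>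
      ennreal C_layer * (\<Sum>j=1..n. ennreal ((1 / 2 ^ j) powr (- b)) * (\<integral>\<^sup>+x\<in>{x. d x < \<Lambda> * (1 / 2 ^ j)}. epow g x \<partial>M))"
    unfolding sum_distrib_left
  proof (rule sum_mono)
    fix j assume j: "j \<in> {1..n}"
    define R where "R = 1 / (2::real) ^ j"
    have "2 ^ 1 \<le> (2::real) ^ j"
      using j by (intro power_increasing) auto
    then have R: "0 < R" "R \<le> 1 / 2"
      by (auto simp: R_def divide_simps)
    have "ennreal (R powr (- (p + b))) * (\<integral>\<^sup>+x\<in>{x. d x < R}. ennreal (\<bar>f x\<bar> powr p) \<partial>M) \<le>
        ennreal (R powr (- (p + b))) * (ennreal (C_layer * R powr p) * (\<integral>\<^sup>+x\<in>{x. d x < \<Lambda> * R}. epow g x \<partial>M))"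
      by (intro mult_left_mono layer_estimate R f_loc g_Lp f_ug f_zero) simp
    also have "\<dots> = ennreal C_layer * (ennreal (R powr (- b)) * (\<integral>\<^sup>+x\<in>{x. d x < \<Lambda> * R}. epow g x \<partial>M))"
    proof -
      have eq: "R powr (- (p + b)) * R powr p = R powr (- b)"
        using R by (simp add: powr_add[symmetric])
      have "ennreal y * (ennreal (c * z) * K) = ennreal c * (ennreal (y * z) * K)"
        if "0 \<le> y" "0 \<le> c" "0 \<le> z" for y c z K
        using that by (simp add: ennreal_mult mult_ac)
      from this[OF powr_ge_zero C_layer_nonneg powr_ge_zero] show ?thesis
        by (simp only: eq)
    qed
    finally show "ennreal ((1 / 2 ^ j) powr (- (p + b))) * (\<integral>\<^sup>+x\<in>{x. d x < 1 / 2 ^ j}. ennreal (\<bar>f x\<bar> powr p) \<partial>M) \<le>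
        ennreal C_layer * (ennreal ((1 / 2 ^ j) powr (- b)) * (\<integral>\<^sup>+x\<in>{x. d x < \<Lambda> * (1 / 2 ^ j)}. epow g x \<partial>M))"
      by (simp only: R_def)
  qed

  have d_sets [measurable]: "{x. d x < c} \<in> sets M" for c
    by (intro borel_sets_M borel_open open_Collect_less continuous_intros)
  have sum_int: "(\<Sum>j=1..n. ennreal (w j) * (\<integral>\<^sup>+x\<in>{x. d x < c j}. h x \<partial>M)) =
      (\<integral>\<^sup>+x. ennreal (\<Sum>j=1..n. if d x < c j then w j else 0) * h x \<partial>M)"
    if w: "\<And>j. 0 \<le> w j" and [measurable]: "h \<in> borel_measurable M" for w c :: "nat \<Rightarrow> real" and h
  proof -
    have "(\<Sum>j=1..n. ennreal (w j) * (\<integral>\<^sup>+x\<in>{x. d x < c j}. h x \<partial>M)) =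
        (\<integral>\<^sup>+x. (\<Sum>j=1..n. ennreal (w j) * (h x * indicator {x. d x < c j} x)) \<partial>M)"
      by (simp add: nn_integral_cmult nn_integral_sum)
    also have "\<dots> = (\<integral>\<^sup>+x. ennreal (\<Sum>j=1..n. if d x < c j then w j else 0) * h x \<partial>M)"
    proof (rule nn_integral_cong)
      fix x
      have "(\<Sum>j=1..n. ennreal (w j) * (h x * indicator {x. d x < c j} x)) =
          (\<Sum>j=1..n. ennreal (if d x < c j then w j else 0) * h x)"
        by (intro sum.cong) auto
      also have "\<dots> = ennreal (\<Sum>j=1..n. if d x < c j then w j else 0) * h x"
        using w by (subst sum_distrib_right[symmetric], subst sum_ennreal) auto
      finally show "(\<Sum>j=1..n. ennreal (w j) * (h x * indicator {x. d x < c j} x)) =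
          ennreal (\<Sum>j=1..n. if d x < c j then w j else 0) * h x" .
    qed
    finally show ?thesis .
  qed

  \<comment> \<open>On the left the weights add up to at least a multiple of v^-(p+b), and v^-(p+b)
    times the p-th power v^b \<delta>^p of \<open>f\<close> is (\<delta> / v)^p.\<close>
  have near: "(\<integral>\<^sup>+x\<in>{x. d x < 1 / 2}. ennreal ((\<delta> x / v x) powr p) \<partial>M) \<le>
      ennreal (4 powr p) * (\<Sum>j=1..n. ennreal ((1 / 2 ^ j) powr (- (p + b))) * (\<integral>\<^sup>+x\<in>{x. d x < 1 / 2 ^ j}. ennreal (\<bar>f x\<bar> powr p) \<partial>M))"
  proof -
    have "(\<integral>\<^sup>+x\<in>{x. d x < 1 / 2}. ennreal ((\<delta> x / v x) powr p) \<partial>M) \<le>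
        (\<integral>\<^sup>+x. ennreal (4 powr p) * (ennreal (\<Sum>j=1..n. if d x < 1 / 2 ^ j then (1 / 2 ^ j) powr (- (p + b)) else 0) * ennreal (\<bar>f x\<bar> powr p)) \<partial>M)"
    proof (rule nn_integral_mono)
      fix x
      show "ennreal ((\<delta> x / v x) powr p) * indicator {x. d x < 1 / 2} x \<le>
          ennreal (4 powr p) * (ennreal (\<Sum>j=1..n. if d x < 1 / 2 ^ j then (1 / 2 ^ j) powr (- (p + b)) else 0) * ennreal (\<bar>f x\<bar> powr p))"
      proof (cases "d x < 1 / 2")
        case True
        then have "v x = d x + 1 / 2 ^ n"
          by (simp add: v_def db_def e_def)
        then have "(2 * v x) powr (- (p + b)) \<le> (\<Sum>j=1..n. if d x < 1 / 2 ^ j then (1 / 2 ^ j) powr (- (p + b)) else 0)"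
          using dyadic_sum_lower[of "d x" n "p + b"] True n p b by (simp add: infdist_nonneg)
        then have "4 powr p * ((2 * v x) powr (- (p + b)) * \<bar>f x\<bar> powr p) \<le>
            4 powr p * ((\<Sum>j=1..n. if d x < 1 / 2 ^ j then (1 / 2 ^ j) powr (- (p + b)) else 0) * \<bar>f x\<bar> powr p)"
          by (intro mult_left_mono mult_right_mono) auto
        moreover have "(\<delta> x / v x) powr p \<le> 4 powr p * ((2 * v x) powr (- (p + b)) * \<bar>f x\<bar> powr p)"
        proof -
          have "(2 * v x) powr (- (p + b)) * \<bar>f x\<bar> powr p = 2 powr (- (p + b)) * (\<delta> x / v x) powr p"
          proof -
            have eq: "v x powr (- p) = v x powr (- (p + b)) * v x powr b"
              using v(1)[of x] by (simp add: powr_add[symmetric])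
            have "(\<delta> x / v x) powr p = v x powr (- p) * \<delta> x powr p"
              using v(1)[of x] \<delta>_nonneg[of x] by (simp add: powr_divide powr_minus divide_simps)
            then show ?thesis
              unfolding f_p powr_mult by (simp only: eq mult.assoc)
          qed
          \<comment> \<open>The exponent 2p - (p + b) = p - b is nonnegative since b \<le> 1 <
            p.\<close>
          moreover have "1 \<le> 4 powr p * 2 powr (- (p + b))"
          proof -
            have "2 powr 0 \<le> (2::real) powr (2 * p - (p + b))"
              using p b by (intro powr_mono) auto
            also have "\<dots> = (2 powr 2) powr p * 2 powr (- (p + b))"
              by (simp only: powr_powr powr_add[symmetric]) simp
            finally show ?thesis
              by simp
          qed
          then have "1 * (\<delta> x / v x) powr p \<le> 4 powr p * 2 powr (- (p + b)) * (\<delta> x / v x) powr p"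
            by (intro mult_right_mono) auto
          ultimately show ?thesis
            by (simp add: mult.assoc)
        qed
        ultimately have "(\<delta> x / v x) powr p \<le> 4 powr p * ((\<Sum>j=1..n. if d x < 1 / 2 ^ j then (1 / 2 ^ j) powr (- (p + b)) else 0) * \<bar>f x\<bar> powr p)"
          by (rule order_trans[rotated])
        then have "ennreal ((\<delta> x / v x) powr p) \<le> ennreal (4 powr p * ((\<Sum>j=1..n. if d x < 1 / 2 ^ j then (1 / 2 ^ j) powr (- (p + b)) else 0) * \<bar>f x\<bar> powr p))"
          by (rule ennreal_leI)
        also have "\<dots> = ennreal (4 powr p) * (ennreal (\<Sum>j=1..n. if d x < 1 / 2 ^ j then (1 / 2 ^ j) powr (- (p + b)) else 0) * ennreal (\<bar>f x\<bar> powr p))"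
          by (subst ennreal_mult, simp, simp add: sum_nonneg, subst ennreal_mult) (auto simp: sum_nonneg)
        finally show ?thesis
          using True by simp
      qed simp
    qed
    also have "\<dots> = ennreal (4 powr p) * (\<Sum>j=1..n. ennreal ((1 / 2 ^ j) powr (- (p + b))) * (\<integral>\<^sup>+x\<in>{x. d x < 1 / 2 ^ j}. ennreal (\<bar>f x\<bar> powr p) \<partial>M))"
      by (subst sum_int) (auto simp: nn_integral_cmult)
    finally show ?thesis .
  qed

  \<comment> \<open>On the right the weights add up to at most a multiple of v^-b / b, which cancels
    the factor v^b of \<open>g_le\<close>.\<close>
  have weights: "(\<Sum>j=1..n. ennreal ((1 / 2 ^ j) powr (- b)) * (\<integral>\<^sup>+x\<in>{x. d x < \<Lambda> * (1 / 2 ^ j)}. epow g x \<partial>M)) \<le>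
      ennreal (8 * \<Lambda> / b * 2 powr p) * (\<integral>\<^sup>+x. k x \<partial>M)"
  proof -
    have "(\<Sum>j=1..n. ennreal ((1 / 2 ^ j) powr (- b)) * (\<integral>\<^sup>+x\<in>{x. d x < \<Lambda> * (1 / 2 ^ j)}. epow g x \<partial>M)) =
        (\<integral>\<^sup>+x. ennreal (\<Sum>j=1..n. if d x < \<Lambda> * (1 / 2 ^ j) then (1 / 2 ^ j) powr (- b) else 0) * epow g x \<partial>M)"
      by (subst sum_int) auto
    also have "\<dots> \<le> (\<integral>\<^sup>+x. ennreal (8 * \<Lambda> / b * 2 powr p) * k x \<partial>M)"
    proof (rule nn_integral_mono)
      fix x
      have "(\<Sum>j=1..n. if d x < \<Lambda> * (1 / 2 ^ j) then (1 / 2 ^ j) powr (- b) else 0) \<le> 8 * \<Lambda> / b * (d x + 1 / 2 ^ n) powr (- b)"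
        using lam b by (intro dyadic_sum_upper) (auto simp: infdist_nonneg \<Lambda>_def)
      also have "\<dots> \<le> 8 * \<Lambda> / b * v x powr (- b)"
        using lam b v(1)[of x] db_bounds(3)[of x]
        by (intro mult_left_mono powr_mono2') (auto simp: \<Lambda>_def v_def e_def)
      finally have "ennreal (\<Sum>j=1..n. if d x < \<Lambda> * (1 / 2 ^ j) then (1 / 2 ^ j) powr (- b) else 0) * epow g x \<le>
          ennreal (8 * \<Lambda> / b * v x powr (- b)) * (ennreal (2 powr p * v x powr b) * k x)"
        by (intro mult_mono ennreal_leI g_le) auto
      also have "\<dots> = ennreal (8 * \<Lambda> / b * 2 powr p) * k x"
      proof -
        have eq: "8 * \<Lambda> / b * v x powr (- b) * (2 powr p * v x powr b) = 8 * \<Lambda> / b * 2 powr p"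
          using v(1)[of x] by (simp add: powr_minus field_simps)
        have "ennreal y * (ennreal z * K) = ennreal (y * z) * K" if "0 \<le> y" "0 \<le> z" for y z K
          using that by (simp add: ennreal_mult mult.assoc)
        from this[of "8 * \<Lambda> / b * v x powr (- b)" "2 powr p * v x powr b" "k x"] show ?thesis
          unfolding eq using lam b by (simp add: \<Lambda>_def)
      qed
      finally show "ennreal (\<Sum>j=1..n. if d x < \<Lambda> * (1 / 2 ^ j) then (1 / 2 ^ j) powr (- b) else 0) * epow g x \<le>
          ennreal (8 * \<Lambda> / b * 2 powr p) * k x" .
    qed
    also have "\<dots> = ennreal (8 * \<Lambda> / b * 2 powr p) * (\<integral>\<^sup>+x. k x \<partial>M)"
      by (simp add: nn_integral_cmult)
    finally show ?thesis .
  qed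

  \<comment> \<open>Where \<open>d\<close> is at least 1 / 2, so is \<open>v\<close>, and the
    quotient is at most 2 \<delta>.\<close>
  have "J \<le> (\<integral>\<^sup>+x. ennreal ((\<delta> x / v x) powr p) * indicator {x. d x < 1 / 2} x + ennreal (2 powr p) * ennreal (\<delta> x powr p) \<partial>M)"
    unfolding J_eq
  proof (rule nn_integral_mono)
    fix x
    show "ennreal ((\<delta> x / v x) powr p) \<le> ennreal ((\<delta> x / v x) powr p) * indicator {x. d x < 1 / 2} x + ennreal (2 powr p) * ennreal (\<delta> x powr p)"
    proof (cases "d x < 1 / 2")
      case False
      then have "1 / 2 \<le> v x"
        using e by (simp add: v_def db_def)
      then have "\<delta> x / v x \<le> \<delta> x / (1 / 2)"
        using \<delta>_nonneg[of x] by (intro divide_left_mono) auto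
      then have "(\<delta> x / v x) powr p \<le> (2 * \<delta> x) powr p"
        using \<delta>_nonneg[of x] v(1)[of x] p by (intro powr_mono2) auto
      then show ?thesis
        using False \<delta>_nonneg[of x] by (simp add: powr_mult ennreal_leI flip: ennreal_mult)
    qed simp
  qed
  also have "\<dots> = (\<integral>\<^sup>+x\<in>{x. d x < 1 / 2}. ennreal ((\<delta> x / v x) powr p) \<partial>M) + ennreal (2 powr p) * D"
    by (simp add: nn_integral_add nn_integral_cmult D_def)
  also have "\<dots> \<le> ennreal (4 powr p) * (ennreal C_layer * (ennreal (8 * \<Lambda> / b * 2 powr p) * (\<integral>\<^sup>+x. k x \<partial>M))) + ennreal (2 powr p) * D"
    by (intro add_right_mono order_trans[OF near] mult_left_mono order_trans[OF layers] weights) auto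
  also have "ennreal (4 powr p) * (ennreal C_layer * (ennreal (8 * \<Lambda> / b * 2 powr p) * (\<integral>\<^sup>+x. k x \<partial>M))) = ennreal (A_hardy / b) * (\<integral>\<^sup>+x. k x \<partial>M)"
  proof -
    have "ennreal y * (ennreal z * (ennreal w * K)) = ennreal (y * z * w) * K" if "0 \<le> y" "0 \<le> z" "0 \<le> w" for y z w K
      using that by (simp add: ennreal_mult mult.assoc)
    from this[of "4 powr p" C_layer "8 * \<Lambda> / b * 2 powr p" "\<integral>\<^sup>+x. k x \<partial>M"]
    have "ennreal (4 powr p) * (ennreal C_layer * (ennreal (8 * \<Lambda> / b * 2 powr p) * (\<integral>\<^sup>+x. k x \<partial>M))) =
        ennreal (4 powr p * C_layer * (8 * \<Lambda> / b * 2 powr p)) * (\<integral>\<^sup>+x. k x \<partial>M)"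
      using C_layer_nonneg lam b by (simp add: \<Lambda>_def)
    also have "4 powr p * C_layer * (8 * \<Lambda> / b * 2 powr p) = A_hardy / b"
      using powr_mult[of 4 2 p] by (simp add: A_hardy_def)
    finally show ?thesis .
  qed
  finally show "J \<le> ennreal (A_hardy / b) * ((\<integral>\<^sup>+x. epow \<rho> x \<partial>M) + ennreal ((2 * (b / p)) powr p) * J) + ennreal (2 powr p) * (\<integral>\<^sup>+x. ennreal (\<delta> x powr p) \<partial>M)"
    by (simp add: k_int D_def s_def)
qed

text \<open>Chosen to bring the coefficient of \<open>J\<close> in \<open>weighted_hardy\<close>, at
  most A 2^p b^(p-1), down to 1 / 2. The summand 1 prevents a division by zero if
  \<open>A_hardy\<close> is 0.\<close>

definition b_hardy :: real
  where "b_hardy = min 1 ((1 / (2 * (A_hardy + 1) * 2 powr p)) powr (1 / (p - 1)))"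

definition C_hardy :: real
  where "C_hardy = 2 powr p * (2 * (A_hardy / b_hardy) + 2 * 2 powr p)"

lemma b_hardy: "0 < b_hardy" "b_hardy \<le> 1" "A_hardy / b_hardy * (2 * (b_hardy / p)) powr p \<le> 1 / 2"
proof -
  let ?c = "1 / (2 * (A_hardy + 1) * 2 powr p)"
  have c: "0 < ?c"
    using A_hardy_nonneg by simp
  show b: "0 < b_hardy" "b_hardy \<le> 1"
    using c by (auto simp: b_hardy_def)
  have "b_hardy powr (p - 1) \<le> (?c powr (1 / (p - 1))) powr (p - 1)"
    using p b by (intro powr_mono2) (auto simp: b_hardy_def)
  also have "\<dots> = ?c"
    using p c by (simp add: powr_powr)
  finally have bc: "b_hardy powr (p - 1) \<le> ?c" .
  have "(2 * (b_hardy / p)) powr p \<le> (2 * b_hardy) powr p"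
    using p b by (intro powr_mono2) (auto simp: divide_le_eq)
  also have "\<dots> = 2 powr p * (b_hardy powr (p - 1) * b_hardy)"
    using b powr_mult_base[of b_hardy "p - 1"] by (simp add: powr_mult mult.commute)
  also have "\<dots> \<le> 2 powr p * (?c * b_hardy)"
    using bc b by (intro mult_left_mono mult_right_mono) auto
  finally have "A_hardy / b_hardy * (2 * (b_hardy / p)) powr p \<le> A_hardy / b_hardy * (2 powr p * (?c * b_hardy))"
    using A_hardy_nonneg b by (intro mult_left_mono) auto
  also have "\<dots> = A_hardy / (2 * (A_hardy + 1))"
  proof -
    have "a / b * (t * (1 / (2 * c * t) * b)) = a / (2 * c)" if "0 < b" "0 < c" "0 < t" for a b c t :: real
      using that by (simp add: divide_simps)
    then show ?thesis
      using b A_hardy_nonneg by simp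
  qed
  also have "\<dots> \<le> 1 / 2"
    using A_hardy_nonneg by (simp add: field_simps)
  finally show "A_hardy / b_hardy * (2 * (b_hardy / p)) powr p \<le> 1 / 2" .
qed

lemma C_hardy_nonneg: "0 \<le> C_hardy"
  using A_hardy_nonneg b_hardy by (simp add: C_hardy_def)

text \<open>Since a quotient by zero is 0, the second claim says nothing on the closure of \<Omega>,
  which may exceed \<Omega>; the first claim supplies this. There the bound on \<open>J\<close>,
  uniform in \<open>n\<close>, bounds 2^n times the integral of \<delta>^p for every
  \<open>n\<close>. The second claim follows by exhausting the set where \<open>db\<close> is
  positive.\<close>

lemma hardy:
  fixes \<delta> :: "'a \<Rightarrow> real"
  assumes \<delta>_meas [measurable]: "\<delta> \<in> borel_measurable M" and \<delta>_nonneg: "\<And>x. 0 \<le> \<delta> x"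
    and \<delta>_fin: "(\<integral>\<^sup>+x. ennreal (\<delta> x powr p) \<partial>M) < \<infinity>"
    and \<rho>: "Lp_integrable_borel M p \<rho>" and ug: "weak_upper_gradient M p \<delta> \<rho>"
    and zero: "AE x in M. x \<in> \<Omega> \<longrightarrow> \<delta> x = 0"
  shows "AE x in M. d x = 0 \<longrightarrow> \<delta> x = 0"
    and "(\<integral>\<^sup>+x. ennreal ((\<delta> x / db x) powr p) \<partial>M) \<le>
      ennreal C_hardy * ((\<integral>\<^sup>+x. epow \<rho> x \<partial>M) + (\<integral>\<^sup>+x. ennreal (\<delta> x powr p) \<partial>M))"
proof -
  let ?P = "\<integral>\<^sup>+x. epow \<rho> x \<partial>M" and ?D = "\<integral>\<^sup>+x. ennreal (\<delta> x powr p) \<partial>M"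
  define J where "J n = (\<integral>\<^sup>+x. ennreal ((\<delta> x / (db x + 1 / 2 ^ n)) powr p) \<partial>M)" for n :: nat
  define C where "C = 2 * (A_hardy / b_hardy) + 2 * 2 powr p"
  obtain P where P: "0 \<le> P" "?P = ennreal P"
    using Lp_integrable_borelD(2)[OF \<rho>] by (cases ?P) auto
  obtain D where D: "0 \<le> D" "?D = ennreal D"
    using \<delta>_fin by (cases ?D) auto
  have J_le: "J n \<le> ennreal (C * (P + D))" if n: "1 \<le> n" for n
  proof -
    have *: "J n \<le> ennreal (A_hardy / b_hardy) * (?P + ennreal ((2 * (b_hardy / p)) powr p) * J n) + ennreal (2 powr p) * ?D"
      and "J n < \<infinity>"
      unfolding J_def using weighted_hardy[OF \<delta>_meas \<delta>_nonneg \<delta>_fin \<rho> ug zero b_hardy(1,2) n] by auto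
    then obtain j where j: "0 \<le> j" "J n = ennreal j"
      by (cases "J n") auto
    define a where "a = A_hardy / b_hardy"
    define c where "c = (2 * (b_hardy / p)) powr p"
    have ac: "0 \<le> a" "0 \<le> c" "a * c \<le> 1 / 2"
      using A_hardy_nonneg b_hardy by (auto simp: a_def c_def)
    have "ennreal j \<le> ennreal (a * (P + c * j) + 2 powr p * D)"
      using * ac P(1) D(1) j unfolding a_def[symmetric] c_def[symmetric] P(2) D(2) j(2)
      by (simp flip: ennreal_mult ennreal_plus)
    then have "j \<le> a * (P + c * j) + 2 powr p * D"
      using ac P(1) D(1) j(1) by (subst (asm) ennreal_le_iff) auto
    \<comment> \<open>Absorption: \<open>j\<close> is a finite number, so half of it may be moved to
      the left.\<close>
    moreover have "a * c * j \<le> 1 / 2 * j"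
      using ac j(1) by (intro mult_right_mono) auto
    ultimately have "j \<le> 2 * (a * P) + 2 * (2 powr p * D)"
      by (simp add: algebra_simps)
    also have "\<dots> \<le> C * (P + D)"
      using ac P(1) D(1) unfolding C_def a_def[symmetric] by (simp add: algebra_simps)
    finally show ?thesis
      unfolding j(2) by (rule ennreal_leI)
  qed

  show "AE x in M. d x = 0 \<longrightarrow> \<delta> x = 0"
  proof -
    have Z [measurable]: "{x. d x = 0} \<in> sets M"
      by (intro borel_sets_M borel_closed closed_Collect_eq continuous_intros)
    define i where "i = (\<integral>\<^sup>+x\<in>{x. d x = 0}. ennreal (\<delta> x powr p) \<partial>M)"
    have "ennreal (2 ^ n) * i \<le> ennreal (C * (P + D))" if n: "1 \<le> n" for n
    proof -
      have "ennreal (2 ^ n) * i = (\<integral>\<^sup>+x. ennreal (2 ^ n) * (ennreal (\<delta> x powr p) * indicator {x. d x = 0} x) \<partial>M)"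
        by (simp add: i_def nn_integral_cmult)
      also have "\<dots> \<le> J n"
        unfolding J_def
      proof (rule nn_integral_mono)
        fix x
        show "ennreal (2 ^ n) * (ennreal (\<delta> x powr p) * indicator {x. d x = 0} x) \<le> ennreal ((\<delta> x / (db x + 1 / 2 ^ n)) powr p)"
        proof (cases "d x = 0")
          case True
          have "((2::real) ^ n) powr 1 \<le> (2 ^ n) powr p"
            using p by (intro powr_mono) auto
          then have "2 ^ n * \<delta> x powr p \<le> (2 ^ n) powr p * \<delta> x powr p"
            by (intro mult_right_mono) auto
          also have "\<dots> = (\<delta> x / (db x + 1 / 2 ^ n)) powr p"
            using True by (simp add: db_def powr_mult mult.commute)
          finally show ?thesis
            using True by (simp flip: ennreal_mult add: ennreal_leI)
        qed simp
      qed
      finally show ?thesis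
        using J_le[OF n] by order
    qed
    note bound = this
    have "i \<le> ?D"
      unfolding i_def by (intro nn_integral_mono) (auto split: split_indicator)
    then obtain i' where i': "0 \<le> i'" "i = ennreal i'"
      using D by (cases i) (auto simp: top_unique)
    have "i' = 0"
    proof (rule ccontr)
      assume "i' \<noteq> 0"
      then have pos: "0 < i'"
        using i' by simp
      obtain n where n: "C * (P + D) / i' < 2 ^ n"
        using real_arch_pow[of 2 "C * (P + D) / i'"] by auto
      have "(2::real) ^ n \<le> 2 ^ Suc n"
        by simp
      then have "C * (P + D) / i' < 2 ^ Suc n"
        using n by linarith
      then have "C * (P + D) < 2 ^ Suc n * i'"
        using pos by (simp add: divide_less_eq)
      moreover have "ennreal (2 ^ Suc n * i') \<le> ennreal (C * (P + D))"
        using bound[of "Suc n"] i' by (simp flip: ennreal_mult)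
      then have "2 ^ Suc n * i' \<le> C * (P + D)"
        using A_hardy_nonneg b_hardy P(1) D(1) by (subst (asm) ennreal_le_iff) (auto simp: C_def)
      ultimately show False
        by simp
    qed
    then have "(\<integral>\<^sup>+x\<in>{x. d x = 0}. ennreal (\<delta> x powr p) \<partial>M) = 0"
      using i' unfolding i_def by simp
    then have "AE x in M. ennreal (\<delta> x powr p) * indicator {x. d x = 0} x = 0"
      by (subst (asm) nn_integral_0_iff_AE) auto
    then show ?thesis
      by eventually_elim (auto simp: ennreal_eq_0_iff split: split_indicator_asm)
  qed

  let ?h = "\<lambda>x. ennreal ((\<delta> x / db x) powr p)"
  \<comment> \<open>On \<open>A n\<close> adding \<open>1 / 2 ^ Suc n\<close> at most doubles the
    denominator, whence the factor \<open>2 powr p\<close> in \<open>C_hardy\<close>. The shift to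
    \<open>Suc n\<close> respects the condition \<open>1 \<le> n\<close> of
    \<open>J_le\<close>.\<close>
  define A where "A n = {x. 1 / 2 ^ Suc n \<le> db x}" for n
  have A [measurable]: "A n \<in> sets M" for n
    unfolding A_def db_def by (intro borel_sets_M borel_closed closed_Collect_le continuous_intros)
  have "emeasure (density M ?h) (A n) \<le> ennreal (2 powr p * (C * (P + D)))" for n
  proof -
    have "emeasure (density M ?h) (A n) = (\<integral>\<^sup>+x\<in>A n. ?h x \<partial>M)"
      by (rule emeasure_density) measurable
    also have "\<dots> \<le> (\<integral>\<^sup>+x. ennreal (2 powr p) * ennreal ((\<delta> x / (db x + 1 / 2 ^ Suc n)) powr p) \<partial>M)"
    proof (rule nn_integral_mono)
      fix x
      show "?h x * indicator (A n) x \<le> ennreal (2 powr p) * ennreal ((\<delta> x / (db x + 1 / 2 ^ Suc n)) powr p)"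
      proof (cases "x \<in> A n")
        case True
        define y where "y = 1 / (2::real) ^ Suc n"
        have y: "0 < y" "y \<le> db x"
          using True by (auto simp: y_def A_def)
        have "\<delta> x / db x \<le> 2 * (\<delta> x / (db x + y))"
          using y \<delta>_nonneg[of x] mult_right_mono[of y "db x" "\<delta> x"] by (simp add: divide_simps algebra_simps)
        then have "(\<delta> x / db x) powr p \<le> (2 * (\<delta> x / (db x + y))) powr p"
          using y \<delta>_nonneg[of x] p by (intro powr_mono2) auto
        also have "\<dots> = 2 powr p * (\<delta> x / (db x + y)) powr p"
          by (rule powr_mult)
        finally show ?thesis
          using True unfolding y_def[symmetric] by (simp flip: ennreal_mult add: ennreal_leI)
      qed simp
    qed
    also have "\<dots> = ennreal (2 powr p) * J (Suc n)"
      unfolding J_def by (rule nn_integral_cmult) measurable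
    also have "\<dots> \<le> ennreal (2 powr p) * ennreal (C * (P + D))"
      by (intro mult_left_mono J_le) auto
    also have "\<dots> = ennreal (2 powr p * (C * (P + D)))"
      using A_hardy_nonneg b_hardy P(1) D(1) by (intro ennreal_mult[symmetric]) (auto simp: C_def)
    finally show ?thesis .
  qed
  then have "(SUP n. emeasure (density M ?h) (A n)) \<le> ennreal (2 powr p * (C * (P + D)))"
    by (intro SUP_least)
  moreover have "(SUP n. emeasure (density M ?h) (A n)) = emeasure (density M ?h) (\<Union>n. A n)"
  proof (rule SUP_emeasure_incseq)
    show "incseq A"
    proof (rule incseq_SucI)
      fix n
      have "1 / 2 ^ Suc (Suc n) \<le> (1::real) / 2 ^ Suc n"
        by (intro divide_left_mono power_increasing) auto
      then show "A n \<subseteq> A (Suc n)"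
        unfolding A_def by (auto intro: order_trans)
    qed
  qed auto
  moreover have "emeasure (density M ?h) (\<Union>n. A n) = (\<integral>\<^sup>+x. ?h x \<partial>M)"
  proof -
    have "emeasure (density M ?h) (\<Union>n. A n) = (\<integral>\<^sup>+x\<in>(\<Union>n. A n). ?h x \<partial>M)"
      by (rule emeasure_density) measurable
    also have "\<dots> = (\<integral>\<^sup>+x. ?h x \<partial>M)"
    proof (rule nn_integral_cong)
      fix x
      show "?h x * indicator (\<Union>n. A n) x = ?h x"
      proof (cases "db x = 0")
        case False
        then have "0 < db x"
          using db_bounds(1)[of x] by simp
        then obtain n where "1 / 2 ^ n < db x"
          using reals_power_lt_ex[of "db x" 2] by (auto simp: power_one_over)
        moreover have "1 / 2 ^ Suc n \<le> (1::real) / 2 ^ n"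
          by (intro divide_left_mono power_increasing) auto
        ultimately have "x \<in> A n"
          by (simp add: A_def)
        then have "x \<in> (\<Union>n. A n)"
          by blast
        then show ?thesis
          by simp
      qed (use p in auto)
    qed
    finally show ?thesis .
  qed
  moreover have "ennreal (2 powr p * (C * (P + D))) = ennreal C_hardy * (?P + ?D)"
    using P D A_hardy_nonneg b_hardy by (simp add: C_hardy_def C_def mult.assoc flip: ennreal_mult ennreal_plus)
  ultimately show "(\<integral>\<^sup>+x. ?h x \<partial>M) \<le> ennreal C_hardy * (?P + ?D)"
    by simp
qed

end

section \<open>Bi-Lipschitz embeddings of separable sets into \<open>c\<^sub>0\<close>\<close>

text \<open>
  Aharoni's theorem, with the pieces at scale \<open>2\<^sup>k\<close> that meet the ball of radius \<open>3/2 2\<^sup>k\<close> at the origin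
  cut away, so that only finitely many large scales contribute at each point.
\<close>

definition aharoni_piece :: "(nat \<Rightarrow> 'v::real_normed_vector) \<Rightarrow> int \<Rightarrow> nat \<Rightarrow> 'v set"
  where "aharoni_piece x k j = ball (x j) (2 powr k) - (\<Union>i<j. ball (x i) (2 powr k)) - ball 0 (3 / 2 * 2 powr k)"

text \<open>A 1-Lipschitz bump around the piece, of height and reach 2^k / 2. Empty pieces are
  singled out because \<open>infdist\<close> to the empty set is 0, which would make the coordinate
  a nonzero constant.\<close>

definition aharoni_coord :: "(nat \<Rightarrow> 'v::real_normed_vector) \<Rightarrow> int \<Rightarrow> nat \<Rightarrow> 'v \<Rightarrow> real"
  where "aharoni_coord x k j y = (if aharoni_piece x k j = {} then 0
    else max 0 (2 powr k / 2 - infdist y (aharoni_piece x k j)))"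

lemma aharoni_coord_lipschitz: "\<bar>aharoni_coord x k j y - aharoni_coord x k j z\<bar> \<le> norm (y - z)"
  using infdist_triangle_abs[of y "aharoni_piece x k j" z] unfolding aharoni_coord_def dist_norm[symmetric]
  by (auto simp: max_def abs_le_iff split: if_splits)

lemma aharoni_coord_eq_0:
  assumes "\<And>a. a \<in> aharoni_piece x k j \<Longrightarrow> 2 powr k / 2 \<le> dist y a"
  shows "aharoni_coord x k j y = 0"
proof (cases "aharoni_piece x k j = {}")
  case False
  then have "2 powr k / 2 \<le> infdist y (aharoni_piece x k j)"
    unfolding infdist_notempty[OF False] using False assms by (intro cINF_greatest)
  then show ?thesis
    by (simp add: aharoni_coord_def)
qed (simp add: aharoni_coord_def)

lemma aharoni_coord_bounds: "0 \<le> aharoni_coord x k j y" "aharoni_coord x k j y \<le> 2 powr k / 2"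
  using infdist_nonneg[of y "aharoni_piece x k j"] by (simp_all add: aharoni_coord_def max_def)

text \<open>The pieces at scale 2^k keep the distance 3/2 2^k from the origin and the bumps reach
  only 2^k / 2 beyond them, so scales above the norm of a point do not see it.\<close>

lemma aharoni_coord_small_norm:
  assumes "norm y < 2 powr k"
  shows "aharoni_coord x k j y = 0"
proof (rule aharoni_coord_eq_0)
  fix a assume "a \<in> aharoni_piece x k j"
  then have "3 / 2 * 2 powr k \<le> norm a"
    by (simp add: aharoni_piece_def)
  moreover have "norm a \<le> norm y + dist y a"
    using norm_triangle_ineq2[of a y] by (simp add: dist_norm norm_minus_commute)
  ultimately show "2 powr k / 2 \<le> dist y a"
    using assms by simp
qed

text \<open>Pieces after the i-th lie outside the ball of radius 2^k about \<open>x i\<close>, so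
  their bumps do not reach the ball of half the radius.\<close>

lemma aharoni_coord_late:
  assumes "y \<in> ball (x i) (2 powr k / 2)" "i < j"
  shows "aharoni_coord x k j y = 0"
proof (rule aharoni_coord_eq_0)
  fix a assume "a \<in> aharoni_piece x k j"
  then have "2 powr k \<le> dist (x i) a"
    using assms(2) by (auto simp: aharoni_piece_def not_less)
  then show "2 powr k / 2 \<le> dist y a"
    using assms(1) dist_triangle[of "x i" a y] by simp
qed

definition aharoni_index :: "nat \<Rightarrow> int \<times> nat"
  where "aharoni_index n = (int_decode (fst (prod_decode n)), snd (prod_decode n))"

lemma inj_aharoni_index: "inj aharoni_index"
  by (rule injI) (metis Pair_inject aharoni_index_def int_decode_eq prod_decode_eq prod_eqI)

lemma aharoni_index_surj: "\<exists>n. aharoni_index n = (k, j)"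
  by (intro exI[of _ "prod_encode (int_encode k, j)"]) (simp add: aharoni_index_def)

text \<open>Only finitely many coordinates reach \<open>e\<close>: large scales vanish by
  \<open>aharoni_coord_small_norm\<close>, at small scales the bumps are lower than
  \<open>e\<close>, and at each of the finitely many remaining scales
  \<open>aharoni_coord_late\<close> and density leave finitely many pieces.\<close>

lemma aharoni_tendsto:
  fixes x :: "nat \<Rightarrow> 'v::real_normed_vector"
  assumes y: "y \<in> closure (range x)"
  shows "(\<lambda>n. aharoni_coord x (fst (aharoni_index n)) (snd (aharoni_index n)) y) \<longlonglongrightarrow> 0"
proof (rule LIMSEQ_I)
  fix e :: real assume e: "0 < e"
  let ?g = "\<lambda>(k, j). aharoni_coord x k j y"
  define K where "K = {\<lfloor>log 2 e\<rfloor>..\<lceil>log 2 (norm y + 1)\<rceil>}"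
  have "\<exists>i. y \<in> ball (x i) (2 powr k / 2)" for k :: int
  proof -
    have "0 < 2 powr real_of_int k / 2"
      by simp
    then have "\<exists>z\<in>range x. dist z y < 2 powr k / 2"
      using y unfolding closure_approachable by blast
    then obtain i where "dist (x i) y < 2 powr k / 2"
      by blast
    then show ?thesis
      by (intro exI[of _ i]) simp
  qed
  then obtain i :: "int \<Rightarrow> nat" where i: "\<And>k::int. y \<in> ball (x (i k)) (2 powr k / 2)"
    by metis
  have "{w. e \<le> ?g w} \<subseteq> (SIGMA k:K. {..i k})"
  proof clarify
    fix k j assume w: "e \<le> aharoni_coord x k j y"
    have "2 powr k \<le> norm y"
      using w e aharoni_coord_small_norm[of y k x j] by (cases "norm y < 2 powr k") auto
    then have "2 powr k \<le> norm y + 1"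
      by simp
    then have "k \<le> log 2 (norm y + 1)"
      by (subst le_log_iff) (auto simp: add_nonneg_pos)
    moreover have "e \<le> 2 powr k"
      using w aharoni_coord_bounds(2)[of x k j y] powr_ge_zero[of 2 "real_of_int k"] by linarith
    then have "log 2 e \<le> k"
      using e by (subst log_le_iff) auto
    moreover have "j \<le> i k"
      using w e aharoni_coord_late[of y x "i k" k j] i[of k] by (cases "i k < j") auto
    ultimately show "k \<in> K \<and> j \<in> {..i k}"
      unfolding K_def by (auto simp: floor_le_iff le_ceiling_iff)
  qed
  then have "finite {w. e \<le> ?g w}"
    by (rule finite_subset) (auto simp: K_def)
  then have "finite (aharoni_index -` {w. e \<le> ?g w})"
    using inj_aharoni_index by (rule finite_vimageI)
  then have "\<exists>N. \<forall>n\<in>aharoni_index -` {w. e \<le> ?g w}. n < N"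
    by (simp only: finite_nat_set_iff_bounded)
  then obtain N where N: "\<forall>n\<in>aharoni_index -` {w. e \<le> ?g w}. n < N" ..
  show "\<exists>no. \<forall>n\<ge>no. norm (aharoni_coord x (fst (aharoni_index n)) (snd (aharoni_index n)) y - 0) < e"
  proof (intro exI[of _ N] allI impI)
    fix n assume "N \<le> n"
    then have "n \<notin> aharoni_index -` {w. e \<le> ?g w}"
      using N by (auto dest!: bspec simp: not_less)
    then show "norm (aharoni_coord x (fst (aharoni_index n)) (snd (aharoni_index n)) y - 0) < e"
      using aharoni_coord_bounds(1)[of x "fst (aharoni_index n)" "snd (aharoni_index n)" y]
      by (auto simp: case_prod_unfold)
  qed
qed

definition aharoni :: "(nat \<Rightarrow> 'v::real_normed_vector) \<Rightarrow> 'v \<Rightarrow> c0"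
  where "aharoni x y = (if y \<in> closure (range x)
    then Abs_c0 (\<lambda>n. aharoni_coord x (fst (aharoni_index n)) (snd (aharoni_index n)) y) else 0)"

lemma aharoni_nth:
  "y \<in> closure (range x) \<Longrightarrow> c0_nth (aharoni x y) n = aharoni_coord x (fst (aharoni_index n)) (snd (aharoni_index n)) y"
  by (simp add: aharoni_def Abs_c0_inverse aharoni_tendsto)

lemma aharoni_0: "aharoni x 0 = 0"
proof (cases "0 \<in> closure (range x)")
  case True
  have "c0_nth (aharoni x 0) = c0_nth 0"
    using True by (auto simp: aharoni_nth zero_c0.rep_eq aharoni_coord_small_norm)
  then show ?thesis
    by (simp add: c0_nth_inject)
qed (simp add: aharoni_def)

lemma aharoni_upper:
  assumes "y \<in> closure (range x)" "z \<in> closure (range x)"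
  shows "norm (aharoni x y - aharoni x z) \<le> norm (y - z)"
  by (rule c0_norm_le) (simp add: minus_c0.rep_eq aharoni_nth assms aharoni_coord_lipschitz)

text \<open>Take the dyadic \<open>r\<close> with 3r \<le> D \<le> 6r. As the norms of the two
  points add up to at least D, one of them is at least 3/2 r, so that point lies in a piece at scale
  \<open>r\<close> and has the coordinate r / 2 there. The piece has diameter below 2r, so the other
  point is farther than \<open>r\<close> from it and has coordinate 0. The constant is 12 = 6r / (r
  / 2).\<close>

lemma aharoni_lower:
  fixes y z :: "'v::real_normed_vector"
  assumes "y \<in> closure (range x)" "z \<in> closure (range x)"
  shows "norm (y - z) \<le> 12 * norm (aharoni x y - aharoni x z)"
proof (cases "y = z")
  case False
  define D where "D = dist y z"
  have D: "0 < D"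
    using False by (simp add: D_def)
  define k where "k = \<lfloor>log 2 (D / 3)\<rfloor>"
  define r where "r = 2 powr real_of_int k"
  have r0: "0 < r"
    by (simp add: r_def)
  have r1: "3 * r \<le> D"
  proof -
    have "real_of_int k \<le> log 2 (D / 3)"
      by (simp add: k_def)
    then show ?thesis
      using D by (simp add: r_def le_log_iff)
  qed
  have r2: "D \<le> 6 * r"
  proof -
    have "log 2 (D / 3) \<le> real_of_int k + 1"
      unfolding k_def by linarith
    then have "D / 3 \<le> 2 powr (real_of_int k + 1)"
      using D by (subst (asm) log_le_iff) auto
    then show ?thesis
      by (simp add: r_def powr_add)
  qed
  have main: "r / 2 \<le> norm (aharoni x y - aharoni x z)"
    if y: "y \<in> closure (range x)" and z: "z \<in> closure (range x)" and D: "dist y z = D" and big: "3 / 2 * r \<le> norm y" for y z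
  proof -
    have "\<exists>w\<in>range x. dist w y < r"
      using y r0 by (auto simp: closure_approachable)
    then have ex: "\<exists>j. y \<in> ball (x j) r"
      by auto
    define j where "j = (LEAST j. y \<in> ball (x j) r)"
    have "y \<in> ball (x j) r"
      unfolding j_def by (rule LeastI_ex[OF ex])
    moreover have "y \<notin> ball (x i) r" if "i < j" for i
      using not_less_Least[of i "\<lambda>j. y \<in> ball (x j) r"] that by (simp add: j_def)
    ultimately have y_in: "y \<in> aharoni_piece x k j"
      using big by (auto simp: aharoni_piece_def r_def)
    then have "aharoni_coord x k j y = r / 2"
      using r0 by (auto simp: aharoni_coord_def r_def)
    moreover have "aharoni_coord x k j z = 0"
    proof (rule aharoni_coord_eq_0)
      fix a assume "a \<in> aharoni_piece x k j"
      then have "dist (x j) a < r" "dist (x j) y < r"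
        using y_in by (auto simp: aharoni_piece_def r_def)
      then have "dist y a < 2 * r"
        using dist_triangle[of y a "x j"] by (simp add: dist_commute)
      then have "r < dist z a"
        using r1 D dist_triangle[of y z a] by (simp add: dist_commute)
      then show "2 powr real_of_int k / 2 \<le> dist z a"
        unfolding r_def[symmetric] using r0 by simp
    qed
    moreover obtain n where "aharoni_index n = (k, j)"
      using aharoni_index_surj by blast
    ultimately have "\<bar>c0_nth (aharoni x y - aharoni x z) n\<bar> = r / 2"
      using y z r0 by (simp add: minus_c0.rep_eq aharoni_nth)
    then show ?thesis
      using c0_nth_le_norm[of "aharoni x y - aharoni x z" n] by simp
  qed
  have "3 / 2 * r \<le> norm y \<or> 3 / 2 * r \<le> norm z"
    using r1 norm_triangle_ineq4[of y z] by (auto simp: D_def dist_norm)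
  then have "r / 2 \<le> norm (aharoni x y - aharoni x z)"
    using main[of y z] main[of z y] assms by (auto simp: D_def dist_commute norm_minus_commute)
  then show ?thesis
    using r2 by (simp add: D_def dist_norm)
qed simp

text \<open>By the lower bound the preimages of a convergent sequence form a Cauchy sequence, which
  converges in the complete domain. Closedness is what turns distance zero from the image into
  membership.\<close>

lemma closed_bilipschitz_image:
  fixes F :: "'v::banach \<Rightarrow> 'w::real_normed_vector"
  assumes S: "closed S" and upper: "\<And>y z. y \<in> S \<Longrightarrow> z \<in> S \<Longrightarrow> norm (F y - F z) \<le> norm (y - z)"
    and lower: "\<And>y z. y \<in> S \<Longrightarrow> z \<in> S \<Longrightarrow> norm (y - z) \<le> L * norm (F y - F z)" and L: "0 < L"
  shows "closed (F ` S)"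
  unfolding closed_sequential_limits
proof (intro allI impI, elim conjE)
  fix w l assume w: "\<forall>n. w n \<in> F ` S" and l: "w \<longlonglongrightarrow> l"
  then have "\<forall>n. \<exists>v. v \<in> S \<and> w n = F v"
    by blast
  then obtain y where y: "\<And>n. y n \<in> S" "\<And>n. w n = F (y n)"
    unfolding choice_iff by blast
  have "Cauchy y"
  proof (rule metric_CauchyI)
    fix e :: real assume e: "0 < e"
    have "Cauchy w"
      using l by (rule LIMSEQ_imp_Cauchy)
    then obtain N where N: "\<And>m n. N \<le> m \<Longrightarrow> N \<le> n \<Longrightarrow> dist (w m) (w n) < e / L"
      using metric_CauchyD[of w "e / L"] e L by auto
    have "dist (y m) (y n) < e" if "N \<le> m" "N \<le> n" for m n
    proof -
      have "dist (y m) (y n) \<le> L * dist (w m) (w n)"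
        using lower[of "y m" "y n"] y by (simp add: dist_norm)
      also have "\<dots> < L * (e / L)"
        using N[OF that] L by (intro mult_strict_left_mono) auto
      finally show ?thesis
        using L by simp
    qed
    then show "\<exists>N. \<forall>m\<ge>N. \<forall>n\<ge>N. dist (y m) (y n) < e"
      by blast
  qed
  then obtain y0 where y0: "y \<longlonglongrightarrow> y0"
    using Cauchy_convergent unfolding convergent_def by blast
  have "y0 \<in> S"
    using y0 closed_sequentially[OF S] y(1) by blast
  moreover have "(\<lambda>n. F (y n)) \<longlonglongrightarrow> F y0"
  proof (rule metric_tendsto_imp_tendsto[OF y0])
    show "\<forall>\<^sub>F n in sequentially. dist (F (y n)) (F y0) \<le> dist (y n) y0"
      using upper y(1) \<open>y0 \<in> S\<close> by (simp add: dist_norm)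
  qed
  moreover have "w = (\<lambda>n. F (y n))"
    using y(2) by (rule ext)
  ultimately have "w \<longlonglongrightarrow> F y0"
    by simp
  then have "l = F y0"
    using l by (rule LIMSEQ_unique[rotated])
  moreover note \<open>y0 \<in> S\<close>
  ultimately show "l \<in> F ` S"
    by blast
qed

text \<open>The closure of the rational combinations of \<open>D\<close>. They are coded by lists of
  coefficients and vectors, for which countability is immediate and addition is concatenation. A
  linear space is needed because the Whitney sum combines its elements.\<close>

lemma separable_closed_subspace:
  fixes D :: "'v::real_normed_vector set"
  assumes D: "countable D"
  obtains x :: "nat \<Rightarrow> 'v" where "D \<subseteq> closure (range x)" "subspace (closure (range x))"
proof -
  define c where "c l = sum_list (map (\<lambda>(q, v). real_of_rat q *\<^sub>R v) l)" for l :: "(rat \<times> 'v) list"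
  define Q where "Q = c ` lists (UNIV \<times> D)"
  have "countable Q"
    unfolding Q_def using D by (intro countable_image countable_lists) auto
  moreover have Q0: "0 \<in> Q"
    unfolding Q_def by (intro image_eqI[of _ _ "[]"]) (auto simp: c_def)
  ultimately obtain x :: "nat \<Rightarrow> 'v" where x: "range x = Q"
    by (metis range_from_nat_into empty_iff)
  have add: "y + z \<in> Q" if yz: "y \<in> Q" "z \<in> Q" for y z
  proof -
    obtain l l' where l: "y = c l" "l \<in> lists (UNIV \<times> D)" "z = c l'" "l' \<in> lists (UNIV \<times> D)"
      using yz unfolding Q_def by blast
    have "y + z = c (l @ l')"
      by (simp add: l c_def)
    moreover have "l @ l' \<in> lists (UNIV \<times> D)"
      using l by simp
    ultimately show ?thesis
      unfolding Q_def by blast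
  qed
  have scale: "real_of_rat q *\<^sub>R y \<in> Q" if y: "y \<in> Q" for q y
  proof -
    obtain l where l: "y = c l" "l \<in> lists (UNIV \<times> D)"
      using y unfolding Q_def by blast
    have "real_of_rat q *\<^sub>R c l = c (map (\<lambda>(s, v). (q * s, v)) l)" for l
      by (induction l) (auto simp: c_def scaleR_add_right of_rat_mult)
    moreover have "map (\<lambda>(s, v). (q * s, v)) l \<in> lists (UNIV \<times> D)"
      using l(2) by (auto simp: in_lists_conv_set)
    ultimately show ?thesis
      unfolding Q_def l(1) by blast
  qed
  have "D \<subseteq> Q"
  proof
    fix v assume "v \<in> D"
    then show "v \<in> Q"
      unfolding Q_def by (intro image_eqI[of _ _ "[(1, v)]"]) (auto simp: c_def)
  qed
  then have "D \<subseteq> closure (range x)"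
    using closure_subset x by blast
  moreover have "subspace (closure (range x))"
    unfolding x subspace_def
  proof (intro conjI ballI allI)
    show "0 \<in> closure Q"
      using Q0 closure_subset by blast
    show "y + z \<in> closure Q" if yz: "y \<in> closure Q" "z \<in> closure Q" for y z
    proof -
      obtain f g where fg: "\<And>n. f n \<in> Q" "f \<longlonglongrightarrow> y" "\<And>n. g n \<in> Q" "g \<longlonglongrightarrow> z"
        using yz by (metis closure_sequential)
      then have "(\<lambda>n. f n + g n) \<longlonglongrightarrow> y + z"
        by (intro tendsto_add)
      then show ?thesis
        unfolding closure_sequential using add fg by (intro exI[of _ "\<lambda>n. f n + g n"]) auto
    qed
    show "a *\<^sub>R y \<in> closure Q" if y: "y \<in> closure Q" for a y
    proof -
      obtain f where f: "\<And>n. f n \<in> Q" "f \<longlonglongrightarrow> y"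
        using y by (metis closure_sequential)
      have "\<exists>q. \<bar>real_of_rat q - a\<bar> < 1 / real (Suc n)" for n
      proof -
        obtain q where "a - 1 / real (Suc n) < real_of_rat q" "real_of_rat q < a"
          using of_rat_dense[of "a - 1 / real (Suc n)" a] by auto
        then show ?thesis
          by (intro exI[of _ q]) (simp only: abs_less_iff, argo)
      qed
      then obtain q where q: "\<And>n. \<bar>real_of_rat (q n) - a\<bar> < 1 / real (Suc n)"
        by metis
      have "(\<lambda>n. real_of_rat (q n)) \<longlonglongrightarrow> a"
      proof (rule metric_tendsto_imp_tendsto[OF LIMSEQ_inverse_real_of_nat])
        show "\<forall>\<^sub>F n in sequentially. dist (real_of_rat (q n)) a \<le> dist (inverse (real (Suc n))) 0"
          using q by (intro always_eventually allI) (simp add: dist_real_def inverse_eq_divide less_imp_le)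
      qed
      then have "(\<lambda>n. real_of_rat (q n) *\<^sub>R f n) \<longlonglongrightarrow> a *\<^sub>R y"
        using f(2) by (intro tendsto_scaleR)
      then show ?thesis
        unfolding closure_sequential using scale f by (intro exI[of _ "\<lambda>n. real_of_rat (q n) *\<^sub>R f n"]) auto
    qed
  qed
  ultimately show ?thesis
    by (rule that)
qed

lemma c0_nth_diff: "c0_nth x n - c0_nth y n = c0_nth (x - y) n"
  by (simp add: minus_c0.rep_eq)

lemma continuous_on_c0_nth: "continuous_on UNIV (\<lambda>x. c0_nth x n)"
  unfolding continuous_on_iff
proof (intro ballI allI impI)
  fix x :: c0 and e :: real assume "0 < e"
  then show "\<exists>d>0. \<forall>x'\<in>UNIV. dist x' x < d \<longrightarrow> dist (c0_nth x' n) (c0_nth x n) < e"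
    using c0_nth_le_norm by (intro exI[of _ e]) (auto simp: dist_norm c0_nth_diff intro: le_less_trans)
qed

lemma c0_nth_measurable: "w \<in> borel_measurable N \<Longrightarrow> (\<lambda>x. c0_nth (w x) n) \<in> borel_measurable N"
  by (rule measurable_compose[OF _ borel_measurable_continuous_onI[OF continuous_on_c0_nth]])

section \<open>The Whitney extension\<close>

text \<open>The function to be modified enters only in \<open>whitney_fun\<close>. The constants are
  defined here, outside it, and do not involve \<open>F\<close> and \<open>V0\<close> either: after
  export \<open>whitney.c_ext\<close> takes only the numbers p, cD, CP, lam and c\<Omega>.\<close>

locale whitney = pi_omega \<mu> p cD CP lam \<Omega> c\<Omega>
  for \<mu> :: "'z::metric_space set \<Rightarrow> ennreal" and p cD CP lam \<Omega> c\<Omega> +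
  fixes F :: "'v::banach \<Rightarrow> c0" and V0 :: "'v set"
  assumes V0: "subspace V0" "closed V0" and F0: "F 0 = 0"
    and F_upper: "\<And>y z. y \<in> V0 \<Longrightarrow> z \<in> V0 \<Longrightarrow> norm (F y - F z) \<le> norm (y - z)"
    and F_lower: "\<And>y z. y \<in> V0 \<Longrightarrow> z \<in> V0 \<Longrightarrow> norm (y - z) \<le> 12 * norm (F y - F z)"
begin

definition C :: "c0 set"
  where "C = F ` V0"

definition T :: "c0 \<Rightarrow> 'v"
  where "T y = (if y \<in> C then inv_into V0 F y else 0)"

lemma zero_V0: "0 \<in> V0"
  using V0(1) by (rule subspace_0)

lemma zero_C: "0 \<in> C"
  unfolding C_def using zero_V0 F0 by force

lemma closed_C: "closed C"
  unfolding C_def using V0(2) F_upper F_lower by (rule closed_bilipschitz_image) auto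

lemma F_T: "y \<in> C \<Longrightarrow> F (T y) = y"
  by (simp add: T_def C_def f_inv_into_f)

lemma T_V0: "T y \<in> V0"
  using inv_into_into[of y F V0] zero_V0 by (simp add: T_def C_def)

lemma T_F: "v \<in> V0 \<Longrightarrow> T (F v) = v"
proof -
  assume v: "v \<in> V0"
  have "norm (T (F v) - v) \<le> 12 * norm (F (T (F v)) - F v)"
    by (rule F_lower[OF T_V0 v])
  then show "T (F v) = v"
    using F_T[of "F v"] v by (simp add: C_def)
qed

lemma T_lipschitz: "y \<in> C \<Longrightarrow> z \<in> C \<Longrightarrow> norm (T y - T z) \<le> 12 * norm (y - z)"
  using F_lower[OF T_V0 T_V0, of y z] by (simp add: F_T)

lemma norm_F_le: "v \<in> V0 \<Longrightarrow> norm (F v) \<le> norm v" "v \<in> V0 \<Longrightarrow> norm v \<le> 12 * norm (F v)"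
  using F_upper[of v 0] F_lower[of v 0] zero_V0 F0 by auto

definition U :: "'z set"
  where "U = {x. 0 < d x}"

lemma open_U: "open U"
  unfolding U_def by (intro open_Collect_less continuous_intros)

lemma U_iff: "x \<in> U \<longleftrightarrow> 0 < db x"
  by (auto simp: U_def db_def)

text \<open>Large enough for 7 lam * 2, from \<open>pp_poincare\<close> on a ball of radius 2
  \<tau>, and for lam * 16, from comparing averages in a ball of radius 16 \<tau> in
  \<open>near_a\<close>.\<close>

definition N1 :: real
  where "N1 = 16 * lam"

text \<open>For near points \<tau> y is at most 2 \<tau> x, so 3 \<tau> x + 3 \<tau> y + N1 \<tau> y
  is at most (3 + 6 + 2 N1) \<tau> x; see \<open>near_ball\<close>.\<close>

definition N2 :: real
  where "N2 = 9 + 2 * N1"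

text \<open>Gives \<tau> the Lipschitz constant 1 / (8 N2), as \<open>net_overlap\<close> demands
  for the balls of radius N2 \<tau>.\<close>

definition \<kappa> :: real
  where "\<kappa> = 8 * N2"

definition \<tau> :: "'z \<Rightarrow> real"
  where "\<tau> x = db x / \<kappa>"

lemma N_bounds: "16 \<le> N1" "41 \<le> N2" "328 \<le> \<kappa>" "14 * lam \<le> N1" "N1 \<le> N2"
  using lam by (auto simp: N1_def N2_def \<kappa>_def)

definition X :: "'z set"
  where "X = (SOME X. net \<tau> U X)"

lemma net_X: "net \<tau> U X"
proof -
  have "\<exists>X. net \<tau> U X"
    by (rule net_exists) (use N_bounds in \<open>auto simp: \<tau>_def U_iff\<close>)
  then show ?thesis
    unfolding X_def by (rule someI_ex)
qed

lemma countable_X: "countable X" and X_U: "x \<in> X \<Longrightarrow> x \<in> U"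
  using net_X by (auto simp: net_def)

lemma \<tau>_pos: "x \<in> X \<Longrightarrow> 0 < \<tau> x"
  using X_U[of x] N_bounds by (simp add: \<tau>_def U_iff)

lemma db_eq: "db x = \<kappa> * \<tau> x"
  using N_bounds by (simp add: \<tau>_def)

lemma \<tau>_le_1: "\<tau> x \<le> 1"
  using db_bounds[of x] N_bounds by (simp add: \<tau>_def divide_le_eq)

lemma \<tau>_lipschitz: "\<bar>\<tau> x - \<tau> y\<bar> \<le> dist x y / \<kappa>"
  using db_lipschitz[of x y] N_bounds by (simp add: \<tau>_def diff_divide_distrib[symmetric] divide_right_mono)

lemma cover_X:
  assumes "z \<in> U"
  obtains x where "x \<in> X" "z \<in> ball x (2 * \<tau> x)"
proof -
  obtain x where x: "x \<in> X" "dist z x < max (\<tau> z) (\<tau> x)"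
    using net_X assms by (auto simp: net_def)
  have "\<bar>\<tau> z - \<tau> x\<bar> \<le> dist z x / 328"
    using \<tau>_lipschitz[of z x] N_bounds by (meson divide_left_mono order_trans zero_le_dist zero_less_numeral mult_pos_pos less_le_trans)
  then have "dist z x < 2 * \<tau> x"
    using x \<tau>_pos[OF x(1)] by (auto simp: max_def split: if_splits)
  then show ?thesis
    using that x by (simp add: dist_commute)
qed

definition kN :: nat
  where "kN = overlap N2"

lemma X_overlap: "finite {x \<in> X. z \<in> ball x (N2 * \<tau> x)}" "card {x \<in> X. z \<in> ball x (N2 * \<tau> x)} \<le> kN"
  unfolding kN_def
  by (rule net_overlap[OF net_X]; use N_bounds \<tau>_lipschitz in \<open>simp add: \<kappa>_def\<close>)+

text \<open>The radius 3 \<tau> is that of the supports of the cut-offs \<open>\<psi>\<close>, so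
  near centres are those whose terms may be present together in the Whitney sum.\<close>

definition near :: "'z \<Rightarrow> 'z \<Rightarrow> bool"
  where "near x y \<longleftrightarrow> x \<in> X \<and> y \<in> X \<and> ball x (3 * \<tau> x) \<inter> ball y (3 * \<tau> y) \<noteq> {}"

lemma near_sym: "near x y \<Longrightarrow> near y x"
  by (auto simp: near_def)

lemma near_refl: "x \<in> X \<Longrightarrow> near x x"
  using \<tau>_pos[of x] by (auto simp: near_def intro!: exI[of _ x])

lemma near_X: "near x y \<Longrightarrow> x \<in> X" "near x y \<Longrightarrow> y \<in> X"
  by (auto simp: near_def)

lemma near_dist: "near x y \<Longrightarrow> dist x y < 3 * \<tau> x + 3 * \<tau> y"
proof -
  assume "near x y"
  then obtain w where "dist x w < 3 * \<tau> x" "dist y w < 3 * \<tau> y"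
    by (auto simp: near_def)
  then show ?thesis
    using dist_triangle[of x y w] by (simp add: dist_commute)
qed

lemma near_\<tau>: "near x y \<Longrightarrow> \<tau> y \<le> 2 * \<tau> x"
proof -
  assume xy: "near x y"
  have "\<tau> y - \<tau> x \<le> dist x y / \<kappa>"
    using \<tau>_lipschitz[of y x] by (simp add: dist_commute)
  also have "\<dots> \<le> dist x y / 328"
    using N_bounds by (intro divide_left_mono) auto
  finally show ?thesis
    using near_dist[OF xy] \<tau>_pos[of x] \<tau>_pos[of y] near_X[OF xy] by simp
qed

definition jN :: nat
  where "jN = (LEAST j. 9 + 2 * N2 \<le> 2 ^ j)"

lemma jN: "9 + 2 * N2 \<le> 2 ^ jN"
proof -
  have "\<exists>j. 9 + 2 * N2 \<le> 2 ^ j"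
    using real_arch_pow[of 2 "9 + 2 * N2"] by (auto intro: less_imp_le)
  then show ?thesis
    unfolding jN_def by (rule LeastI_ex)
qed

lemma near_measure:
  assumes "near x y" "r \<le> N2"
  shows "m x (r * \<tau> x) \<le> cD ^ jN * m y (2 * \<tau> y)"
proof (rule m_compare)
  have pos: "0 < \<tau> x" "0 < \<tau> y"
    using near_X[OF assms(1)] \<tau>_pos by auto
  then show "0 < 2 * \<tau> y"
    by simp
  have "r * \<tau> x \<le> N2 * (2 * \<tau> y)"
    using assms(2) pos near_\<tau>[OF near_sym[OF assms(1)]] N_bounds by (intro mult_mono) auto
  then have "dist y x + r * \<tau> x \<le> (9 + 2 * N2) * \<tau> y"
    using near_dist[OF assms(1)] near_\<tau>[OF near_sym[OF assms(1)]] by (simp add: dist_commute algebra_simps)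
  also have "\<dots> \<le> 2 ^ jN * \<tau> y"
    using jN pos by (intro mult_right_mono) auto
  also have "\<dots> \<le> 2 ^ jN * (2 * \<tau> y)"
    using pos by simp
  finally show "dist y x + r * \<tau> x \<le> 2 ^ jN * (2 * \<tau> y)" .
qed

lemma near_ball:
  assumes "near x y" "r \<le> N1"
  shows "ball y (r * \<tau> y) \<subseteq> ball x (N2 * \<tau> x)"
proof
  fix z assume "z \<in> ball y (r * \<tau> y)"
  then have "dist x z < 3 * \<tau> x + 3 * \<tau> y + r * \<tau> y"
    using near_dist[OF assms(1)] dist_triangle[of x z y] by simp
  also have "r * \<tau> y \<le> N1 * (2 * \<tau> x)"
    using assms(2) \<tau>_pos[of y] near_X[OF assms(1)] near_\<tau>[OF assms(1)] N_bounds by (intro mult_mono) auto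
  also have "3 * \<tau> x + 3 * \<tau> y + N1 * (2 * \<tau> x) \<le> N2 * \<tau> x"
    using near_\<tau>[OF assms(1)] by (simp add: N2_def algebra_simps)
  finally show "z \<in> ball x (N2 * \<tau> x)"
    by simp
qed

text \<open>The average is taken coordinate by coordinate, so that scalar inequalities apply to it;
  \<open>cavg_nth\<close> shows that the coordinates form a null sequence, which gives
  \<open>Abs_c0\<close> its meaning.\<close>

definition cavg :: "('z \<Rightarrow> c0) \<Rightarrow> 'z \<Rightarrow> real \<Rightarrow> c0"
  where "cavg w x r = Abs_c0 (\<lambda>n. avg (\<lambda>z. c0_nth (w z) n) x r)"

definition a :: "('z \<Rightarrow> c0) \<Rightarrow> 'z \<Rightarrow> c0"
  where "a w x = cavg w x (2 * \<tau> x)"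

text \<open>A nearest point of \<open>C\<close> need not exist; the factor 2 and the slack leave
  room for an approximate one. The slack carries a factor \<open>\<tau> x\<close>, the same order as
  the bound for the distance to \<open>C\<close>, so it is harmless in
  \<open>near_b\<close>.\<close>

definition v :: "('z \<Rightarrow> c0) \<Rightarrow> 'z \<Rightarrow> 'v"
  where "v w x = (SOME v. v \<in> V0 \<and> norm (a w x - F v) \<le> 2 * infdist (a w x) C + \<tau> x * norm (a w x))"

lemma v_choice:
  assumes "x \<in> X"
  shows "v w x \<in> V0 \<and> norm (a w x - F (v w x)) \<le> 2 * infdist (a w x) C + \<tau> x * norm (a w x)"
  unfolding v_def
proof (rule someI_ex, cases "a w x = 0")
  case True
  then show "\<exists>v. v \<in> V0 \<and> norm (a w x - F v) \<le> 2 * infdist (a w x) C + \<tau> x * norm (a w x)"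
    using zero_V0 F0 by (intro exI[of _ 0]) (auto simp: infdist_nonneg)
next
  case False
  then have "infdist (a w x) C < 2 * infdist (a w x) C + \<tau> x * norm (a w x)"
    using \<tau>_pos[OF assms] infdist_nonneg[of "a w x" C] by (simp add: add_nonneg_pos)
  then have "(INF c\<in>C. dist (a w x) c) < 2 * infdist (a w x) C + \<tau> x * norm (a w x)"
    using zero_C by (subst infdist_notempty[symmetric]) auto
  then obtain c where "c \<in> C" "dist (a w x) c < 2 * infdist (a w x) C + \<tau> x * norm (a w x)"
    using zero_C by (subst (asm) cINF_less_iff) auto
  then show "\<exists>v. v \<in> V0 \<and> norm (a w x - F v) \<le> 2 * infdist (a w x) C + \<tau> x * norm (a w x)"
    unfolding C_def by (auto simp: dist_norm intro!: less_imp_le)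
qed

end

section \<open>Integral estimates on the Whitney balls for a fixed function\<close>

locale whitney_fun = whitney \<mu> p cD CP lam \<Omega> c\<Omega> F V0
  for \<mu> :: "'z::metric_space set \<Rightarrow> ennreal" and p cD CP lam \<Omega> c\<Omega> and F :: "'v::banach \<Rightarrow> c0" and V0 +
  fixes w :: "'z \<Rightarrow> c0" and \<rho> :: "'z \<Rightarrow> ennreal"
  assumes w_meas [measurable]: "w \<in> borel_measurable M"
    and w_fin: "(\<integral>\<^sup>+x. ennreal (norm (w x) powr p) \<partial>M) < \<infinity>"
    and \<rho>: "Lp_integrable_borel M p \<rho>" and w_ug: "weak_upper_gradient M p w \<rho>"
    and w_C: "AE x in M. x \<in> \<Omega> \<longrightarrow> w x \<in> C"
begin

abbreviation P :: ennreal
  where "P \<equiv> \<integral>\<^sup>+x. epow \<rho> x \<partial>M"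

abbreviation W :: ennreal
  where "W \<equiv> \<integral>\<^sup>+x. ennreal (norm (w x) powr p) \<partial>M"

lemma \<rho>_borel [measurable]: "\<rho> \<in> borel_measurable borel"
  using Lp_integrable_borelD(1)[OF \<rho>] by simp

lemma \<rho>_M [measurable]: "\<rho> \<in> borel_measurable M"
  by (rule borel_measurable_M) simp

definition \<delta> :: "'z \<Rightarrow> real"
  where "\<delta> x = infdist (w x) C"

lemma \<delta>_meas [measurable]: "\<delta> \<in> borel_measurable M"
  unfolding \<delta>_def
  by (rule measurable_compose[OF w_meas borel_measurable_continuous_onI]) (intro continuous_intros)

lemma \<delta>_bounds: "0 \<le> \<delta> x" "\<delta> x \<le> norm (w x)"
  using infdist_le[OF zero_C, of "w x"] by (auto simp: \<delta>_def infdist_nonneg)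

lemma ug_compose:
  fixes f :: "c0 \<Rightarrow> 'w::real_normed_vector"
  assumes "\<And>y z. norm (f y - f z) \<le> norm (y - z)"
  shows "weak_upper_gradient M p (\<lambda>x. f (w x)) \<rho>"
  using weak_upper_gradient_compose[OF null_hull_M _ w_ug \<rho>, of UNIV f 1] assms p by simp

lemma \<delta>_ug: "weak_upper_gradient M p \<delta> \<rho>"
  unfolding \<delta>_def[abs_def]
  by (rule ug_compose[of "\<lambda>y. infdist y C"]) (use infdist_triangle_abs in \<open>auto simp flip: dist_norm\<close>)

lemma \<delta>_le_W: "(\<integral>\<^sup>+x. ennreal (\<delta> x powr p) \<partial>M) \<le> W"
  using \<delta>_bounds p by (intro nn_integral_mono ennreal_leI powr_mono2) auto

lemma \<delta>_hardy:
  "AE x in M. d x = 0 \<longrightarrow> \<delta> x = 0"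
  "(\<integral>\<^sup>+x. ennreal ((\<delta> x / db x) powr p) \<partial>M) \<le> ennreal C_hardy * (P + W)"
proof -
  have fin: "(\<integral>\<^sup>+x. ennreal (\<delta> x powr p) \<partial>M) < \<infinity>"
    using \<delta>_le_W w_fin by (rule le_less_trans)
  have zero: "AE x in M. x \<in> \<Omega> \<longrightarrow> \<delta> x = 0"
    using w_C by eventually_elim (auto simp: \<delta>_def)
  note hardy = hardy[OF \<delta>_meas \<delta>_bounds(1) fin \<rho> \<delta>_ug zero]
  show "AE x in M. d x = 0 \<longrightarrow> \<delta> x = 0"
    by (rule hardy(1))
  show "(\<integral>\<^sup>+x. ennreal ((\<delta> x / db x) powr p) \<partial>M) \<le> ennreal C_hardy * (P + W)"
    by (rule order_trans[OF hardy(2)]) (intro mult_left_mono add_left_mono \<delta>_le_W, simp)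
qed

text \<open>All quantities whose local means occur are collected in one integrable function, so that
  a single number \<open>kk x\<close> controls everything on the Whitney ball at
  \<open>x\<close>.\<close>

definition Q :: "'z \<Rightarrow> ennreal"
  where "Q x = epow \<rho> x + (ennreal ((\<delta> x / db x) powr p) + ennreal (norm (w x) powr p))"

lemma Q_meas [measurable]: "Q \<in> borel_measurable M"
  unfolding Q_def[abs_def] by measurable

lemma Q_ge: "epow \<rho> x \<le> Q x" "ennreal ((\<delta> x / db x) powr p) \<le> Q x" "ennreal (norm (w x) powr p) \<le> Q x"
  unfolding Q_def by (auto simp: add_increasing add_increasing2)

lemma Q_int: "(\<integral>\<^sup>+x. Q x \<partial>M) \<le> ennreal (1 + C_hardy) * (P + W)"
proof -
  have "(\<integral>\<^sup>+x. Q x \<partial>M) = P + ((\<integral>\<^sup>+x. ennreal ((\<delta> x / db x) powr p) \<partial>M) + W)"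
    by (simp add: Q_def nn_integral_add)
  also have "\<dots> \<le> P + (ennreal C_hardy * (P + W) + W)"
    by (intro add_left_mono add_right_mono \<delta>_hardy(2))
  also have "\<dots> = ennreal (1 + C_hardy) * (P + W)"
    using C_hardy_nonneg by (simp add: distrib_right distrib_left ac_simps)
  finally show ?thesis .
qed

lemma Q_fin: "(\<integral>\<^sup>+x. Q x \<partial>M) < \<infinity>"
proof -
  have "ennreal (1 + C_hardy) * (P + W) < \<infinity>"
    using w_fin Lp_integrable_borelD(2)[OF \<rho>] by (simp add: ennreal_mult_less_top)
  with Q_int show ?thesis
    by (rule le_less_trans)
qed

lemma norm_w_loc_int: "loc_int (\<lambda>x. norm (w x))"
  by (rule loc_int_of_Lp) (use w_fin in auto)

lemma nth_loc_int: "loc_int (\<lambda>z. c0_nth (w z) n)"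
proof (rule loc_int_of_Lp)
  show "(\<lambda>z. c0_nth (w z) n) \<in> borel_measurable M"
    by (rule c0_nth_measurable) simp
  have "(\<integral>\<^sup>+x. ennreal (\<bar>c0_nth (w x) n\<bar> powr p) \<partial>M) \<le> W"
    using c0_nth_le_norm p by (intro nn_integral_mono ennreal_leI powr_mono2) auto
  then show "(\<integral>\<^sup>+x. ennreal (\<bar>c0_nth (w x) n\<bar> powr p) \<partial>M) < \<infinity>"
    using w_fin by (rule le_less_trans)
qed

lemma nth_ug: "weak_upper_gradient M p (\<lambda>z. c0_nth (w z) n) \<rho>"
  by (rule ug_compose[of "\<lambda>y. c0_nth y n"]) (simp add: c0_nth_diff c0_nth_le_norm)

text \<open>The coordinates of \<open>w\<close> tend to 0 at every point and are dominated by its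
  norm, which is integrable on balls; so their averages form a null sequence.\<close>

lemma cavg_nth: "c0_nth (cavg w x r) n = avg (\<lambda>z. c0_nth (w z) n) x r"
proof -
  have "(\<lambda>n. LINT z|M. indicator (ball x r) z *\<^sub>R c0_nth (w z) n) \<longlonglongrightarrow> (LINT z|M. 0)"
  proof (rule integral_dominated_convergence[where w = "\<lambda>z. indicator (ball x r) z *\<^sub>R norm (w z)"])
    show "integrable M (\<lambda>z. indicator (ball x r) z *\<^sub>R norm (w z))"
      using norm_w_loc_int by (simp add: loc_int_def set_integrable_def)
    show "AE z in M. (\<lambda>n. indicator (ball x r) z *\<^sub>R c0_nth (w z) n) \<longlonglongrightarrow> 0"
      using c0_nth_tendsto by (intro always_eventually allI) (auto split: split_indicator)
    show "AE z in M. norm (indicator (ball x r) z *\<^sub>R c0_nth (w z) n) \<le> indicator (ball x r) z *\<^sub>R norm (w z)" for n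
      using c0_nth_le_norm by (intro always_eventually allI) (auto split: split_indicator)
    show "(\<lambda>z. indicator (ball x r) z *\<^sub>R c0_nth (w z) n) \<in> borel_measurable M" for n
      using c0_nth_measurable[OF w_meas, of n] by measurable
  qed simp
  then have "(\<lambda>n. avg (\<lambda>z. c0_nth (w z) n) x r) \<longlonglongrightarrow> 0 / m x r"
    unfolding avg_def set_lebesgue_integral_def by (intro tendsto_divide_zero[THEN tendsto_eq_rhs]) simp_all
  then show ?thesis
    by (simp add: cavg_def Abs_c0_inverse)
qed

text \<open>The common majorant in \<open>pp_poincare\<close> pays off here: it bounds all
  coordinates of \<open>w - cavg w x r\<close> at once, hence the supremum norm.\<close>

lemma w_minus_cavg:
  assumes r: "0 < r"
  obtains G where "G \<in> borel_measurable M"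
    "AE z in M. z \<in> ball x r \<longrightarrow> ennreal (norm (w z - cavg w x r)) \<le> G z"
    "(\<integral>\<^sup>+z\<in>ball x r. epowr (G z) p \<partial>M) \<le> ennreal (C_pp * r powr p) * (\<integral>\<^sup>+z\<in>ball x (7 * lam * r). Q z \<partial>M)"
proof -
  obtain G where G: "G \<in> borel_measurable M"
    "AE z in M. z \<in> ball x r \<longrightarrow> (\<forall>n. ennreal \<bar>c0_nth (w z) n - avg (\<lambda>z. c0_nth (w z) n) x r\<bar> \<le> G z)"
    "(\<integral>\<^sup>+z\<in>ball x r. epowr (G z) p \<partial>M) \<le> ennreal (C_pp * r powr p) * (\<integral>\<^sup>+z\<in>ball x (7 * lam * r). epow \<rho> z \<partial>M)"
    using pp_poincare[OF r \<rho>, of "\<lambda>n z. c0_nth (w z) n" x] nth_loc_int nth_ug by blast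
  have "AE z in M. z \<in> ball x r \<longrightarrow> ennreal (norm (w z - cavg w x r)) \<le> G z"
    using G(2)
  proof eventually_elim
    case (elim z)
    show ?case
    proof
      assume z: "z \<in> ball x r"
      show "ennreal (norm (w z - cavg w x r)) \<le> G z"
      proof (cases "G z")
        case (real g)
        have "norm (w z - cavg w x r) \<le> g"
        proof (rule c0_norm_le)
          fix n
          show "\<bar>c0_nth (w z - cavg w x r) n\<bar> \<le> g"
            using elim z real by (simp add: minus_c0.rep_eq cavg_nth)
        qed
        then show ?thesis
          using real by (simp add: ennreal_leI)
      qed simp
    qed
  qed
  moreover have "(\<integral>\<^sup>+z\<in>ball x r. epowr (G z) p \<partial>M) \<le> ennreal (C_pp * r powr p) * (\<integral>\<^sup>+z\<in>ball x (7 * lam * r). Q z \<partial>M)"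
    using Q_ge(1) by (intro order_trans[OF G(3)] mult_left_mono nn_integral_mono mult_right_mono) auto
  ultimately show ?thesis
    using that G(1) by blast
qed

text \<open>Used to estimate a number attached to a ball, such as the norm of an average: the
  pointwise bound is raised to the power p and integrated over the ball.\<close>

lemma const_le:
  assumes [measurable]: "f \<in> borel_measurable M" "G \<in> borel_measurable M" and c: "0 \<le> c" "\<And>z. 0 \<le> f z"
    and le: "AE z in M. z \<in> B \<longrightarrow> ennreal c \<le> ennreal (f z) + G z" and [measurable]: "B \<in> sets M"
  shows "ennreal (c powr p) * emeasure M B \<le>
    ennreal (2 powr p) * ((\<integral>\<^sup>+z\<in>B. ennreal (f z powr p) \<partial>M) + (\<integral>\<^sup>+z\<in>B. epowr (G z) p \<partial>M))"
proof -
  have "ennreal (c powr p) * emeasure M B = (\<integral>\<^sup>+z. ennreal (c powr p) * indicator B z \<partial>M)"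
    by (rule nn_integral_cmult_indicator[symmetric]) simp
  also have "\<dots> \<le> (\<integral>\<^sup>+z. ennreal (2 powr p) * (ennreal (f z powr p) * indicator B z + epowr (G z) p * indicator B z) \<partial>M)"
  proof (rule nn_integral_mono_AE)
    show "AE z in M. ennreal (c powr p) * indicator B z \<le>
        ennreal (2 powr p) * (ennreal (f z powr p) * indicator B z + epowr (G z) p * indicator B z)"
      using le
    proof eventually_elim
      case (elim z)
      have "ennreal (c powr p) \<le> ennreal (2 powr p) * (ennreal (f z powr p) + epowr (G z) p)" if "z \<in> B"
      proof -
        have "epowr (ennreal c) p \<le> epowr (ennreal (f z) + G z) p"
          using elim that p by (intro epowr_mono) auto
        also have "\<dots> \<le> ennreal (2 powr p) * (epowr (ennreal (f z)) p + epowr (G z) p)"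
          using p by (intro epowr_add_le) simp
        finally show ?thesis
          using c by (simp add: epowr_ennreal)
      qed
      then show ?case
        by (auto split: split_indicator)
    qed
  qed
  also have "\<dots> = ennreal (2 powr p) * ((\<integral>\<^sup>+z\<in>B. ennreal (f z powr p) \<partial>M) + (\<integral>\<^sup>+z\<in>B. epowr (G z) p \<partial>M))"
    by (simp add: nn_integral_cmult nn_integral_add)
  finally show ?thesis .
qed

end

context whitney
begin

text \<open>The first summand is for \<delta> by way of Hardy's inequality, the second for the norm
  of \<open>w\<close>, the third for the oscillation; so one constant serves both
  \<open>infdist_a_le\<close> and \<open>norm_a_le\<close>.\<close>

definition K0 :: real
  where "K0 = 2 powr p * ((2 * \<kappa>) powr p + 1 + C_pp * 2 powr p)"

definition K1 :: real
  where "K1 = (K0 * cD ^ jN) powr (1 / p)"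

definition K2 :: real
  where "K2 = 2 * (cD ^ jN * (2 * CP * 16)) * (cD ^ jN) powr (1 / p)"

text \<open>In \<open>near_v\<close> the approximation errors at two near centres contribute 6
  \<open>K1\<close> and 3 \<open>K1\<close>, the difference of averages \<open>K2\<close>, and the
  inverse of \<open>F\<close> the factor 12. The bound 48 \<open>K1\<close> in
  \<open>near_v_norm\<close> is covered as well.\<close>

definition K :: real
  where "K = 12 * (9 * K1 + K2)"

lemma K_nonneg: "0 \<le> K0" "0 \<le> K1" "0 \<le> K2" "0 \<le> K"
  using C_pp_nonneg CP cD(1) by (auto simp: K0_def K1_def K2_def K_def)

definition \<psi> :: "'z \<Rightarrow> 'z \<Rightarrow> real"
  where "\<psi> x z = max 0 (min 1 (3 - dist z x / \<tau> x))"

definition Zs :: "'z \<Rightarrow> 'z set"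
  where "Zs z = {x \<in> X. z \<in> ball x (3 * \<tau> x)}"

definition Nb :: "'z \<Rightarrow> 'z set"
  where "Nb x = {y. near x y}"

definition Eu :: "('z \<Rightarrow> c0) \<Rightarrow> 'z \<Rightarrow> 'v"
  where "Eu w z = inverse (\<Sum>x\<in>Zs z. \<psi> x z) *\<^sub>R (\<Sum>x\<in>Zs z. \<psi> x z *\<^sub>R v w x)"

lemma \<psi>_bounds: "0 \<le> \<psi> x z" "\<psi> x z \<le> 1"
  by (auto simp: \<psi>_def)

lemma \<psi>_zero: "x \<in> X \<Longrightarrow> z \<notin> ball x (3 * \<tau> x) \<Longrightarrow> \<psi> x z = 0"
  using \<tau>_pos[of x] by (auto simp: \<psi>_def dist_commute not_less field_simps)

lemma \<psi>_one: "x \<in> X \<Longrightarrow> z \<in> ball x (2 * \<tau> x) \<Longrightarrow> \<psi> x z = 1"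
  using \<tau>_pos[of x] by (auto simp: \<psi>_def dist_commute field_simps)

lemma \<psi>_lipschitz: "x \<in> X \<Longrightarrow> \<bar>\<psi> x y - \<psi> x z\<bar> \<le> dist y z / \<tau> x"
proof -
  assume "x \<in> X"
  then have \<tau>: "0 < \<tau> x"
    by (rule \<tau>_pos)
  have "\<bar>dist y x - dist z x\<bar> \<le> dist y z"
    using dist_triangle[of y x z] dist_triangle[of z x y] by (simp add: dist_commute abs_le_iff)
  then have "\<bar>dist y x - dist z x\<bar> / \<tau> x \<le> dist y z / \<tau> x"
    using \<tau> by (intro divide_right_mono) auto
  moreover have "\<bar>\<psi> x y - \<psi> x z\<bar> \<le> \<bar>dist y x / \<tau> x - dist z x / \<tau> x\<bar>"
    by (auto simp: \<psi>_def)
  ultimately show ?thesis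
    using \<tau> by (simp add: diff_divide_distrib[symmetric])
qed

lemma Nb_finite: "finite (Nb x)" "card (Nb x) \<le> kN"
proof -
  have sub: "Nb x \<subseteq> {y \<in> X. x \<in> ball y (N2 * \<tau> y)}"
  proof
    fix y assume "y \<in> Nb x"
    then have y: "near x y"
      by (simp add: Nb_def)
    have "dist x y < 3 * \<tau> x + 3 * \<tau> y"
      by (rule near_dist[OF y])
    also have "\<dots> \<le> 9 * \<tau> y"
      using near_\<tau>[OF near_sym[OF y]] by simp
    also have "\<dots> \<le> N2 * \<tau> y"
      using N_bounds \<tau>_pos[of y] near_X[OF y] by (intro mult_right_mono) auto
    finally show "y \<in> {y \<in> X. x \<in> ball y (N2 * \<tau> y)}"
      using near_X[OF y] by (simp add: dist_commute)
  qed
  show "finite (Nb x)"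
    using sub X_overlap(1) by (rule finite_subset)
  show "card (Nb x) \<le> kN"
    using card_mono[OF X_overlap(1) sub] X_overlap(2) by (rule order_trans)
qed

lemma Zs_subset: "x \<in> X \<Longrightarrow> z \<in> ball x (3 * \<tau> x) \<Longrightarrow> Zs z \<subseteq> Nb x"
  by (auto simp: Zs_def Nb_def near_def)

text \<open>The index set \<open>Zs z\<close> changes with the point; on a ball it may be replaced
  by the fixed set \<open>Nb x\<close>, since the added terms vanish. Values at two points of the
  ball can then be compared term by term.\<close>

lemma sum_Zs:
  fixes f :: "'z \<Rightarrow> 'v"
  assumes "x \<in> X" "z \<in> ball x (3 * \<tau> x)"
  shows "(\<Sum>y\<in>Zs z. \<psi> y z) = (\<Sum>y\<in>Nb x. \<psi> y z)"
    and "(\<Sum>y\<in>Zs z. \<psi> y z *\<^sub>R f y) = (\<Sum>y\<in>Nb x. \<psi> y z *\<^sub>R f y)"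
proof -
  have "\<psi> y z = 0" if "y \<in> Nb x - Zs z" for y
    using that by (intro \<psi>_zero) (auto simp: Nb_def Zs_def near_X)
  then show "(\<Sum>y\<in>Zs z. \<psi> y z) = (\<Sum>y\<in>Nb x. \<psi> y z)"
    "(\<Sum>y\<in>Zs z. \<psi> y z *\<^sub>R f y) = (\<Sum>y\<in>Nb x. \<psi> y z *\<^sub>R f y)"
    using Zs_subset[OF assms] by (intro sum.mono_neutral_left Nb_finite; auto)+
qed

lemma Eu_V0: "Eu w z \<in> V0"
  unfolding Eu_def by (intro subspace_scale[OF V0(1)] subspace_sum[OF V0(1)]) (auto simp: Zs_def v_choice)

end

context whitney_fun
begin

abbreviation IQ :: "'z \<Rightarrow> real \<Rightarrow> ennreal"
  where "IQ x r \<equiv> \<integral>\<^sup>+z\<in>ball x r. Q z \<partial>M"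

lemma IQ_mono: "ball x r \<subseteq> ball y s \<Longrightarrow> IQ x r \<le> IQ y s"
  by (intro nn_integral_mono) (auto split: split_indicator)

lemma IQ_fin: "IQ x r < \<infinity>"
proof -
  have "IQ x r \<le> (\<integral>\<^sup>+z. Q z \<partial>M)"
    by (intro nn_integral_mono) (auto split: split_indicator)
  then show ?thesis
    using Q_fin by (rule le_less_trans)
qed

text \<open>The local size of the gradient at the centre \<open>x\<close>: all differences on the
  Whitney ball will be bounded by multiples of \<open>\<tau> x * kk x\<close>. It is finite because
  \<open>Q\<close> is integrable.\<close>

definition kk :: "'z \<Rightarrow> real"
  where "kk x = enn2real (mean Q x (N2 * \<tau> x))"

lemma kk_nonneg: "0 \<le> kk x"
  by (simp add: kk_def)

lemma kk_eq:
  assumes "x \<in> X"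
  shows "mean Q x (N2 * \<tau> x) = ennreal (kk x)"
proof -
  have "0 < N2 * \<tau> x"
    using \<tau>_pos[OF assms] N_bounds by simp
  then have "IQ x (N2 * \<tau> x) / emeasure M (ball x (N2 * \<tau> x)) < \<infinity>"
    using m_pos[of "N2 * \<tau> x" x] IQ_fin[of x "N2 * \<tau> x"] by (simp add: emeasure_m ennreal_divide_eq_top_iff less_top[symmetric])
  then show ?thesis
    using epowr_less_top[of _ "1 / p"] by (simp add: kk_def mean_def)
qed

lemma kk_power:
  assumes "x \<in> X"
  shows "ennreal (kk x powr p) * ennreal (m x (N2 * \<tau> x)) = IQ x (N2 * \<tau> x)"
  using mean_power_times[of "N2 * \<tau> x" Q x] \<tau>_pos[OF assms] N_bounds
  by (simp add: kk_eq[OF assms] epowr_ennreal kk_nonneg emeasure_m)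

text \<open>Takes the p-th root of an estimate on the ball at \<open>y\<close> and moves it to a
  near centre \<open>x\<close>: the integral over the smaller ball is part of the one defining
  \<open>kk x\<close>, and doubling compares the measures.\<close>

lemma root_le:
  assumes xy: "near x y" and c: "0 \<le> c" and A: "0 \<le> A"
    and le: "ennreal (c powr p) * emeasure M (ball y (2 * \<tau> y)) \<le> ennreal A * IQ y (N1 * \<tau> y)"
  shows "c \<le> (A * cD ^ jN) powr (1 / p) * kk x"
proof -
  define M1 where "M1 = m x (N2 * \<tau> x)"
  define M2 where "M2 = m y (2 * \<tau> y)"
  define D where "D = cD ^ jN"
  have pos: "0 < M1" "0 < M2" "0 \<le> D"
    using \<tau>_pos near_X[OF xy] N_bounds cD(1) by (auto simp: M1_def M2_def D_def intro!: m_pos)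
  have comp: "M1 \<le> D * M2"
    unfolding M1_def M2_def D_def by (rule near_measure[OF xy]) simp
  have "ennreal (c powr p) * ennreal M2 \<le> ennreal A * IQ x (N2 * \<tau> x)"
    using near_ball[OF xy order_refl] by (intro order_trans[OF le[unfolded emeasure_m, folded M2_def]] mult_left_mono IQ_mono) auto
  also have "\<dots> = ennreal (A * (kk x powr p * M1))"
    unfolding kk_power[OF near_X(1)[OF xy], symmetric] M1_def[symmetric] using A pos by (simp flip: ennreal_mult)
  finally have "ennreal (c powr p * M2) \<le> ennreal (A * (kk x powr p * M1))"
    using pos by (simp flip: ennreal_mult)
  then have "c powr p * M2 \<le> A * (kk x powr p * M1)"
    using A pos by (subst (asm) ennreal_le_iff) auto
  then have "D * (c powr p * M2) \<le> D * (A * (kk x powr p * M1))"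
    using pos by (intro mult_left_mono)
  moreover have "c powr p * M1 \<le> c powr p * (D * M2)"
    using comp by (intro mult_left_mono) auto
  ultimately have "c powr p * M1 \<le> (A * D * kk x powr p) * M1"
    by (simp add: mult_ac)
  then have "c powr p \<le> A * D * kk x powr p"
    using pos by simp
  then have "(c powr p) powr (1 / p) \<le> (A * D * kk x powr p) powr (1 / p)"
    using p by (intro powr_mono2) auto
  then show ?thesis
    using p c A pos kk_nonneg[of x] by (simp add: powr_powr powr_mult D_def)
qed

lemma G_bound:
  assumes x: "x \<in> X"
  obtains G where "G \<in> borel_measurable M"
    "AE z in M. z \<in> ball x (2 * \<tau> x) \<longrightarrow> ennreal (norm (w z - a w x)) \<le> G z"
    "(\<integral>\<^sup>+z\<in>ball x (2 * \<tau> x). epowr (G z) p \<partial>M) \<le> ennreal (C_pp * 2 powr p * \<tau> x powr p) * IQ x (N1 * \<tau> x)"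
proof -
  have \<tau>: "0 < \<tau> x"
    by (rule \<tau>_pos[OF x])
  obtain G where G: "G \<in> borel_measurable M"
    "AE z in M. z \<in> ball x (2 * \<tau> x) \<longrightarrow> ennreal (norm (w z - cavg w x (2 * \<tau> x))) \<le> G z"
    "(\<integral>\<^sup>+z\<in>ball x (2 * \<tau> x). epowr (G z) p \<partial>M) \<le> ennreal (C_pp * (2 * \<tau> x) powr p) * IQ x (7 * lam * (2 * \<tau> x))"
    by (rule w_minus_cavg[of "2 * \<tau> x" x]) (use \<tau> in auto)
  have "IQ x (7 * lam * (2 * \<tau> x)) \<le> IQ x (N1 * \<tau> x)"
    using mult_right_mono[OF N_bounds(4), of "\<tau> x"] \<tau> by (intro IQ_mono subset_ball) (simp add: mult_ac)
  then have "ennreal (C_pp * (2 * \<tau> x) powr p) * IQ x (7 * lam * (2 * \<tau> x)) \<le>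
      ennreal (C_pp * 2 powr p * \<tau> x powr p) * IQ x (N1 * \<tau> x)"
    using \<tau> by (simp add: powr_mult mult.assoc mult_left_mono)
  then show ?thesis
    using that G by (auto simp: a_def intro: order_trans)
qed

lemma db_on_ball:
  assumes "x \<in> X" "z \<in> ball x (2 * \<tau> x)"
  shows "\<tau> x \<le> db z" "db z \<le> 2 * \<kappa> * \<tau> x"
proof -
  have \<tau>: "0 < \<tau> x"
    by (rule \<tau>_pos[OF assms(1)])
  have *: "\<bar>db z - db x\<bar> \<le> 2 * \<tau> x"
    using db_lipschitz[of z x] assms(2) by (simp add: dist_commute)
  have "328 * \<tau> x \<le> \<kappa> * \<tau> x"
    using N_bounds \<tau> by (intro mult_right_mono) auto
  with * \<tau> show "\<tau> x \<le> db z" "db z \<le> 2 * \<kappa> * \<tau> x"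
    unfolding db_eq[of x] by linarith+
qed

text \<open>The distance from the average to \<open>C\<close> is at most \<delta> plus the
  oscillation of \<open>w\<close>. Both gain the factor \<tau>^p, the oscillation from the Poincare
  inequality and \<delta> from Hardy's, because \<open>db\<close> is at most 2 \<kappa> \<tau> on
  the ball.\<close>

lemma infdist_a_le:
  assumes x: "x \<in> X"
  shows "ennreal (infdist (a w x) C powr p) * emeasure M (ball x (2 * \<tau> x)) \<le> ennreal (K0 * \<tau> x powr p) * IQ x (N1 * \<tau> x)"
proof -
  have \<tau>: "0 < \<tau> x"
    by (rule \<tau>_pos[OF x])
  let ?B = "ball x (2 * \<tau> x)"
  obtain G where [measurable]: "G \<in> borel_measurable M"
    and G: "AE z in M. z \<in> ?B \<longrightarrow> ennreal (norm (w z - a w x)) \<le> G z"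
    and G_int: "(\<integral>\<^sup>+z\<in>?B. epowr (G z) p \<partial>M) \<le> ennreal (C_pp * 2 powr p * \<tau> x powr p) * IQ x (N1 * \<tau> x)"
    using G_bound[OF x] by blast
  have sub: "?B \<subseteq> ball x (N1 * \<tau> x)"
    using N_bounds \<tau> by (intro subset_ball mult_right_mono) auto
  have "ennreal (infdist (a w x) C powr p) * emeasure M ?B \<le>
      ennreal (2 powr p) * ((\<integral>\<^sup>+z\<in>?B. ennreal (\<delta> z powr p) \<partial>M) + (\<integral>\<^sup>+z\<in>?B. epowr (G z) p \<partial>M))"
  proof (rule const_le)
    show "AE z in M. z \<in> ?B \<longrightarrow> ennreal (infdist (a w x) C) \<le> ennreal (\<delta> z) + G z"
      using G
    proof eventually_elim
      case (elim z)
      have "ennreal (infdist (a w x) C) \<le> ennreal (\<delta> z) + ennreal (norm (w z - a w x))"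
        using infdist_triangle[of "a w x" C "w z"] \<delta>_bounds[of z]
        by (simp add: \<delta>_def dist_norm norm_minus_commute flip: ennreal_plus)
      with elim show ?case
        by (meson add_left_mono order_trans)
    qed
  qed (auto simp: \<delta>_bounds infdist_nonneg)
  also have "(\<integral>\<^sup>+z\<in>?B. ennreal (\<delta> z powr p) \<partial>M) \<le> ennreal ((2 * \<kappa>) powr p * \<tau> x powr p) * IQ x (N1 * \<tau> x)"
  proof -
    have "(\<integral>\<^sup>+z\<in>?B. ennreal (\<delta> z powr p) \<partial>M) \<le> (\<integral>\<^sup>+z. ennreal ((2 * \<kappa>) powr p * \<tau> x powr p) * (Q z * indicator (ball x (N1 * \<tau> x)) z) \<partial>M)"
    proof (rule nn_integral_mono)
      fix z
      have "ennreal (\<delta> z powr p) \<le> ennreal ((2 * \<kappa>) powr p * \<tau> x powr p) * Q z" if z: "z \<in> ?B"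
      proof -
        note db = db_on_ball[OF x z]
        have "\<delta> z powr p = db z powr p * (\<delta> z / db z) powr p"
          using db \<tau> \<delta>_bounds[of z] by (simp add: powr_divide)
        also have "\<dots> \<le> (2 * \<kappa> * \<tau> x) powr p * (\<delta> z / db z) powr p"
          using db \<tau> p by (intro mult_right_mono powr_mono2) auto
        also have "\<dots> = (2 * \<kappa>) powr p * \<tau> x powr p * (\<delta> z / db z) powr p"
          by (simp only: powr_mult)
        finally have "ennreal (\<delta> z powr p) \<le> ennreal ((2 * \<kappa>) powr p * \<tau> x powr p) * ennreal ((\<delta> z / db z) powr p)"
          by (simp add: ennreal_leI flip: ennreal_mult)
        also have "\<dots> \<le> ennreal ((2 * \<kappa>) powr p * \<tau> x powr p) * Q z"
          by (intro mult_left_mono Q_ge) simp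
        finally show ?thesis .
      qed
      then show "ennreal (\<delta> z powr p) * indicator ?B z \<le> ennreal ((2 * \<kappa>) powr p * \<tau> x powr p) * (Q z * indicator (ball x (N1 * \<tau> x)) z)"
        using sub by (auto split: split_indicator)
    qed
    then show ?thesis
      by (simp add: nn_integral_cmult)
  qed
  also note G_int
  also have "ennreal (2 powr p) * (ennreal ((2 * \<kappa>) powr p * \<tau> x powr p) * IQ x (N1 * \<tau> x) + ennreal (C_pp * 2 powr p * \<tau> x powr p) * IQ x (N1 * \<tau> x)) =
      ennreal (2 powr p * ((2 * \<kappa>) powr p * \<tau> x powr p + C_pp * 2 powr p * \<tau> x powr p)) * IQ x (N1 * \<tau> x)"
  proof -
    have "ennreal b * (ennreal c * J + ennreal e * J) = ennreal (b * (c + e)) * J"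
      if "0 \<le> b" "0 \<le> c" "0 \<le> e" for b c e J
      using that by (simp add: ennreal_mult distrib_right distrib_left mult.assoc)
    then show ?thesis
      using C_pp_nonneg by simp
  qed
  also have "\<dots> \<le> ennreal (K0 * \<tau> x powr p) * IQ x (N1 * \<tau> x)"
    by (intro mult_right_mono ennreal_leI) (auto simp: K0_def algebra_simps)
  finally show ?thesis
    by (simp add: add_mono mult_left_mono)
qed

lemma norm_a_le:
  assumes x: "x \<in> X"
  shows "ennreal (norm (a w x) powr p) * emeasure M (ball x (2 * \<tau> x)) \<le> ennreal K0 * IQ x (N1 * \<tau> x)"
proof -
  have \<tau>: "0 < \<tau> x"
    by (rule \<tau>_pos[OF x])
  let ?B = "ball x (2 * \<tau> x)"
  obtain G where [measurable]: "G \<in> borel_measurable M"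
    and G: "AE z in M. z \<in> ?B \<longrightarrow> ennreal (norm (w z - a w x)) \<le> G z"
    and G_int: "(\<integral>\<^sup>+z\<in>?B. epowr (G z) p \<partial>M) \<le> ennreal (C_pp * 2 powr p * \<tau> x powr p) * IQ x (N1 * \<tau> x)"
    using G_bound[OF x] by blast
  have sub: "?B \<subseteq> ball x (N1 * \<tau> x)"
    using N_bounds \<tau> by (intro subset_ball mult_right_mono) auto
  have "ennreal (norm (a w x) powr p) * emeasure M ?B \<le>
      ennreal (2 powr p) * ((\<integral>\<^sup>+z\<in>?B. ennreal (norm (w z) powr p) \<partial>M) + (\<integral>\<^sup>+z\<in>?B. epowr (G z) p \<partial>M))"
  proof (rule const_le)
    show "AE z in M. z \<in> ?B \<longrightarrow> ennreal (norm (a w x)) \<le> ennreal (norm (w z)) + G z"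
      using G
    proof eventually_elim
      case (elim z)
      have "ennreal (norm (a w x)) \<le> ennreal (norm (w z)) + ennreal (norm (w z - a w x))"
        using norm_triangle_ineq4[of "w z" "w z - a w x"] by (simp flip: ennreal_plus)
      with elim show ?case
        by (meson add_left_mono order_trans)
    qed
  qed auto
  also have "(\<integral>\<^sup>+z\<in>?B. ennreal (norm (w z) powr p) \<partial>M) \<le> ennreal 1 * IQ x (N1 * \<tau> x)"
    using sub Q_ge(3) by (simp, intro nn_integral_mono) (auto split: split_indicator)
  also have "(\<integral>\<^sup>+z\<in>?B. epowr (G z) p \<partial>M) \<le> ennreal (C_pp * 2 powr p) * IQ x (N1 * \<tau> x)"
  proof (rule order_trans[OF G_int], rule mult_right_mono, rule ennreal_leI)
    have "\<tau> x powr p \<le> 1"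
      using \<tau> \<tau>_le_1[of x] p by (simp add: powr_le_one_le powr_le1)
    then show "C_pp * 2 powr p * \<tau> x powr p \<le> C_pp * 2 powr p"
      using C_pp_nonneg by (intro mult_left_le) auto
  qed simp
  also have "ennreal (2 powr p) * (ennreal 1 * IQ x (N1 * \<tau> x) + ennreal (C_pp * 2 powr p) * IQ x (N1 * \<tau> x)) =
      ennreal (2 powr p * (1 + C_pp * 2 powr p)) * IQ x (N1 * \<tau> x)"
    using C_pp_nonneg by (subst distrib_right[symmetric], subst ennreal_mult) (auto simp: mult.assoc)
  also have "\<dots> \<le> ennreal K0 * IQ x (N1 * \<tau> x)"
    by (intro mult_right_mono ennreal_leI) (auto simp: K0_def algebra_simps)
  finally show ?thesis
    by (simp add: add_mono mult_left_mono)
qed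

lemma near_infdist_a: "near x y \<Longrightarrow> infdist (a w y) C \<le> K1 * \<tau> y * kk x"
proof -
  assume xy: "near x y"
  have \<tau>: "0 < \<tau> y"
    using \<tau>_pos near_X[OF xy] by blast
  have "infdist (a w y) C \<le> (K0 * \<tau> y powr p * cD ^ jN) powr (1 / p) * kk x"
    by (rule root_le[OF xy infdist_nonneg _ infdist_a_le[OF near_X(2)[OF xy]]]) (use K_nonneg in auto)
  also have "(K0 * \<tau> y powr p * cD ^ jN) powr (1 / p) = K1 * \<tau> y"
    using \<tau> p by (simp add: K1_def powr_mult powr_powr)
  finally show ?thesis .
qed

lemma near_norm_a: "near x y \<Longrightarrow> norm (a w y) \<le> K1 * kk x"
  unfolding K1_def using K_nonneg by (intro root_le[where y = y] norm_a_le near_X(2)) auto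

lemma near_b: "near x y \<Longrightarrow> norm (a w y - F (v w y)) \<le> 3 * K1 * \<tau> y * kk x"
proof -
  assume xy: "near x y"
  have y: "y \<in> X"
    using near_X[OF xy] by blast
  have "norm (a w y - F (v w y)) \<le> 2 * infdist (a w y) C + \<tau> y * norm (a w y)"
    using v_choice[OF y] by blast
  also have "\<dots> \<le> 2 * (K1 * \<tau> y * kk x) + \<tau> y * (K1 * kk x)"
    using near_infdist_a[OF xy] near_norm_a[OF xy] \<tau>_pos[OF y] by (intro add_mono mult_left_mono) auto
  finally show ?thesis
    by (simp add: algebra_simps)
qed

lemma mean_\<rho>_le:
  assumes x: "x \<in> X"
  shows "mean (epow \<rho>) x (N1 * \<tau> x) \<le> ennreal ((cD ^ jN) powr (1 / p) * kk x)"
proof -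
  have \<tau>: "0 < \<tau> x"
    by (rule \<tau>_pos[OF x])
  define M1 where "M1 = m x (N1 * \<tau> x)"
  define M2 where "M2 = m x (N2 * \<tau> x)"
  define D where "D = cD ^ jN"
  have pos: "0 < M1" "0 < M2" "0 \<le> D"
    using \<tau> N_bounds cD(1) by (auto simp: M1_def M2_def D_def intro!: m_pos)
  have "M2 \<le> D * m x (2 * \<tau> x)"
    unfolding M2_def D_def by (rule near_measure[OF near_refl[OF x]]) simp
  also have "\<dots> \<le> D * M1"
    unfolding M1_def using N_bounds \<tau> pos by (intro mult_left_mono m_mono subset_ball mult_right_mono) auto
  finally have comp: "M2 \<le> D * M1" .
  have "epowr (mean (epow \<rho>) x (N1 * \<tau> x)) p * ennreal M1 = (\<integral>\<^sup>+z\<in>ball x (N1 * \<tau> x). epow \<rho> z \<partial>M)"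
    using mean_power_times[of "N1 * \<tau> x" "epow \<rho>" x] N_bounds \<tau> by (simp add: M1_def emeasure_m)
  also have "\<dots> \<le> IQ x (N1 * \<tau> x)"
    using Q_ge(1) by (intro nn_integral_mono mult_right_mono) auto
  also have "\<dots> \<le> IQ x (N2 * \<tau> x)"
    using N_bounds \<tau> by (intro IQ_mono subset_ball mult_right_mono) auto
  also have "\<dots> = ennreal (kk x powr p * M2)"
    unfolding kk_power[OF x, symmetric] M2_def[symmetric] using pos by (simp add: ennreal_mult)
  also have "\<dots> \<le> ennreal (kk x powr p * (D * M1))"
    using comp by (intro ennreal_leI mult_left_mono) auto
  also have "\<dots> = ennreal (D * kk x powr p) * ennreal M1"
    using pos by (simp add: mult_ac flip: ennreal_mult)
  finally have "ennreal M1 * epowr (mean (epow \<rho>) x (N1 * \<tau> x)) p \<le> ennreal M1 * ennreal (D * kk x powr p)"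
    by (simp add: mult.commute)
  then have "epowr (mean (epow \<rho>) x (N1 * \<tau> x)) p \<le> ennreal (D * kk x powr p)"
    using pos by (subst (asm) ennreal_mult_le_mult_iff) auto
  then have "epowr (epowr (mean (epow \<rho>) x (N1 * \<tau> x)) p) (1 / p) \<le> epowr (ennreal (D * kk x powr p)) (1 / p)"
    using p by (intro epowr_mono) auto
  then show ?thesis
    using p pos kk_nonneg[of x] by (simp add: epowr_inverse epowr_ennreal powr_mult powr_powr D_def)
qed

text \<open>In each coordinate the two averages are compared with the average over the ball of
  radius 16 \<tau> x, which contains both balls since 3 + 6 + 4 \<le> 16. The bound is the same for
  all coordinates.\<close>

lemma near_a: "near x y \<Longrightarrow> norm (a w x - a w y) \<le> K2 * \<tau> x * kk x"
proof (rule c0_norm_le)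
  assume xy: "near x y"
  fix n
  have x: "x \<in> X" and y: "y \<in> X"
    using near_X[OF xy] by auto
  have \<tau>: "0 < \<tau> x" "0 < \<tau> y"
    using \<tau>_pos x y by auto
  let ?u = "\<lambda>z. c0_nth (w z) n"
  let ?D = "cD ^ jN"
  have compare: "\<bar>avg ?u z (2 * \<tau> z) - avg ?u x (16 * \<tau> x)\<bar> \<le> ?D * (2 * CP * (16 * \<tau> x)) * (?D powr (1 / p) * kk x)"
    if z: "near x z" for z
  proof -
    have sub: "ball z (2 * \<tau> z) \<subseteq> ball x (16 * \<tau> x)"
    proof
      fix q assume "q \<in> ball z (2 * \<tau> z)"
      then show "q \<in> ball x (16 * \<tau> x)"
        using near_dist[OF z] near_\<tau>[OF z] dist_triangle[of x q z] \<tau>(1) by simp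
    qed
    have "ennreal \<bar>avg ?u z (2 * \<tau> z) - avg ?u x (16 * \<tau> x)\<bar> \<le>
        ennreal (?D * (2 * CP * (16 * \<tau> x))) * mean (epow \<rho>) x (lam * (16 * \<tau> x))"
      using \<tau> \<tau>_pos[OF near_X(2)[OF z]] cD(1) N_bounds
      by (intro avg_compare sub near_measure[OF z] nth_loc_int \<rho> nth_ug) auto
    also have "lam * (16 * \<tau> x) = N1 * \<tau> x"
      by (simp add: N1_def)
    also have "ennreal (?D * (2 * CP * (16 * \<tau> x))) * mean (epow \<rho>) x (N1 * \<tau> x) \<le>
        ennreal (?D * (2 * CP * (16 * \<tau> x))) * ennreal (?D powr (1 / p) * kk x)"
      by (intro mult_left_mono mean_\<rho>_le x) simp
    also have "\<dots> = ennreal (?D * (2 * CP * (16 * \<tau> x)) * (?D powr (1 / p) * kk x))"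
      using \<tau> CP cD(1) kk_nonneg[of x] by (intro ennreal_mult[symmetric]) auto
    finally show ?thesis
      using \<tau> CP cD(1) kk_nonneg[of x] by (subst (asm) ennreal_le_iff) auto
  qed
  have "\<bar>c0_nth (a w x - a w y) n\<bar> = \<bar>avg ?u x (2 * \<tau> x) - avg ?u y (2 * \<tau> y)\<bar>"
    by (simp add: minus_c0.rep_eq a_def cavg_nth)
  also have "\<dots> \<le> 2 * (?D * (2 * CP * (16 * \<tau> x)) * (?D powr (1 / p) * kk x))"
    using compare[OF near_refl[OF x]] compare[OF xy] by linarith
  also have "\<dots> = K2 * \<tau> x * kk x"
    by (simp add: K2_def)
  finally show "\<bar>c0_nth (a w x - a w y) n\<bar> \<le> K2 * \<tau> x * kk x" .
qed

text \<open>The comparison takes place in c0, by passing through the two averages; the lower bound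
  of \<open>F\<close> carries it over to \<open>V0\<close>.\<close>

lemma near_v: "near x y \<Longrightarrow> norm (v w y - v w x) \<le> K * \<tau> x * kk x"
proof -
  assume xy: "near x y"
  have x: "x \<in> X" and y: "y \<in> X"
    using near_X[OF xy] by auto
  have "norm (v w y - v w x) \<le> 12 * norm (F (v w y) - F (v w x))"
    using v_choice[OF x] v_choice[OF y] by (intro F_lower) auto
  also have "norm (F (v w y) - F (v w x)) \<le> norm (a w y - F (v w y)) + norm (a w x - a w y) + norm (a w x - F (v w x))"
    using norm_triangle_ineq4[of "(a w x - F (v w x)) - (a w x - a w y)" "a w y - F (v w y)"]
      norm_triangle_ineq4[of "a w x - F (v w x)" "a w x - a w y"] by simp
  also have "\<dots> \<le> 3 * K1 * \<tau> y * kk x + K2 * \<tau> x * kk x + 3 * K1 * \<tau> x * kk x"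
    by (intro add_mono near_b near_a xy near_refl x)
  also have "3 * K1 * \<tau> y * kk x \<le> 3 * K1 * (2 * \<tau> x) * kk x"
    using near_\<tau>[OF xy] K_nonneg kk_nonneg by (intro mult_right_mono mult_left_mono) auto
  finally show ?thesis
    by (simp add: K_def algebra_simps)
qed

lemma near_v_norm: "near x y \<Longrightarrow> norm (v w y) \<le> K * kk x"
proof -
  assume xy: "near x y"
  have y: "y \<in> X"
    using near_X[OF xy] by blast
  have vy: "v w y \<in> V0" "norm (a w y - F (v w y)) \<le> 2 * infdist (a w y) C + \<tau> y * norm (a w y)"
    using v_choice[OF y] by auto
  have "infdist (a w y) C \<le> norm (a w y)"
    using infdist_le[OF zero_C, of "a w y"] by simp
  moreover have "\<tau> y * norm (a w y) \<le> 1 * norm (a w y)"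
    using \<tau>_le_1 by (intro mult_right_mono) auto
  moreover have "norm (F (v w y)) \<le> norm (a w y) + norm (a w y - F (v w y))"
    using norm_triangle_ineq4[of "a w y" "a w y - F (v w y)"] by simp
  ultimately have "norm (F (v w y)) \<le> 4 * norm (a w y)"
    using vy(2) by linarith
  moreover have "norm (v w y) \<le> 12 * norm (F (v w y))"
    by (rule norm_F_le(2)[OF vy(1)])
  moreover have "norm (a w y) \<le> K1 * kk x"
    by (rule near_norm_a[OF xy])
  ultimately have "norm (v w y) \<le> 48 * (K1 * kk x)"
    by linarith
  also have "\<dots> \<le> K * kk x"
    using K_nonneg kk_nonneg[of x] by (simp add: K_def mult.assoc[symmetric] mult_right_mono)
  finally show ?thesis .
qed

end

section \<open>The Whitney sum: Lipschitz bounds and upper gradient\<close>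

context whitney
begin

text \<open>In \<open>Eu_lipschitz\<close> numerator and denominator contribute equally, and each of
  at most \<open>kN\<close> cut-offs has slope at most 2 / \<tau> x; the \<tau> x cancels against K
  \<tau> x kk x.\<close>

definition LE :: real
  where "LE = 4 * real kN * K"

definition Kh :: real
  where "Kh = 2 powr p * (C_pp * 2 powr p + (2 * K) powr p)"

text \<open>The last two summands are the bound in \<open>ext_norm\<close>, the rest is the bound in
  \<open>ext_ug\<close>, with \<open>12 powr p\<close> for the Lipschitz constant of
  \<open>T\<close>.\<close>

definition CE :: real
  where "CE = 12 powr p * (2 powr p * (2 powr p * (2 powr p + LE powr p * (real kN * (1 + C_hardy))) +
    3 powr p * (Kh * (real kN * (1 + C_hardy))))) + K powr p * (real kN * (1 + C_hardy)) + 12 powr p"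

lemma LE_nonneg: "0 \<le> LE" "0 \<le> Kh"
  using K_nonneg C_pp_nonneg by (auto simp: LE_def Kh_def)

text \<open>The second case is the closure of \<Omega>; by the first part of Hardy's inequality
  \<open>w\<close> lies in \<open>C\<close> almost everywhere there, so \<open>T\<close> is a true
  inverse at almost all of these points.\<close>

definition ext :: "('z \<Rightarrow> c0) \<Rightarrow> 'z \<Rightarrow> 'v"
  where "ext w z = (if z \<in> U then Eu w z else T (w z))"

lemma T_measurable [measurable]: "T \<in> borel_measurable borel"
proof -
  have "continuous_on C (inv_into V0 F)"
  proof (rule lipschitz_on_continuous_on[of 12], rule lipschitz_onI)
    fix y z assume "y \<in> C" "z \<in> C"
    then show "dist (inv_into V0 F y) (inv_into V0 F z) \<le> 12 * dist y z"
      using T_lipschitz[of y z] by (simp add: T_def dist_norm)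
  qed simp
  then show ?thesis
    unfolding T_def[abs_def] using closed_C by (intro borel_measurable_continuous_on_if) auto
qed

end

context whitney_fun
begin

text \<open>The normalized cut-offs sum to 1, so the Whitney sum is \<open>v w x\<close> plus a
  weighted average of differences, each at most K \<tau> x kk x by \<open>near_v\<close>. The last
  three claims prepare the quotient rule in \<open>Eu_lipschitz\<close>.\<close>

lemma Eu_near:
  assumes x: "x \<in> X" and z: "z \<in> ball x (2 * \<tau> x)"
  shows "norm (Eu w z - v w x) \<le> K * \<tau> x * kk x" and "norm (Eu w z) \<le> K * kk x"
    and "Eu w z = v w x + inverse (\<Sum>y\<in>Nb x. \<psi> y z) *\<^sub>R (\<Sum>y\<in>Nb x. \<psi> y z *\<^sub>R (v w y - v w x))"
    and "1 \<le> (\<Sum>y\<in>Nb x. \<psi> y z)"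
    and "norm (\<Sum>y\<in>Nb x. \<psi> y z *\<^sub>R (v w y - v w x)) \<le> (\<Sum>y\<in>Nb x. \<psi> y z) * (K * \<tau> x * kk x)"
proof -
  have \<tau>: "0 < \<tau> x"
    by (rule \<tau>_pos[OF x])
  have z3: "z \<in> ball x (3 * \<tau> x)"
    using z \<tau> by auto
  define S where "S = (\<Sum>y\<in>Nb x. \<psi> y z)"
  have "\<psi> x z \<le> S"
    unfolding S_def using near_refl[OF x] by (intro member_le_sum Nb_finite) (auto simp: \<psi>_bounds Nb_def)
  then show S1: "1 \<le> (\<Sum>y\<in>Nb x. \<psi> y z)"
    using \<psi>_one[OF x z] by (simp add: S_def)
  then have S: "1 \<le> S"
    by (simp add: S_def)
  have bound: "norm (\<Sum>y\<in>Nb x. \<psi> y z *\<^sub>R f y) \<le> S * B" if "\<And>y. y \<in> Nb x \<Longrightarrow> norm (f y) \<le> B" for f :: "'z \<Rightarrow> 'v" and B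
  proof -
    have "norm (\<Sum>y\<in>Nb x. \<psi> y z *\<^sub>R f y) \<le> (\<Sum>y\<in>Nb x. \<psi> y z * B)"
      using that \<psi>_bounds by (intro sum_norm_le) (auto intro!: mult_left_mono)
    then show ?thesis
      by (simp add: S_def sum_distrib_right)
  qed
  have inv: "inverse S * Y \<le> B" if "Y \<le> S * B" for Y B
    using that S by (simp add: inverse_eq_divide pos_divide_le_eq mult.commute)
  have Eu_eq: "Eu w z = inverse S *\<^sub>R (\<Sum>y\<in>Nb x. \<psi> y z *\<^sub>R v w y)"
    unfolding Eu_def sum_Zs[OF x z3] S_def ..
  have "norm (\<Sum>y\<in>Nb x. \<psi> y z *\<^sub>R v w y) \<le> S * (K * kk x)"
    by (rule bound) (auto simp: Nb_def near_v_norm)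
  from inv[OF this] show "norm (Eu w z) \<le> K * kk x"
    unfolding Eu_eq using S by simp
  have "(\<Sum>y\<in>Nb x. \<psi> y z *\<^sub>R (v w y - v w x)) = (\<Sum>y\<in>Nb x. \<psi> y z *\<^sub>R v w y) - S *\<^sub>R v w x"
    by (simp add: scaleR_diff_right sum_subtractf S_def scaleR_left.sum)
  then have Eu_diff: "Eu w z = v w x + inverse S *\<^sub>R (\<Sum>y\<in>Nb x. \<psi> y z *\<^sub>R (v w y - v w x))"
    unfolding Eu_eq using S by (simp add: scaleR_diff_right)
  then show "Eu w z = v w x + inverse (\<Sum>y\<in>Nb x. \<psi> y z) *\<^sub>R (\<Sum>y\<in>Nb x. \<psi> y z *\<^sub>R (v w y - v w x))"
    by (simp add: S_def)
  have A: "norm (\<Sum>y\<in>Nb x. \<psi> y z *\<^sub>R (v w y - v w x)) \<le> S * (K * \<tau> x * kk x)"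
    by (rule bound) (auto simp: Nb_def near_v)
  then show "norm (\<Sum>y\<in>Nb x. \<psi> y z *\<^sub>R (v w y - v w x)) \<le> (\<Sum>y\<in>Nb x. \<psi> y z) * (K * \<tau> x * kk x)"
    by (simp add: S_def)
  from inv[OF A] show "norm (Eu w z - v w x) \<le> K * \<tau> x * kk x"
    unfolding Eu_diff using S by simp
qed

text \<open>A cut-off has slope of order 1 / \<tau> x and multiplies a difference of order \<tau> x
  kk x, so the scale drops out and \<open>kk x\<close> remains as the Lipschitz constant.\<close>

lemma Eu_lipschitz:
  assumes x: "x \<in> X" and z: "z1 \<in> ball x (2 * \<tau> x)" "z2 \<in> ball x (2 * \<tau> x)"
  shows "norm (Eu w z1 - Eu w z2) \<le> LE * kk x * dist z1 z2"
proof -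
  have \<tau>: "0 < \<tau> x"
    by (rule \<tau>_pos[OF x])
  define S where "S z = (\<Sum>y\<in>Nb x. \<psi> y z)" for z
  define A where "A z = (\<Sum>y\<in>Nb x. \<psi> y z *\<^sub>R (v w y - v w x))" for z
  define B where "B = K * \<tau> x * kk x"
  define t where "t = real kN * (2 * dist z1 z2 / \<tau> x)"
  have B: "0 \<le> B" and t: "0 \<le> t"
    using K_nonneg \<tau> kk_nonneg[of x] by (auto simp: B_def t_def)
  note E1 = Eu_near(3-5)[OF x z(1), folded S_def A_def B_def]
  note E2 = Eu_near(3-5)[OF x z(2), folded S_def A_def B_def]
  have each: "\<bar>\<psi> y z1 - \<psi> y z2\<bar> \<le> 2 * dist z1 z2 / \<tau> x" if "y \<in> Nb x" for y
  proof -
    have xy: "near x y"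
      using that by (simp add: Nb_def)
    have "\<bar>\<psi> y z1 - \<psi> y z2\<bar> \<le> dist z1 z2 / \<tau> y"
      by (rule \<psi>_lipschitz[OF near_X(2)[OF xy]])
    also have "\<dots> \<le> dist z1 z2 / (\<tau> x / 2)"
      using near_\<tau>[OF near_sym[OF xy]] \<tau> by (intro divide_left_mono) (auto intro!: mult_pos_pos \<tau>_pos near_X(2)[OF xy])
    finally show ?thesis
      by (simp add: mult.commute)
  qed
  have sum_bound: "(\<Sum>y\<in>Nb x. \<bar>\<psi> y z1 - \<psi> y z2\<bar>) \<le> t"
  proof -
    have "(\<Sum>y\<in>Nb x. \<bar>\<psi> y z1 - \<psi> y z2\<bar>) \<le> real (card (Nb x)) * (2 * dist z1 z2 / \<tau> x)"
      by (rule sum_bounded_above[OF each])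
    also have "\<dots> \<le> t"
      unfolding t_def using Nb_finite(2)[of x] \<tau> by (intro mult_right_mono) auto
    finally show ?thesis .
  qed
  have S_diff: "\<bar>S z2 - S z1\<bar> \<le> t"
  proof -
    have "\<bar>S z1 - S z2\<bar> \<le> (\<Sum>y\<in>Nb x. \<bar>\<psi> y z1 - \<psi> y z2\<bar>)"
      unfolding S_def sum_subtractf[symmetric] by (rule sum_abs)
    then show ?thesis
      using sum_bound by linarith
  qed
  have A_diff: "norm (A z1 - A z2) \<le> t * B"
  proof -
    have "norm (A z1 - A z2) \<le> (\<Sum>y\<in>Nb x. \<bar>\<psi> y z1 - \<psi> y z2\<bar> * B)"
      unfolding A_def sum_subtractf[symmetric] scaleR_diff_left[symmetric]
    proof (rule sum_norm_le)
      fix y assume "y \<in> Nb x"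
      then have "norm (v w y - v w x) \<le> B"
        unfolding B_def by (intro near_v) (simp add: Nb_def)
      then show "norm ((\<psi> y z1 - \<psi> y z2) *\<^sub>R (v w y - v w x)) \<le> \<bar>\<psi> y z1 - \<psi> y z2\<bar> * B"
        by (simp add: mult_left_mono)
    qed
    also have "\<dots> \<le> t * B"
      unfolding sum_distrib_right[symmetric] using sum_bound B by (rule mult_right_mono)
    finally show ?thesis .
  qed
  \<comment> \<open>The quotient rule, arranged so that the inverse of \<open>S z2\<close> cancels
    the factor \<open>S z2\<close> in the bound for \<open>A z2\<close>.\<close>
  have "Eu w z1 - Eu w z2 = inverse (S z1) *\<^sub>R (A z1 - A z2) + (inverse (S z1) * inverse (S z2) * (S z2 - S z1)) *\<^sub>R A z2"
  proof -
    have eq: "inverse (S z1) * inverse (S z2) * (S z2 - S z1) = inverse (S z1) - inverse (S z2)"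
      using E1(2) E2(2) by (simp add: field_simps)
    show ?thesis
      unfolding E1(1) E2(1) eq by (simp add: scaleR_diff_left scaleR_diff_right)
  qed
  then have "norm (Eu w z1 - Eu w z2) \<le> inverse (S z1) * norm (A z1 - A z2) + inverse (S z1) * inverse (S z2) * \<bar>S z2 - S z1\<bar> * norm (A z2)"
    using norm_triangle_ineq[of "inverse (S z1) *\<^sub>R (A z1 - A z2)" "(inverse (S z1) * inverse (S z2) * (S z2 - S z1)) *\<^sub>R A z2"] E1(2) E2(2)
    by (simp add: abs_mult)
  also have "\<dots> \<le> 1 * (t * B) + 1 * inverse (S z2) * t * (S z2 * B)"
    using E1(2) E2(2) B t A_diff S_diff E2(3) by (intro add_mono mult_mono) (auto simp: inverse_le_1_iff)
  also have "\<dots> = 2 * (t * B)"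
    using E2(2) by simp
  also have "\<dots> = LE * kk x * dist z1 z2"
    using \<tau> by (simp add: t_def B_def LE_def)
  finally show ?thesis .
qed

definition H :: "'z \<Rightarrow> ennreal"
  where "H = disc_avg X (\<lambda>x. N2 * \<tau> x) Q"

lemma H_borel [measurable]: "H \<in> borel_measurable borel"
  unfolding H_def by (rule disc_avg_borel[OF countable_X])

lemma H_M [measurable]: "H \<in> borel_measurable M"
  by (rule borel_measurable_M) simp

lemma kk_le_H: "x \<in> X \<Longrightarrow> z \<in> ball x (2 * \<tau> x) \<Longrightarrow> ennreal (kk x) \<le> H z"
proof -
  assume x: "x \<in> X" and z: "z \<in> ball x (2 * \<tau> x)"
  have "2 * \<tau> x \<le> N2 * \<tau> x"
    using N_bounds \<tau>_pos[OF x] by (intro mult_right_mono) auto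
  then have "z \<in> ball x (N2 * \<tau> x)"
    using z by simp
  then show "ennreal (kk x) \<le> H z"
    unfolding H_def kk_eq[OF x, symmetric] by (rule disc_avg_ge[OF x])
qed

lemma H_int: "(\<integral>\<^sup>+x. epow H x \<partial>M) \<le> ennreal (real kN * (1 + C_hardy)) * (P + W)"
proof -
  have "(\<integral>\<^sup>+x\<in>UNIV. epow H x \<partial>M) \<le> of_nat kN * (\<integral>\<^sup>+x\<in>UNIV. Q x \<partial>M)"
    unfolding H_def
    by (rule disc_avg_integral[OF countable_X _ X_overlap]) (use \<tau>_pos N_bounds sets.top[of M] in auto)
  also have "\<dots> \<le> of_nat kN * (ennreal (1 + C_hardy) * (P + W))"
    using Q_int by (simp add: mult_left_mono)
  finally show ?thesis
    using C_hardy_nonneg by (simp add: ennreal_mult ennreal_of_nat_eq_real_of_nat mult.assoc)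
qed

lemma Eu_local:
  assumes "z \<in> U"
  obtains x r where "x \<in> X" "0 < r" "ball z r \<subseteq> ball x (2 * \<tau> x)"
proof -
  obtain x where x: "x \<in> X" "z \<in> ball x (2 * \<tau> x)"
    using cover_X[OF assms] by blast
  then obtain r where "0 < r" "ball z r \<subseteq> ball x (2 * \<tau> x)"
    by (meson open_ball open_contains_ball)
  then show ?thesis
    using that x(1) by blast
qed

text \<open>Stated for every map that oscillates no more than the Whitney sum, because it is applied
  to the composition with \<open>F\<close>, which is what has to be compared with \<open>w\<close>
  in c0.\<close>

lemma Eu_ug:
  assumes f: "\<And>y z. norm (f y - f z) \<le> norm (Eu w y - Eu w z)"
    and path: "(s, t, \<gamma>) \<in> paths_in U" and fin: "curve_length \<gamma> s t < \<infinity>"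
  shows "ennreal (norm (f (\<gamma> s) - f (\<gamma> t))) \<le> path_integral (s, t, \<gamma>) (\<lambda>x. ennreal LE * H x)"
proof (rule ug_local_Lipschitz[OF _ _ path fin])
  fix z assume "z \<in> U"
  then obtain x r where x: "x \<in> X" and r: "0 < r" "ball z r \<subseteq> ball x (2 * \<tau> x)"
    by (rule Eu_local)
  have "ennreal (norm (f y1 - f y2)) \<le> ennreal LE * H q * ennreal (dist y1 y2)"
    if "y1 \<in> ball z r" "y2 \<in> ball z r" "q \<in> ball z r" for y1 y2 q
  proof -
    have "norm (f y1 - f y2) \<le> LE * kk x * dist y1 y2"
      using f Eu_lipschitz[OF x subsetD[OF r(2) that(1)] subsetD[OF r(2) that(2)]] by (rule order_trans)
    then have "ennreal (norm (f y1 - f y2)) \<le> ennreal (LE * kk x * dist y1 y2)"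
      by (rule ennreal_leI)
    also have "\<dots> = ennreal LE * ennreal (kk x) * ennreal (dist y1 y2)"
      using LE_nonneg kk_nonneg[of x] by (simp add: ennreal_mult)
    also have "\<dots> \<le> ennreal LE * H q * ennreal (dist y1 y2)"
      using kk_le_H[OF x, of q] r(2) that(3) by (intro mult_right_mono mult_left_mono) auto
    finally show ?thesis .
  qed
  then show "\<exists>r>0. \<forall>x\<in>ball z r. \<forall>y\<in>ball z r. \<forall>q\<in>ball z r. ennreal (norm (f x - f y)) \<le> ennreal LE * H q * ennreal (dist x y)"
    using r(1) by blast
qed measurable

lemma Eu_continuous:
  assumes f: "\<And>y z. norm (f y - f z) \<le> norm (Eu w y - Eu w z)"
  shows "continuous_on U f"
  unfolding continuous_on_iff
proof (intro ballI allI impI)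
  fix z and \<epsilon> :: real assume "z \<in> U" and e: "0 < \<epsilon>"
  then obtain x r where x: "x \<in> X" and r: "0 < r" "ball z r \<subseteq> ball x (2 * \<tau> x)"
    by (auto elim: Eu_local)
  define L where "L = LE * kk x + 1"
  have L: "0 < L" "LE * kk x \<le> L"
    using LE_nonneg kk_nonneg[of x] by (auto simp: L_def add_nonneg_pos)
  have "dist (f y) (f z) < \<epsilon>" if "dist y z < min r (\<epsilon> / L)" for y
  proof -
    have "dist (f y) (f z) \<le> LE * kk x * dist y z"
    proof -
      have "y \<in> ball z r" "z \<in> ball z r"
        using that r(1) by (auto simp: dist_commute)
      then have "norm (Eu w y - Eu w z) \<le> LE * kk x * dist y z"
        by (intro Eu_lipschitz x subsetD[OF r(2)])
      then show ?thesis
        using f[of y z] unfolding dist_norm[of "f y"] by (rule order_trans[rotated])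
    qed
    also have "\<dots> \<le> L * dist y z"
      using L by (intro mult_right_mono) auto
    also have "\<dots> < L * (\<epsilon> / L)"
      using L that by (intro mult_strict_left_mono) auto
    finally show ?thesis
      using L by simp
  qed
  then show "\<exists>d>0. \<forall>y\<in>U. dist y z < d \<longrightarrow> dist (f y) (f z) < \<epsilon>"
    using r(1) L e by (intro exI[of _ "min r (\<epsilon> / L)"]) auto
qed

lemma F_Eu: "norm (F (Eu w y) - F (Eu w z)) \<le> norm (Eu w y - Eu w z)"
  by (intro F_upper Eu_V0)

lemma ext_measurable [measurable]: "ext w \<in> borel_measurable M"
proof -
  have "(\<lambda>z. if z \<in> U then Eu w z else 0) \<in> borel_measurable borel"
    using open_U Eu_continuous[of "Eu w"] by (intro borel_measurable_continuous_on_if) auto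
  then have [measurable]: "(\<lambda>z. if z \<in> U then Eu w z else 0) \<in> borel_measurable M"
    by (rule borel_measurable_M)
  have [measurable]: "U \<in> sets M"
    using open_U by (intro borel_sets_M) simp
  have "(\<lambda>z. if z \<in> U then (if z \<in> U then Eu w z else 0) else T (w z)) \<in> borel_measurable M"
    by measurable
  moreover have "(\<lambda>z. if z \<in> U then (if z \<in> U then Eu w z else 0) else T (w z)) = ext w"
    by (auto simp: ext_def)
  ultimately show ?thesis
    by simp
qed

lemma ext_V0: "ext w z \<in> V0"
  by (simp add: ext_def Eu_V0 T_V0)

section \<open>The correction \<open>h\<close> and the passage across the boundary\<close>

definition h :: "'z \<Rightarrow> c0"
  where "h z = (if z \<in> U then w z - F (Eu w z) else 0)"

text \<open>The subtraction is carried out in the real coordinates, where it preserves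
  measurability; the norm is the supremum of countably many of them.\<close>

lemma norm_h_measurable [measurable]: "(\<lambda>z. norm (h z)) \<in> borel_measurable M"
proof -
  have "(\<lambda>z. if z \<in> U then F (Eu w z) else 0) \<in> borel_measurable borel"
    using open_U Eu_continuous[of "\<lambda>z. F (Eu w z)"] F_Eu by (intro borel_measurable_continuous_on_if) auto
  then have 1: "(\<lambda>z. if z \<in> U then F (Eu w z) else 0) \<in> borel_measurable M"
    by (rule borel_measurable_M)
  have [measurable]: "U \<in> sets M"
    using open_U by (intro borel_sets_M) simp
  have nth [measurable]: "(\<lambda>z. c0_nth (h z) n) \<in> borel_measurable M" for n
  proof -
    note [measurable] = c0_nth_measurable[OF w_meas, of n] c0_nth_measurable[OF 1, of n]
    have "(\<lambda>z. if z \<in> U then c0_nth (w z) n - c0_nth (if z \<in> U then F (Eu w z) else 0) n else 0) \<in> borel_measurable M"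
      by measurable
    moreover have "(\<lambda>z. if z \<in> U then c0_nth (w z) n - c0_nth (if z \<in> U then F (Eu w z) else 0) n else 0) = (\<lambda>z. c0_nth (h z) n)"
      by (auto simp: h_def minus_c0.rep_eq zero_c0.rep_eq)
    ultimately show ?thesis
      by simp
  qed
  show ?thesis
    unfolding norm_c0_def by (rule borel_measurable_cSUP) (use c0_bdd_above in auto)
qed

text \<open>\<open>h\<close> is the sum of the oscillation of \<open>w\<close>, the approximation
  error at the centre, and the difference between \<open>F (v w x)\<close> and
  \<open>F (Eu w z)\<close>. Each has p-th power integral of order \<tau>^p times that of
  \<open>Q\<close>, and \<open>db\<close> is at least \<tau> x on the ball.\<close>

lemma h_ball:
  assumes x: "x \<in> X"
  shows "(\<integral>\<^sup>+z\<in>ball x (2 * \<tau> x). ennreal ((norm (h z) / db z) powr p) \<partial>M) \<le> ennreal Kh * IQ x (N2 * \<tau> x)"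
proof -
  have \<tau>: "0 < \<tau> x"
    by (rule \<tau>_pos[OF x])
  let ?B = "ball x (2 * \<tau> x)"
  obtain G where [measurable]: "G \<in> borel_measurable M"
    and G: "AE z in M. z \<in> ?B \<longrightarrow> ennreal (norm (w z - a w x)) \<le> G z"
    and G_int: "(\<integral>\<^sup>+z\<in>?B. epowr (G z) p \<partial>M) \<le> ennreal (C_pp * 2 powr p * \<tau> x powr p) * IQ x (N1 * \<tau> x)"
    using G_bound[OF x] by blast
  define c where "c = 2 * K * \<tau> x * kk x"
  have c: "0 \<le> c"
    using K_nonneg \<tau> kk_nonneg[of x] by (simp add: c_def)
  \<comment> \<open>Replaces the p-th power of 1 / \<open>db\<close> and cancels the common factor
    \<open>\<tau> x powr p\<close> of the three contributions.\<close>
  define q where "q = inverse (\<tau> x powr p)"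
  have q: "0 < q" "q * \<tau> x powr p = 1"
    using \<tau> by (auto simp: q_def)
  have h_le: "ennreal (norm (h z)) \<le> G z + ennreal c" if z: "z \<in> ?B" and Gz: "ennreal (norm (w z - a w x)) \<le> G z" for z
  proof -
    have "0 < db z"
      using db_on_ball(1)[OF x z] \<tau> by simp
    then have "h z = (w z - a w x) + (a w x - F (v w x)) + (F (v w x) - F (Eu w z))"
      by (simp add: h_def U_iff)
    then have "norm (h z) \<le> norm (w z - a w x) + norm (a w x - F (v w x)) + norm (F (v w x) - F (Eu w z))"
      by (metis norm_triangle_ineq add_right_mono order_trans)
    also have "norm (a w x - F (v w x)) \<le> K * \<tau> x * kk x"
    proof -
      have "3 * K1 * \<tau> x * kk x \<le> K * \<tau> x * kk x"
        using K_nonneg \<tau> kk_nonneg[of x] by (intro mult_right_mono) (auto simp: K_def)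
      then show ?thesis
        using near_b[OF near_refl[OF x]] by simp
    qed
    also have "norm (F (v w x) - F (Eu w z)) \<le> K * \<tau> x * kk x"
    proof -
      have "norm (F (v w x) - F (Eu w z)) \<le> norm (v w x - Eu w z)"
        using v_choice[OF x] by (intro F_upper Eu_V0) auto
      then show ?thesis
        using Eu_near(1)[OF x z] by (simp add: norm_minus_commute)
    qed
    finally have "norm (h z) \<le> norm (w z - a w x) + c"
      by (simp add: c_def algebra_simps)
    then have "ennreal (norm (h z)) \<le> ennreal (norm (w z - a w x)) + ennreal c"
      using c by (simp flip: ennreal_plus)
    also have "\<dots> \<le> G z + ennreal c"
      using Gz by (rule add_right_mono)
    finally show ?thesis .
  qed
  have "(\<integral>\<^sup>+z\<in>?B. ennreal ((norm (h z) / db z) powr p) \<partial>M) \<le>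
      (\<integral>\<^sup>+z. ennreal (q * 2 powr p) * (epowr (G z) p * indicator ?B z + ennreal (c powr p) * indicator ?B z) \<partial>M)"
  proof (rule nn_integral_mono_AE)
    show "AE z in M. ennreal ((norm (h z) / db z) powr p) * indicator ?B z \<le>
        ennreal (q * 2 powr p) * (epowr (G z) p * indicator ?B z + ennreal (c powr p) * indicator ?B z)"
      using G
    proof eventually_elim
      case (elim z)
      have "ennreal ((norm (h z) / db z) powr p) \<le> ennreal (q * 2 powr p) * (epowr (G z) p + ennreal (c powr p))" if z: "z \<in> ?B"
      proof -
        have "norm (h z) / db z \<le> norm (h z) / \<tau> x"
          using db_on_ball(1)[OF x z] \<tau> by (intro divide_left_mono) auto
        then have "(norm (h z) / db z) powr p \<le> (norm (h z) / \<tau> x) powr p"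
          using db_on_ball(1)[OF x z] \<tau> p by (intro powr_mono2) auto
        also have "\<dots> = q * norm (h z) powr p"
          using \<tau> by (simp add: q_def powr_divide field_simps)
        finally have "ennreal ((norm (h z) / db z) powr p) \<le> ennreal q * epowr (ennreal (norm (h z))) p"
          using q by (simp add: epowr_ennreal ennreal_leI flip: ennreal_mult)
        also have "epowr (ennreal (norm (h z))) p \<le> epowr (G z + ennreal c) p"
          using h_le[OF z] elim z p by (intro epowr_mono) auto
        also have "\<dots> \<le> ennreal (2 powr p) * (epowr (G z) p + epowr (ennreal c) p)"
          using p by (intro epowr_add_le) simp
        finally show ?thesis
          using q c by (simp add: epowr_ennreal ennreal_mult mult.assoc mult_left_mono)
      qed
      then show ?case
        by (auto split: split_indicator)
    qed
  qed
  also have "\<dots> = ennreal (q * 2 powr p) * ((\<integral>\<^sup>+z\<in>?B. epowr (G z) p \<partial>M) + ennreal (c powr p) * emeasure M ?B)"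
    by (simp add: nn_integral_cmult nn_integral_add nn_integral_cmult_indicator)
  also have "\<dots> \<le> ennreal (q * 2 powr p) * (ennreal (C_pp * 2 powr p * \<tau> x powr p) * IQ x (N2 * \<tau> x) + ennreal ((2 * K) powr p * \<tau> x powr p) * IQ x (N2 * \<tau> x))"
  proof (intro mult_left_mono add_mono)
    have "IQ x (N1 * \<tau> x) \<le> IQ x (N2 * \<tau> x)"
      using N_bounds \<tau> by (intro IQ_mono subset_ball mult_right_mono) auto
    then show "(\<integral>\<^sup>+z\<in>?B. epowr (G z) p \<partial>M) \<le> ennreal (C_pp * 2 powr p * \<tau> x powr p) * IQ x (N2 * \<tau> x)"
      by (intro order_trans[OF G_int] mult_left_mono) auto
    have cp: "c powr p = (2 * K) powr p * \<tau> x powr p * kk x powr p"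
      by (simp only: c_def powr_mult)
    have "emeasure M ?B \<le> ennreal (m x (N2 * \<tau> x))"
      unfolding emeasure_m[symmetric] using N_bounds \<tau> by (intro emeasure_mono subset_ball mult_right_mono) auto
    then have "ennreal (c powr p) * emeasure M ?B \<le> ennreal (c powr p) * ennreal (m x (N2 * \<tau> x))"
      by (rule mult_left_mono) simp
    also have "\<dots> = ennreal ((2 * K) powr p * \<tau> x powr p) * IQ x (N2 * \<tau> x)"
      unfolding cp kk_power[OF x, symmetric] by (simp add: ennreal_mult m_nonneg mult.assoc)
    finally show "ennreal (c powr p) * emeasure M ?B \<le> ennreal ((2 * K) powr p * \<tau> x powr p) * IQ x (N2 * \<tau> x)" .
  qed simp
  also have "\<dots> = ennreal (q * 2 powr p * (C_pp * 2 powr p * \<tau> x powr p + (2 * K) powr p * \<tau> x powr p)) * IQ x (N2 * \<tau> x)"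
  proof -
    have "ennreal b * (ennreal c * J + ennreal e * J) = ennreal (b * (c + e)) * J"
      if "0 \<le> b" "0 \<le> c" "0 \<le> e" for b c e J
      using that by (simp add: ennreal_mult distrib_right distrib_left mult.assoc)
    then show ?thesis
      using C_pp_nonneg q by simp
  qed
  also have "q * 2 powr p * (C_pp * 2 powr p * \<tau> x powr p + (2 * K) powr p * \<tau> x powr p) = Kh"
  proof -
    have "q * 2 powr p * (C_pp * 2 powr p * \<tau> x powr p + (2 * K) powr p * \<tau> x powr p) = (q * \<tau> x powr p) * Kh"
      by (simp add: Kh_def algebra_simps)
    then show ?thesis
      by (simp add: q(2))
  qed
  finally show ?thesis .
qed

lemma h_int: "(\<integral>\<^sup>+z. ennreal ((norm (h z) / db z) powr p) \<partial>M) \<le> ennreal (Kh * (real kN * (1 + C_hardy))) * (P + W)"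
proof -
  let ?f = "\<lambda>z. ennreal ((norm (h z) / db z) powr p)"
  have "(\<integral>\<^sup>+z. ?f z \<partial>M) = (\<integral>\<^sup>+z\<in>U. ?f z \<partial>M)"
    using p by (intro nn_integral_cong) (auto simp: h_def split: split_indicator)
  also have "\<dots> \<le> (\<integral>\<^sup>+x. (\<integral>\<^sup>+z\<in>ball x (2 * \<tau> x). ?f z \<partial>M) \<partial>count_space X)"
  proof (rule cover_sum[OF countable_X])
    show "U \<subseteq> (\<Union>x\<in>X. ball x (2 * \<tau> x))"
      using cover_X by blast
  qed auto
  also have "\<dots> \<le> (\<integral>\<^sup>+x. ennreal Kh * IQ x (N2 * \<tau> x) \<partial>count_space X)"
    by (intro nn_integral_mono) (auto intro: h_ball)
  also have "\<dots> = ennreal Kh * (\<integral>\<^sup>+x. IQ x (N2 * \<tau> x) \<partial>count_space X)"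
    by (rule nn_integral_cmult) simp
  also have "\<dots> \<le> ennreal Kh * (of_nat kN * (\<integral>\<^sup>+x. Q x \<partial>M))"
    by (intro mult_left_mono overlap_sum[OF countable_X _ X_overlap]) auto
  also have "\<dots> \<le> ennreal Kh * (of_nat kN * (ennreal (1 + C_hardy) * (P + W)))"
    using Q_int by (intro mult_left_mono) auto
  also have "\<dots> = ennreal (Kh * (real kN * (1 + C_hardy))) * (P + W)"
    using C_hardy_nonneg LE_nonneg by (simp add: ennreal_mult ennreal_of_nat_eq_real_of_nat mult.assoc)
  finally show ?thesis .
qed

end

context whitney
begin

lemma CE_pos: "0 < CE"
  unfolding CE_def using C_hardy_nonneg LE_nonneg by (intro add_nonneg_pos add_nonneg_nonneg mult_nonneg_nonneg) auto

lemma norm_T_le: "norm (T y) \<le> 12 * norm y"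
proof (cases "y \<in> C")
  case True
  then show ?thesis
    using norm_F_le(2)[OF T_V0, of y] by (simp add: F_T)
qed (simp add: T_def)

end

context whitney_fun
begin

lemma ext_norm: "(\<integral>\<^sup>+z. ennreal (norm (ext w z) powr p) \<partial>M) \<le> ennreal CE * (P + W)"
proof -
  have "(\<integral>\<^sup>+z. ennreal (norm (ext w z) powr p) \<partial>M) \<le>
      (\<integral>\<^sup>+z. ennreal (K powr p) * epow H z + ennreal (12 powr p) * ennreal (norm (w z) powr p) \<partial>M)"
  proof (rule nn_integral_mono)
    fix z
    show "ennreal (norm (ext w z) powr p) \<le> ennreal (K powr p) * epow H z + ennreal (12 powr p) * ennreal (norm (w z) powr p)"
    proof (cases "z \<in> U")
      case True
      then obtain x where x: "x \<in> X" "z \<in> ball x (2 * \<tau> x)"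
        by (rule cover_X)
      have "ennreal (norm (Eu w z)) \<le> ennreal (K * kk x)"
        using Eu_near(2)[OF x] by (rule ennreal_leI)
      also have "\<dots> \<le> ennreal K * H z"
        using kk_le_H[OF x] K_nonneg kk_nonneg[of x] by (simp add: ennreal_mult mult_left_mono)
      finally have "epowr (ennreal (norm (Eu w z))) p \<le> epowr (ennreal K * H z) p"
        using p by (intro epowr_mono) auto
      then have "ennreal (norm (Eu w z) powr p) \<le> ennreal (K powr p) * epow H z"
        using K_nonneg by (simp add: epowr_ennreal epowr_mult)
      then show ?thesis
        using True by (simp add: ext_def add_increasing2)
    next
      case False
      have "norm (T (w z)) powr p \<le> (12 * norm (w z)) powr p"
        using norm_T_le[of "w z"] p by (intro powr_mono2) auto
      also have "\<dots> = 12 powr p * norm (w z) powr p"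
        by (rule powr_mult)
      finally have "ennreal (norm (T (w z)) powr p) \<le> ennreal (12 powr p) * ennreal (norm (w z) powr p)"
        by (simp add: ennreal_leI flip: ennreal_mult)
      then show ?thesis
        using False by (simp add: ext_def add_increasing)
    qed
  qed
  also have "\<dots> = ennreal (K powr p) * (\<integral>\<^sup>+z. epow H z \<partial>M) + ennreal (12 powr p) * W"
    by (simp add: nn_integral_add nn_integral_cmult)
  also have "\<dots> \<le> ennreal (K powr p) * (ennreal (real kN * (1 + C_hardy)) * (P + W)) + ennreal (12 powr p) * (P + W)"
    by (intro add_mono mult_left_mono H_int) auto
  also have "\<dots> = ennreal (K powr p * (real kN * (1 + C_hardy)) + 12 powr p) * (P + W)"
  proof -
    have "ennreal b * (ennreal c * J) + ennreal e * J = ennreal (b * c + e) * J"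
      if "0 \<le> b" "0 \<le> c" "0 \<le> e" for b c e J
      using that by (simp add: ennreal_mult distrib_right mult.assoc)
    then show ?thesis
      using C_hardy_nonneg by simp
  qed
  also have "\<dots> \<le> ennreal CE * (P + W)"
    unfolding CE_def using C_hardy_nonneg LE_nonneg by (intro mult_right_mono ennreal_leI) auto
  finally show ?thesis .
qed

text \<open>The cutoff is removed separately for each path: only its two endpoints matter, and at
  each of them either \<open>h\<close> vanishes or the cut-off is 1 for large \<open>n\<close>. So
  the bound \<open>g0\<close>, common to all cut-offs, is already an upper gradient of
  \<open>h\<close>. Then \<open>w - h\<close> has values in \<open>C\<close> almost everywhere, and
  composing it with \<open>T\<close> gives \<open>ext w\<close>.\<close>

lemma ext_ug: "\<exists>g. Lp_integrable_borel M p g \<and> weak_upper_gradient M p (ext w) g \<and> (\<integral>\<^sup>+x. epow g x \<partial>M) \<le> ennreal CE * (P + W)"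
proof -
  have U_sets [measurable]: "U \<in> sets borel"
    using open_U by simp
  define \<rho>1 where "\<rho>1 x = \<rho> x + ennreal LE * H x" for x
  have [measurable]: "\<rho>1 \<in> borel_measurable borel"
    unfolding \<rho>1_def by measurable
  obtain Fm where [measurable]: "Fm \<in> borel_measurable borel"
    and Fm_ge: "\<And>x. ennreal (norm (h x)) \<le> Fm x" and Fm_eq: "AE x in M. Fm x = ennreal (norm (h x))"
    using majorant_M[of "\<lambda>x. ennreal (norm (h x))"] by auto
  \<comment> \<open>The majorant must vanish off \<open>U\<close>, as \<open>h\<close> does: there 3
    / \<open>db\<close> is 0 by convention while the slope bound of the cut-off is not, and the
    product would not be dominated by \<open>g1\<close>.\<close>
  define F1 where "F1 x = Fm x * indicator U x" for x
  have [measurable]: "F1 \<in> borel_measurable borel"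
    unfolding F1_def by measurable
  have F1_ge: "ennreal (norm (h x)) \<le> F1 x" for x
    using Fm_ge[of x] by (auto simp: F1_def h_def split: split_indicator)
  define g1 where "g1 x = F1 x * ennreal (3 / db x)" for x
  have [measurable]: "g1 \<in> borel_measurable borel"
    unfolding g1_def by measurable
  define g0 where "g0 x = \<rho>1 x + g1 x" for x
  have g0_borel [measurable]: "g0 \<in> borel_measurable borel"
    unfolding g0_def by measurable
  define G where "G x = \<rho> x + g0 x" for x
  have G_borel [measurable]: "G \<in> borel_measurable borel"
    unfolding G_def by measurable

  define B where "B = real kN * (1 + C_hardy)"
  have B: "0 \<le> B"
    using C_hardy_nonneg by (simp add: B_def)
  have g1_int: "(\<integral>\<^sup>+x. epow g1 x \<partial>M) \<le> ennreal (3 powr p * (Kh * B)) * (P + W)"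
  proof -
    have "(\<integral>\<^sup>+x. epow g1 x \<partial>M) = (\<integral>\<^sup>+x. ennreal (3 powr p) * ennreal ((norm (h x) / db x) powr p) \<partial>M)"
    proof (rule nn_integral_cong_AE)
      show "AE x in M. epow g1 x = ennreal (3 powr p) * ennreal ((norm (h x) / db x) powr p)"
        using Fm_eq
      proof eventually_elim
        case (elim x)
        then have "F1 x = ennreal (norm (h x))"
          by (auto simp: F1_def h_def split: split_indicator)
        then have "g1 x = ennreal (3 * (norm (h x) / db x))"
          using db_bounds(1)[of x] by (simp add: g1_def flip: ennreal_mult)
        then have "epow g1 x = ennreal ((3 * (norm (h x) / db x)) powr p)"
          using db_bounds(1)[of x] by (simp only: epowr_ennreal[of "3 * (norm (h x) / db x)"]) (simp add: epowr_ennreal)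
        then show ?case
          by (simp only: powr_mult) (simp add: ennreal_mult)
      qed
    qed
    also have "\<dots> = ennreal (3 powr p) * (\<integral>\<^sup>+x. ennreal ((norm (h x) / db x) powr p) \<partial>M)"
      by (rule nn_integral_cmult) measurable
    also have "\<dots> \<le> ennreal (3 powr p) * (ennreal (Kh * B) * (P + W))"
      unfolding B_def by (intro mult_left_mono h_int) simp
    finally show ?thesis
      using B LE_nonneg by (simp add: ennreal_mult mult.assoc)
  qed
  have borel_M: "f \<in> borel_measurable M" if "f \<in> borel_measurable borel" for f :: "'z \<Rightarrow> ennreal"
    using that by (rule borel_measurable_M)
  have [measurable]: "\<rho>1 \<in> borel_measurable M" "g1 \<in> borel_measurable M" "G \<in> borel_measurable M"
    by (intro borel_M; measurable)+
  have G_int: "(\<integral>\<^sup>+x. epow G x \<partial>M) \<le> ennreal (2 powr p * (2 powr p * (2 powr p + LE powr p * B) + 3 powr p * (Kh * B))) * (P + W)"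
  proof -
    have G_eq: "G x = (2 * \<rho> x + ennreal LE * H x) + g1 x" for x
    proof -
      have "2 * \<rho> x = \<rho> x + \<rho> x"
        by (rule mult_2)
      then show ?thesis
        by (simp only: G_def g0_def \<rho>1_def add.assoc)
    qed
    have "(\<integral>\<^sup>+x. epow G x \<partial>M) \<le> ennreal (2 powr p) * ((\<integral>\<^sup>+x. epowr (2 * \<rho> x + ennreal LE * H x) p \<partial>M) + (\<integral>\<^sup>+x. epow g1 x \<partial>M))"
      unfolding G_eq using p by (intro nn_integral_epowr_add_le) measurable
    also have "(\<integral>\<^sup>+x. epowr (2 * \<rho> x + ennreal LE * H x) p \<partial>M) \<le>
        ennreal (2 powr p) * ((\<integral>\<^sup>+x. epowr (2 * \<rho> x) p \<partial>M) + (\<integral>\<^sup>+x. epowr (ennreal LE * H x) p \<partial>M))"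
      using p by (intro nn_integral_epowr_add_le) measurable
    also have "(\<integral>\<^sup>+x. epowr (2 * \<rho> x) p \<partial>M) = ennreal (2 powr p) * P"
      using epowr_ennreal[of 2 p] by (simp add: epowr_mult nn_integral_cmult)
    also have "(\<integral>\<^sup>+x. epowr (ennreal LE * H x) p \<partial>M) = ennreal (LE powr p) * (\<integral>\<^sup>+x. epow H x \<partial>M)"
      using LE_nonneg by (simp add: epowr_mult epowr_ennreal nn_integral_cmult)
    also have "\<dots> \<le> ennreal (LE powr p) * (ennreal B * (P + W))"
      unfolding B_def by (intro mult_left_mono H_int) simp
    also have "ennreal (2 powr p) * P \<le> ennreal (2 powr p) * (P + W)"
      by (intro mult_left_mono) auto
    also note g1_int
    also have "ennreal (2 powr p) * (ennreal (2 powr p) * (ennreal (2 powr p) * (P + W) + ennreal (LE powr p) * (ennreal B * (P + W))) + ennreal (3 powr p * (Kh * B)) * (P + W)) =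
        ennreal (2 powr p * (2 powr p * (2 powr p + LE powr p * B) + 3 powr p * (Kh * B))) * (P + W)"
    proof -
      have "ennreal b * (ennreal b * (ennreal b * J + ennreal c * (ennreal e * J)) + ennreal f * J) = ennreal (b * (b * (b + c * e) + f)) * J"
        if "0 \<le> b" "0 \<le> c" "0 \<le> e" "0 \<le> f" for b c e f J
        using that by (simp add: ennreal_mult distrib_right distrib_left mult.assoc)
      then show ?thesis
        using B LE_nonneg by simp
    qed
    finally show ?thesis
      by (simp add: add_mono mult_left_mono)
  qed
  have PW: "P + W < \<infinity>"
    using w_fin Lp_integrable_borelD(2)[OF \<rho>] by simp
  have G_Lp: "Lp_integrable_borel M p G"
    unfolding Lp_integrable_borel_def using le_less_trans[OF G_int] PW by (auto simp: ennreal_mult_less_top)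
  have \<rho>1_Lp: "Lp_integrable_borel M p \<rho>1"
  proof -
    have "(\<integral>\<^sup>+x. epow \<rho>1 x \<partial>M) \<le> (\<integral>\<^sup>+x. epow G x \<partial>M)"
      using p by (intro nn_integral_mono epowr_mono) (auto simp: G_def g0_def add_increasing2 add_increasing)
    then show ?thesis
      using G_Lp by (auto simp: Lp_integrable_borel_def intro: le_less_trans)
  qed

  obtain \<sigma>0 where \<sigma>0: "Lp_integrable_borel M p \<sigma>0" "ug_outside \<sigma>0 UNIV w \<rho>"
    using w_ug by (auto simp: weak_upper_gradient_iff)
  define \<sigma> where "\<sigma> x = max (\<sigma>0 x) (\<rho>1 x)" for x
  have \<sigma>: "Lp_integrable_borel M p \<sigma>"
    unfolding \<sigma>_def using p by (intro Lp_integrable_borel_max null_hull_M \<sigma>0 \<rho>1_Lp) simp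
  have \<sigma>_borel: "\<sigma> \<in> borel_measurable borel"
    using Lp_integrable_borelD(1)[OF \<sigma>] by simp
  have w_path: "ennreal (norm (w (\<gamma> s) - w (\<gamma> t))) \<le> path_integral (s, t, \<gamma>) \<rho>"
    if path: "(s, t, \<gamma>) \<in> paths_in UNIV" and fin: "path_integral (s, t, \<gamma>) \<sigma> < \<infinity>" for s t \<gamma>
  proof -
    have "path_integral (s, t, \<gamma>) \<sigma>0 < \<infinity>"
      by (rule path_integral_finite_mono[OF path _ fin]) (simp add: \<sigma>_def)
    then show ?thesis
      using \<sigma>0(2) path by (rule ug_outsideD[rotated 2])
  qed
  have h_ug_U: "ug_outside \<sigma> U h \<rho>1"
    unfolding ug_outside_def
  proof (intro allI impI)
    fix s t \<gamma> assume path: "(s, t, \<gamma>) \<in> paths_in U" and fin: "path_integral (s, t, \<gamma>) \<sigma> < \<infinity>"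
    have path': "(s, t, \<gamma>) \<in> paths_in UNIV"
      using path by (auto simp: paths_in_def)
    have len: "curve_length \<gamma> s t < \<infinity>"
      using fin by (auto simp: path_integral_def split: if_splits)
    have "\<gamma> s \<in> U" "\<gamma> t \<in> U"
      using path by (auto simp: paths_in_def)
    then have "h (\<gamma> s) - h (\<gamma> t) = (w (\<gamma> s) - w (\<gamma> t)) - (F (Eu w (\<gamma> s)) - F (Eu w (\<gamma> t)))"
      by (simp add: h_def)
    then have "norm (h (\<gamma> s) - h (\<gamma> t)) \<le> norm (w (\<gamma> s) - w (\<gamma> t)) + norm (F (Eu w (\<gamma> s)) - F (Eu w (\<gamma> t)))"
      by (simp only: norm_triangle_ineq4)
    then have "ennreal (norm (h (\<gamma> s) - h (\<gamma> t))) \<le> ennreal (norm (w (\<gamma> s) - w (\<gamma> t))) + ennreal (norm (F (Eu w (\<gamma> s)) - F (Eu w (\<gamma> t))))"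
      by (simp flip: ennreal_plus)
    also have "\<dots> \<le> path_integral (s, t, \<gamma>) \<rho> + path_integral (s, t, \<gamma>) (\<lambda>x. ennreal LE * H x)"
      using Eu_ug[of "\<lambda>z. F (Eu w z)", OF F_Eu path len] by (intro add_mono w_path path' fin)
    also have "\<dots> = path_integral (s, t, \<gamma>) \<rho>1"
      unfolding \<rho>1_def by (rule path_integral_add[OF path', symmetric]) simp_all
    finally show "ennreal (norm (h (\<gamma> s) - h (\<gamma> t))) \<le> path_integral (s, t, \<gamma>) \<rho>1" .
  qed

  define \<theta> where "\<theta> n x = max 0 (min 1 (real n * db x - 1))" for n :: nat and x
  \<comment> \<open>The cut-off is constant where \<open>db\<close> is at least 2 / n. The threshold
    3 / n leaves the margin by which \<open>db\<close> may change between points of a ball of radius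
    1 / (2 n). Both cases give S \<le> 3 / \<open>db\<close> on \<open>U\<close>, the weight in
    \<open>g1\<close>.\<close>
  define S where "S n x = (if db x < 3 / real n then real n else 0)" for n :: nat and x
  have \<theta>_lip: "\<bar>\<theta> n x - \<theta> n y\<bar> \<le> real n * dist x y" for n x y
  proof -
    have "\<bar>\<theta> n x - \<theta> n y\<bar> \<le> \<bar>real n * db x - real n * db y\<bar>"
      by (auto simp: \<theta>_def)
    also have "\<dots> = real n * \<bar>db x - db y\<bar>"
      by (simp add: abs_mult flip: right_diff_distrib)
    also have "\<dots> \<le> real n * dist x y"
      by (intro mult_left_mono db_lipschitz) simp
    finally show ?thesis .
  qed
  have mult: "ug_outside \<sigma> UNIV (\<lambda>x. \<theta> n x *\<^sub>R h x) (\<lambda>x. ennreal \<bar>\<theta> n x\<bar> * \<rho>1 x + F1 x * ennreal (S n x))"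
    if n: "1 \<le> n" for n
  proof (rule ug_mult[OF open_U \<sigma>_borel _ _ h_ug_U _ F1_ge, where S = "real n"])
    have n0: "0 < real n"
      using n by simp
    show "\<rho>1 x \<le> \<sigma> x" for x
      by (simp add: \<sigma>_def)
    show "\<theta> n \<in> borel_measurable borel" "S n \<in> borel_measurable borel"
      unfolding \<theta>_def[abs_def] S_def[abs_def] by measurable
    show "0 \<le> S n x" "S n x \<le> real n" for x
      by (auto simp: S_def)
    show "\<exists>r>0. \<forall>x\<in>ball z r. \<forall>y\<in>ball z r. \<forall>q\<in>ball z r. \<bar>\<theta> n x - \<theta> n y\<bar> \<le> S n q * dist x y" for z
    proof (intro exI[of _ "1 / (2 * real n)"] conjI ballI)
      fix x y q assume *: "x \<in> ball z (1 / (2 * real n))" "y \<in> ball z (1 / (2 * real n))" "q \<in> ball z (1 / (2 * real n))"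
      show "\<bar>\<theta> n x - \<theta> n y\<bar> \<le> S n q * dist x y"
      proof (cases "db q < 3 / real n")
        case True
        then show ?thesis
          using \<theta>_lip[of n x y] by (simp add: S_def)
      next
        case False
        have one: "\<theta> n x = 1" if x: "x \<in> ball z (1 / (2 * real n))" for x
        proof -
          have "dist q x < 1 / (2 * real n) + 1 / (2 * real n)"
            using x *(3) dist_triangle[of q x z] by (simp add: dist_commute)
          then have "dist q x < 1 / real n"
            by simp
          moreover have "3 / real n \<le> db q"
            using False by simp
          moreover have "\<bar>db q - db x\<bar> \<le> dist q x"
            by (rule db_lipschitz)
          moreover have "3 / real n = 2 / real n + 1 / real n"
            by (simp add: add_divide_distrib[symmetric])
          ultimately have "2 / real n \<le> db x"
            by linarith
          then have "2 \<le> real n * db x"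
            using n0 by (simp add: field_simps)
          then show ?thesis
            by (simp add: \<theta>_def)
        qed
        show ?thesis
          using one[OF *(1)] one[OF *(2)] by (simp add: S_def)
      qed
    qed (use n0 in simp)
    show "\<exists>r>0. \<forall>x\<in>ball z r. \<theta> n x = 0" if "z \<notin> U" for z
    proof (intro exI[of _ "1 / real n"] conjI ballI)
      fix x assume "x \<in> ball z (1 / real n)"
      moreover have "db z = 0"
        using that db_bounds(1)[of z] by (simp add: U_iff)
      ultimately have "db x \<le> 1 / real n"
        using db_lipschitz[of z x] by simp
      then have "real n * db x \<le> 1"
        using n0 by (simp add: field_simps)
      then show "\<theta> n x = 0"
        by (simp add: \<theta>_def)
    qed (use n0 in simp)
  qed measurable
  have h_ug: "ug_outside \<sigma> UNIV h g0"
    unfolding ug_outside_def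
  proof (intro allI impI)
    fix s t \<gamma> assume path: "(s, t, \<gamma>) \<in> paths_in UNIV" and fin: "path_integral (s, t, \<gamma>) \<sigma> < \<infinity>"
    \<comment> \<open>For an endpoint off \<open>U\<close> the quotient is 0 and imposes no
      condition; there \<open>h\<close> vanishes anyway.\<close>
    obtain n1 n2 :: nat where n12: "2 / db (\<gamma> s) \<le> real n1" "2 / db (\<gamma> t) \<le> real n2"
      using real_arch_simple by metis
    define n where "n = max 1 (max n1 n2)"
    have n: "1 \<le> n" "2 / db (\<gamma> s) \<le> real n" "2 / db (\<gamma> t) \<le> real n"
      using n12 by (auto simp: n_def)
    have eq: "\<theta> n x *\<^sub>R h x = h x" if "2 / db x \<le> real n" for x
    proof (cases "x \<in> U")
      case True
      then have "2 \<le> real n * db x"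
        using that by (simp add: U_iff pos_divide_le_eq)
      then show ?thesis
        by (simp add: \<theta>_def)
    qed (simp add: h_def)
    have "ennreal (norm (\<theta> n (\<gamma> s) *\<^sub>R h (\<gamma> s) - \<theta> n (\<gamma> t) *\<^sub>R h (\<gamma> t))) \<le>
        path_integral (s, t, \<gamma>) (\<lambda>x. ennreal \<bar>\<theta> n x\<bar> * \<rho>1 x + F1 x * ennreal (S n x))"
      using mult[OF n(1)] path fin by (rule ug_outsideD)
    also have "\<dots> \<le> path_integral (s, t, \<gamma>) g0"
    proof (rule path_integral_mono[OF path])
      fix x
      have "\<bar>\<theta> n x\<bar> \<le> 1"
        by (simp add: \<theta>_def)
      then have "ennreal \<bar>\<theta> n x\<bar> * \<rho>1 x \<le> 1 * \<rho>1 x"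
        by (intro mult_right_mono) auto
      moreover have "F1 x * ennreal (S n x) \<le> g1 x"
      proof (cases "x \<in> U")
        case True
        have "S n x \<le> 3 / db x"
          using True n(1) by (auto simp: S_def U_iff field_simps)
        then show ?thesis
          unfolding g1_def by (intro mult_left_mono ennreal_leI) auto
      qed (simp add: F1_def)
      ultimately show "ennreal \<bar>\<theta> n x\<bar> * \<rho>1 x + F1 x * ennreal (S n x) \<le> g0 x"
        unfolding g0_def by (simp add: add_mono)
    qed
    finally show "ennreal (norm (h (\<gamma> s) - h (\<gamma> t))) \<le> path_integral (s, t, \<gamma>) g0"
      using eq[OF n(2)] eq[OF n(3)] by simp
  qed
  have "ug_outside \<sigma> UNIV (\<lambda>x. w x - h x) G"
    unfolding ug_outside_def
  proof (intro allI impI)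
    fix s t \<gamma> assume path: "(s, t, \<gamma>) \<in> paths_in UNIV" and fin: "path_integral (s, t, \<gamma>) \<sigma> < \<infinity>"
    have "(w (\<gamma> s) - h (\<gamma> s)) - (w (\<gamma> t) - h (\<gamma> t)) = (w (\<gamma> s) - w (\<gamma> t)) - (h (\<gamma> s) - h (\<gamma> t))"
      by simp
    then have "norm ((w (\<gamma> s) - h (\<gamma> s)) - (w (\<gamma> t) - h (\<gamma> t))) \<le> norm (w (\<gamma> s) - w (\<gamma> t)) + norm (h (\<gamma> s) - h (\<gamma> t))"
      by (simp only: norm_triangle_ineq4)
    then have "ennreal (norm ((w (\<gamma> s) - h (\<gamma> s)) - (w (\<gamma> t) - h (\<gamma> t)))) \<le> ennreal (norm (w (\<gamma> s) - w (\<gamma> t))) + ennreal (norm (h (\<gamma> s) - h (\<gamma> t)))"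
      by (simp flip: ennreal_plus)
    also have "\<dots> \<le> path_integral (s, t, \<gamma>) \<rho> + path_integral (s, t, \<gamma>) g0"
      by (intro add_mono w_path path fin ug_outsideD[OF h_ug])
    also have "\<dots> = path_integral (s, t, \<gamma>) G"
      unfolding G_def by (rule path_integral_add[OF path, symmetric]) simp_all
    finally show "ennreal (norm ((w (\<gamma> s) - h (\<gamma> s)) - (w (\<gamma> t) - h (\<gamma> t)))) \<le> path_integral (s, t, \<gamma>) G" .
  qed
  then have ug: "weak_upper_gradient M p (\<lambda>x. w x - h x) G"
    unfolding weak_upper_gradient_iff using \<sigma> by auto
  have in_C: "AE x in M. w x - h x \<in> C"
    using \<delta>_hardy(1)
  proof eventually_elim
    case (elim x)
    show ?case
    proof (cases "x \<in> U")
      case True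
      then show ?thesis
        using Eu_V0 by (simp add: h_def C_def)
    next
      case False
      then have "d x = 0"
        using infdist_nonneg[of x \<Omega>] by (simp add: U_def)
      then have "infdist (w x) C = 0"
        using elim by (simp add: \<delta>_def)
      then have "w x \<in> C"
        using in_closed_iff_infdist_zero[OF closed_C] zero_C by blast
      then show ?thesis
        using False by (simp add: h_def)
    qed
  qed
  have "weak_upper_gradient M p (\<lambda>x. T (w x - h x)) (\<lambda>x. ennreal 12 * G x)"
    using p by (intro weak_upper_gradient_compose[OF null_hull_M _ ug G_Lp in_C closed_C T_lipschitz]) auto
  moreover have "(\<lambda>x. T (w x - h x)) = ext w"
    by (auto simp: h_def ext_def T_F Eu_V0)
  moreover have "Lp_integrable_borel M p (\<lambda>x. ennreal 12 * G x)"
    by (rule Lp_integrable_borel_cmult[OF null_hull_M G_Lp]) simp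
  moreover have "(\<integral>\<^sup>+x. epowr (ennreal 12 * G x) p \<partial>M) \<le> ennreal CE * (P + W)"
  proof -
    have "(\<integral>\<^sup>+x. epowr (ennreal 12 * G x) p \<partial>M) = ennreal (12 powr p) * (\<integral>\<^sup>+x. epow G x \<partial>M)"
      using epowr_ennreal[of 12 p] by (simp add: epowr_mult nn_integral_cmult)
    also have "\<dots> \<le> ennreal (12 powr p) * (ennreal (2 powr p * (2 powr p * (2 powr p + LE powr p * B) + 3 powr p * (Kh * B))) * (P + W))"
      by (intro mult_left_mono G_int) simp
    also have "\<dots> = ennreal (12 powr p * (2 powr p * (2 powr p * (2 powr p + LE powr p * B) + 3 powr p * (Kh * B)))) * (P + W)"
    proof -
      have "ennreal b * (ennreal c * J) = ennreal (b * c) * J" if "0 \<le> b" "0 \<le> c" for b c J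
        using that by (simp add: ennreal_mult mult.assoc)
      then show ?thesis
        using B LE_nonneg by simp
    qed
    also have "\<dots> \<le> ennreal CE * (P + W)"
      unfolding CE_def B_def[symmetric] using B by (intro mult_right_mono ennreal_leI) auto
    finally show ?thesis .
  qed
  ultimately show ?thesis
    by auto
qed

end

section \<open>Extension of functions with values in a closed subspace\<close>

lemma separable_space_subset_closure:
  fixes y :: "nat \<Rightarrow> 'a::metric_space"
  assumes S: "S \<subseteq> closure (range y)"
  shows "separable_space (top_of_set S)"
proof -
  define I where "I = {i. \<exists>s\<in>S. dist s (y (fst i)) < 1 / real (Suc (snd i))}"
  have "\<forall>i. \<exists>s. i \<in> I \<longrightarrow> s \<in> S \<and> dist s (y (fst i)) < 1 / real (Suc (snd i))"
    unfolding I_def by blast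
  then obtain c where c: "\<And>i. i \<in> I \<Longrightarrow> c i \<in> S \<and> dist (c i) (y (fst i)) < 1 / real (Suc (snd i))"
    unfolding choice_iff by blast
  have "S \<subseteq> closure (c ` I)"
  proof
    fix s assume s: "s \<in> S"
    show "s \<in> closure (c ` I)"
      unfolding closure_approachable
    proof (intro allI impI)
      fix e :: real assume "0 < e"
      then obtain j where j: "1 / real (Suc j) < e / 2"
        using nat_approx_posE[of "e / 2"] by auto
      have "s \<in> closure (range y)"
        using s S by blast
      then have "\<forall>e>0. \<exists>z\<in>range y. dist z s < e"
        by (simp only: closure_approachable)
      then obtain z where "z \<in> range y" "dist z s < 1 / real (Suc j)"
        using zero_less_divide_1_iff[of "real (Suc j)"] by (metis of_nat_0_less_iff zero_less_Suc)
      then obtain n where n: "dist (y n) s < 1 / real (Suc j)"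
        by blast
      then have I: "(n, j) \<in> I"
        using s by (auto simp: I_def dist_commute)
      have "dist (c (n, j)) s \<le> dist (c (n, j)) (y n) + dist (y n) s"
        by (rule dist_triangle)
      also have "\<dots> < 1 / real (Suc j) + 1 / real (Suc j)"
        using c[OF I] n by (intro add_strict_mono) auto
      finally have "dist (c (n, j)) s < e"
        using j by simp
      then show "\<exists>z\<in>c ` I. dist z s < e"
        using I by blast
    qed
  qed
  moreover have "c ` I \<subseteq> S"
    using c by auto
  ultimately have "top_of_set S closure_of (c ` I) = S"
    by (auto simp: closure_of_subtopology Int_absorb1)
  then show ?thesis
    unfolding separable_space_def using \<open>c ` I \<subseteq> S\<close> by (intro exI[of _ "c ` I"]) auto
qed

text \<open>An upper gradient comes with a representative that is only almost everywhere equal to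
  the given function; completeness makes this representative measurable.\<close>

lemma complete_caratheodory_measure:
  fixes \<mu> :: "'a::metric_space set \<Rightarrow> ennreal"
  assumes regular: "borel_regular_outer_measure \<mu>"
  shows "complete_measure (caratheodory_measure \<mu>)"
proof
  fix A N assume A: "A \<subseteq> N" and N: "N \<in> null_sets (caratheodory_measure \<mu>)"
  interpret sigma_algebra UNIV "Pow UNIV :: 'a set set"
    by (rule sigma_algebra_Pow)
  have mono: "\<And>B D. B \<subseteq> D \<Longrightarrow> \<mu> B \<le> \<mu> D"
    using regular by (auto simp: borel_regular_outer_measure_def outer_measure_space_def increasing_def)
  have sets_iff: "B \<in> sets (caratheodory_measure \<mu>) \<longleftrightarrow> (\<forall>X. \<mu> (X \<inter> B) + \<mu> (X - B) = \<mu> X)" for B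
    unfolding sets_caratheodory_measure[OF regular] lambda_system_eq by blast
  have N_lambda: "\<mu> (X \<inter> N) + \<mu> (X - N) = \<mu> X" for X
    using N sets_iff by (auto simp: null_sets_def)
  have "\<mu> N = 0"
    using N emeasure_caratheodory_measure[OF regular, of N] by (auto simp: null_sets_def)
  then have null: "\<mu> (X \<inter> B) = 0" if "B \<subseteq> N" for X B
    using mono[of "X \<inter> B" N] that by auto
  have "\<mu> (X \<inter> A) + \<mu> (X - A) = \<mu> X" for X
  proof (rule antisym)
    have "\<mu> (X - A) \<le> \<mu> X"
      by (rule mono) auto
    then show "\<mu> (X \<inter> A) + \<mu> (X - A) \<le> \<mu> X"
      using null[OF A] by simp
    have "\<mu> X = \<mu> (X - N)"
      using N_lambda[of X] null[of N X] by simp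
    also have "\<dots> \<le> \<mu> (X - A)"
      using A by (intro mono) auto
    finally show "\<mu> X \<le> \<mu> (X \<inter> A) + \<mu> (X - A)"
      by (simp add: add_increasing)
  qed
  then show "A \<in> sets (caratheodory_measure \<mu>)"
    by (simp add: sets_iff)
qed

lemma (in complete_measure) borel_measurable_AE_cong:
  assumes f: "f \<in> borel_measurable M" and eq: "AE x in M. g x = f x"
  shows "g \<in> borel_measurable M"
proof (rule measurableI)
  fix B :: "'b set" assume "B \<in> sets borel"
  then have B: "f -` B \<inter> space M \<in> sets M"
    by (rule measurable_sets[OF f])
  have "AE x in M. x \<in> f -` B \<inter> space M \<longleftrightarrow> x \<in> g -` B \<inter> space M"
    using eq by eventually_elim auto
  then show "g -` B \<inter> space M \<in> sets M"
    using B by (rule in_sets_AE) auto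
qed simp

lemma le_cmult_INF_ennreal:
  fixes f :: "'i \<Rightarrow> ennreal"
  assumes c: "0 < c" and le: "\<And>i. i \<in> I \<Longrightarrow> x \<le> ennreal c * (b + f i)"
  shows "x \<le> ennreal c * (b + (INF i\<in>I. f i))"
proof -
  have le': "x / ennreal c \<le> b + f i" if "i \<in> I" for i
    using le[OF that] c by (intro divide_le_posI_ennreal) (auto simp: mult.commute)
  have "x / ennreal c \<le> b + (INF i\<in>I. f i)"
  proof (cases "b = top")
    case False
    then have "x / ennreal c - b \<le> (INF i\<in>I. f i)"
      using le' by (intro INF_greatest) (simp add: ennreal_minus_le_iff)
    then show ?thesis
      using False by (simp add: ennreal_minus_le_iff)
  qed simp
  then have "ennreal c * (x / ennreal c) \<le> ennreal c * (b + (INF i\<in>I. f i))"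
    by (rule mult_left_mono) simp
  then show ?thesis
    using c by (simp add: ennreal_times_divide ennreal_mult_divide_eq mult.commute[of "ennreal c" x])
qed

section \<open>Change of representative and the infimum over gradients\<close>

context whitney
begin

text \<open>The Whitney sum sees \<open>w\<close> only through its averages. This matters because
  the gradients in the infimum of the norm belong to different representatives.\<close>

lemma ext_cong_AE:
  assumes w: "w \<in> borel_measurable M" "w' \<in> borel_measurable M" and eq: "AE x in M. w x = w' x"
  shows "AE x in M. ext w x = ext w' x"
proof -
  have avg: "avg (\<lambda>z. c0_nth (w z) n) x r = avg (\<lambda>z. c0_nth (w' z) n) x r" for x r n
  proof -
    have "(LINT z:ball x r|M. c0_nth (w z) n) = (LINT z:ball x r|M. c0_nth (w' z) n)"
      unfolding set_lebesgue_integral_def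
    proof (rule integral_cong_AE)
      have [measurable]: "ball x r \<in> sets M"
        by (rule borel_sets_M) simp
      note [measurable] = c0_nth_measurable[OF w(1), of n] c0_nth_measurable[OF w(2), of n]
      show "(\<lambda>z. indicator (ball x r) z *\<^sub>R c0_nth (w z) n) \<in> borel_measurable M"
        "(\<lambda>z. indicator (ball x r) z *\<^sub>R c0_nth (w' z) n) \<in> borel_measurable M"
        by measurable
      show "AE z in M. indicator (ball x r) z *\<^sub>R c0_nth (w z) n = indicator (ball x r) z *\<^sub>R c0_nth (w' z) n"
        using eq by eventually_elim simp
    qed
    then show ?thesis
      by (simp add: avg_def)
  qed
  have "v w = v w'"
    by (auto simp: fun_eq_iff v_def a_def cavg_def avg)
  then have Eu: "Eu w = Eu w'"
    by (auto simp: fun_eq_iff Eu_def)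
  show ?thesis
    using eq by eventually_elim (simp add: ext_def Eu)
qed

definition c_ext :: real
  where "c_ext = 2 * (CE powr (1 / p) * 2 powr (1 / p))"

lemma c_ext_pos: "0 < c_ext"
  using CE_pos by (simp add: c_ext_def)

text \<open>The extension \<open>e\<close> is built from one representative of \<open>w\<close>. For
  any other gradient of \<open>w\<close> the estimates apply to the extension of that gradient's
  representative, which is \<open>e\<close> up to a null set by \<open>ext_cong_AE\<close>; so the
  bound holds for every gradient and passes to the infimum.\<close>

lemma W1p_ext:
  assumes V0_closure: "V0 = closure (range (y :: nat \<Rightarrow> 'v))"
    and w: "w \<in> W1p M p" and w_C: "AE x in M. x \<in> \<Omega> \<longrightarrow> w x \<in> C"
  obtains e where "e \<in> W1p M p" "AE x in M. x \<in> \<Omega> \<longrightarrow> e x = T (w x)"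
    "W1p_norm M p e \<le> ennreal c_ext * W1p_norm M p w"
proof -
  interpret complete_measure M
    by (rule complete_caratheodory_measure[OF regular])
  have w_meas: "w \<in> borel_measurable M"
    using w unfolding W1p_def Lp_def bochner_measurable_def by blast
  have w_int: "(\<integral>\<^sup>+x. ennreal (norm (w x) powr p) \<partial>M) < \<infinity>"
    using w by (simp add: W1p_def Lp_def epowr_ennreal)
  have rep: "\<exists>w'. whitney_fun \<mu> p cD CP lam \<Omega> c\<Omega> F V0 w' \<rho> \<and> w' \<in> borel_measurable M \<and> (AE x in M. w' x = w x)"
    if \<rho>: "\<rho> \<in> Lp_weak_upper_gradients M p w" for \<rho>
  proof -
    obtain w' where w': "Lp_integrable_borel M p \<rho>" "AE x in M. w' x = w x" "weak_upper_gradient M p w' \<rho>"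
      using \<rho> unfolding Lp_weak_upper_gradients_def by blast
    have meas: "w' \<in> borel_measurable M"
      by (rule borel_measurable_AE_cong[OF w_meas w'(2)])
    have "(\<integral>\<^sup>+x. ennreal (norm (w' x) powr p) \<partial>M) = (\<integral>\<^sup>+x. ennreal (norm (w x) powr p) \<partial>M)"
      by (rule nn_integral_cong_AE, rule AE_mp[OF w'(2)], rule AE_I2) simp
    moreover have "AE x in M. x \<in> \<Omega> \<longrightarrow> w' x \<in> C"
      using w'(2) w_C by eventually_elim simp
    ultimately have "whitney_fun \<mu> p cD CP lam \<Omega> c\<Omega> F V0 w' \<rho>"
      using meas w' w_int by unfold_locales auto
    then show ?thesis
      using meas w'(2) by blast
  qed
  obtain \<rho>0 where "\<rho>0 \<in> Lp_weak_upper_gradients M p w"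
    using w by (auto simp: W1p_def)
  then obtain w0 where w0: "whitney_fun \<mu> p cD CP lam \<Omega> c\<Omega> F V0 w0 \<rho>0" "w0 \<in> borel_measurable M" "AE x in M. w0 x = w x"
    using rep by blast
  define e where "e = ext w0"
  define c where "c = CE powr (1 / p) * 2 powr (1 / p)"
  have grad: "\<exists>g\<in>Lp_weak_upper_gradients M p e.
      Lp_norm M p g \<le> ennreal c * (Lp_norm M p (\<lambda>x. ennreal (norm (w x))) + Lp_norm M p \<rho>) \<and>
      Lp_norm M p (\<lambda>x. ennreal (norm (e x))) \<le> ennreal c * (Lp_norm M p (\<lambda>x. ennreal (norm (w x))) + Lp_norm M p \<rho>) \<and>
      (\<integral>\<^sup>+x. ennreal (norm (e x) powr p) \<partial>M) < \<infinity>"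
    if \<rho>: "\<rho> \<in> Lp_weak_upper_gradients M p w" for \<rho>
  proof -
    obtain w' where w': "whitney_fun \<mu> p cD CP lam \<Omega> c\<Omega> F V0 w' \<rho>" "w' \<in> borel_measurable M" "AE x in M. w' x = w x"
      using rep[OF \<rho>] by blast
    interpret f: whitney_fun \<mu> p cD CP lam \<Omega> c\<Omega> F V0 w' \<rho>
      by (rule w'(1))
    have "AE x in M. w' x = w0 x"
      using w'(3) w0(3) by eventually_elim simp
    then have eq: "AE x in M. ext w' x = e x"
      unfolding e_def by (rule ext_cong_AE[OF w'(2) w0(2)])
    obtain g where g: "Lp_integrable_borel M p g" "weak_upper_gradient M p (ext w') g"
      "(\<integral>\<^sup>+x. epow g x \<partial>M) \<le> ennreal CE * (f.P + f.W)"
      using f.ext_ug by blast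
    have W_eq: "f.W = (\<integral>\<^sup>+x. epowr (ennreal (norm (w x))) p \<partial>M)"
      by (rule nn_integral_cong_AE, rule AE_mp[OF w'(3)], rule AE_I2) (simp add: epowr_ennreal)
    have sum_eq: "f.P + f.W = (\<integral>\<^sup>+x. epowr (ennreal (norm (w x))) p \<partial>M) + f.P"
      unfolding W_eq by (rule add.commute)
    have e_le: "(\<integral>\<^sup>+x. epowr (ennreal (norm (e x))) p \<partial>M) \<le> ennreal CE * (f.P + f.W)"
    proof -
      have "(\<integral>\<^sup>+x. epowr (ennreal (norm (e x))) p \<partial>M) = (\<integral>\<^sup>+x. ennreal (norm (ext w' x) powr p) \<partial>M)"
        by (rule nn_integral_cong_AE, rule AE_mp[OF eq], rule AE_I2) (simp add: epowr_ennreal)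
      then show ?thesis
        using f.ext_norm by simp
    qed
    have fin: "ennreal CE * (f.P + f.W) < \<infinity>"
      using f.w_fin Lp_integrable_borelD(2)[OF f.\<rho>] by (simp add: ennreal_mult_less_top)
    have "g \<in> Lp_weak_upper_gradients M p e"
      using g(1,2) eq unfolding Lp_weak_upper_gradients_def by blast
    moreover have "Lp_norm M p g \<le> ennreal c * (Lp_norm M p (\<lambda>x. ennreal (norm (w x))) + Lp_norm M p \<rho>)"
      unfolding c_def using p CE_pos g(3) sum_eq by (intro Lp_norm_le_sum) auto
    moreover have "Lp_norm M p (\<lambda>x. ennreal (norm (e x))) \<le> ennreal c * (Lp_norm M p (\<lambda>x. ennreal (norm (w x))) + Lp_norm M p \<rho>)"
      unfolding c_def using p CE_pos e_le sum_eq by (intro Lp_norm_le_sum) auto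
    moreover have "(\<integral>\<^sup>+x. ennreal (norm (e x) powr p) \<partial>M) < \<infinity>"
      using le_less_trans[OF e_le fin] by (simp add: epowr_ennreal)
    ultimately show ?thesis
      by blast
  qed
  interpret f0: whitney_fun \<mu> p cD CP lam \<Omega> c\<Omega> F V0 w0 \<rho>0
    by (rule w0(1))
  have "separable_space (top_of_set (e ` (space M - {})))"
  proof (rule separable_space_subset_closure)
    show "e ` (space M - {}) \<subseteq> closure (range y)"
      using f0.ext_V0 by (auto simp: e_def V0_closure)
  qed
  then have "bochner_measurable M e"
    unfolding bochner_measurable_def e_def using f0.ext_measurable by (intro conjI bexI[of _ "{}"]) auto
  moreover have "(\<integral>\<^sup>+x. ennreal (norm (e x) powr p) \<partial>M) < \<infinity>" "Lp_weak_upper_gradients M p e \<noteq> {}"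
    using grad[OF \<open>\<rho>0 \<in> _\<close>] by blast+
  ultimately have "e \<in> W1p M p"
    by (simp add: W1p_def Lp_def epowr_ennreal)
  moreover have "AE x in M. x \<in> \<Omega> \<longrightarrow> e x = T (w x)"
    using w0(3) by eventually_elim (simp add: e_def ext_def U_def)
  moreover have "W1p_norm M p e \<le> ennreal c_ext * W1p_norm M p w"
    unfolding W1p_norm_def[of _ _ w]
  proof (rule le_cmult_INF_ennreal)
    fix \<rho> assume "\<rho> \<in> Lp_weak_upper_gradients M p w"
    then obtain g where g: "g \<in> Lp_weak_upper_gradients M p e"
      "Lp_norm M p g \<le> ennreal c * (Lp_norm M p (\<lambda>x. ennreal (norm (w x))) + Lp_norm M p \<rho>)"
      "Lp_norm M p (\<lambda>x. ennreal (norm (e x))) \<le> ennreal c * (Lp_norm M p (\<lambda>x. ennreal (norm (w x))) + Lp_norm M p \<rho>)"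
      using grad by blast
    have "W1p_norm M p e \<le> Lp_norm M p (\<lambda>x. ennreal (norm (e x))) + Lp_norm M p g"
      unfolding W1p_norm_def using g(1) by (intro add_left_mono INF_lower)
    also have "\<dots> \<le> ennreal c * (Lp_norm M p (\<lambda>x. ennreal (norm (w x))) + Lp_norm M p \<rho>) +
        ennreal c * (Lp_norm M p (\<lambda>x. ennreal (norm (w x))) + Lp_norm M p \<rho>)"
      by (intro add_mono g)
    also have "\<dots> = ennreal c_ext * (Lp_norm M p (\<lambda>x. ennreal (norm (w x))) + Lp_norm M p \<rho>)"
    proof -
      have "ennreal b * J + ennreal b * J = ennreal (2 * b) * J" if "0 \<le> b" for b J
        by (simp only: mult_2 ennreal_plus[OF that that] distrib_right)
      from this[of c] show ?thesis
        by (simp add: c_ext_def c_def)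
    qed
    finally show "W1p_norm M p e \<le> ennreal c_ext * (Lp_norm M p (\<lambda>x. ennreal (norm (w x))) + Lp_norm M p \<rho>)" .
  qed (rule c_ext_pos)
  ultimately show ?thesis
    using that by blast
qed

end

text \<open>Every gradient of \<open>u\<close> is also one of \<open>F \<circ> u\<close>, by
  \<open>weak_upper_gradient_compose\<close> with constant 1. \<open>F\<close> is Borel because it
  is continuous on the closed set \<open>V0\<close> and zero elsewhere.\<close>

lemma W1p_compose:
  fixes u :: "'z::metric_space \<Rightarrow> 'v::real_normed_vector" and F :: "'v \<Rightarrow> 'w::real_normed_vector"
  assumes M: "borel_null_hull M" and p: "0 < p" and u: "u \<in> W1p M p"
    and V0: "AE z in M. u z \<in> V0" "V0 = closure (range (x :: nat \<Rightarrow> 'v))"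
    and F: "F 0 = 0" "0 \<in> V0" "\<And>y. y \<notin> V0 \<Longrightarrow> F y = 0"
      "\<And>y z. y \<in> V0 \<Longrightarrow> z \<in> V0 \<Longrightarrow> norm (F y - F z) \<le> norm (y - z)"
  shows "(\<lambda>z. F (u z)) \<in> W1p M p" "W1p_norm M p (\<lambda>z. F (u z)) \<le> W1p_norm M p u"
proof -
  have closed: "closed V0"
    using V0 by simp
  have cont: "continuous_on V0 F"
    by (rule lipschitz_on_continuous_on[of 1], rule lipschitz_onI) (use F(4) in \<open>auto simp: dist_norm\<close>)
  have "(\<lambda>y. if y \<in> V0 then F y else 0) \<in> borel_measurable borel"
    using closed cont by (intro borel_measurable_continuous_on_if) auto
  moreover have "(\<lambda>y. if y \<in> V0 then F y else 0) = F"
    using F(3) by auto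
  ultimately have "F \<in> borel_measurable borel"
    by simp
  moreover have "u \<in> borel_measurable M"
    using u unfolding W1p_def Lp_def bochner_measurable_def by blast
  ultimately have meas: "(\<lambda>z. F (u z)) \<in> borel_measurable M"
    by (rule measurable_compose[rotated])
  obtain N where N: "{z \<in> space M. \<not> u z \<in> V0} \<subseteq> N" "emeasure M N = 0" "N \<in> sets M"
    using V0(1) by (rule AE_E)
  have "separable_space (top_of_set ((\<lambda>z. F (u z)) ` (space M - N)))"
  proof (rule separable_space_subset_closure)
    have "F ` V0 \<subseteq> closure (range (\<lambda>n. F (x n)))"
      unfolding V0(2)
    proof (rule image_closure_subset)
      show "continuous_on (closure (range x)) F"
        using cont V0(2) by simp
      show "F ` range x \<subseteq> closure (range (\<lambda>n. F (x n)))"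
        using closure_subset[of "range (\<lambda>n. F (x n))"] by auto
    qed simp
    then show "(\<lambda>z. F (u z)) ` (space M - N) \<subseteq> closure (range (\<lambda>n. F (x n)))"
      using N(1) by blast
  qed
  then have bochner: "bochner_measurable M (\<lambda>z. F (u z))"
    unfolding bochner_measurable_def using meas N by (intro conjI bexI[of _ N]) (auto simp: null_sets_def)
  have norm_le: "ennreal (norm (F (u z))) \<le> ennreal (norm (u z))" for z
    using F(4)[of "u z" 0] F(1-3) by (cases "u z \<in> V0") (auto intro!: ennreal_leI)
  have "(\<integral>\<^sup>+z. epowr (ennreal (norm (F (u z)))) p \<partial>M) \<le> (\<integral>\<^sup>+z. epowr (ennreal (norm (u z))) p \<partial>M)"
    using p by (intro nn_integral_mono epowr_mono norm_le) auto
  also have "\<dots> < \<infinity>"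
    using u unfolding W1p_def Lp_def by blast
  finally have Lp: "(\<lambda>z. F (u z)) \<in> Lp M p"
    using bochner unfolding Lp_def by blast
  have ug: "Lp_weak_upper_gradients M p u \<subseteq> Lp_weak_upper_gradients M p (\<lambda>z. F (u z))"
  proof
    fix \<rho> assume "\<rho> \<in> Lp_weak_upper_gradients M p u"
    then obtain v where v: "Lp_integrable_borel M p \<rho>" "AE z in M. v z = u z" "weak_upper_gradient M p v \<rho>"
      unfolding Lp_weak_upper_gradients_def by blast
    have "AE z in M. v z \<in> V0"
      using v(2) V0(1) by eventually_elim simp
    then have "weak_upper_gradient M p (\<lambda>z. F (v z)) (\<lambda>z. ennreal 1 * \<rho> z)"
      using F(4) by (intro weak_upper_gradient_compose[OF M p v(3,1) _ closed]) auto
    then have "weak_upper_gradient M p (\<lambda>z. F (v z)) \<rho>"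
      by simp
    moreover have "AE z in M. F (v z) = F (u z)"
      using v(2) by eventually_elim simp
    ultimately show "\<rho> \<in> Lp_weak_upper_gradients M p (\<lambda>z. F (u z))"
      using v(1) unfolding Lp_weak_upper_gradients_def
      by (intro CollectI conjI exI[of _ "\<lambda>z. F (v z)"])
  qed
  show "(\<lambda>z. F (u z)) \<in> W1p M p"
    using Lp ug u unfolding W1p_def by blast
  show "W1p_norm M p (\<lambda>z. F (u z)) \<le> W1p_norm M p u"
    unfolding W1p_norm_def by (intro add_mono Lp_norm_mono p norm_le INF_superset_mono ug) simp
qed

text \<open>The subspace and its embedding are chosen for the individual \<open>u\<close>, but the
  factor \<open>whitney.c_ext\<close> is determined by the constants of the space and of \<Omega>,
  so the bound is uniform in \<open>u\<close>.\<close>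

lemma (in pi_omega) W1p_extension:
  fixes u :: "'a \<Rightarrow> 'v::banach" and E :: "('a \<Rightarrow> c0) \<Rightarrow> ('a \<Rightarrow> c0)"
  assumes E: "\<And>w. w \<in> W1p (restrict_space M \<Omega>) p \<Longrightarrow> E w \<in> W1p M p"
    "\<And>w. w \<in> W1p (restrict_space M \<Omega>) p \<Longrightarrow> AE z in restrict_space M \<Omega>. E w z = w z"
    "\<And>w. w \<in> W1p (restrict_space M \<Omega>) p \<Longrightarrow> W1p_norm M p (E w) \<le> ennreal cE * W1p_norm (restrict_space M \<Omega>) p w"
    and cE: "0 \<le> cE" and u: "u \<in> W1p (restrict_space M \<Omega>) p"
  shows "\<exists>e. e \<in> W1p M p \<and> (AE z in restrict_space M \<Omega>. e z = u z) \<and>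
    W1p_norm M p e \<le> ennreal (whitney.c_ext p cD CP lam c\<Omega> * cE) * W1p_norm (restrict_space M \<Omega>) p u"
proof -
  let ?M\<Omega> = "restrict_space M \<Omega>"
  obtain N where N: "N \<in> null_sets ?M\<Omega>" "separable_space (top_of_set (u ` (space ?M\<Omega> - N)))"
    using u unfolding W1p_def Lp_def bochner_measurable_def by blast
  then obtain D where D: "countable D" "D \<subseteq> u ` (space ?M\<Omega> - N)"
    "top_of_set (u ` (space ?M\<Omega> - N)) closure_of D = u ` (space ?M\<Omega> - N)"
    unfolding separable_space_def by auto
  obtain x :: "nat \<Rightarrow> 'v" where x: "D \<subseteq> closure (range x)" "subspace (closure (range x))"
    using separable_closed_subspace[OF D(1)] .
  define V0 where "V0 = closure (range x)"
  have "u ` (space ?M\<Omega> - N) \<subseteq> closure D"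
    using D(2,3) by (auto simp: closure_of_subtopology Int_absorb1)
  also have "\<dots> \<subseteq> V0"
    using x(1) unfolding V0_def by (rule closure_minimal) simp
  finally have u_V0: "AE z in ?M\<Omega>. u z \<in> V0"
    using N(1) by (intro AE_I'[of N]) auto
  interpret f: whitney \<mu> p cD CP lam \<Omega> c\<Omega> "aharoni x" V0
    using x(2) aharoni_0 aharoni_upper[of _ x] aharoni_lower[of _ x] by unfold_locales (auto simp: V0_def)
  have sets: "\<Omega> \<inter> space M \<in> sets M"
    using \<Omega>_sets by auto
  define w where "w = (\<lambda>z. aharoni x (u z))"
  have hull: "borel_null_hull ?M\<Omega>"
    by (rule borel_null_hull_restrict[OF null_hull_M space_caratheodory_measure[OF regular] \<Omega>_sets])
  have outside: "aharoni x y = 0" if "y \<notin> V0" for y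
    using that by (simp add: aharoni_def V0_def)
  have p0: "0 < p"
    using p by simp
  have w: "w \<in> W1p ?M\<Omega> p" "W1p_norm ?M\<Omega> p w \<le> W1p_norm ?M\<Omega> p u"
    unfolding w_def
    using W1p_compose[OF hull p0 u u_V0 V0_def f.F0 f.zero_V0 outside f.F_upper] by blast+
  have E_eq: "AE z in M. z \<in> \<Omega> \<longrightarrow> E w z = w z"
    using E(2)[OF w(1)] by (simp add: AE_restrict_space_iff[OF sets])
  have u_V0': "AE z in M. z \<in> \<Omega> \<longrightarrow> u z \<in> V0"
    using u_V0 by (simp add: AE_restrict_space_iff[OF sets])
  have "AE z in M. z \<in> \<Omega> \<longrightarrow> E w z \<in> f.C"
    using E_eq u_V0' by eventually_elim (auto simp: w_def f.C_def)
  then obtain e where e: "e \<in> W1p M p" "AE z in M. z \<in> \<Omega> \<longrightarrow> e z = f.T (E w z)"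
    "W1p_norm M p e \<le> ennreal f.c_ext * W1p_norm M p (E w)"
    using f.W1p_ext[OF V0_def E(1)[OF w(1)]] by blast
  have "AE z in M. z \<in> \<Omega> \<longrightarrow> e z = u z"
    using e(2) E_eq u_V0' by eventually_elim (auto simp: w_def f.T_F)
  then have "AE z in ?M\<Omega>. e z = u z"
    by (simp add: AE_restrict_space_iff[OF sets])
  moreover have "W1p_norm M p e \<le> ennreal (f.c_ext * cE) * W1p_norm ?M\<Omega> p u"
  proof -
    have "W1p_norm M p e \<le> ennreal f.c_ext * (ennreal cE * W1p_norm ?M\<Omega> p u)"
      using E(3)[OF w(1)] w(2) by (intro order_trans[OF e(3)] mult_left_mono order_trans[OF E(3)[OF w(1)]]) auto
    then show ?thesis
      using f.c_ext_pos cE by (simp add: ennreal_mult mult.assoc)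
  qed
  ultimately show ?thesis
    using e(1) by blast
qed

section \<open>From extensions of single functions to an extension map\<close>

lemma W1p_norm_cong_AE:
  assumes "AE x in M. u x = v x"
  shows "W1p_norm M p u = W1p_norm M p v"
proof -
  have "Lp_weak_upper_gradients M p u = Lp_weak_upper_gradients M p v"
  proof -
    have "(AE x in M. f x = u x) \<longleftrightarrow> (AE x in M. f x = v x)" for f
      using assms by (auto elim: eventually_elim2)
    then show ?thesis
      by (simp add: Lp_weak_upper_gradients_def)
  qed
  moreover have "Lp_norm M p (\<lambda>x. ennreal (norm (u x))) = Lp_norm M p (\<lambda>x. ennreal (norm (v x)))"
    unfolding Lp_norm_def
    by (intro arg_cong[where f = "\<lambda>I. epowr I (1 / p)"], rule nn_integral_cong_AE, rule AE_mp[OF assms], rule AE_I2) simp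
  ultimately show ?thesis
    by (simp add: W1p_norm_def)
qed

lemma zero_W1p:
  assumes "1 < p"
  shows "(\<lambda>_. 0 :: 'v::real_normed_vector) \<in> W1p M p" "W1p_norm M p (\<lambda>_. 0 :: 'v) = 0"
proof -
  have sep: "separable_space (top_of_set ((\<lambda>_. 0 :: 'v) ` (space M - {})))"
    by (rule separable_space_subset_closure[of _ "\<lambda>_. 0"]) (use closure_subset in auto)
  have Lp: "(\<lambda>_. 0 :: 'v) \<in> Lp M p"
    unfolding Lp_def bochner_measurable_def using sep by (auto intro!: bexI[of _ "{}"])
  have int: "Lp_integrable_borel M p (\<lambda>_. 0)"
    by (simp add: Lp_integrable_borel_def)
  then have "p_negligible M p {}"
    by (auto simp: p_negligible_def)
  then have "weak_upper_gradient M p (\<lambda>_. 0 :: 'v) (\<lambda>_. 0)"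
    unfolding weak_upper_gradient_def by (intro conjI exI[of _ "{}"]) auto
  then have ug: "(\<lambda>_. 0) \<in> Lp_weak_upper_gradients M p (\<lambda>_. 0 :: 'v)"
    using int unfolding Lp_weak_upper_gradients_def by auto
  show "(\<lambda>_. 0 :: 'v) \<in> W1p M p"
    using Lp ug unfolding W1p_def by blast
  have "(INF \<rho>\<in>Lp_weak_upper_gradients M p (\<lambda>_. 0 :: 'v). Lp_norm M p \<rho>) \<le> Lp_norm M p (\<lambda>_. 0)"
    using ug by (rule INF_lower)
  then show "W1p_norm M p (\<lambda>_. 0 :: 'v) = 0"
    by (simp add: W1p_norm_def Lp_norm_def)
qed

text \<open>The relation between \<open>u\<close> and an admissible extension depends only on the
  class of \<open>u\<close>. Equivalent functions thus define the same predicate, and the choice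
  operator picks the same extension for them; so the map descends to classes.\<close>

lemma W1p_extension_setI:
  fixes \<mu> :: "'z::metric_space set \<Rightarrow> ennreal"
  defines "M \<equiv> caratheodory_measure \<mu>"
  assumes c: "0 < c"
    and ex: "\<And>u :: 'z \<Rightarrow> 'v::real_normed_vector. u \<in> W1p (restrict_space M \<Omega>) p \<Longrightarrow>
      \<exists>e. e \<in> W1p M p \<and> (AE z in restrict_space M \<Omega>. e z = u z) \<and>
        W1p_norm M p e \<le> ennreal c * W1p_norm (restrict_space M \<Omega>) p u"
  shows "W1p_extension_set TYPE('v) p \<mu> \<Omega>"
proof -
  define R where "R u e \<longleftrightarrow> e \<in> W1p M p \<and> (AE z in restrict_space M \<Omega>. e z = u z) \<and>
    W1p_norm M p e \<le> ennreal c * W1p_norm (restrict_space M \<Omega>) p u" for u e :: "'z \<Rightarrow> 'v"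
  have cong: "R u = R v" if "AE z in restrict_space M \<Omega>. u z = v z" for u v
  proof -
    have "(AE z in restrict_space M \<Omega>. e z = u z) \<longleftrightarrow> (AE z in restrict_space M \<Omega>. e z = v z)" for e
      using that by (auto elim: eventually_elim2)
    then show ?thesis
      using W1p_norm_cong_AE[OF that] by (simp add: R_def fun_eq_iff)
  qed
  have "R u (Eps (R u))" if "u \<in> W1p (restrict_space M \<Omega>) p" for u
    using ex[OF that] unfolding R_def[symmetric] by (rule someI_ex)
  then show ?thesis
    unfolding W1p_extension_set_def Let_def M_def[symmetric]
    using c cong by (intro exI[of _ c] conjI exI[of _ "\<lambda>u. Eps (R u)"]) (simp_all add: R_def)
qed

theorem corollary1p7:
  fixes p :: real and \<mu> :: "'z::metric_space set \<Rightarrow> ennreal" and \<Omega> :: "'z set"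
  assumes "1 < p"
    and "PI_space p \<mu>"
    and "\<Omega> \<in> sets (caratheodory_measure \<mu>)"
    and "measure_density \<mu> \<Omega>"
    and "W1p_extension_set TYPE(c0) p \<mu> \<Omega>"
  shows "W1p_extension_set TYPE('v::banach) p \<mu> \<Omega>"
proof (cases "\<Omega> = {}")
  \<comment> \<open>For empty \<Omega> all functions agree almost everywhere on \<Omega>, and
    extension by zero has norm 0.\<close>
  case True
  show ?thesis
  proof (rule W1p_extension_setI[of 1])
    fix u :: "'z \<Rightarrow> 'v"
    show "\<exists>e. e \<in> W1p (caratheodory_measure \<mu>) p \<and> (AE z in restrict_space (caratheodory_measure \<mu>) \<Omega>. e z = u z) \<and>
        W1p_norm (caratheodory_measure \<mu>) p e \<le> ennreal 1 * W1p_norm (restrict_space (caratheodory_measure \<mu>) \<Omega>) p u"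
      using zero_W1p[OF assms(1), of "caratheodory_measure \<mu>", where 'v = 'v] True
      by (intro exI[of _ "\<lambda>_. 0"]) (simp add: AE_restrict_space_iff)
  qed simp
next
  case False
  have regular: "borel_regular_outer_measure \<mu>" and separable: "separable_space (euclidean :: 'z topology)"
    and balls: "\<And>x r. 0 < r \<Longrightarrow> 0 < \<mu> (ball x r) \<and> \<mu> (ball x r) < \<infinity>"
    using assms(2) by (auto simp: PI_space_def metric_measure_space_def)
  obtain c where c: "\<And>x r. 0 < r \<Longrightarrow> \<mu> (ball x (2 * r)) \<le> ennreal c * \<mu> (ball x r)"
    using assms(2) unfolding PI_space_def doubling_def by blast
  \<comment> \<open>A constant of at least 1 makes its powers usable as bounds in
    \<open>card_separated\<close> and \<open>m_compare\<close>.\<close>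
  have doubling: "\<mu> (ball x (2 * r)) \<le> ennreal (max 1 c) * \<mu> (ball x r)" if "0 < r" for x r
    using c[OF that] by (rule order_trans) (intro mult_right_mono ennreal_leI, auto)
  have "weak_poincare p \<mu>"
    using assms(2) by (simp add: PI_space_def)
  then obtain CP lam where CP: "0 < CP" "1 \<le> lam" and poincare: "\<forall>x r. 0 < r \<longrightarrow>
      (let B = ball x r; B' = ball x (lam * r);
           M = restrict_space (caratheodory_measure \<mu>) B;
           M' = restrict_space (caratheodory_measure \<mu>) B'
       in \<forall>(u :: 'z \<Rightarrow> real) \<rho>.
         integrable M' u \<longrightarrow> Lp_integrable_borel M' p \<rho> \<longrightarrow> weak_upper_gradient M' p u \<rho> \<longrightarrow>
         (let u\<^sub>B = (\<integral>y. u y \<partial>M) / enn2real (\<mu> B)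
          in (\<integral>\<^sup>+ y. ennreal \<bar>u y - u\<^sub>B\<bar> \<partial>M) / \<mu> B
             \<le> ennreal (CP * diameter B) * epowr ((\<integral>\<^sup>+ y. epowr (\<rho> y) p \<partial>M') / \<mu> B') (1 / p)))"
    unfolding weak_poincare_def by blast
  obtain c\<Omega> where c\<Omega>: "0 < c\<Omega>" "\<And>x r. x \<in> \<Omega> \<Longrightarrow> 0 < r \<Longrightarrow> r \<le> 1 \<Longrightarrow> ennreal c\<Omega> * \<mu> (ball x r) \<le> \<mu> (ball x r \<inter> \<Omega>)"
    using assms(4) unfolding measure_density_def by auto
  interpret pi_omega \<mu> p "max 1 c" CP lam \<Omega> c\<Omega>
  proof unfold_locales
    show "max 1 c \<ge> 1"
      by simp
  qed (use assms(1,3) False regular separable balls doubling CP c\<Omega> poincare[unfolded Let_def] in blast)+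
  obtain cE E where E: "0 < cE"
    "\<And>w. w \<in> W1p (restrict_space M \<Omega>) p \<Longrightarrow> E w \<in> W1p M p"
    "\<And>w. w \<in> W1p (restrict_space M \<Omega>) p \<Longrightarrow> AE z in restrict_space M \<Omega>. E w z = (w z :: c0)"
    "\<And>w. w \<in> W1p (restrict_space M \<Omega>) p \<Longrightarrow> W1p_norm M p (E w) \<le> ennreal cE * W1p_norm (restrict_space M \<Omega>) p w"
    using assms(5) unfolding W1p_extension_set_def Let_def by blast
  \<comment> \<open>The constant \<open>c_ext\<close> is the same for all embeddings, so the trivial
    embedding of the zero space provides its positivity before any \<open>u\<close> is
    given.\<close>
  interpret f: whitney \<mu> p "max 1 c" CP lam \<Omega> c\<Omega> "\<lambda>_ :: real. 0" "{0}"
    by unfold_locales (auto simp: subspace_0)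
  show ?thesis
  proof (rule W1p_extension_setI)
    show "0 < f.c_ext * cE"
      using f.c_ext_pos E(1) by simp
    show "\<exists>e. e \<in> W1p M p \<and> (AE z in restrict_space M \<Omega>. e z = u z) \<and>
        W1p_norm M p e \<le> ennreal (f.c_ext * cE) * W1p_norm (restrict_space M \<Omega>) p u"
      if "u \<in> W1p (restrict_space M \<Omega>) p" for u :: "'z \<Rightarrow> 'v"
      using E(1) by (intro W1p_extension[OF E(2-4) _ that]) auto
  qed
qed

end
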